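(* The space of initial conditions $S$ of the system $\frac{dq}{dt}=\frac{\partial I}{\partial p}$, $\frac{dp}{dt}=-\frac{\partial I}{\partial q}$ (with $I$, $\tilde S$ and $(-K_{\tilde S})_{red}$ as in the context) is obtained by gluing ten copies of $\mathbb{C}^2$: $$S=\tilde S-(-K_{\tilde S})_{red}=\mathbb{C}^2\cup\bigcup_{j=0}^{8}U_j,\qquad \mathbb{C}^2\ni(q,p),\quad U_j\cong\mathbb{C}^2\ni(x_j,y_j)\quad(j=0,1,\dots,8),$$ via the birational and symplectic transformations $$\begin{aligned} r_0&: x_0=1/q,\ y_0=-(qp+\alpha_0)q,\\ r_1&: x_1=-(pq-\alpha_1)p,\ y_1=1/p,\\ r_2&: x_2=-(pq-(\alpha_1+\alpha_2))p,\ y_2=1/p,\\ r_3&: x_3=-(pq-(\alpha_1+\alpha_2+\alpha_3))p,\ y_3=1/p,\\ r_4&: x_4=-(pq-(\alpha_1+\alpha_2+\alpha_3+\alpha_4))p,\ y_4=1/p,\\ r_5&: x_5=-(pq-(\alpha_1+\alpha_2+\alpha_3+\alpha_4+\alpha_5))p,\ y_5=1/p,\\ r_6&: x_6=-(p(q-1)-\alpha_6)p,\ y_6=1/p,\\ r_7&: x_7=-(p(q-1)-(\alpha_6+\alpha_7))p,\ y_7=1/p,\\ r_8&: x_8=-(x_0y_0-\alpha_8)y_0,\ y_8=1/y_0. \end{aligned}$$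
   Context: The constant parameters $\alpha_0,\dots,\alpha_8$ satisfy $6\alpha_0+5\alpha_1+4\alpha_2+3\alpha_3+2\alpha_4+\alpha_5+4\alpha_6+2\alpha_7+3\alpha_8=0$. The Hamiltonian is $$\begin{aligned} I={}&q^5(q-1)^4p^6+q^4(q-1)^3(3\kappa q+\beta_1)p^5+q^3(q-1)^2\{3(\kappa^2+\varepsilon)q^2+mq+\beta_2\}p^4\\ &+q^2(q-1)\{A_3q^3+xq^2-(A_3+x+\beta_3+2\gamma_1\gamma_2)q+\beta_3\}p^3\\ &+q\{A_2q^4+B_2q^3+C_2q^2+(\gamma_2^2-A_2-B_2-C_2-\beta_4)q+\beta_4\}p^2\\ &+\{3\kappa\varepsilon^2q^4+B_1q^3+C_1q^2+G_1q-\beta_5\}p+\varepsilon^3q^3+\varepsilon^2b_0q^2+\varepsilon c_0q, \end{aligned}$$ where $\kappa=2\alpha_0+\alpha_8$, $\varepsilon=\alpha_0(\alpha_0+\alpha_8)$, $\gamma_1=2\alpha_6+\alpha_7$, $\gamma_2=\alpha_6(\alpha_6+\alpha_7)$; $\beta_1,\dots,\beta_5$ are the elementary symmetric functions (of degree $1,\dots,5$) of the numbers $\rho_k=\alpha_1+\cdots+\alpha_k$, $k=1,\dots,5$; and $$\begin{aligned} v&=\gamma_1^2+2\gamma_2-\beta_2,\qquad m=v-3(\kappa^2+\varepsilon),\qquad b_0=v+4\kappa\gamma_1+3\kappa^2-\varepsilon,\\ A_3&=\kappa^3+6\kappa\varepsilon,\qquad x=2\kappa v+3\kappa^3-12\kappa\varepsilon+6\kappa^2\gamma_1-4\varepsilon\gamma_1,\\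 k_0&=\gamma_1^3+5\kappa\gamma_1^2+\kappa\gamma_2+9\kappa^2\gamma_1-\varepsilon\gamma_1+5\kappa^3-(\gamma_1+2\kappa)\beta_2-\beta_3,\\ A_2&=3\kappa^2\varepsilon+3\varepsilon^2,\\ B_2&=(\kappa^2+2\varepsilon)v+4\kappa^3\gamma_1+4\kappa\varepsilon\gamma_1+3\kappa^4-3\kappa^2\varepsilon-6\varepsilon^2,\\ C_2&=\beta_4-3A_2-2B_2+\gamma_2(\gamma_1^2+\gamma_2+3\kappa\gamma_1+3\kappa^2+3\varepsilon-\beta_2)-\gamma_1k_0,\\ c_2&=-2\gamma_1^2-4\gamma_2+3\beta_2-3\kappa^2+3\varepsilon-6\kappa\gamma_1,\\ c_1&=-2\gamma_1\gamma_2-4\kappa^3+3\kappa\varepsilon-2\kappa\gamma_1^2-4\kappa\gamma_2+\kappa\beta_2-6\kappa^2\gamma_1+2\varepsilon\gamma_1-\beta_3,\\ c_0&=C_2-\kappa c_1-\varepsilon c_2,\\ B_1&=2\kappa\varepsilon b_0-2\varepsilon^2(2\kappa+\gamma_1),\qquad C_1=\kappa c_0+\varepsilon c_1,\\ G_1&=\gamma_2k_0+\beta_5-3\kappa\varepsilon^2-B_1-C_1 . \end{aligned}$$ Construction of $\tilde S$. The Hirzebruch surface $\Sigma_2$ is obtained by gluing four copies of $\mathbb{C}^2$ with coordinates $(z_j,w_j)$, $j=0,1,2,3$, via $z_0=q$, $w_0=p$; $z_1=1/q$, $w_1=-(qp+\alpha_0)q$; $z_2=z_0$, $w_2=1/w_0$;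 $z_3=z_1$, $w_3=1/w_1$. Let $D^{(0)}=\{w_2=0\}\cup\{w_3=0\}\subset\Sigma_2$. Blow up $\Sigma_2$ at $a_\nu^{(0)}=\{(z_2,w_2)=(\nu,0)\}$ ($\nu=0,1$) and $a_\infty^{(0)}=\{(z_3,w_3)=(0,0)\}$, with exceptional curves $D_\nu^{(1)}$; near them use $(u_\nu,v_\nu)=\left(\frac{z_2-\nu}{w_2},w_2\right)$ ($\nu=0,1$), $(u_\infty,v_\infty)=\left(\frac{z_3}{w_3},w_3\right)$. Next blow up the eight points: on $D_0^{(1)}$, $v_0=0$ and $u_0=\rho_1,\dots,\rho_5$; on $D_1^{(1)}$, $v_1=0$ and $u_1=\alpha_6,\ \alpha_6+\alpha_7$; on $D_\infty^{(1)}$, $(u_\infty,v_\infty)=(\alpha_8,0)$. Finally blow down successively the strict transform of $D^{(0)}$, then the image of $D_\infty^{(1)}$, then the image of $D_1^{(1)}$ (each a $(-1)$-curve when contracted) to nonsingular points. The result is $\tilde S$; its anticanonical divisor is $-K_{\tilde S}=D_0^{(1)}$ (image of the strict transform), and $(-K_{\tilde S})_{red}$ denotes the corresponding reduced divisor. "Obtained by gluing via the $r_j$" means that $S$ is covered by the affine planes with coordinates $(q,p)$ and $(x_j,y_j)$, identified with each other by the birational maps $r_j$ ($r_8$ being taken relative to $(x_0,y_0)$).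
   Formalization: The eight points blown up in the second step are assumed distinct (ρ_1,…,ρ_5 pairwise different and α_7≠0); if two of them coincide, two of the r_j coincide and the claim fails or the construction of S̃ is not defined. *)

theory Defs
  imports "HOL-Analysis.Analysis" "HOL-Computational_Algebra.Polynomial"
begin

section \<open>Complex surfaces given by atlases\<close>

type_synonym c2 = "complex \<times> complex"

text \<open>An atlas is a set of local parametrizations: a pair (A, f) stands for the map f from the
  open set A of the complex plane squared onto an open piece of the surface; the inverse of f
  restricted to A is the corresponding coordinate system.\<close>

type_synonym 'a chart = "c2 set \<times> (c2 \<Rightarrow> 'a)"
type_synonym 'a atlas = "'a chart set"

definition cscale :: "complex \<Rightarrow> c2 \<Rightarrow> c2" where
  "cscale c h = (c * fst h, c * snd h)"

definition holo2 :: "c2 set \<Rightarrow> (c2 \<Rightarrow> c2) \<Rightarrow> bool" where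
  "holo2 A f \<longleftrightarrow> open A \<and>
     (\<forall>z\<in>A. \<exists>D. (f has_derivative D) (at z) \<and> (\<forall>c h. D (cscale c h) = cscale c (D h)))"

definition points :: "'a atlas \<Rightarrow> 'a set" where
  "points M = (\<Union>(A, \<phi>)\<in>M. \<phi> ` A)"

definition surface_topology :: "'a atlas \<Rightarrow> 'a topology" where
  "surface_topology M =
     topology (\<lambda>V. V \<subseteq> points M \<and> (\<forall>(A, \<phi>)\<in>M. open {z\<in>A. \<phi> z \<in> V}))"

lemma openin_surface_topology:
  "openin (surface_topology M) V \<longleftrightarrow>
     V \<subseteq> points M \<and> (\<forall>(A, \<phi>)\<in>M. open {z\<in>A. \<phi> z \<in> V})"
proof -
  let ?P = "\<lambda>V. V \<subseteq> points M \<and> (\<forall>(A, \<phi>)\<in>M. open {z\<in>A. \<phi> z \<in> V})"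
  have "istopology ?P"
    unfolding istopology_def
  proof (intro conjI allI impI)
    fix S T assume S: "?P S" and T: "?P T"
    show "S \<inter> T \<subseteq> points M" using S by auto
    have "{z \<in> A. \<phi> z \<in> S \<inter> T} = {z \<in> A. \<phi> z \<in> S} \<inter> {z \<in> A. \<phi> z \<in> T}"
      for A and \<phi> :: "c2 \<Rightarrow> 'a" by auto
    then show "\<forall>(A, \<phi>)\<in>M. open {z \<in> A. \<phi> z \<in> S \<inter> T}" using S T by auto
  next
    fix K assume K: "\<forall>U\<in>K. ?P U"
    show "\<Union>K \<subseteq> points M" using K by auto
    have "{z \<in> A. \<phi> z \<in> \<Union>K} = (\<Union>U\<in>K. {z \<in> A. \<phi> z \<in> U})"
      for A and \<phi> :: "c2 \<Rightarrow> 'a" by auto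
    then show "\<forall>(A, \<phi>)\<in>M. open {z \<in> A. \<phi> z \<in> \<Union>K}" using K by fastforce
  qed
  then show ?thesis unfolding surface_topology_def by (simp add: topology_inverse')
qed

definition holomorphic_map :: "'a atlas \<Rightarrow> 'b atlas \<Rightarrow> ('a \<Rightarrow> 'b) \<Rightarrow> bool" where
  "holomorphic_map M N F \<longleftrightarrow> F ` points M \<subseteq> points N \<and>
     (\<forall>(A, \<phi>)\<in>M. \<forall>(B, \<psi>)\<in>N.
        holo2 {z\<in>A. F (\<phi> z) \<in> \<psi> ` B} (\<lambda>z. inv_into B \<psi> (F (\<phi> z))))"

text \<open>In the next definition, holomorphy of the identity says that all coordinate changes are
  holomorphic on open sets.\<close>

definition complex_surface :: "'a atlas \<Rightarrow> bool" where
  "complex_surface M \<longleftrightarrow>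
     (\<forall>(A, \<phi>)\<in>M. open A \<and> inj_on \<phi> A) \<and> holomorphic_map M M id \<and>
     Hausdorff_space (surface_topology M) \<and> second_countable (surface_topology M)"

definition biholomorphic :: "'a atlas \<Rightarrow> 'b atlas \<Rightarrow> ('a \<Rightarrow> 'b) \<Rightarrow> bool" where
  "biholomorphic M N F \<longleftrightarrow> bij_betw F (points M) (points N) \<and>
     holomorphic_map M N F \<and> holomorphic_map N M (inv_into (points M) F)"

definition open_part :: "'a atlas \<Rightarrow> 'a set \<Rightarrow> 'a atlas" where
  "open_part M V = (\<lambda>(A, \<phi>). ({z\<in>A. \<phi> z \<in> V}, \<phi>)) ` M"

section \<open>Gluing, blowing up, blowing down\<close>

text \<open>Copies of the complex plane squared, indexed by I, glued along the equivalence relation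
  generated by R. The points are the equivalence classes.\<close>

definition glue_point :: "(('i \<times> c2) \<times> ('i \<times> c2)) set \<Rightarrow> 'i \<Rightarrow> c2 \<Rightarrow> ('i \<times> c2) set" where
  "glue_point R i z = (R \<union> R\<inverse>)\<^sup>* `` {(i, z)}"

definition glue :: "'i set \<Rightarrow> (('i \<times> c2) \<times> ('i \<times> c2)) set \<Rightarrow> ('i \<times> c2) set atlas" where
  "glue I R = (\<lambda>i. (UNIV, glue_point R i)) ` I"

text \<open>Simultaneous blow-up of M at the distinct points c k (0,0), k in K, where c k parametrizes a
  coordinate plane of M. The points of the exceptional curve over the k-th centre are
  Inr (k, l), with l the direction z : w in the coordinates (z, w) of c k: Some u stands for u : 1
  and None for 1 : 0. The two charts are (u, v) = (z/w, w) and (s, t) = (z, w/z).\<close>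

definition centres :: "'k set \<Rightarrow> ('k \<Rightarrow> c2 \<Rightarrow> 'a) \<Rightarrow> 'a set" where
  "centres K c = (\<lambda>k. c k (0, 0)) ` K"

definition uv_chart :: "('k \<Rightarrow> c2 \<Rightarrow> 'a) \<Rightarrow> 'k \<Rightarrow> c2 \<Rightarrow> 'a + 'k \<times> complex option" where
  "uv_chart c k = (\<lambda>(u, v). if v = 0 then Inr (k, Some u) else Inl (c k (u * v, v)))"

definition st_chart :: "('k \<Rightarrow> c2 \<Rightarrow> 'a) \<Rightarrow> 'k \<Rightarrow> c2 \<Rightarrow> 'a + 'k \<times> complex option" where
  "st_chart c k = (\<lambda>(s, t). if s = 0 then Inr (k, if t = 0 then None else Some (1 / t))
                            else Inl (c k (s, s * t)))"

definition blowup ::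
  "'a atlas \<Rightarrow> 'k set \<Rightarrow> ('k \<Rightarrow> c2 \<Rightarrow> 'a) \<Rightarrow> ('a + 'k \<times> complex option) atlas" where
  "blowup M K c =
     (\<lambda>(A, \<phi>). ({z\<in>A. \<phi> z \<notin> centres K c}, \<lambda>z. Inl (\<phi> z))) ` M
     \<union> (\<lambda>k. ({(u, v). v = 0 \<or> c k (u * v, v) \<notin> centres K c}, uv_chart c k)) ` K
     \<union> (\<lambda>k. ({(s, t). s = 0 \<or> c k (s, s * t) \<notin> centres K c}, st_chart c k)) ` K"

definition strict_transform ::
  "'a atlas \<Rightarrow> 'k set \<Rightarrow> ('k \<Rightarrow> c2 \<Rightarrow> 'a) \<Rightarrow> 'a set \<Rightarrow> ('a + 'k \<times> complex option) set" where
  "strict_transform M K c C =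
     surface_topology (blowup M K c) closure_of (Inl ` (C - centres K c))"

text \<open>Contraction of the curve C to a nonsingular point P. For a compact M, the surface N is
  determined by M and C up to isomorphism, since a continuous function that is holomorphic off a
  point of a complex surface is holomorphic.\<close>

definition blows_down :: "'a atlas \<Rightarrow> 'a set \<Rightarrow> 'b atlas \<Rightarrow> ('a \<Rightarrow> 'b) \<Rightarrow> bool" where
  "blows_down M C N \<pi> \<longleftrightarrow> complex_surface N \<and> C \<subseteq> points M \<and> holomorphic_map M N \<pi> \<and>
     (\<exists>P\<in>points N. \<pi> ` C = {P} \<and>
        biholomorphic (open_part M (points M - C)) (open_part N (points N - {P})) \<pi>)"

section \<open>Birational and symplectic maps\<close>

definition polyfun2 :: "complex poly poly \<Rightarrow> c2 \<Rightarrow> complex" where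
  "polyfun2 P z = poly (poly P [:snd z:]) (fst z)"

definition rational2 :: "(c2 \<Rightarrow> c2) \<Rightarrow> bool" where
  "rational2 f \<longleftrightarrow> (\<exists>P1 Q1 P2 Q2. Q1 \<noteq> 0 \<and> Q2 \<noteq> 0 \<and>
     (\<forall>z. polyfun2 Q1 z \<noteq> 0 \<and> polyfun2 Q2 z \<noteq> 0 \<longrightarrow>
        f z = (polyfun2 P1 z / polyfun2 Q1 z, polyfun2 P2 z / polyfun2 Q2 z)))"

definition birational2 :: "(c2 \<Rightarrow> c2) \<Rightarrow> bool" where
  "birational2 f \<longleftrightarrow> rational2 f \<and> (\<exists>g. rational2 g \<and>
     (\<exists>H. H \<noteq> 0 \<and> (\<forall>z. polyfun2 H z \<noteq> 0 \<longrightarrow> g (f z) = z \<and> f (g z) = z)))"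

definition symplectic_form :: "c2 \<Rightarrow> c2 \<Rightarrow> complex" where
  "symplectic_form h k = fst h * snd k - snd h * fst k"

definition symplectic_on :: "c2 set \<Rightarrow> (c2 \<Rightarrow> c2) \<Rightarrow> bool" where
  "symplectic_on A f \<longleftrightarrow> holo2 A f \<and>
     (\<forall>z\<in>A. \<forall>h k. symplectic_form (frechet_derivative f (at z) h) (frechet_derivative f (at z) k)
                   = symplectic_form h k)"

section \<open>Spaces of initial conditions\<close>

text \<open>A vector field is given by its coordinate expression Y (A, f) in every chart.\<close>

definition holomorphic_field :: "'a atlas \<Rightarrow> ('a chart \<Rightarrow> c2 \<Rightarrow> c2) \<Rightarrow> bool" where
  "holomorphic_field M Y \<longleftrightarrow> (\<forall>(A, \<phi>)\<in>M. holo2 A (Y (A, \<phi>))) \<and>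
     (\<forall>(A, \<phi>)\<in>M. \<forall>(B, \<psi>)\<in>M. \<forall>z\<in>A. \<phi> z \<in> \<psi> ` B \<longrightarrow>
        frechet_derivative (\<lambda>x. inv_into B \<psi> (\<phi> x)) (at z) (Y (A, \<phi>) z)
          = Y (B, \<psi>) (inv_into B \<psi> (\<phi> z)))"

definition entire_solution ::
  "'a atlas \<Rightarrow> ('a chart \<Rightarrow> c2 \<Rightarrow> c2) \<Rightarrow> (complex \<Rightarrow> 'a) \<Rightarrow> bool" where
  "entire_solution M Y \<gamma> \<longleftrightarrow> continuous_map euclidean (surface_topology M) \<gamma> \<and>
     (\<forall>t. \<forall>(A, \<phi>)\<in>M. \<gamma> t \<in> \<phi> ` A \<longrightarrow>
        ((\<lambda>\<tau>. inv_into A \<phi> (\<gamma> \<tau>)) has_derivative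
           (\<lambda>h. cscale h (Y (A, \<phi>) (inv_into A \<phi> (\<gamma> t))))) (at t))"

text \<open>Okamoto's notion for an autonomous system with right-hand side X: the phase plane embeds
  (by j) as a dense open subset of the surface S, the system extends holomorphically to S, and
  the points of S at any time t0 parametrize the solutions, each of which is
  defined for all complex times. Adding the chart (UNIV, j) to S expresses both that j is a
  biholomorphic map onto an open subset and that the extended field restricts to X.\<close>

definition space_of_initial_conditions :: "'a atlas \<Rightarrow> (c2 \<Rightarrow> 'a) \<Rightarrow> (c2 \<Rightarrow> c2) \<Rightarrow> bool" where
  "space_of_initial_conditions S j X \<longleftrightarrow>
     complex_surface S \<and> range j \<subseteq> points S \<and> complex_surface (insert (UNIV, j) S) \<and>
     surface_topology S closure_of range j = points S \<and>
     (\<exists>Y. holomorphic_field (insert (UNIV, j) S) Y \<and> Y (UNIV, j) = X \<and>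
        (\<forall>t0. \<forall>s\<in>points S. \<exists>!\<gamma>. entire_solution (insert (UNIV, j) S) Y \<gamma> \<and> \<gamma> t0 = s))"

section \<open>The Hamiltonian system\<close>

definition \<rho> :: "(nat \<Rightarrow> complex) \<Rightarrow> nat \<Rightarrow> complex" where
  "\<rho> \<alpha> k = (\<Sum>i=1..k. \<alpha> i)"

definition \<beta> :: "(nat \<Rightarrow> complex) \<Rightarrow> nat \<Rightarrow> complex" where
  "\<beta> \<alpha> k = (\<Sum>J | J \<subseteq> {1..5} \<and> card J = k. \<Prod>i\<in>J. \<rho> \<alpha> i)"

definition hamiltonian :: "(nat \<Rightarrow> complex) \<Rightarrow> complex \<Rightarrow> complex \<Rightarrow> complex" where
  "hamiltonian \<alpha> q p = (
     let \<kappa> = 2 * \<alpha> 0 + \<alpha> 8; \<epsilon> = \<alpha> 0 * (\<alpha> 0 + \<alpha> 8);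
         \<gamma>1 = 2 * \<alpha> 6 + \<alpha> 7; \<gamma>2 = \<alpha> 6 * (\<alpha> 6 + \<alpha> 7);
         \<beta>1 = \<beta> \<alpha> 1; \<beta>2 = \<beta> \<alpha> 2; \<beta>3 = \<beta> \<alpha> 3; \<beta>4 = \<beta> \<alpha> 4; \<beta>5 = \<beta> \<alpha> 5;
         v = \<gamma>1^2 + 2 * \<gamma>2 - \<beta>2;
         m = v - 3 * (\<kappa>^2 + \<epsilon>);
         b0 = v + 4 * \<kappa> * \<gamma>1 + 3 * \<kappa>^2 - \<epsilon>;
         A3 = \<kappa>^3 + 6 * \<kappa> * \<epsilon>;
         x = 2 * \<kappa> * v + 3 * \<kappa>^3 - 12 * \<kappa> * \<epsilon> + 6 * \<kappa>^2 * \<gamma>1 - 4 * \<epsilon> * \<gamma>1;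
         k0 = \<gamma>1^3 + 5 * \<kappa> * \<gamma>1^2 + \<kappa> * \<gamma>2 + 9 * \<kappa>^2 * \<gamma>1 - \<epsilon> * \<gamma>1 + 5 * \<kappa>^3
              - (\<gamma>1 + 2 * \<kappa>) * \<beta>2 - \<beta>3;
         A2 = 3 * \<kappa>^2 * \<epsilon> + 3 * \<epsilon>^2;
         B2 = (\<kappa>^2 + 2 * \<epsilon>) * v + 4 * \<kappa>^3 * \<gamma>1 + 4 * \<kappa> * \<epsilon> * \<gamma>1 + 3 * \<kappa>^4
              - 3 * \<kappa>^2 * \<epsilon> - 6 * \<epsilon>^2;
         C2 = \<beta>4 - 3 * A2 - 2 * B2
              + \<gamma>2 * (\<gamma>1^2 + \<gamma>2 + 3 * \<kappa> * \<gamma>1 + 3 * \<kappa>^2 + 3 * \<epsilon> - \<beta>2) - \<gamma>1 * k0;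
         c2 = - 2 * \<gamma>1^2 - 4 * \<gamma>2 + 3 * \<beta>2 - 3 * \<kappa>^2 + 3 * \<epsilon> - 6 * \<kappa> * \<gamma>1;
         c1 = - 2 * \<gamma>1 * \<gamma>2 - 4 * \<kappa>^3 + 3 * \<kappa> * \<epsilon> - 2 * \<kappa> * \<gamma>1^2 - 4 * \<kappa> * \<gamma>2 + \<kappa> * \<beta>2
              - 6 * \<kappa>^2 * \<gamma>1 + 2 * \<epsilon> * \<gamma>1 - \<beta>3;
         c0 = C2 - \<kappa> * c1 - \<epsilon> * c2;
         B1 = 2 * \<kappa> * \<epsilon> * b0 - 2 * \<epsilon>^2 * (2 * \<kappa> + \<gamma>1);
         C1 = \<kappa> * c0 + \<epsilon> * c1;
         G1 = \<gamma>2 * k0 + \<beta>5 - 3 * \<kappa> * \<epsilon>^2 - B1 - C1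
     in q^5 * (q - 1)^4 * p^6
        + q^4 * (q - 1)^3 * (3 * \<kappa> * q + \<beta>1) * p^5
        + q^3 * (q - 1)^2 * (3 * (\<kappa>^2 + \<epsilon>) * q^2 + m * q + \<beta>2) * p^4
        + q^2 * (q - 1) * (A3 * q^3 + x * q^2 - (A3 + x + \<beta>3 + 2 * \<gamma>1 * \<gamma>2) * q + \<beta>3) * p^3
        + q * (A2 * q^4 + B2 * q^3 + C2 * q^2 + (\<gamma>2^2 - A2 - B2 - C2 - \<beta>4) * q + \<beta>4) * p^2
        + (3 * \<kappa> * \<epsilon>^2 * q^4 + B1 * q^3 + C1 * q^2 + G1 * q - \<beta>5) * p
        + \<epsilon>^3 * q^3 + \<epsilon>^2 * b0 * q^2 + \<epsilon> * c0 * q)"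

definition hamiltonian_field :: "(nat \<Rightarrow> complex) \<Rightarrow> c2 \<Rightarrow> c2" where
  "hamiltonian_field \<alpha> = (\<lambda>(q, p).
     (deriv (\<lambda>p'. hamiltonian \<alpha> q p') p, - deriv (\<lambda>q'. hamiltonian \<alpha> q' p) q))"

section \<open>The rational surface\<close>

text \<open>The first three identifications are the defining ones. The last one is the resulting
  relation between charts 2 and 3; it has to be listed because it also identifies points with
  w2 = 0, which do not lie in charts 0 and 1.\<close>

definition sigma2_rel :: "(nat \<Rightarrow> complex) \<Rightarrow> ((nat \<times> c2) \<times> (nat \<times> c2)) set" where
  "sigma2_rel \<alpha> =
     {((0, (q, p)), (1, (1 / q, - (q * p + \<alpha> 0) * q))) | q p. q \<noteq> 0}
   \<union> {((0, (q, p)), (2, (q, 1 / p))) | q p. p \<noteq> 0}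
   \<union> {((1, (z, w)), (3, (z, 1 / w))) | z w. w \<noteq> 0}
   \<union> {((2, (z, w)), (3, (1 / z, - w / (z * (z + \<alpha> 0 * w))))) | z w. z \<noteq> 0 \<and> z + \<alpha> 0 * w \<noteq> 0}"

definition sigma2 :: "(nat \<Rightarrow> complex) \<Rightarrow> (nat \<times> c2) set atlas" where
  "sigma2 \<alpha> = glue {0, 1, 2, 3} (sigma2_rel \<alpha>)"

abbreviation zw :: "(nat \<Rightarrow> complex) \<Rightarrow> nat \<Rightarrow> c2 \<Rightarrow> (nat \<times> c2) set" where
  "zw \<alpha> i \<equiv> glue_point (sigma2_rel \<alpha>) i"

definition D_section :: "(nat \<Rightarrow> complex) \<Rightarrow> (nat \<times> c2) set set" where
  "D_section \<alpha> = range (\<lambda>z. zw \<alpha> 2 (z, 0)) \<union> range (\<lambda>z. zw \<alpha> 3 (z, 0))"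

datatype base = At0 | At1 | AtInf

type_synonym bl1 = "(nat \<times> c2) set + base \<times> complex option"
type_synonym bl2 = "bl1 + nat \<times> complex option"

fun first_coords :: "(nat \<Rightarrow> complex) \<Rightarrow> base \<Rightarrow> c2 \<Rightarrow> (nat \<times> c2) set" where
  "first_coords \<alpha> At0 (z, w) = zw \<alpha> 2 (z, w)"
| "first_coords \<alpha> At1 (z, w) = zw \<alpha> 2 (z + 1, w)"
| "first_coords \<alpha> AtInf (z, w) = zw \<alpha> 3 (z, w)"

definition X1 :: "(nat \<Rightarrow> complex) \<Rightarrow> bl1 atlas" where
  "X1 \<alpha> = blowup (sigma2 \<alpha>) UNIV (first_coords \<alpha>)"

definition D_exc :: "base \<Rightarrow> bl1 set" where
  "D_exc \<nu> = range (\<lambda>l. Inr (\<nu>, l))"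

definition second_base :: "nat \<Rightarrow> base" where
  "second_base k = (if k \<le> 5 then At0 else if k \<le> 7 then At1 else AtInf)"

definition second_pos :: "(nat \<Rightarrow> complex) \<Rightarrow> nat \<Rightarrow> complex" where
  "second_pos \<alpha> k = (if k \<le> 5 then \<rho> \<alpha> k else if k = 6 then \<alpha> 6
                     else if k = 7 then \<alpha> 6 + \<alpha> 7 else \<alpha> 8)"

text \<open>The local coordinates (u, v), translated so as to be centred at the k-th of the eight points.\<close>

definition second_coords :: "(nat \<Rightarrow> complex) \<Rightarrow> nat \<Rightarrow> c2 \<Rightarrow> bl1" where
  "second_coords \<alpha> k = (\<lambda>(a, b).
     uv_chart (first_coords \<alpha>) (second_base k) (second_pos \<alpha> k + a, b))"

definition X2 :: "(nat \<Rightarrow> complex) \<Rightarrow> bl2 atlas" where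
  "X2 \<alpha> = blowup (X1 \<alpha>) {1..8} (second_coords \<alpha>)"

definition D_section_strict :: "(nat \<Rightarrow> complex) \<Rightarrow> bl2 set" where
  "D_section_strict \<alpha> =
     strict_transform (X1 \<alpha>) {1..8} (second_coords \<alpha>)
       (strict_transform (sigma2 \<alpha>) UNIV (first_coords \<alpha>) (D_section \<alpha>))"

definition D_exc_strict :: "(nat \<Rightarrow> complex) \<Rightarrow> base \<Rightarrow> bl2 set" where
  "D_exc_strict \<alpha> \<nu> = strict_transform (X1 \<alpha>) {1..8} (second_coords \<alpha>) (D_exc \<nu>)"

definition qp_point :: "(nat \<Rightarrow> complex) \<Rightarrow> c2 \<Rightarrow> bl2" where
  "qp_point \<alpha> z = Inl (Inl (zw \<alpha> 0 z))"

section \<open>The ten planes\<close>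

text \<open>The map r 8 is a map of the coordinates (x0, y0); the others are maps of (q, p).\<close>

definition r :: "(nat \<Rightarrow> complex) \<Rightarrow> nat \<Rightarrow> c2 \<Rightarrow> c2" where
  "r \<alpha> j = (\<lambda>(q, p).
     if j = 0 then (1 / q, - (q * p + \<alpha> 0) * q)
     else if j \<le> 5 then (- (p * q - (\<Sum>i=1..j. \<alpha> i)) * p, 1 / p)
     else if j = 6 then (- (p * (q - 1) - \<alpha> 6) * p, 1 / p)
     else if j = 7 then (- (p * (q - 1) - (\<alpha> 6 + \<alpha> 7)) * p, 1 / p)
     else (- (q * p - \<alpha> 8) * p, 1 / p))"

definition r_dom :: "nat \<Rightarrow> c2 set" where
  "r_dom j = (if j = 0 then {(q, p). q \<noteq> 0} else {(q, p). p \<noteq> 0})"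

text \<open>The index None is the (q, p)-plane, and Some j is the plane U j.\<close>

definition ten_rel :: "(nat \<Rightarrow> complex) \<Rightarrow> ((nat option \<times> c2) \<times> (nat option \<times> c2)) set" where
  "ten_rel \<alpha> = {((None, z), (Some j, r \<alpha> j z)) | j z. j \<le> 7 \<and> z \<in> r_dom j}
             \<union> {((Some 0, z), (Some 8, r \<alpha> 8 z)) | z. z \<in> r_dom 8}"

definition ten_planes :: "(nat \<Rightarrow> complex) \<Rightarrow> (nat option \<times> c2) set atlas" where
  "ten_planes \<alpha> = glue (insert None (Some ` {0..8})) (ten_rel \<alpha>)"

end

theory Submission
  imports Defs "HOL-Complex_Analysis.Complex_Analysis"
begin

text \<open>
  None of the three contracted curves meets the complement \<open>W\<close> of the four strict transforms
  in the second blow-up, and each contracted curve meets the curves that remain; hence the blow-downs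
  map \<open>W\<close> biholomorphically onto \<open>S\<close>. In the coordinates \<open>(u, v)\<close> of the second blow-up the plane \<open>U\<^sub>j\<close> is,
  up to a sign, the standard chart at the \<open>j\<close>-th centre, and together with \<open>\<complex>\<^sup>2\<close> and \<open>U\<^sub>0\<close> these charts
  cover \<open>W\<close>; two of their points coincide in \<open>W\<close> exactly if the maps \<open>r\<^sub>j\<close> identify them.

  The coefficients of \<open>I\<close> are such that \<open>I\<close> is a polynomial in each of the ten charts, and the \<open>r\<^sub>j\<close> are
  symplectic, so the Hamiltonian fields glue to a holomorphic field on \<open>S\<close>. Because \<open>I\<close> has poles
  along the removed curves, every level set of \<open>I\<close> is covered by compact pieces of finitely many charts.
  As \<open>I\<close> is a first integral, the local complex-time flow on a level set exists for a time bounded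
  below uniformly, and a flow with this property extends to all complex times.
\<close>

section \<open>Holomorphic functions of two variables\<close>

text \<open>The linear relation among the parameters enters as
  \<open>b1 = - 3 * \<kappa> - 2 * \<gamma>1\<close>. It makes the leading coefficient of I along q
  = 1 a square and the subleading ones along q = 1 and q = infinity divisible by what the cube and
  the square leave over; the lengthy coefficients of I are solutions of these divisibility
  conditions. In the chart at a centre s, the substitution u - s = -xy then cancels all poles.
  Distinctness of the eight centres acts elsewhere: when x tends to infinity near a centre, the
  leading coefficient involves the differences of centres on one exceptional curve, so level sets
  stay bounded there. The Hausdorff property and second countability of the glued planes come from
  \<open>S_tilde\<close> through the contractions. Compatibility of the fields is checked only along
  the maps \<open>r j\<close> and then carried through the generated equivalence. Extending a flow
  by powers of short-time maps, rather than along paths in the complex time plane, avoids a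
  monodromy argument.\<close>

definition hol :: "c2 set \<Rightarrow> (c2 \<Rightarrow> complex) \<Rightarrow> bool" where
  "hol A f \<longleftrightarrow> open A \<and>
     (\<forall>z\<in>A. \<exists>a b. (f has_derivative (\<lambda>h. a * fst h + b * snd h)) (at z))"

definition dx :: "(c2 \<Rightarrow> complex) \<Rightarrow> c2 \<Rightarrow> complex" where
  "dx f z = deriv (\<lambda>x. f (x, snd z)) (fst z)"

definition dy :: "(c2 \<Rightarrow> complex) \<Rightarrow> c2 \<Rightarrow> complex" where
  "dy f z = deriv (\<lambda>y. f (fst z, y)) (snd z)"

lemma has_derivative_slices:
  fixes f :: "c2 \<Rightarrow> complex"
  assumes "(f has_derivative (\<lambda>h. a * fst h + b * snd h)) (at (x, y))"
  shows "((\<lambda>x. f (x, y)) has_field_derivative a) (at x)"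
    and "((\<lambda>y. f (x, y)) has_field_derivative b) (at y)"
proof -
  have "((\<lambda>x. f (x, y)) has_derivative (\<lambda>h. a * fst (h, 0::complex) + b * snd (h, 0::complex))) (at x)"
    by (rule has_derivative_compose[where g = f and f = "\<lambda>x. (x, y)"])
       (use assms in \<open>auto intro!: derivative_eq_intros\<close>)
  then show "((\<lambda>x. f (x, y)) has_field_derivative a) (at x)"
    by (simp add: has_field_derivative_def)
  have "((\<lambda>y. f (x, y)) has_derivative (\<lambda>h. a * fst (0::complex, h) + b * snd (0::complex, h))) (at y)"
    by (rule has_derivative_compose[where g = f and f = "\<lambda>y. (x, y)"])
       (use assms in \<open>auto intro!: derivative_eq_intros\<close>)
  then show "((\<lambda>y. f (x, y)) has_field_derivative b) (at y)"
    by (simp add: has_field_derivative_def)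
qed

lemma hol_has_derivative:
  assumes "hol A f" "z \<in> A"
  shows "(f has_derivative (\<lambda>h. dx f z * fst h + dy f z * snd h)) (at z)"
proof -
  obtain a b where D: "(f has_derivative (\<lambda>h. a * fst h + b * snd h)) (at (fst z, snd z))"
    using assms by (auto simp: hol_def)
  from has_derivative_slices[OF D] have "dx f z = a" "dy f z = b"
    by (auto simp: dx_def dy_def DERIV_imp_deriv)
  with D show ?thesis by simp
qed

lemma hol_slices:
  assumes "hol A f" "(x, y) \<in> A"
  shows "((\<lambda>x. f (x, y)) has_field_derivative dx f (x, y)) (at x)"
    and "((\<lambda>y. f (x, y)) has_field_derivative dy f (x, y)) (at y)"
  using has_derivative_slices[OF hol_has_derivative[OF assms]] by auto

lemma hol_continuous_on: "hol A f \<Longrightarrow> continuous_on A f"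
  by (meson continuous_at_imp_continuous_on has_derivative_continuous hol_has_derivative)

lemma hol_open: "hol A f \<Longrightarrow> open A"
  by (simp add: hol_def)

section \<open>Continuous separately holomorphic functions and Osgood's lemma\<close>

definition sep_hol :: "c2 set \<Rightarrow> (c2 \<Rightarrow> complex) \<Rightarrow> bool" where
  "sep_hol A f \<longleftrightarrow> open A \<and> continuous_on A f \<and>
     (\<forall>x y. (x, y) \<in> A \<longrightarrow> (\<lambda>x. f (x, y)) field_differentiable at x \<and>
                          (\<lambda>y. f (x, y)) field_differentiable at y)"

lemma hol_imp_sep_hol: "hol A f \<Longrightarrow> sep_hol A f"
  unfolding sep_hol_def
  using hol_open hol_continuous_on hol_slices field_differentiable_def by blast

lemma open_contains_bicball:
  assumes "open (A :: c2 set)" "(a, b) \<in> A"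
  obtains R where "R > 0" "cball a R \<times> cball b R \<subseteq> A"
proof -
  obtain U V where UV: "open U" "open V" "(a, b) \<in> U \<times> V" "U \<times> V \<subseteq> A"
    using assms by (rule open_prod_elim)
  obtain R1 where R1: "R1 > 0" "cball a R1 \<subseteq> U"
    using UV open_contains_cball[of U] by auto
  obtain R2 where R2: "R2 > 0" "cball b R2 \<subseteq> V"
    using UV open_contains_cball[of V] by auto
  have "cball a (min R1 R2) \<times> cball b (min R1 R2) \<subseteq> cball a R1 \<times> cball b R2"
    by auto
  then have "cball a (min R1 R2) \<times> cball b (min R1 R2) \<subseteq> A"
    using R1 R2 UV by blast
  moreover have "min R1 R2 > 0" using R1 R2 by auto
  ultimately show thesis using that by blast
qed

lemma sep_hol_slice_holomorphic:
  assumes "sep_hol A f" "\<And>x. x \<in> U \<Longrightarrow> (x, y) \<in> A"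
  shows "(\<lambda>x. f (x, y)) holomorphic_on U"
  using assms unfolding sep_hol_def holomorphic_on_def
  by (blast intro: field_differentiable_at_within)

lemma sep_hol_slice_holomorphic':
  assumes "sep_hol A f" "\<And>y. y \<in> U \<Longrightarrow> (x, y) \<in> A"
  shows "(\<lambda>y. f (x, y)) holomorphic_on U"
  using assms unfolding sep_hol_def holomorphic_on_def
  by (blast intro: field_differentiable_at_within)

text \<open>The difference of the slices at y and at b is uniformly small, by uniform continuity of
  f on a compact bidisc, and Cauchy's inequality passes this smallness on to the x-derivatives. What
  remains is the change of x along the slice y = b, a one-variable matter.\<close>

lemma sep_hol_dx_continuous:
  assumes f: "sep_hol A f"
  shows "continuous_on A (dx f)"
proof -
  have A: "open A" using f by (simp add: sep_hol_def)
  have "isCont (dx f) (a, b)" if ab: "(a, b) \<in> A" for a b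
  proof -
    obtain R where R: "R > 0" "cball a R \<times> cball b R \<subseteq> A"
      using open_contains_bicball[OF A ab] by blast
    have holx: "(\<lambda>x. f (x, y)) holomorphic_on ball a R" if "y \<in> cball b R" for y
      by (rule sep_hol_slice_holomorphic[OF f]) (use R that in auto)
    have "uniformly_continuous_on (cball a R \<times> cball b R) f"
      using f R by (intro compact_uniformly_continuous compact_Times)
        (auto simp: sep_hol_def intro: continuous_on_subset)
    then have uc: "\<exists>d>0. \<forall>z\<in>cball a R \<times> cball b R. \<forall>z'\<in>cball a R \<times> cball b R.
        dist z' z < d \<longrightarrow> dist (f z') (f z) < e" if "e > 0" for e
      using that unfolding uniformly_continuous_on_def by blast
    have ca: "isCont (\<lambda>x. dx f (x, b)) a"
    proof -
      have "deriv (\<lambda>x. f (x, b)) holomorphic_on ball a R"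
        using holx[of b] R by (intro holomorphic_deriv) auto
      then have "continuous_on (ball a R) (\<lambda>x. dx f (x, b))"
        unfolding dx_def by (auto intro: holomorphic_on_imp_continuous_on)
      then show ?thesis
        using R by (simp add: continuous_on_eq_continuous_at)
    qed
    have "\<exists>d>0. \<forall>z. dist z (a, b) < d \<longrightarrow> dist (dx f z) (dx f (a, b)) < e" if e: "e > 0" for e
    proof -
      \<comment> \<open>The tolerance \<open>e * R / 4\<close> anticipates Cauchy's inequality on a
        circle of radius \<open>R / 2\<close>, which turns it into \<open>e / 2\<close>.\<close>
      obtain d1 where d1: "d1 > 0"
        "\<And>z z'. \<lbrakk>z \<in> cball a R \<times> cball b R; z' \<in> cball a R \<times> cball b R; dist z' z < d1\<rbrakk>
          \<Longrightarrow> dist (f z') (f z) < e * R / 4"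
        using uc[of "e * R / 4"] e R by (metis divide_pos_pos mult_pos_pos zero_less_numeral)
      obtain d2 where d2: "d2 > 0" "\<And>x. dist x a < d2 \<Longrightarrow> dist (dx f (x, b)) (dx f (a, b)) < e / 2"
        using ca e unfolding continuous_at_eps_delta by (metis half_gt_zero)
      define d where "d = Min {d1, d2, R / 2}"
      have d: "d > 0" "d \<le> d1" "d \<le> d2" "d \<le> R / 2"
        using d1 d2 R by (auto simp: d_def)
      have "dist (dx f (x, y)) (dx f (a, b)) < e" if xy: "dist (x, y) (a, b) < d" for x y
      proof -
        have dxy: "dist x a < d" "dist y b < d"
          using xy dist_fst_le[of "(x, y)" "(a, b)"] dist_snd_le[of "(x, y)" "(a, b)"] by auto
        have sub: "cball x (R / 2) \<subseteq> ball a R"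
        proof
          fix w assume "w \<in> cball x (R / 2)"
          then show "w \<in> ball a R"
            using dxy d dist_triangle[of a w x] by (simp add: dist_commute)
        qed
        define g where "g = (\<lambda>x. f (x, y) - f (x, b))"
        have yb: "y \<in> cball b R" "b \<in> cball b R"
          using dxy d R by (auto simp: dist_commute)
        have ghol: "g holomorphic_on ball a R"
          unfolding g_def using holx yb by (intro holomorphic_on_diff) auto
        have "norm ((deriv ^^ 1) g x) \<le> fact 1 * (e * R / 4) / (R / 2) ^ 1"
        proof (rule Cauchy_inequality)
          show "g holomorphic_on ball x (R / 2)"
            using ghol sub ball_subset_cball by (meson holomorphic_on_subset subset_trans)
          show "continuous_on (cball x (R / 2)) g"
            using ghol sub by (meson holomorphic_on_imp_continuous_on holomorphic_on_subset)
          show "0 < R / 2" using R by simp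
          fix w assume "norm (x - w) = R / 2"
          then have "w \<in> ball a R" using sub by (auto simp: dist_norm)
          then have "dist (f (w, y)) (f (w, b)) < e * R / 4"
            using d1(2)[of "(w, b)" "(w, y)"] yb dxy d by (auto simp: dist_Pair_Pair)
          then show "norm (g w) \<le> e * R / 4" by (simp add: g_def dist_norm)
        qed
        then have "norm (deriv g x) \<le> e / 2" using R by simp
        moreover have "deriv g x = dx f (x, y) - dx f (x, b)"
        proof -
          have "x \<in> ball a R" using subsetD[OF sub, of x] R by simp
          then have "(\<lambda>x. f (x, y)) field_differentiable at x" "(\<lambda>x. f (x, b)) field_differentiable at x"
            using holx yb holomorphic_on_imp_differentiable_at open_ball by blast+
          then show ?thesis unfolding g_def dx_def by (simp add: deriv_diff)
        qed
        ultimately have "dist (dx f (x, y)) (dx f (x, b)) \<le> e / 2"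
          by (simp add: dist_norm)
        moreover have "dist (dx f (x, b)) (dx f (a, b)) < e / 2"
          using d2 dxy d by auto
        ultimately show ?thesis
          using dist_triangle[of "dx f (x, y)" "dx f (a, b)" "dx f (x, b)"] by linarith
      qed
      then show ?thesis using d(1) by (metis prod.collapse)
    qed
    then show ?thesis unfolding continuous_at_eps_delta by blast
  qed
  then show ?thesis using A by (auto simp: continuous_on_eq_continuous_at)
qed

lemma sep_hol_swap:
  assumes "sep_hol A f"
  shows "sep_hol (prod.swap -` A) (f \<circ> prod.swap)"
proof -
  have *: "continuous_on UNIV (prod.swap :: c2 \<Rightarrow> c2)"
    unfolding prod.swap_def by (intro continuous_intros)
  have "open (prod.swap -` A)"
    using assms * by (auto simp: sep_hol_def intro: open_vimage)
  moreover have "continuous_on (prod.swap -` A) (f \<circ> prod.swap)"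
    using assms by (intro continuous_on_compose continuous_on_subset[OF *])
      (auto simp: sep_hol_def intro: continuous_on_subset)
  ultimately show ?thesis using assms by (auto simp: sep_hol_def)
qed

lemma sep_hol_dy_continuous:
  assumes f: "sep_hol A f"
  shows "continuous_on A (dy f)"
proof -
  have *: "continuous_on UNIV (prod.swap :: c2 \<Rightarrow> c2)"
    unfolding prod.swap_def by (intro continuous_intros)
  have "continuous_on A (dx (f \<circ> prod.swap) \<circ> prod.swap)"
    by (intro continuous_on_compose continuous_on_subset[OF *]
        continuous_on_subset[OF sep_hol_dx_continuous[OF sep_hol_swap[OF f]]]) auto
  then show ?thesis
    by (rule continuous_on_eq) (simp add: dx_def dy_def)
qed

text \<open>Osgood's lemma. Partial derivatives combine to a total derivative once one of them is
  continuous, and Cauchy's estimate has supplied that continuity.\<close>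

lemma sep_hol_imp_hol:
  assumes f: "sep_hol A f"
  shows "hol A f"
proof -
  have A: "open A" using f by (simp add: sep_hol_def)
  have "(f has_derivative (\<lambda>h. dx f (a, b) * fst h + dy f (a, b) * snd h)) (at (a, b))"
    if ab: "(a, b) \<in> A" for a b
  proof -
    obtain R where R: "R > 0" "cball a R \<times> cball b R \<subseteq> A"
      using open_contains_bicball[OF A ab] by blast
    let ?X = "ball a R" and ?Y = "ball b R"
    have XY: "?X \<times> ?Y \<subseteq> A"
      using R(2) ball_subset_cball by (meson Sigma_mono subset_trans)
    have "((\<lambda>(x, y). f (x, y)) has_derivative
        (\<lambda>(tx, ty). dx f (a, b) * tx + blinfun_mult_right (dy f (a, b)) ty)) (at (a, b) within ?X \<times> ?Y)"
    proof (rule has_derivative_partialsI)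
      have "((\<lambda>x. f (x, b)) has_field_derivative dx f (a, b)) (at a)"
        using f ab field_differentiable_derivI by (fastforce simp: sep_hol_def dx_def)
      then show "((\<lambda>x. f (x, b)) has_derivative (*) (dx f (a, b))) (at a within ?X)"
        by (simp add: has_field_derivative_def has_derivative_at_withinI)
      fix x y assume "x \<in> ?X" "y \<in> ?Y"
      then have "(x, y) \<in> A" using XY by auto
      then have "((\<lambda>y. f (x, y)) has_field_derivative dy f (x, y)) (at y)"
        using f field_differentiable_derivI by (fastforce simp: sep_hol_def dy_def)
      then show "((\<lambda>y. f (x, y)) has_derivative blinfun_apply (blinfun_mult_right (dy f (x, y)))) (at y within ?Y)"
        by (simp add: has_field_derivative_def has_derivative_at_withinI)
    next
      have "continuous (at (a, b)) (dy f)"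
        using sep_hol_dy_continuous[OF f] A ab continuous_on_eq_continuous_at by blast
      then have "continuous (at (a, b)) (\<lambda>z. blinfun_mult_right (dy f z))"
        by (intro bounded_linear.continuous[OF bounded_linear_blinfun_mult_right])
      then show "continuous (at (a, b) within ?X \<times> ?Y) (\<lambda>(x, y). blinfun_mult_right (dy f (x, y)))"
        by (simp add: case_prod_unfold continuous_at_imp_continuous_at_within)
    qed (use R in auto)
    moreover have "at (a, b) within ?X \<times> ?Y = at (a, b)"
      using R by (intro at_within_open) (auto intro: open_Times)
    ultimately show ?thesis by (simp add: case_prod_unfold)
  qed
  then show ?thesis using A by (auto simp: hol_def)
qed

text \<open>The issue is holomorphy in y: on a slice x = a the function \<open>dx f\<close> is a
  uniform limit of difference quotients in x, each of them holomorphic in y. Hamiltonian fields and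
  pushed fields are built from such derivatives.\<close>

lemma hol_dx:
  assumes f: "hol A f"
  shows "hol A (dx f)"
proof (rule sep_hol_imp_hol)
  note sf = hol_imp_sep_hol[OF f]
  note A = hol_open[OF f]
  have cont: "continuous_on A (dx f)" by (rule sep_hol_dx_continuous[OF sf])
  show "sep_hol A (dx f)"
    unfolding sep_hol_def
  proof (intro conjI allI impI)
    fix a b assume ab: "(a, b) \<in> A"
    obtain R where R: "R > 0" "cball a R \<times> cball b R \<subseteq> A"
      using open_contains_bicball[OF A ab] by blast
    have "(\<lambda>x. f (x, b)) holomorphic_on ball a R"
      by (rule sep_hol_slice_holomorphic[OF sf]) (use R in auto)
    then have "deriv (\<lambda>x. f (x, b)) holomorphic_on ball a R"
      by (intro holomorphic_deriv) auto
    then show "(\<lambda>x. dx f (x, b)) field_differentiable at a"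
      using R by (auto simp: dx_def[abs_def] intro: holomorphic_on_imp_differentiable_at)
    \<comment> \<open>With n + 2 in the denominator the increments are shorter than R already at n =
      0, so \<open>a + h n\<close> stays in the bidisc.\<close>
    define h where "h n = complex_of_real (R / real (n + 2))" for n
    have nh: "norm (h n) = R / real (n + 2)" for n
      using R unfolding h_def norm_of_real by simp
    have hpos: "norm (h n) > 0" "norm (h n) < R" for n
      using R by (auto simp: nh field_simps add_pos_nonneg)
    define F where "F n y = (f (a + h n, y) - f (a, y)) / h n" for n y
    have unif: "uniform_limit (cball b R) F (\<lambda>y. dx f (a, y)) sequentially"
    proof (rule uniform_limitI)
      fix e :: real assume e: "e > 0"
      have "uniformly_continuous_on (cball a R \<times> cball b R) (dx f)"
        using R by (intro compact_uniformly_continuous compact_Times continuous_on_subset[OF cont]) auto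
      then obtain d where d: "d > 0"
        "\<And>z z'. \<lbrakk>z \<in> cball a R \<times> cball b R; z' \<in> cball a R \<times> cball b R; dist z' z < d\<rbrakk>
          \<Longrightarrow> dist (dx f z') (dx f z) < e / 2"
        using e unfolding uniformly_continuous_on_def by (metis half_gt_zero)
      have "(\<lambda>n. R / real (n + 2)) \<longlonglongrightarrow> 0"
        by (rule LIMSEQ_ignore_initial_segment[OF lim_const_over_n])
      then have "\<forall>\<^sub>F n in sequentially. R / real (n + 2) < d"
        using d(1) order_tendstoD(2) by blast
      then show "\<forall>\<^sub>F n in sequentially. \<forall>y\<in>cball b R. dist (F n y) (dx f (a, y)) < e"
      proof eventually_elim
        case (elim n)
        show ?case
        proof
          fix y assume y: "y \<in> cball b R"
          have hn: "norm (h n) < d" using elim by (simp add: nh)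
          \<comment> \<open>Subtracting the linear function of slope \<open>dx f (a, y)\<close>
            leaves a derivative of size at most \<open>e / 2\<close>; the mean value inequality then
            bounds the error of the difference quotient uniformly in y.\<close>
          have "norm ((f (a + h n, y) - dx f (a, y) * (a + h n)) - (f (a, y) - dx f (a, y) * a))
              \<le> e / 2 * norm (a + h n - a)"
          proof (rule field_differentiable_bound[where S = "cball a (norm (h n))"
                and f = "\<lambda>x. f (x, y) - dx f (a, y) * x" and f' = "\<lambda>x. dx f (x, y) - dx f (a, y)"])
            fix x assume x: "x \<in> cball a (norm (h n))"
            then have xR: "x \<in> cball a R" using hpos[of n] by auto
            have "(x, y) \<in> A" using xR y R by auto
            from hol_slices(1)[OF f this]
            have "((\<lambda>x. f (x, y) - dx f (a, y) * x) has_field_derivative dx f (x, y) - dx f (a, y)) (at x)"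
              by (auto intro!: derivative_eq_intros)
            then show "((\<lambda>x. f (x, y) - dx f (a, y) * x) has_field_derivative dx f (x, y) - dx f (a, y))
                (at x within cball a (norm (h n)))"
              by (rule DERIV_subset) auto
            show "norm (dx f (x, y) - dx f (a, y)) \<le> e / 2"
              using d(2)[of "(a, y)" "(x, y)"] xR y R x hn
              by (simp add: dist_Pair_Pair dist_norm norm_minus_commute)
          qed (auto simp: dist_norm)
          then have "norm (f (a + h n, y) - f (a, y) - dx f (a, y) * h n) \<le> e / 2 * norm (h n)"
            by (simp add: algebra_simps)
          then have "norm ((f (a + h n, y) - f (a, y) - dx f (a, y) * h n) / h n) \<le> e / 2"
            using hpos[of n] by (simp add: norm_divide field_simps)
          moreover have "(f (a + h n, y) - f (a, y) - dx f (a, y) * h n) / h n = F n y - dx f (a, y)"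
            using hpos[of n] by (simp add: F_def field_simps)
          ultimately show "dist (F n y) (dx f (a, y)) < e"
            using e by (simp add: dist_norm)
        qed
      qed
    qed
    have "(\<lambda>y. dx f (a, y)) holomorphic_on ball b R"
    proof (rule holomorphic_uniform_sequence[where f = F])
      show "F n holomorphic_on ball b R" for n
      proof -
        have "a + h n \<in> cball a R" "a \<in> cball a R"
          using hpos[of n] R by (auto simp: dist_norm)
        then have "(\<lambda>y. f (a + h n, y)) holomorphic_on ball b R" "(\<lambda>y. f (a, y)) holomorphic_on ball b R"
          by (intro sep_hol_slice_holomorphic'[OF sf]; use R in force)+
        moreover have "h n \<noteq> 0" using hpos(1)[of n] by auto
        ultimately show ?thesis unfolding F_def by (intro holomorphic_intros) auto
      qed
      fix y assume "y \<in> ball b R"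
      then obtain d where "d > 0" "cball y d \<subseteq> ball b R"
        using open_contains_cball open_ball by blast
      then show "\<exists>d>0. cball y d \<subseteq> ball b R \<and> uniform_limit (cball y d) F (\<lambda>y. dx f (a, y)) sequentially"
        using uniform_limit_on_subset[OF unif] ball_subset_cball by (metis subset_trans)
    qed auto
    then show "(\<lambda>y. dx f (a, y)) field_differentiable at b"
      using R by (auto intro: holomorphic_on_imp_differentiable_at)
  qed (use A cont in auto)
qed

lemma hol_dy:
  assumes f: "hol A f"
  shows "hol A (dy f)"
proof -
  have "hol (prod.swap -` A) (dx (f \<circ> prod.swap))"
    by (rule hol_dx[OF sep_hol_imp_hol[OF sep_hol_swap[OF hol_imp_sep_hol[OF f]]]])
  then have "sep_hol (prod.swap -` prod.swap -` A) (dx (f \<circ> prod.swap) \<circ> prod.swap)"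
    by (rule sep_hol_swap[OF hol_imp_sep_hol])
  moreover have "prod.swap -` prod.swap -` A = A" by auto
  moreover have "dx (f \<circ> prod.swap) \<circ> prod.swap = dy f"
    by (auto simp: dx_def dy_def)
  ultimately show ?thesis by (simp add: sep_hol_imp_hol)
qed

section \<open>Closure of holomorphic functions under arithmetic\<close>

lemma hol_const: "open A \<Longrightarrow> hol A (\<lambda>z. c)"
  unfolding hol_def by (intro conjI ballI exI[of _ 0]) auto

lemma hol_fst: "open A \<Longrightarrow> hol A fst"
  unfolding hol_def
  by (intro conjI ballI exI[of _ 1] exI[of _ 0]) (auto intro!: derivative_eq_intros)

lemma hol_snd: "open A \<Longrightarrow> hol A snd"
  unfolding hol_def
  by (intro conjI ballI exI[of _ 0] exI[of _ 1]) (auto intro!: derivative_eq_intros)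

lemma holI:
  assumes "open A"
    and "\<And>z. z \<in> A \<Longrightarrow> (f has_derivative (\<lambda>h. a z * fst h + b z * snd h)) (at z)"
  shows "hol A f"
  using assms unfolding hol_def by blast

lemma hol_add:
  assumes "hol A f" "hol A g"
  shows "hol A (\<lambda>z. f z + g z)"
  by (rule holI[where a = "\<lambda>z. dx f z + dx g z" and b = "\<lambda>z. dy f z + dy g z"])
     (auto intro!: derivative_eq_intros hol_has_derivative assms hol_open[OF assms(1)] simp: algebra_simps fun_eq_iff)

lemma hol_uminus:
  assumes "hol A f"
  shows "hol A (\<lambda>z. - f z)"
  by (rule holI[where a = "\<lambda>z. - dx f z" and b = "\<lambda>z. - dy f z"])
     (auto intro!: derivative_eq_intros hol_has_derivative assms hol_open[OF assms] simp: algebra_simps fun_eq_iff)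

lemma hol_diff:
  assumes "hol A f" "hol A g"
  shows "hol A (\<lambda>z. f z - g z)"
  using hol_add[OF assms(1) hol_uminus[OF assms(2)]] by simp

lemma hol_mult:
  assumes "hol A f" "hol A g"
  shows "hol A (\<lambda>z. f z * g z)"
  by (rule holI[where a = "\<lambda>z. f z * dx g z + dx f z * g z" and b = "\<lambda>z. f z * dy g z + dy f z * g z"])
     (auto intro!: derivative_eq_intros hol_has_derivative assms hol_open[OF assms(1)] simp: algebra_simps fun_eq_iff)

lemma hol_power: "hol A f \<Longrightarrow> hol A (\<lambda>z. f z ^ n)"
  by (induction n) (simp_all add: hol_const[OF hol_open] hol_mult)

lemma hol_divide:
  assumes f: "hol A f" and g: "hol A g" and nz: "\<And>z. z \<in> A \<Longrightarrow> g z \<noteq> 0"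
  shows "hol A (\<lambda>z. f z / g z)"
proof -
  have "hol A (\<lambda>z. inverse (g z))"
  proof (rule holI)
    fix z assume z: "z \<in> A"
    have "((\<lambda>z. inverse (g z)) has_derivative
        (\<lambda>h. - (inverse (g z) * (dx g z * fst h + dy g z * snd h) * inverse (g z)))) (at z)"
      by (rule Deriv.has_derivative_inverse[OF nz[OF z] hol_has_derivative[OF g z]])
    then show "((\<lambda>z. inverse (g z)) has_derivative
        (\<lambda>h. - (inverse (g z))\<^sup>2 * dx g z * fst h + - (inverse (g z))\<^sup>2 * dy g z * snd h)) (at z)"
      by (simp add: algebra_simps power2_eq_square)
  qed (rule hol_open[OF g])
  from hol_mult[OF f this] show ?thesis by (simp add: divide_inverse)
qed

lemmas hol_intros = hol_const hol_fst hol_snd hol_add hol_uminus hol_diff hol_mult hol_power hol_divide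

section \<open>Holomorphic maps between open subsets of the plane\<close>

lemma holo2_open: "holo2 A f \<Longrightarrow> open A"
  by (simp add: holo2_def)

lemma holo2_has_derivative:
  assumes "holo2 A f" "z \<in> A"
  shows "(f has_derivative frechet_derivative f (at z)) (at z)"
proof -
  obtain D where D: "(f has_derivative D) (at z)"
    using assms by (auto simp: holo2_def)
  then show ?thesis using frechet_derivative_at[OF D] by simp
qed

lemma holo2_cscale:
  assumes "holo2 A f" "z \<in> A"
  shows "frechet_derivative f (at z) (cscale c h) = cscale c (frechet_derivative f (at z) h)"
proof -
  obtain D where D: "(f has_derivative D) (at z)" "\<And>c h. D (cscale c h) = cscale c (D h)"
    using assms by (auto simp: holo2_def)
  from frechet_derivative_at[OF D(1)] D(2) show ?thesis by metis
qed

text \<open>A real-linear map that commutes with \<open>cscale\<close> is complex linear, hence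
  determined by its values at (1, 0) and (0, 1); their four components are the partial
  derivatives.\<close>

lemma holo2_iff: "holo2 A f \<longleftrightarrow> hol A (\<lambda>z. fst (f z)) \<and> hol A (\<lambda>z. snd (f z))"
proof
  assume f: "holo2 A f"
  have "\<exists>a b c d. (f has_derivative (\<lambda>h. (a * fst h + b * snd h, c * fst h + d * snd h))) (at z)"
    if z: "z \<in> A" for z
  proof -
    obtain D where D: "(f has_derivative D) (at z)" "\<And>c h. D (cscale c h) = cscale c (D h)"
      using f z by (auto simp: holo2_def)
    interpret linear D using D has_derivative_linear by blast
    have "D h = (fst (D (1,0)) * fst h + fst (D (0,1)) * snd h, snd (D (1,0)) * fst h + snd (D (0,1)) * snd h)" for h
    proof -
      have "h = cscale (fst h) (1, 0) + cscale (snd h) (0, 1)"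
        by (simp add: cscale_def prod_eq_iff)
      then have "D h = cscale (fst h) (D (1, 0)) + cscale (snd h) (D (0, 1))"
        by (metis D(2) add)
      then show ?thesis by (simp add: cscale_def mult.commute)
    qed
    then have "D = (\<lambda>h. (fst (D (1,0)) * fst h + fst (D (0,1)) * snd h, snd (D (1,0)) * fst h + snd (D (0,1)) * snd h))"
      by blast
    with D(1) have "(f has_derivative (\<lambda>h. (fst (D (1,0)) * fst h + fst (D (0,1)) * snd h, snd (D (1,0)) * fst h + snd (D (0,1)) * snd h))) (at z)"
      by simp
    then show ?thesis by blast
  qed
  moreover have "((\<lambda>z. fst (f z)) has_derivative (\<lambda>h. a * fst h + b * snd h)) (at z) \<and>
      ((\<lambda>z. snd (f z)) has_derivative (\<lambda>h. c * fst h + d * snd h)) (at z)"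
    if "(f has_derivative (\<lambda>h. (a * fst h + b * snd h, c * fst h + d * snd h))) (at z)" for a b c d z
    using has_derivative_fst[OF that] has_derivative_snd[OF that] by simp
  ultimately have "\<exists>a b c d. ((\<lambda>z. fst (f z)) has_derivative (\<lambda>h. a * fst h + b * snd h)) (at z) \<and>
      ((\<lambda>z. snd (f z)) has_derivative (\<lambda>h. c * fst h + d * snd h)) (at z)"
    if "z \<in> A" for z
    using that by blast
  then have "\<exists>a b. ((\<lambda>z. fst (f z)) has_derivative (\<lambda>h. a * fst h + b * snd h)) (at z)"
    "\<exists>c d. ((\<lambda>z. snd (f z)) has_derivative (\<lambda>h. c * fst h + d * snd h)) (at z)"
    if "z \<in> A" for z
    using that by blast+
  then show "hol A (\<lambda>z. fst (f z)) \<and> hol A (\<lambda>z. snd (f z))"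
    using holo2_open[OF f] unfolding hol_def by blast
next
  assume "hol A (\<lambda>z. fst (f z)) \<and> hol A (\<lambda>z. snd (f z))"
  then have f: "hol A (\<lambda>z. fst (f z))" "hol A (\<lambda>z. snd (f z))" by auto
  show "holo2 A f"
    unfolding holo2_def
  proof (intro conjI ballI)
    fix z assume z: "z \<in> A"
    have "(f has_derivative (\<lambda>h. (dx (\<lambda>z. fst (f z)) z * fst h + dy (\<lambda>z. fst (f z)) z * snd h,
        dx (\<lambda>z. snd (f z)) z * fst h + dy (\<lambda>z. snd (f z)) z * snd h))) (at z)"
      using has_derivative_Pair[OF hol_has_derivative[OF f(1) z] hol_has_derivative[OF f(2) z]] by simp
    then show "\<exists>D. (f has_derivative D) (at z) \<and> (\<forall>c h. D (cscale c h) = cscale c (D h))"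
      by (intro exI conjI) (auto simp: cscale_def algebra_simps)
  qed (rule hol_open[OF f(1)])
qed

lemma holo2_components:
  assumes "holo2 A f"
  shows "hol A (\<lambda>z. fst (f z))" "hol A (\<lambda>z. snd (f z))"
  using holo2_iff[of A f] assms by blast+

lemma holo2_derivative_eq:
  assumes "holo2 A f" "z \<in> A"
  shows "frechet_derivative f (at z) =
    (\<lambda>h. (dx (\<lambda>z. fst (f z)) z * fst h + dy (\<lambda>z. fst (f z)) z * snd h,
          dx (\<lambda>z. snd (f z)) z * fst h + dy (\<lambda>z. snd (f z)) z * snd h))"
proof -
  have f: "hol A (\<lambda>z. fst (f z))" "hol A (\<lambda>z. snd (f z))" by (rule holo2_components[OF assms(1)])+
  have "(f has_derivative (\<lambda>h. (dx (\<lambda>z. fst (f z)) z * fst h + dy (\<lambda>z. fst (f z)) z * snd h,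
        dx (\<lambda>z. snd (f z)) z * fst h + dy (\<lambda>z. snd (f z)) z * snd h))) (at z)"
    using has_derivative_Pair[OF hol_has_derivative[OF f(1) assms(2)] hol_has_derivative[OF f(2) assms(2)]]
    by simp
  from frechet_derivative_at[OF this] show ?thesis by (rule sym)
qed

lemma holo2_Pair: "hol A f \<Longrightarrow> hol A g \<Longrightarrow> holo2 A (\<lambda>z. (f z, g z))"
  by (simp add: holo2_iff)

lemma holo2_continuous_on: "holo2 A f \<Longrightarrow> continuous_on A f"
  by (meson continuous_at_imp_continuous_on has_derivative_continuous holo2_has_derivative)

lemma holo2I:
  assumes "open A"
    and "\<And>z. z \<in> A \<Longrightarrow> \<exists>D. (f has_derivative D) (at z) \<and> (\<forall>c h. D (cscale c h) = cscale c (D h))"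
  shows "holo2 A f"
  using assms unfolding holo2_def by (intro conjI ballI)

lemma holo2E:
  assumes "holo2 A f" "z \<in> A"
  obtains D where "(f has_derivative D) (at z)" "\<And>c h. D (cscale c h) = cscale c (D h)"
  using assms(1)[unfolded holo2_def, THEN conjunct2, rule_format, OF assms(2)] by (elim exE conjE) auto

lemma holo2_subset:
  assumes "holo2 A f" "open B" "B \<subseteq> A"
  shows "holo2 B f"
proof (rule holo2I)
  fix z assume "z \<in> B"
  then have "z \<in> A" using assms(3) by auto
  from holo2E[OF assms(1) this] show "\<exists>D. (f has_derivative D) (at z) \<and> (\<forall>c h. D (cscale c h) = cscale c (D h))"
    by metis
qed (rule assms)

lemma holo2_cong:
  assumes "holo2 A f" "\<And>z. z \<in> A \<Longrightarrow> f z = g z"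
  shows "holo2 A g"
proof (rule holo2I)
  fix z assume z: "z \<in> A"
  obtain D where D: "(f has_derivative D) (at z)" "\<And>c h. D (cscale c h) = cscale c (D h)"
    using holo2E[OF assms(1) z] by metis
  have "(g has_derivative D) (at z)"
    by (rule has_derivative_transform_within_open[OF D(1) holo2_open[OF assms(1)] z assms(2)])
  with D(2) show "\<exists>D. (g has_derivative D) (at z) \<and> (\<forall>c h. D (cscale c h) = cscale c (D h))"
    by metis
qed (rule holo2_open[OF assms(1)])

lemma holo2_id: "open A \<Longrightarrow> holo2 A (\<lambda>z. z)"
  by (rule holo2I, assumption, rule exI, rule conjI, rule has_derivative_ident, simp)

lemma holo2_local:
  assumes "\<And>z. z \<in> A \<Longrightarrow> \<exists>B. z \<in> B \<and> B \<subseteq> A \<and> holo2 B f"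
  shows "holo2 A f"
proof (rule holo2I)
  have "\<exists>T. open T \<and> z \<in> T \<and> T \<subseteq> A" if "z \<in> A" for z
    using assms[OF that] holo2_open[of _ f] by metis
  then show "open A" by (subst open_subopen) (rule ballI)
  fix z assume "z \<in> A"
  then obtain B where B: "z \<in> B" "holo2 B f" using assms by metis
  from holo2E[OF B(2,1)] show "\<exists>D. (f has_derivative D) (at z) \<and> (\<forall>c h. D (cscale c h) = cscale c (D h))"
    by metis
qed

lemma holo2_compose:
  assumes f: "holo2 A f" and g: "holo2 B g" and "\<And>z. z \<in> A \<Longrightarrow> f z \<in> B"
  shows "holo2 A (\<lambda>z. g (f z))"
  unfolding holo2_def
proof (intro conjI ballI)
  fix z assume z: "z \<in> A"
  obtain D where D: "(f has_derivative D) (at z)" "\<And>c h. D (cscale c h) = cscale c (D h)"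
    using f z by (auto simp: holo2_def)
  obtain E where E: "(g has_derivative E) (at (f z))" "\<And>c h. E (cscale c h) = cscale c (E h)"
    using g assms(3)[OF z] unfolding holo2_def by blast
  have "((\<lambda>z. g (f z)) has_derivative (\<lambda>h. E (D h))) (at z)"
    by (rule has_derivative_compose[OF D(1) E(1)])
  then show "\<exists>D. ((\<lambda>z. g (f z)) has_derivative D) (at z) \<and> (\<forall>c h. D (cscale c h) = cscale c (D h))"
    using D(2) E(2) by metis
qed (rule holo2_open[OF f])

lemma holo2_derivative_compose:
  assumes "holo2 A f" "holo2 B g" "z \<in> A" "f z \<in> B"
  shows "frechet_derivative (\<lambda>z. g (f z)) (at z) h =
    frechet_derivative g (at (f z)) (frechet_derivative f (at z) h)"
proof -
  have "((\<lambda>z. g (f z)) has_derivative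
      (\<lambda>h. frechet_derivative g (at (f z)) (frechet_derivative f (at z) h))) (at z)"
    by (rule has_derivative_compose[OF holo2_has_derivative[OF assms(1,3)] holo2_has_derivative[OF assms(2,4)]])
  from frechet_derivative_at[OF this] show ?thesis by metis
qed

lemma holo2_derivative_cong:
  assumes "open A" "z \<in> A" "\<And>z. z \<in> A \<Longrightarrow> f z = g z" "f differentiable at z"
  shows "frechet_derivative f (at z) = frechet_derivative g (at z)"
proof -
  have "(f has_derivative frechet_derivative f (at z)) (at z)"
    using assms(4) frechet_derivative_works by blast
  then have "(g has_derivative frechet_derivative f (at z)) (at z)"
    using assms has_derivative_transform_within_open by blast
  then show ?thesis by (rule frechet_derivative_at)
qed

lemma holo2_differentiable: "holo2 A f \<Longrightarrow> z \<in> A \<Longrightarrow> f differentiable at z"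
  unfolding differentiable_def using holo2_has_derivative by blast

text \<open>In terms of partial derivatives the pushed field is a sum of products of holomorphic
  functions, because \<open>dx\<close> and \<open>dy\<close> preserve holomorphy.\<close>

lemma holo2_pushforward:
  assumes f: "holo2 A f" and X: "holo2 A X"
  shows "holo2 A (\<lambda>z. frechet_derivative f (at z) (X z))"
proof -
  have f': "hol A (\<lambda>z. fst (f z))" "hol A (\<lambda>z. snd (f z))" by (rule holo2_components[OF f])+
  have X': "hol A (\<lambda>z. fst (X z))" "hol A (\<lambda>z. snd (X z))" by (rule holo2_components[OF X])+
  have "holo2 A (\<lambda>z. (dx (\<lambda>z. fst (f z)) z * fst (X z) + dy (\<lambda>z. fst (f z)) z * snd (X z),
          dx (\<lambda>z. snd (f z)) z * fst (X z) + dy (\<lambda>z. snd (f z)) z * snd (X z)))"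
    by (intro holo2_Pair hol_add hol_mult hol_dx hol_dy f' X')
  then show ?thesis
    by (rule holo2_cong) (simp add: holo2_derivative_eq[OF f])
qed

text \<open>The four partial derivatives are bounded on the compact set, the sum of their norms
  dominates the operator norm, and convexity admits the mean value inequality.\<close>

lemma holo2_Lipschitz:
  assumes f: "holo2 A f" and K: "compact K" "convex K" "K \<subseteq> A"
  obtains L where "L > 0" "\<And>z w. z \<in> K \<Longrightarrow> w \<in> K \<Longrightarrow> norm (f z - f w) \<le> L * norm (z - w)"
proof -
  have f': "hol A (\<lambda>z. fst (f z))" "hol A (\<lambda>z. snd (f z))" by (rule holo2_components[OF f])+
  define B where "B z = norm (dx (\<lambda>z. fst (f z)) z) + norm (dy (\<lambda>z. fst (f z)) z)
     + norm (dx (\<lambda>z. snd (f z)) z) + norm (dy (\<lambda>z. snd (f z)) z)" for z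
  have "continuous_on K (dx (\<lambda>z. fst (f z)))" "continuous_on K (dy (\<lambda>z. fst (f z)))"
    "continuous_on K (dx (\<lambda>z. snd (f z)))" "continuous_on K (dy (\<lambda>z. snd (f z)))"
    by (rule continuous_on_subset[OF hol_continuous_on[OF hol_dx[OF f'(1)]] K(3)]
        continuous_on_subset[OF hol_continuous_on[OF hol_dy[OF f'(1)]] K(3)]
        continuous_on_subset[OF hol_continuous_on[OF hol_dx[OF f'(2)]] K(3)]
        continuous_on_subset[OF hol_continuous_on[OF hol_dy[OF f'(2)]] K(3)])+
  then have "continuous_on K B"
    unfolding B_def by (intro continuous_intros)
  then have "bounded (B ` K)" using K compact_continuous_image compact_imp_bounded by blast
  then obtain M where M: "M > 0" "\<And>z. z \<in> K \<Longrightarrow> \<bar>B z\<bar> \<le> M"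
    unfolding bounded_pos by auto
  have "norm (f z - f w) \<le> M * norm (z - w)" if "z \<in> K" "w \<in> K" for z w
  proof (rule differentiable_bound[OF K(2) _ _ that])
    fix x assume x: "x \<in> K"
    then have xA: "x \<in> A" using K by auto
    show "(f has_derivative frechet_derivative f (at x)) (at x within K)"
      using holo2_has_derivative[OF f xA] by (rule has_derivative_at_withinI)
    show "onorm (frechet_derivative f (at x)) \<le> M"
    proof (rule onorm_le)
      fix h
      have "norm (frechet_derivative f (at x) h) \<le>
         norm (dx (\<lambda>z. fst (f z)) x * fst h + dy (\<lambda>z. fst (f z)) x * snd h) +
         norm (dx (\<lambda>z. snd (f z)) x * fst h + dy (\<lambda>z. snd (f z)) x * snd h)"
        by (simp add: holo2_derivative_eq[OF f xA]) (rule norm_Pair_le)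
      also have "\<dots> \<le> (norm (dx (\<lambda>z. fst (f z)) x) * norm h + norm (dy (\<lambda>z. fst (f z)) x) * norm h) +
         (norm (dx (\<lambda>z. snd (f z)) x) * norm h + norm (dy (\<lambda>z. snd (f z)) x) * norm h)"
        by (intro add_mono norm_triangle_le)
           (auto simp: norm_mult intro!: add_mono mult_left_mono norm_fst_le[of "fst h" "snd h", simplified] norm_snd_le[of "snd h" "fst h", simplified])
      also have "\<dots> = B x * norm h" by (simp add: B_def algebra_simps)
      also have "\<dots> \<le> M * norm h" using M(2)[OF x] by (intro mult_right_mono) auto
      finally show "norm (frechet_derivative f (at x) h) \<le> M * norm h" .
    qed
  qed
  with M(1) that show thesis by blast
qed

section \<open>Atlases\<close>

lemma pointsI: "(A, \<phi>) \<in> M \<Longrightarrow> z \<in> A \<Longrightarrow> \<phi> z \<in> points M"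
  unfolding points_def by (rule UN_I[of "(A, \<phi>)"]) auto

lemma pointsE:
  assumes "x \<in> points M"
  obtains A \<phi> z where "(A, \<phi>) \<in> M" "z \<in> A" "x = \<phi> z"
  using assms unfolding points_def by auto

lemma holomorphic_mapI:
  assumes "\<And>x. x \<in> points M \<Longrightarrow> F x \<in> points N"
    and "\<And>A \<phi> B \<psi>. (A, \<phi>) \<in> M \<Longrightarrow> (B, \<psi>) \<in> N \<Longrightarrow>
      holo2 {z\<in>A. F (\<phi> z) \<in> \<psi> ` B} (\<lambda>z. inv_into B \<psi> (F (\<phi> z)))"
  shows "holomorphic_map M N F"
  using assms unfolding holomorphic_map_def by blast

lemma holomorphic_map_points: "holomorphic_map M N F \<Longrightarrow> x \<in> points M \<Longrightarrow> F x \<in> points N"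
  unfolding holomorphic_map_def by blast

lemma holomorphic_map_charts:
  assumes "holomorphic_map M N F" "(A, \<phi>) \<in> M" "(B, \<psi>) \<in> N"
  shows "holo2 {z\<in>A. F (\<phi> z) \<in> \<psi> ` B} (\<lambda>z. inv_into B \<psi> (F (\<phi> z)))"
proof -
  have "\<forall>c\<in>M. \<forall>d\<in>N. case c of (A, \<phi>) \<Rightarrow> case d of (B, \<psi>) \<Rightarrow>
      holo2 {z\<in>A. F (\<phi> z) \<in> \<psi> ` B} (\<lambda>z. inv_into B \<psi> (F (\<phi> z)))"
    using assms(1) unfolding holomorphic_map_def by fast
  from bspec[OF bspec[OF this assms(2)] assms(3)] show ?thesis by simp
qed

lemma holomorphic_map_cong:
  assumes "holomorphic_map M N F" "\<And>x. x \<in> points M \<Longrightarrow> F x = G x"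
  shows "holomorphic_map M N G"
proof (rule holomorphic_mapI)
  show "G x \<in> points N" if "x \<in> points M" for x
    using holomorphic_map_points[OF assms(1) that] assms(2)[OF that] by simp
  fix A \<phi> B \<psi> assume M: "(A, \<phi>) \<in> M" and N: "(B, \<psi>) \<in> N"
  have eq: "F (\<phi> z) = G (\<phi> z)" if "z \<in> A" for z
    using assms(2) pointsI[OF M that] by blast
  have "{z\<in>A. G (\<phi> z) \<in> \<psi> ` B} = {z\<in>A. F (\<phi> z) \<in> \<psi> ` B}" using eq by auto
  moreover have "holo2 {z\<in>A. F (\<phi> z) \<in> \<psi> ` B} (\<lambda>z. inv_into B \<psi> (G (\<phi> z)))"
    by (rule holo2_cong[OF holomorphic_map_charts[OF assms(1) M N]]) (use eq in auto)
  ultimately show "holo2 {z\<in>A. G (\<phi> z) \<in> \<psi> ` B} (\<lambda>z. inv_into B \<psi> (G (\<phi> z)))" by simp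
qed

text \<open>Continuity of holomorphic maps: near a point F is a chart after a continuous coordinate
  expression, and the domain of that expression is open by \<open>holo2\<close>.\<close>

lemma holomorphic_map_vimage_open:
  assumes F: "holomorphic_map M N F" and V: "openin (surface_topology N) V" and M: "(A, \<phi>) \<in> M"
  shows "open {z\<in>A. F (\<phi> z) \<in> V}"
proof (subst open_subopen, intro ballI)
  fix z assume "z \<in> {z\<in>A. F (\<phi> z) \<in> V}"
  then have z: "z \<in> A" "F (\<phi> z) \<in> V" by auto
  obtain B \<psi> w where N: "(B, \<psi>) \<in> N" "w \<in> B" "F (\<phi> z) = \<psi> w"
    using holomorphic_map_points[OF F pointsI[OF M z(1)]] by (elim pointsE)
  define D where "D = {z\<in>A. F (\<phi> z) \<in> \<psi> ` B}"
  define g where "g = (\<lambda>z. inv_into B \<psi> (F (\<phi> z)))"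
  have g: "holo2 D g" using holomorphic_map_charts[OF F M N(1)] by (simp add: D_def g_def)
  have g_in: "g z \<in> B \<and> \<psi> (g z) = F (\<phi> z)" if "z \<in> D" for z
    using that by (auto simp: D_def g_def inv_into_into f_inv_into_f)
  have "open {w\<in>B. \<psi> w \<in> V}"
    using V N(1) by (auto simp: openin_surface_topology)
  then have "open (g -` {w\<in>B. \<psi> w \<in> V} \<inter> D)"
    using continuous_on_open_vimage[OF holo2_open[OF g]] holo2_continuous_on[OF g] by blast
  moreover have "g -` {w\<in>B. \<psi> w \<in> V} \<inter> D \<subseteq> {z\<in>A. F (\<phi> z) \<in> V}"
    using g_in by (auto simp: D_def)
  moreover have "z \<in> D" using z N by (auto simp: D_def)
  then have "z \<in> g -` {w\<in>B. \<psi> w \<in> V} \<inter> D"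
    using g_in[of z] z by auto
  ultimately show "\<exists>T. open T \<and> z \<in> T \<and> T \<subseteq> {z\<in>A. F (\<phi> z) \<in> V}" by blast
qed

lemma holomorphic_map_openin:
  assumes "holomorphic_map M N F" "openin (surface_topology N) V"
  shows "openin (surface_topology M) {x \<in> points M. F x \<in> V}"
  unfolding openin_surface_topology
proof (intro conjI ballI)
  fix c assume c: "c \<in> M"
  obtain A \<phi> where [simp]: "c = (A, \<phi>)" by force
  have "{z\<in>A. \<phi> z \<in> {x \<in> points M. F x \<in> V}} = {z\<in>A. F (\<phi> z) \<in> V}"
    using pointsI[of A \<phi> M] c by auto
  then show "case c of (A, \<phi>) \<Rightarrow> open {z\<in>A. \<phi> z \<in> {x \<in> points M. F x \<in> V}}"
    using holomorphic_map_vimage_open[OF assms, of A \<phi>] c by simp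
qed auto

lemma holomorphic_map_comp:
  assumes F: "holomorphic_map M N F" and G: "holomorphic_map N L G"
  shows "holomorphic_map M L (\<lambda>x. G (F x))"
proof (rule holomorphic_mapI)
  show "G (F x) \<in> points L" if "x \<in> points M" for x
    using that holomorphic_map_points F G by metis
  fix A \<phi> C \<xi> assume M: "(A, \<phi>) \<in> M" and L: "(C, \<xi>) \<in> L"
  show "holo2 {z\<in>A. G (F (\<phi> z)) \<in> \<xi> ` C} (\<lambda>z. inv_into C \<xi> (G (F (\<phi> z))))"
  proof (rule holo2_local)
    fix z assume "z \<in> {z\<in>A. G (F (\<phi> z)) \<in> \<xi> ` C}"
    then have z: "z \<in> A" "G (F (\<phi> z)) \<in> \<xi> ` C" by auto
    obtain B \<psi> w where N: "(B, \<psi>) \<in> N" "w \<in> B" "F (\<phi> z) = \<psi> w"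
      using holomorphic_map_points[OF F pointsI[OF M z(1)]] by (elim pointsE)
    define D where "D = {z\<in>A. F (\<phi> z) \<in> \<psi> ` B}"
    define g where "g = (\<lambda>z. inv_into B \<psi> (F (\<phi> z)))"
    define E where "E = {z\<in>B. G (\<psi> z) \<in> \<xi> ` C}"
    define h where "h = (\<lambda>z. inv_into C \<xi> (G (\<psi> z)))"
    have g: "holo2 D g" using holomorphic_map_charts[OF F M N(1)] by (simp add: D_def g_def)
    have h: "holo2 E h" using holomorphic_map_charts[OF G N(1) L] by (simp add: E_def h_def)
    have g_in: "g z \<in> B" "\<psi> (g z) = F (\<phi> z)" if "z \<in> D" for z
      using that by (auto simp: D_def g_def inv_into_into f_inv_into_f)
    define W0 where "W0 = g -` E \<inter> D"
    have W0: "open W0" unfolding W0_def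
      using continuous_on_open_vimage[OF holo2_open[OF g]] holo2_continuous_on[OF g] holo2_open[OF h] by blast
    have "holo2 W0 (\<lambda>z. h (g z))"
      by (rule holo2_compose[OF holo2_subset[OF g W0] h]) (auto simp: W0_def)
    then have "holo2 W0 (\<lambda>z. inv_into C \<xi> (G (F (\<phi> z))))"
      by (rule holo2_cong) (simp add: h_def W0_def g_in)
    moreover have "z \<in> W0"
      using z N g_in[of z] by (auto simp: W0_def E_def D_def)
    moreover have "W0 \<subseteq> {z\<in>A. G (F (\<phi> z)) \<in> \<xi> ` C}"
      using g_in by (auto simp: W0_def E_def D_def)
    ultimately show "\<exists>B. z \<in> B \<and> B \<subseteq> {z\<in>A. G (F (\<phi> z)) \<in> \<xi> ` C} \<and>
        holo2 B (\<lambda>z. inv_into C \<xi> (G (F (\<phi> z))))" by blast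
  qed
qed

section \<open>Restriction of an atlas to an open part\<close>

lemma points_open_part: "points (open_part M V) = points M \<inter> V"
  unfolding points_def open_part_def by auto

lemma open_part_charts:
  "(A, \<phi>) \<in> open_part M V \<longleftrightarrow> (\<exists>B. (B, \<phi>) \<in> M \<and> A = {z\<in>B. \<phi> z \<in> V})"
  unfolding open_part_def by auto

text \<open>Enough to replace \<open>inv_into\<close> over a chart domain by \<open>inv_into\<close>
  over a smaller one. It is the property that the blow-up atlases are shown to have before they are
  mapped to a surface.\<close>

definition inj_atlas :: "'a atlas \<Rightarrow> bool" where
  "inj_atlas M \<longleftrightarrow> (\<forall>(A, \<phi>)\<in>M. inj_on \<phi> A)"

lemma inj_atlasD: "inj_atlas M \<Longrightarrow> (A, \<phi>) \<in> M \<Longrightarrow> inj_on \<phi> A"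
  unfolding inj_atlas_def by auto

lemma inj_atlas_open_part: "inj_atlas M \<Longrightarrow> inj_atlas (open_part M V)"
  unfolding inj_atlas_def open_part_def by (auto intro: inj_on_subset)

lemma holomorphic_map_open_part:
  assumes F: "holomorphic_map M N F" and N: "inj_atlas N"
    and V: "openin (surface_topology M) V" and VW: "\<And>x. x \<in> V \<Longrightarrow> F x \<in> W"
  shows "holomorphic_map (open_part M V) (open_part N W) F"
proof (rule holomorphic_mapI)
  show "F x \<in> points (open_part N W)" if "x \<in> points (open_part M V)" for x
    using that VW holomorphic_map_points[OF F] by (auto simp: points_open_part)
  fix A' \<phi> B' \<psi> assume "(A', \<phi>) \<in> open_part M V" "(B', \<psi>) \<in> open_part N W"
  then obtain A B where A: "(A, \<phi>) \<in> M" "A' = {z\<in>A. \<phi> z \<in> V}" and B: "(B, \<psi>) \<in> N" "B' = {z\<in>B. \<psi> z \<in> W}"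
    by (auto simp: open_part_charts)
  have h: "holo2 {z\<in>A. F (\<phi> z) \<in> \<psi> ` B} (\<lambda>z. inv_into B \<psi> (F (\<phi> z)))"
    by (rule holomorphic_map_charts[OF F A(1) B(1)])
  have eq: "{z\<in>A'. F (\<phi> z) \<in> \<psi> ` B'} = {z\<in>A. F (\<phi> z) \<in> \<psi> ` B} \<inter> {z\<in>A. \<phi> z \<in> V}"
  proof (intro equalityI subsetI)
    fix z assume "z \<in> {z\<in>A. F (\<phi> z) \<in> \<psi> ` B} \<inter> {z\<in>A. \<phi> z \<in> V}"
    then obtain w where "z \<in> A" "\<phi> z \<in> V" "w \<in> B" "F (\<phi> z) = \<psi> w" by auto
    moreover from this VW[of "\<phi> z"] have "w \<in> B'" by (simp add: B)
    ultimately show "z \<in> {z\<in>A'. F (\<phi> z) \<in> \<psi> ` B'}" by (auto simp: A)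
  qed (auto simp: A B)
  have "open {z\<in>A. \<phi> z \<in> V}" using V A(1) by (auto simp: openin_surface_topology)
  then have op: "open {z\<in>A'. F (\<phi> z) \<in> \<psi> ` B'}"
    unfolding eq by (intro open_Int holo2_open[OF h])
  have "holo2 {z\<in>A'. F (\<phi> z) \<in> \<psi> ` B'} (\<lambda>z. inv_into B \<psi> (F (\<phi> z)))"
    by (rule holo2_subset[OF h op]) (use eq in auto)
  then show "holo2 {z\<in>A'. F (\<phi> z) \<in> \<psi> ` B'} (\<lambda>z. inv_into B' \<psi> (F (\<phi> z)))"
  proof (rule holo2_cong)
    fix z assume "z \<in> {z\<in>A'. F (\<phi> z) \<in> \<psi> ` B'}"
    then obtain w where w: "w \<in> B'" "F (\<phi> z) = \<psi> w" by auto
    have "inj_on \<psi> B" using inj_atlasD[OF N B(1)] .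
    moreover have "B' \<subseteq> B" using B by auto
    ultimately show "inv_into B \<psi> (F (\<phi> z)) = inv_into B' \<psi> (F (\<phi> z))"
      using w by (metis inj_on_subset inv_into_f_f subsetD)
  qed
qed

lemma openin_open_part:
  assumes "openin (surface_topology M) V"
  shows "openin (surface_topology (open_part M V)) U \<longleftrightarrow> openin (surface_topology M) U \<and> U \<subseteq> V"
proof -
  have "{z \<in> {z\<in>A. \<phi> z \<in> V}. \<phi> z \<in> U} = {z\<in>A. \<phi> z \<in> U}" if "U \<subseteq> V" for A and \<phi> :: "c2 \<Rightarrow> 'a"
    using that by auto
  then show ?thesis
    unfolding openin_surface_topology points_open_part by (auto simp: open_part_def)
qed

lemma surface_topology_open_part:
  assumes "openin (surface_topology M) V"
  shows "surface_topology (open_part M V) = subtopology (surface_topology M) V"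
  unfolding topology_eq using openin_open_part[OF assms] openin_open_subtopology[OF assms] by auto

lemma topspace_surface_topology:
  assumes "\<And>A \<phi>. (A, \<phi>) \<in> M \<Longrightarrow> open A"
  shows "topspace (surface_topology M) = points M"
proof -
  have "openin (surface_topology M) (points M)"
    unfolding openin_surface_topology
  proof (intro conjI ballI)
    fix c assume c: "c \<in> M"
    obtain A \<phi> where [simp]: "c = (A, \<phi>)" by force
    have "{z\<in>A. \<phi> z \<in> points M} = A" using pointsI[of A \<phi> M] c by auto
    then show "case c of (A, \<phi>) \<Rightarrow> open {z\<in>A. \<phi> z \<in> points M}" using assms[of A \<phi>] c by simp
  qed auto
  moreover have "U \<subseteq> points M" if "openin (surface_topology M) U" for U
    using that by (simp add: openin_surface_topology)
  ultimately show ?thesis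
    by (metis openin_subset openin_topspace subset_antisym)
qed

lemma complex_surface_charts:
  assumes "complex_surface M" "(A, \<phi>) \<in> M"
  shows "open A" "inj_on \<phi> A"
  using assms unfolding complex_surface_def by auto

lemma complex_surface_inj_atlas: "complex_surface M \<Longrightarrow> inj_atlas M"
  unfolding complex_surface_def inj_atlas_def by auto

lemma complex_surface_id: "complex_surface M \<Longrightarrow> holomorphic_map M M (\<lambda>x. x)"
  unfolding complex_surface_def id_def by auto

lemma complex_surfaceI:
  assumes "\<And>A \<phi>. (A, \<phi>) \<in> M \<Longrightarrow> open A" "\<And>A \<phi>. (A, \<phi>) \<in> M \<Longrightarrow> inj_on \<phi> A"
    and "holomorphic_map M M (\<lambda>x. x)"
    and "Hausdorff_space (surface_topology M)" "second_countable (surface_topology M)"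
  shows "complex_surface M"
  using assms unfolding complex_surface_def id_def by auto

lemma complex_surface_open_part:
  assumes M: "complex_surface M" and V: "openin (surface_topology M) V"
  shows "complex_surface (open_part M V)"
proof (rule complex_surfaceI)
  show "open A" if "(A, \<phi>) \<in> open_part M V" for A \<phi>
    using that V by (auto simp: open_part_charts openin_surface_topology)
  show "inj_on \<phi> A" if "(A, \<phi>) \<in> open_part M V" for A \<phi>
    using inj_atlasD[OF inj_atlas_open_part[OF complex_surface_inj_atlas[OF M]] that] .
  show "holomorphic_map (open_part M V) (open_part M V) (\<lambda>x. x)"
    by (rule holomorphic_map_open_part[OF complex_surface_id[OF M] complex_surface_inj_atlas[OF M] V])
  show "Hausdorff_space (surface_topology (open_part M V))"
    "second_countable (surface_topology (open_part M V))"
    using M unfolding surface_topology_open_part[OF V]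
    by (auto simp: complex_surface_def intro: Hausdorff_space_subtopology second_countable_subtopology)
qed

section \<open>Biholomorphic maps\<close>

lemma biholomorphicI:
  assumes "holomorphic_map M N F" "holomorphic_map N M G"
    and "\<And>x. x \<in> points M \<Longrightarrow> G (F x) = x" "\<And>y. y \<in> points N \<Longrightarrow> F (G y) = y"
  shows "biholomorphic M N F"
proof -
  have bij: "bij_betw F (points M) (points N)"
    by (rule bij_betw_byWitness[where f' = G])
       (use assms(3,4) holomorphic_map_points[OF assms(1)] holomorphic_map_points[OF assms(2)] in auto)
  have "inv_into (points M) F y = G y" if "y \<in> points N" for y
    using that assms(3,4) bij holomorphic_map_points[OF assms(2) that]
    by (metis bij_betw_inv_into_left)
  then have "holomorphic_map N M (inv_into (points M) F)"
    by (intro holomorphic_map_cong[OF assms(2)]) simp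
  with bij assms(1) show ?thesis by (simp add: biholomorphic_def)
qed

lemma biholomorphicE:
  assumes F: "biholomorphic M N F"
  obtains G where "holomorphic_map M N F" "holomorphic_map N M G"
    "\<And>x. x \<in> points M \<Longrightarrow> G (F x) = x" "\<And>y. y \<in> points N \<Longrightarrow> F (G y) = y"
    "\<And>x. x \<in> points M \<Longrightarrow> F x \<in> points N" "\<And>y. y \<in> points N \<Longrightarrow> G y \<in> points M"
proof
  have h: "holomorphic_map M N F" "holomorphic_map N M (inv_into (points M) F)"
    using F by (auto simp: biholomorphic_def)
  then show "holomorphic_map M N F" "holomorphic_map N M (inv_into (points M) F)" .
  show "F x \<in> points N" if "x \<in> points M" for x
    using holomorphic_map_points[OF h(1) that] .
  show "inv_into (points M) F y \<in> points M" if "y \<in> points N" for y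
    using holomorphic_map_points[OF h(2) that] .
  have bij: "bij_betw F (points M) (points N)" using F by (simp add: biholomorphic_def)
  show "inv_into (points M) F (F x) = x" if "x \<in> points M" for x
    using bij_betw_inv_into_left[OF bij that] .
  show "F (inv_into (points M) F y) = y" if "y \<in> points N" for y
    using bij_betw_inv_into_right[OF bij that] .
qed

lemma biholomorphic_comp:
  assumes "biholomorphic M N F" "biholomorphic N L G"
  shows "biholomorphic M L (\<lambda>x. G (F x))"
proof -
  obtain F' where F: "holomorphic_map M N F" "holomorphic_map N M F'"
    "\<And>x. x \<in> points M \<Longrightarrow> F' (F x) = x" "\<And>y. y \<in> points N \<Longrightarrow> F (F' y) = y"
    using biholomorphicE[OF assms(1)] by metis
  obtain G' where G: "holomorphic_map N L G" "holomorphic_map L N G'"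
    "\<And>x. x \<in> points N \<Longrightarrow> G' (G x) = x" "\<And>y. y \<in> points L \<Longrightarrow> G (G' y) = y"
    using biholomorphicE[OF assms(2)] by metis
  show ?thesis
    by (rule biholomorphicI[OF holomorphic_map_comp[OF F(1) G(1)] holomorphic_map_comp[OF G(2) F(2)]])
       (use F G holomorphic_map_points[OF F(1)] holomorphic_map_points[OF G(2)] in auto)
qed

lemma biholomorphic_image_openin:
  assumes F: "biholomorphic M N F" and V: "openin (surface_topology M) V"
  shows "openin (surface_topology N) (F ` V)"
proof -
  obtain G where G: "holomorphic_map M N F" "holomorphic_map N M G"
    "\<And>x. x \<in> points M \<Longrightarrow> G (F x) = x" "\<And>y. y \<in> points N \<Longrightarrow> F (G y) = y"
    using biholomorphicE[OF F] by metis
  have VM: "V \<subseteq> points M" using V by (simp add: openin_surface_topology)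
  have "F ` V = {y \<in> points N. G y \<in> V}"
  proof (intro equalityI subsetI)
    fix y assume "y \<in> F ` V"
    then obtain x where x: "x \<in> V" "y = F x" by blast
    then show "y \<in> {y \<in> points N. G y \<in> V}"
      using VM G(3)[of x] holomorphic_map_points[OF G(1), of x] by auto
  next
    fix y assume "y \<in> {y \<in> points N. G y \<in> V}"
    then have "F (G y) = y" "G y \<in> V" using G(4) by auto
    then show "y \<in> F ` V" by (metis imageI)
  qed
  then show ?thesis using holomorphic_map_openin[OF G(2) V] by simp
qed

lemma biholomorphic_open_part:
  assumes F: "biholomorphic M N F" and M: "inj_atlas M" and N: "inj_atlas N"
    and V: "openin (surface_topology M) V"
  shows "biholomorphic (open_part M V) (open_part N (F ` V)) F"
proof -
  obtain G where G: "holomorphic_map M N F" "holomorphic_map N M G"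
    "\<And>x. x \<in> points M \<Longrightarrow> G (F x) = x" "\<And>y. y \<in> points N \<Longrightarrow> F (G y) = y"
    using biholomorphicE[OF F] by metis
  have VM: "V \<subseteq> points M" using V by (simp add: openin_surface_topology)
  show ?thesis
  proof (rule biholomorphicI[of _ _ _ G])
    show "holomorphic_map (open_part M V) (open_part N (F ` V)) F"
      by (rule holomorphic_map_open_part[OF G(1) N V]) auto
    show "holomorphic_map (open_part N (F ` V)) (open_part M V) G"
      by (rule holomorphic_map_open_part[OF G(2) M biholomorphic_image_openin[OF F V]])
         (use VM G(3) in auto)
  qed (use G in \<open>auto simp: points_open_part\<close>)
qed

lemma biholomorphic_homeomorphic_map:
  assumes F: "biholomorphic M N F"
    and M: "\<And>A \<phi>. (A, \<phi>) \<in> M \<Longrightarrow> open A" and N: "\<And>A \<phi>. (A, \<phi>) \<in> N \<Longrightarrow> open A"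
  shows "homeomorphic_map (surface_topology M) (surface_topology N) F"
proof -
  obtain G where G: "holomorphic_map M N F" "holomorphic_map N M G"
    "\<And>x. x \<in> points M \<Longrightarrow> G (F x) = x" "\<And>y. y \<in> points N \<Longrightarrow> F (G y) = y"
    using biholomorphicE[OF F] by metis
  have tM: "topspace (surface_topology M) = points M" and tN: "topspace (surface_topology N) = points N"
    by (intro topspace_surface_topology M N; assumption)+
  have "continuous_map (surface_topology M) (surface_topology N) F"
    "continuous_map (surface_topology N) (surface_topology M) G"
    unfolding continuous_map_def tM tN
    using holomorphic_map_openin[OF G(1)] holomorphic_map_openin[OF G(2)]
      holomorphic_map_points[OF G(1)] holomorphic_map_points[OF G(2)] by auto
  then have "homeomorphic_maps (surface_topology M) (surface_topology N) F G"
    unfolding homeomorphic_maps_def tM tN using G by auto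
  then show ?thesis by (rule homeomorphic_maps_imp_map)
qed

section \<open>Equivalent atlases\<close>

text \<open>The two atlases define the same points, the same topology and the same complex
  structure. This allows the ten planes and the charts inherited from \<open>S_tilde\<close> to be
  exchanged.\<close>

definition equiv_atlas :: "'a atlas \<Rightarrow> 'a atlas \<Rightarrow> bool" where
  "equiv_atlas M N \<longleftrightarrow> holomorphic_map M N (\<lambda>x. x) \<and> holomorphic_map N M (\<lambda>x. x)"

lemma equiv_atlas_sym: "equiv_atlas M N \<Longrightarrow> equiv_atlas N M"
  by (simp add: equiv_atlas_def)

lemma equiv_atlas_trans: "equiv_atlas M N \<Longrightarrow> equiv_atlas N L \<Longrightarrow> equiv_atlas M L"
  unfolding equiv_atlas_def
  using holomorphic_map_comp[of M N "\<lambda>x. x" L "\<lambda>x. x"] holomorphic_map_comp[of L N "\<lambda>x. x" M "\<lambda>x. x"]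
  by blast

lemma equiv_atlas_self: "equiv_atlas M N \<Longrightarrow> holomorphic_map M M (\<lambda>x. x)"
  using equiv_atlas_trans[OF _ equiv_atlas_sym] by (auto simp: equiv_atlas_def)

lemma equiv_atlas_points:
  assumes "equiv_atlas M N"
  shows "points M = points N"
  using assms holomorphic_map_points[of M N "\<lambda>x. x"] holomorphic_map_points[of N M "\<lambda>x. x"]
  by (auto simp: equiv_atlas_def)

lemma equiv_atlas_topology:
  assumes "equiv_atlas M N"
  shows "surface_topology M = surface_topology N"
proof -
  have *: "openin (surface_topology M') V" if "openin (surface_topology N') V" "equiv_atlas M' N'"
    for M' N' :: "'a atlas" and V
  proof -
    have "holomorphic_map M' N' (\<lambda>x. x)" using that(2) by (simp add: equiv_atlas_def)
    from holomorphic_map_openin[OF this that(1)]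
    have "openin (surface_topology M') {x \<in> points M'. x \<in> V}" .
    moreover have "V \<subseteq> points M'"
      using that equiv_atlas_points[OF that(2)] by (simp add: openin_surface_topology)
    then have "{x \<in> points M'. x \<in> V} = V" by auto
    ultimately show ?thesis by simp
  qed
  show ?thesis
    unfolding topology_eq using *[OF _ assms] *[OF _ equiv_atlas_sym[OF assms]] by blast
qed

lemma equiv_atlas_complex_surface:
  assumes M: "complex_surface M" and eq: "equiv_atlas M N"
    and "\<And>A \<phi>. (A, \<phi>) \<in> N \<Longrightarrow> open A" "\<And>A \<phi>. (A, \<phi>) \<in> N \<Longrightarrow> inj_on \<phi> A"
  shows "complex_surface N"
proof (rule complex_surfaceI)
  show "holomorphic_map N N (\<lambda>x. x)" by (rule equiv_atlas_self[OF equiv_atlas_sym[OF eq]])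
  show "Hausdorff_space (surface_topology N)" "second_countable (surface_topology N)"
    using M unfolding equiv_atlas_topology[OF eq, symmetric] complex_surface_def by auto
qed (use assms in auto)

text \<open>A chart of an equivalent atlas is already compatible with M. This is how the chart
  \<open>(UNIV, j)\<close> demanded by \<open>space_of_initial_conditions\<close> is added.\<close>

lemma equiv_atlas_insert:
  assumes eq: "equiv_atlas M N" and c: "c \<in> N"
  shows "equiv_atlas (insert c M) M"
proof -
  note MM = equiv_atlas_self[OF eq]
  have MN: "holomorphic_map M N (\<lambda>x. x)" and NM: "holomorphic_map N M (\<lambda>x. x)"
    using eq by (auto simp: equiv_atlas_def)
  obtain C \<xi> where [simp]: "c = (C, \<xi>)" by force
  have pts: "points (insert c M) = points M"
    using equiv_atlas_points[OF eq] c unfolding points_def by auto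
  have "holomorphic_map (insert c M) M (\<lambda>x. x)"
  proof (rule holomorphic_mapI)
    fix A \<phi> B \<psi> assume "(A, \<phi>) \<in> insert c M" "(B, \<psi>) \<in> M"
    then show "holo2 {z\<in>A. \<phi> z \<in> \<psi> ` B} (\<lambda>z. inv_into B \<psi> (\<phi> z))"
      using holomorphic_map_charts[OF MM, of A \<phi> B \<psi>] holomorphic_map_charts[OF NM, of A \<phi> B \<psi>] c by auto
  qed (use pts in simp)
  moreover have "holomorphic_map M (insert c M) (\<lambda>x. x)"
  proof (rule holomorphic_mapI)
    fix A \<phi> B \<psi> assume "(A, \<phi>) \<in> M" "(B, \<psi>) \<in> insert c M"
    then show "holo2 {z\<in>A. \<phi> z \<in> \<psi> ` B} (\<lambda>z. inv_into B \<psi> (\<phi> z))"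
      using holomorphic_map_charts[OF MM, of A \<phi> B \<psi>] holomorphic_map_charts[OF MN, of A \<phi> B \<psi>] c by auto
  qed (use pts in simp)
  ultimately show ?thesis by (simp add: equiv_atlas_def)
qed

section \<open>Extending vector fields\<close>

text \<open>The choice of \<open>i\<close> is immaterial once the fields \<open>V i\<close> are compatible.\<close>

definition push_field :: "('i \<Rightarrow> c2 \<Rightarrow> 'a) \<Rightarrow> 'i set \<Rightarrow> ('i \<Rightarrow> c2 \<Rightarrow> c2) \<Rightarrow> 'a chart \<Rightarrow> c2 \<Rightarrow> c2" where
  "push_field \<Psi> I V c z =
     (let i = SOME i. i \<in> I \<and> snd c z \<in> range (\<Psi> i); w = inv (\<Psi> i) (snd c z)
      in frechet_derivative (\<lambda>x. inv_into (fst c) (snd c) (\<Psi> i x)) (at w) (V i w))"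

definition plane_atlas :: "('i \<Rightarrow> c2 \<Rightarrow> 'a) \<Rightarrow> 'i set \<Rightarrow> 'a atlas" where
  "plane_atlas \<Psi> I = (\<lambda>i. (UNIV, \<Psi> i)) ` I"

text \<open>The fields are explicit in the planes \<open>\<Psi> i\<close>, whereas
  \<open>holomorphic_field\<close> asks for an expression in every chart of M. The locale bridges
  the two; \<open>compat\<close> is agreement of the plane fields on overlaps.\<close>

locale plane_fields =
  fixes \<Psi> :: "'i \<Rightarrow> c2 \<Rightarrow> 'a" and I :: "'i set" and V :: "'i \<Rightarrow> c2 \<Rightarrow> c2" and M :: "'a atlas"
  assumes inj: "i \<in> I \<Longrightarrow> inj (\<Psi> i)"
    and equiv: "equiv_atlas (plane_atlas \<Psi> I) M"
    and inj_M: "inj_atlas M"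
    and V: "i \<in> I \<Longrightarrow> holo2 UNIV (V i)"
    and compat: "i \<in> I \<Longrightarrow> j \<in> I \<Longrightarrow> \<Psi> i w = \<Psi> j w' \<Longrightarrow>
      frechet_derivative (\<lambda>x. inv (\<Psi> j) (\<Psi> i x)) (at w) (V i w) = V j w'"
begin

lemma chart_holo:
  assumes "i \<in> I" "(A, \<phi>) \<in> M"
  shows "holo2 {w. \<Psi> i w \<in> \<phi> ` A} (\<lambda>w. inv_into A \<phi> (\<Psi> i w))"
    and "holo2 {z\<in>A. \<phi> z \<in> range (\<Psi> i)} (\<lambda>z. inv (\<Psi> i) (\<phi> z))"
proof -
  have "(UNIV, \<Psi> i) \<in> plane_atlas \<Psi> I" using assms by (auto simp: plane_atlas_def)
  then show "holo2 {w. \<Psi> i w \<in> \<phi> ` A} (\<lambda>w. inv_into A \<phi> (\<Psi> i w))"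
    "holo2 {z\<in>A. \<phi> z \<in> range (\<Psi> i)} (\<lambda>z. inv (\<Psi> i) (\<phi> z))"
    using equiv holomorphic_map_charts[of "plane_atlas \<Psi> I" M "\<lambda>x. x" UNIV "\<Psi> i" A \<phi>]
      holomorphic_map_charts[of M "plane_atlas \<Psi> I" "\<lambda>x. x" A \<phi> UNIV "\<Psi> i"] assms(2)
    by (auto simp: equiv_atlas_def)
qed

lemma plane_holo:
  assumes "i \<in> I" "j \<in> I"
  shows "holo2 {w. \<Psi> i w \<in> range (\<Psi> j)} (\<lambda>w. inv (\<Psi> j) (\<Psi> i w))"
proof -
  have "(UNIV, \<Psi> i) \<in> plane_atlas \<Psi> I" "(UNIV, \<Psi> j) \<in> plane_atlas \<Psi> I"
    using assms by (auto simp: plane_atlas_def)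
  from holomorphic_map_charts[OF equiv_atlas_self[OF equiv] this] show ?thesis by simp
qed

lemma points_M: "points M = (\<Union>i\<in>I. range (\<Psi> i))"
  using equiv_atlas_points[OF equiv] by (auto simp: points_def plane_atlas_def)

text \<open>The plane picked by \<open>SOME\<close> may be replaced by any plane through the point:
  the passage from plane i to the chart factors through the picked plane j, and
  \<open>compat\<close> handles the first factor of the chain rule.\<close>

lemma push_field_eq:
  assumes i: "i \<in> I" and M: "(A, \<phi>) \<in> M" and z: "z \<in> A" "\<phi> z = \<Psi> i w"
  shows "push_field \<Psi> I V (A, \<phi>) z = frechet_derivative (\<lambda>x. inv_into A \<phi> (\<Psi> i x)) (at w) (V i w)"
proof -
  define j where "j = (SOME j. j \<in> I \<and> \<phi> z \<in> range (\<Psi> j))"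
  have "j \<in> I \<and> \<phi> z \<in> range (\<Psi> j)"
    unfolding j_def by (rule someI[of _ i]) (use i z in auto)
  then have j: "j \<in> I" "\<phi> z \<in> range (\<Psi> j)" by auto
  define u where "u = inv (\<Psi> j) (\<phi> z)"
  have u: "\<Psi> j u = \<phi> z" using j(2) by (simp add: u_def f_inv_into_f)
  let ?g = "\<lambda>x. inv (\<Psi> j) (\<Psi> i x)" and ?h = "\<lambda>x. inv_into A \<phi> (\<Psi> j x)"
  have gw: "?g w = u" using z by (simp add: u_def)
  let ?D = "{x. \<Psi> i x \<in> range (\<Psi> j)}"
  have wD: "w \<in> ?D" using z j by simp
  have uE: "?g w \<in> {w. \<Psi> j w \<in> \<phi> ` A}" unfolding gw using u z(1) by simp
  have "frechet_derivative (\<lambda>x. ?h (?g x)) (at w) (V i w) =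
      frechet_derivative ?h (at (?g w)) (frechet_derivative ?g (at w) (V i w))"
    by (rule holo2_derivative_compose[OF plane_holo[OF i j(1)] chart_holo(1)[OF j(1) M] wD uE])
  also have "frechet_derivative ?g (at w) (V i w) = V j u"
    by (rule compat[OF i j(1)]) (use z u in simp)
  finally have 1: "frechet_derivative (\<lambda>x. ?h (?g x)) (at w) (V i w) = frechet_derivative ?h (at u) (V j u)"
    by (simp add: gw)
  have "frechet_derivative (\<lambda>x. inv_into A \<phi> (\<Psi> i x)) (at w) = frechet_derivative (\<lambda>x. ?h (?g x)) (at w)"
  proof (rule holo2_derivative_cong[OF holo2_open[OF plane_holo[OF i j(1)]] wD])
    show "(\<lambda>x. inv_into A \<phi> (\<Psi> i x)) differentiable at w"
      by (rule holo2_differentiable[OF chart_holo(1)[OF i M]]) (use z in \<open>auto simp: image_iff\<close>, metis)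
  qed (auto simp: f_inv_into_f)
  with 1 show ?thesis by (simp add: push_field_def Let_def j_def[symmetric] u_def[symmetric])
qed

lemma holomorphic_push_field: "holomorphic_field M (push_field \<Psi> I V)"
proof -
  have 1: "holo2 A (push_field \<Psi> I V (A, \<phi>))" if M: "(A, \<phi>) \<in> M" for A \<phi>
  proof (rule holo2_local)
    fix z assume z: "z \<in> A"
    then obtain i where i: "i \<in> I" "\<phi> z \<in> range (\<Psi> i)"
      using pointsI[OF M z] points_M by auto
    let ?D = "{z\<in>A. \<phi> z \<in> range (\<Psi> i)}" and ?g = "\<lambda>z. inv (\<Psi> i) (\<phi> z)"
    let ?E = "{w. \<Psi> i w \<in> \<phi> ` A}"
    have "holo2 ?E (\<lambda>w. frechet_derivative (\<lambda>x. inv_into A \<phi> (\<Psi> i x)) (at w) (V i w))"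
      using holo2_open[OF chart_holo(1)[OF i(1) M]]
      by (intro holo2_pushforward chart_holo(1)[OF i(1) M] holo2_subset[OF V[OF i(1)]]) auto
    from holo2_compose[OF chart_holo(2)[OF i(1) M] this]
    have "holo2 ?D (\<lambda>z. frechet_derivative (\<lambda>x. inv_into A \<phi> (\<Psi> i x)) (at (?g z)) (V i (?g z)))"
      by (auto simp: f_inv_into_f)
    then have "holo2 ?D (push_field \<Psi> I V (A, \<phi>))"
      by (rule holo2_cong) (rule push_field_eq[OF i(1) M, symmetric], auto simp: f_inv_into_f)
    then show "\<exists>B. z \<in> B \<and> B \<subseteq> A \<and> holo2 B (push_field \<Psi> I V (A, \<phi>))"
      using z i by (intro exI[of _ ?D]) auto
  qed
  have 2: "frechet_derivative (\<lambda>x. inv_into B \<psi> (\<phi> x)) (at z) (push_field \<Psi> I V (A, \<phi>) z)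
          = push_field \<Psi> I V (B, \<psi>) (inv_into B \<psi> (\<phi> z))"
    if M: "(A, \<phi>) \<in> M" and N: "(B, \<psi>) \<in> M" and z: "z \<in> A" "\<phi> z \<in> \<psi> ` B" for A \<phi> B \<psi> z
  proof -
    obtain i w where i: "i \<in> I" "\<phi> z = \<Psi> i w"
      using pointsI[OF M z(1)] points_M by auto
    let ?z' = "inv_into B \<psi> (\<phi> z)"
    let ?E = "{w. \<Psi> i w \<in> \<phi> ` A}"
    let ?g = "\<lambda>x. inv_into A \<phi> (\<Psi> i x)" and ?h = "\<lambda>x. inv_into B \<psi> (\<phi> x)"
    have MM: "holomorphic_map M M (\<lambda>x. x)" using equiv_atlas_self[OF equiv_atlas_sym[OF equiv]] .
    have gw: "?g w = z" using inj_atlasD[OF inj_M M] z i by (metis inv_into_f_f)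
    have wE: "w \<in> ?E" using z i by (auto simp: image_iff) metis
    have "frechet_derivative (\<lambda>x. inv_into B \<psi> (\<Psi> i x)) (at w) = frechet_derivative (\<lambda>x. ?h (?g x)) (at w)"
    proof (rule holo2_derivative_cong[OF holo2_open[OF chart_holo(1)[OF i(1) M]] wE])
      show "(\<lambda>x. inv_into B \<psi> (\<Psi> i x)) differentiable at w"
        by (rule holo2_differentiable[OF chart_holo(1)[OF i(1) N]]) (use z i in simp)
    qed (auto simp: f_inv_into_f)
    moreover have "frechet_derivative (\<lambda>x. ?h (?g x)) (at w) (V i w)
        = frechet_derivative ?h (at (?g w)) (frechet_derivative ?g (at w) (V i w))"
      by (rule holo2_derivative_compose[OF chart_holo(1)[OF i(1) M] holomorphic_map_charts[OF MM M N] wE])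
         (use gw z in simp)
    moreover have "push_field \<Psi> I V (B, \<psi>) ?z' = frechet_derivative (\<lambda>x. inv_into B \<psi> (\<Psi> i x)) (at w) (V i w)"
      by (rule push_field_eq[OF i(1) N]) (use z i in \<open>auto simp: inv_into_into f_inv_into_f\<close>)
    ultimately show ?thesis
      using push_field_eq[OF i(1) M z(1) i(2)] gw by simp
  qed
  show ?thesis unfolding holomorphic_field_def using 1 2 by blast
qed

end

section \<open>Differential equations with complex time\<close>

lemma norm_cscale: "norm (cscale c v) = norm c * norm v"
  by (simp add: cscale_def norm_prod_def norm_mult power_mult_distrib real_sqrt_mult flip: distrib_left)

lemma cscale_diff_right: "cscale c (v - w) = cscale c v - cscale c w"
  by (simp add: cscale_def algebra_simps)

text \<open>Mean value inequality for the difference of two curves; it drives both the Picard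
  iteration and the uniqueness proof.\<close>

lemma cscale_derivative_bound:
  assumes S: "convex S" "\<And>t. t \<in> S \<Longrightarrow> (\<phi> has_derivative (\<lambda>h. cscale h (a t))) (at t within S)"
    "\<And>t. t \<in> S \<Longrightarrow> (\<psi> has_derivative (\<lambda>h. cscale h (b t))) (at t within S)"
    "\<And>t. t \<in> S \<Longrightarrow> norm (a t - b t) \<le> B" and st: "s \<in> S" "t \<in> S"
  shows "norm ((\<phi> t - \<psi> t) - (\<phi> s - \<psi> s)) \<le> B * norm (t - s)"
proof (rule differentiable_bound[OF S(1) _ _ st(2,1)])
  fix x assume x: "x \<in> S"
  show "((\<lambda>t. \<phi> t - \<psi> t) has_derivative (\<lambda>h. cscale h (a x - b x))) (at x within S)"
    using has_derivative_diff[OF S(2,3)[OF x]] by (simp add: cscale_diff_right)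
  show "onorm (\<lambda>h. cscale h (a x - b x)) \<le> B"
    by (rule onorm_le, subst norm_cscale, subst mult.commute) (rule mult_right_mono[OF S(4)[OF x] norm_ge_zero])
qed

lemma cscale_const_derivative: "((\<lambda>t. c) has_derivative (\<lambda>h. cscale h (0, 0))) (at t within S)"
  by (simp add: cscale_def zero_prod_def[symmetric])

lemma continuous_on_cscale_derivative:
  assumes "\<And>t. t \<in> T \<Longrightarrow> (\<phi> has_derivative (\<lambda>h. cscale h (a t))) (at t)"
  shows "continuous_on T \<phi>"
  using assms by (meson continuous_at_imp_continuous_on has_derivative_continuous)

lemma holomorphic_along:
  assumes "holo2 UNIV X" "(\<phi> has_derivative (\<lambda>h. cscale h v)) (at t)"
  shows "(\<lambda>t. fst (X (\<phi> t))) field_differentiable at t" "(\<lambda>t. snd (X (\<phi> t))) field_differentiable at t"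
proof -
  obtain D where D: "(X has_derivative D) (at (\<phi> t))" "\<And>c h. D (cscale c h) = cscale c (D h)"
    using holo2E[OF assms(1)] by (metis UNIV_I)
  have X\<phi>: "((\<lambda>t. X (\<phi> t)) has_derivative (\<lambda>h. cscale h (D v))) (at t)"
    using has_derivative_compose[OF assms(2) D(1)] by (simp add: D(2))
  have "((\<lambda>t. fst (X (\<phi> t))) has_field_derivative fst (D v)) (at t)"
    "((\<lambda>t. snd (X (\<phi> t))) has_field_derivative snd (D v)) (at t)"
    using has_derivative_fst[OF X\<phi>] has_derivative_snd[OF X\<phi>]
    by (simp_all add: has_field_derivative_def cscale_def mult.commute[of "fst (D v)", abs_def]
        mult.commute[of "snd (D v)", abs_def])
  then show "(\<lambda>t. fst (X (\<phi> t))) field_differentiable at t" "(\<lambda>t. snd (X (\<phi> t))) field_differentiable at t"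
    by (auto simp: field_differentiable_def)
qed

text \<open>The next Picard iterate. Time is complex, so integration means taking a holomorphic
  primitive, which exists because a disc is convex.\<close>

lemma picard_step:
  assumes X: "holo2 UNIV X" and \<phi>: "\<And>t. t \<in> ball 0 \<epsilon> \<Longrightarrow> \<exists>v. (\<phi> has_derivative (\<lambda>h. cscale h v)) (at t)"
  obtains \<psi> where "\<psi> 0 = z0"
    "\<And>t. t \<in> ball 0 \<epsilon> \<Longrightarrow> (\<psi> has_derivative (\<lambda>h. cscale h (X (\<phi> t)))) (at t)"
proof -
  have "(\<lambda>t. fst (X (\<phi> t))) holomorphic_on ball 0 \<epsilon>" "(\<lambda>t. snd (X (\<phi> t))) holomorphic_on ball 0 \<epsilon>"
    unfolding holomorphic_on_def using holomorphic_along[OF X] \<phi>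
    by (metis field_differentiable_at_within)+
  then obtain g1 g2 where
    "\<And>t. t \<in> ball 0 \<epsilon> \<Longrightarrow> (g1 has_field_derivative fst (X (\<phi> t))) (at t within ball 0 \<epsilon>)"
    "\<And>t. t \<in> ball 0 \<epsilon> \<Longrightarrow> (g2 has_field_derivative snd (X (\<phi> t))) (at t within ball 0 \<epsilon>)"
    using holomorphic_convex_primitive'[OF convex_ball open_ball] by metis
  then have g: "(g1 has_field_derivative fst (X (\<phi> t))) (at t)" "(g2 has_field_derivative snd (X (\<phi> t))) (at t)"
    if "t \<in> ball 0 \<epsilon>" for t
    using that at_within_open[OF that open_ball] by metis+
  define \<psi> where "\<psi> t = z0 + (g1 t - g1 0, g2 t - g2 0)" for t
  show thesis
  proof (rule that[of \<psi>])
    show "\<psi> 0 = z0" by (simp add: \<psi>_def zero_prod_def[symmetric])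
    fix t :: complex assume t: "t \<in> ball 0 \<epsilon>"
    have "((\<lambda>t. z0 + (g1 t - g1 0, g2 t - g2 0)) has_derivative
        (\<lambda>h. 0 + (fst (X (\<phi> t)) * h - 0, snd (X (\<phi> t)) * h - 0))) (at t)"
      using g[OF t] unfolding has_field_derivative_def
      by (intro has_derivative_add has_derivative_const has_derivative_Pair has_derivative_diff)
    then show "(\<psi> has_derivative (\<lambda>h. cscale h (X (\<phi> t)))) (at t)"
      by (simp add: \<psi>_def[abs_def] cscale_def mult.commute)
  qed
qed

text \<open>One radius \<epsilon> serves all initial values of norm at most R, as it depends only on
  bounds for X on the ball of radius R + 1. This uniformity is what later makes solutions extend to
  all times.\<close>

lemma picard:
  assumes X: "holo2 UNIV X"
  obtains \<epsilon> where "\<epsilon> > 0" "\<And>z0. norm z0 \<le> R \<Longrightarrow>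
    \<exists>\<phi>. \<phi> 0 = z0 \<and> (\<forall>t\<in>ball 0 \<epsilon>. (\<phi> has_derivative (\<lambda>h. cscale h (X (\<phi> t)))) (at t))"
proof -
  define K where "K = cball (0 :: c2) (R + 1)"
  have K: "compact K" "convex K" by (auto simp: K_def)
  obtain L where L: "L > 0" "\<And>z w. z \<in> K \<Longrightarrow> w \<in> K \<Longrightarrow> norm (X z - X w) \<le> L * norm (z - w)"
    using holo2_Lipschitz[OF X K] by auto
  have "bounded (X ` K)"
    by (intro compact_imp_bounded compact_continuous_image K continuous_on_subset[OF holo2_continuous_on[OF X]]) auto
  then obtain M where M: "M > 0" "\<And>z. z \<in> K \<Longrightarrow> norm (X z) \<le> M"
    by (auto simp: bounded_pos)
  \<comment> \<open>The bound 1 / M keeps the iterates within distance 1 of z0, hence in K; the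
    bound 1 / (2 L) halves the distance of consecutive iterates at each step.\<close>
  define \<epsilon> where "\<epsilon> = min (1 / (2 * L)) (1 / M)"
  have \<epsilon>: "\<epsilon> > 0" "M * \<epsilon> \<le> 1" "L * \<epsilon> \<le> 1 / 2"
    using L M by (auto simp: \<epsilon>_def min_def field_simps)
  have "\<exists>\<phi>. \<phi> 0 = z0 \<and> (\<forall>t\<in>ball 0 \<epsilon>. (\<phi> has_derivative (\<lambda>h. cscale h (X (\<phi> t)))) (at t))"
    if z0: "norm z0 \<le> R" for z0
  proof -
    let ?B = "ball (0 :: complex) \<epsilon>"
    have z0_K: "w \<in> K" if "norm (w - z0) \<le> 1" for w
      using norm_triangle_sub[of w z0] z0 that by (simp add: K_def)
    \<comment> \<open>P carries differentiability along with the distance bound, since the next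
      primitive requires X along the iterate to be holomorphic; Q links consecutive
      iterates.\<close>
    define P where "P \<phi> \<longleftrightarrow> \<phi> 0 = z0 \<and> (\<forall>t\<in>?B. norm (\<phi> t - z0) \<le> 1 \<and> (\<exists>v. (\<phi> has_derivative (\<lambda>h. cscale h v)) (at t)))"
      for \<phi> :: "complex \<Rightarrow> c2"
    define Q where "Q \<phi> \<psi> \<longleftrightarrow> (\<forall>t\<in>?B. (\<psi> has_derivative (\<lambda>h. cscale h (X (\<phi> t)))) (at t))"
      for \<phi> \<psi> :: "complex \<Rightarrow> c2"
    have P0: "P (\<lambda>t. z0)" unfolding P_def by (intro conjI ballI exI[of _ "(0, 0)"] cscale_const_derivative) auto
    have step: "\<exists>\<psi>. P \<psi> \<and> Q \<phi> \<psi>" if P: "P \<phi>" for \<phi>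
    proof -
      obtain \<psi> where \<psi>: "\<psi> 0 = z0" "\<And>t. t \<in> ?B \<Longrightarrow> (\<psi> has_derivative (\<lambda>h. cscale h (X (\<phi> t)))) (at t)"
        using picard_step[OF X, of \<epsilon> \<phi> z0] P by (metis P_def)
      have "norm (\<psi> t - z0) \<le> 1" if t: "t \<in> ?B" for t
      proof -
        have "norm ((\<psi> t - z0) - (\<psi> 0 - z0)) \<le> M * norm (t - 0)"
        proof (rule cscale_derivative_bound[where S = ?B and a = "\<lambda>t. X (\<phi> t)" and b = "\<lambda>t. (0,0)"])
          fix s assume s: "s \<in> ?B"
          show "(\<psi> has_derivative (\<lambda>h. cscale h (X (\<phi> s)))) (at s within ?B)"
            using \<psi>(2)[OF s] by (rule has_derivative_at_withinI)
          show "norm (X (\<phi> s) - (0,0)) \<le> M"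
            using M(2) z0_K P s by (auto simp: P_def zero_prod_def[symmetric])
        qed (use t cscale_const_derivative \<epsilon> in auto)
        also have "\<dots> \<le> M * \<epsilon>" using t M by auto
        finally show ?thesis using \<psi>(1) \<epsilon> by simp
      qed
      then have "P \<psi>" "Q \<phi> \<psi>" using \<psi> unfolding P_def Q_def by blast+
      then show ?thesis by blast
    qed
    have "\<exists>f. \<forall>n. (P (f n) \<and> (n = 0 \<longrightarrow> f n = (\<lambda>t. z0))) \<and> Q (f n) (f (Suc n))"
      by (rule dependent_nat_choice) (use P0 step in auto)
    then obtain f where f: "\<And>n. P (f n)" "f 0 = (\<lambda>t. z0)" "\<And>n. Q (f n) (f (Suc n))"
      by auto
    have fK: "f n t \<in> K" if "t \<in> ?B" for n t
      using f(1)[of n] that z0_K by (auto simp: P_def)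
    have contr: "norm (f (Suc n) t - f n t) \<le> (1 / 2) ^ n" if "t \<in> ?B" for n t
      using that
    proof (induction n arbitrary: t)
      case 0
      then show ?case using f(1)[of 1] f(2) by (simp add: P_def)
    next
      case (Suc n)
      have "norm ((f (Suc (Suc n)) t - f (Suc n) t) - (f (Suc (Suc n)) 0 - f (Suc n) 0)) \<le> (L * (1/2)^n) * norm (t - 0)"
      proof (rule cscale_derivative_bound[where S = ?B and a = "\<lambda>t. X (f (Suc n) t)" and b = "\<lambda>t. X (f n t)"])
        fix s assume s: "s \<in> ?B"
        show "(f (Suc (Suc n)) has_derivative (\<lambda>h. cscale h (X (f (Suc n) s)))) (at s within ?B)"
          "(f (Suc n) has_derivative (\<lambda>h. cscale h (X (f n s)))) (at s within ?B)"
          using f(3) s by (auto simp: Q_def intro: has_derivative_at_withinI)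
        have "norm (X (f (Suc n) s) - X (f n s)) \<le> L * norm (f (Suc n) s - f n s)"
          by (rule L(2)[OF fK[OF s] fK[OF s]])
        also have "\<dots> \<le> L * (1/2)^n" using Suc.IH[OF s] L(1) by (intro mult_left_mono) auto
        finally show "norm (X (f (Suc n) s) - X (f n s)) \<le> L * (1/2)^n" .
      qed (use Suc.prems \<epsilon> in auto)
      also have "\<dots> \<le> (L * (1/2)^n) * \<epsilon>" using Suc.prems L by (intro mult_left_mono) auto
      also have "\<dots> = (L * \<epsilon>) * (1/2)^n" by simp
      also have "\<dots> \<le> 1/2 * (1/2)^n" using \<epsilon> by (intro mult_right_mono) auto
      finally show ?case using f(1) by (simp add: P_def)
    qed
    define \<phi> where "\<phi> t = z0 + (\<Sum>n. f (Suc n) t - f n t)" for t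
    have "uniform_limit ?B (\<lambda>n t. \<Sum>k<n. f (Suc k) t - f k t) (\<lambda>t. \<Sum>n. f (Suc n) t - f n t) sequentially"
      by (rule Weierstrass_m_test[OF contr]) (auto intro: summable_geometric)
    then have "uniform_limit ?B (\<lambda>n t. z0 + (\<Sum>k<n. f (Suc k) t - f k t)) \<phi> sequentially"
      unfolding \<phi>_def by (intro uniform_limit_intros)
    moreover have "z0 + (\<Sum>k<n. f (Suc k) t - f k t) = f n t" for n t
      using sum_lessThan_telescope[of "\<lambda>k. f k t" n] by (simp add: f(2))
    ultimately have unif: "uniform_limit ?B f \<phi> sequentially" by simp
    have lim: "(\<lambda>n. f n t) \<longlonglongrightarrow> \<phi> t" if "t \<in> ?B" for t
      by (rule tendsto_uniform_limitI[OF unif that])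
    have \<phi>K: "\<phi> t \<in> K" if "t \<in> ?B" for t
      using closed_sequentially[OF compact_imp_closed[OF K(1)] _ lim[OF that]] fK[OF that] by blast
    \<comment> \<open>The sequence is shifted because the derivative of \<open>f (Suc n)\<close> is
      X along \<open>f n\<close>. By the Lipschitz bound these derivatives converge uniformly to X
      along the limit.\<close>
    have "\<exists>g. \<forall>t\<in>?B. (\<lambda>n. f (Suc n) t) \<longlonglongrightarrow> g t \<and> (g has_derivative (\<lambda>h. cscale h (X (\<phi> t)))) (at t within ?B)"
    proof (rule has_derivative_sequence[where f' = "\<lambda>n t h. cscale h (X (f n t))" and ?x0.0 = 0])
      show "(f (Suc n) has_derivative (\<lambda>h. cscale h (X (f n t)))) (at t within ?B)" if "t \<in> ?B" for n t
        using f(3)[of n] that by (auto simp: Q_def intro: has_derivative_at_withinI)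
      fix e :: real assume e: "e > 0"
      from uniform_limitD[OF unif, of "e / L"] e L
      have "\<forall>\<^sub>F n in sequentially. \<forall>t\<in>?B. dist (f n t) (\<phi> t) < e / L" by simp
      then show "\<forall>\<^sub>F n in sequentially. \<forall>t\<in>?B. \<forall>h. norm (cscale h (X (f n t)) - cscale h (X (\<phi> t))) \<le> e * norm h"
      proof eventually_elim
        case (elim n)
        show ?case
        proof (intro ballI allI)
          fix t h assume t: "t \<in> ?B"
          have "norm (cscale h (X (f n t)) - cscale h (X (\<phi> t))) = norm h * norm (X (f n t) - X (\<phi> t))"
            by (simp add: norm_cscale cscale_diff_right[symmetric])
          also have "\<dots> \<le> norm h * (L * norm (f n t - \<phi> t))"
            by (intro mult_left_mono L(2) fK \<phi>K t) auto
          also have "\<dots> \<le> norm h * (L * (e / L))"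
            using bspec[OF elim t] L by (intro mult_left_mono) (auto simp: dist_norm)
          finally show "norm (cscale h (X (f n t)) - cscale h (X (\<phi> t))) \<le> e * norm h"
            using L(1) by (simp add: mult.commute)
        qed
      qed
    next
      show "(\<lambda>n. f (Suc n) 0) \<longlonglongrightarrow> z0" using f(1) by (simp add: P_def)
    qed (use \<epsilon> in auto)
    then obtain g where g: "\<And>t. t \<in> ?B \<Longrightarrow> (\<lambda>n. f (Suc n) t) \<longlonglongrightarrow> g t"
      "\<And>t. t \<in> ?B \<Longrightarrow> (g has_derivative (\<lambda>h. cscale h (X (\<phi> t)))) (at t within ?B)" by blast
    have g\<phi>: "g t = \<phi> t" if "t \<in> ?B" for t
      using LIMSEQ_unique[OF g(1)[OF that] LIMSEQ_Suc[OF lim[OF that]]] .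
    have "(\<phi> has_derivative (\<lambda>h. cscale h (X (\<phi> t)))) (at t)" if t: "t \<in> ?B" for t
    proof -
      have "(g has_derivative (\<lambda>h. cscale h (X (\<phi> t)))) (at t)"
        using g(2)[OF t] at_within_open[OF t open_ball] by simp
      from has_derivative_transform_within_open[OF this open_ball t g\<phi>] show ?thesis by simp
    qed
    moreover have "\<phi> 0 = z0" by (simp add: \<phi>_def) (use f(1) in \<open>simp add: P_def\<close>)
    ultimately show ?thesis by blast
  qed
  with \<epsilon>(1) that show thesis by blast
qed

text \<open>Near t0 both curves stay within R of the initial value, so they differ by at most 2 R.
  Feeding a bound on the difference back into the equation multiplies it by L \<delta>, which is at
  most 1/2; hence the difference is zero.\<close>

lemma ode_local_unique:
  assumes X: "holo2 A X" and T: "open T" "t0 \<in> T"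
    and \<phi>: "\<And>t. t \<in> T \<Longrightarrow> (\<phi> has_derivative (\<lambda>h. cscale h (X (\<phi> t)))) (at t)"
    and \<psi>: "\<And>t. t \<in> T \<Longrightarrow> (\<psi> has_derivative (\<lambda>h. cscale h (X (\<psi> t)))) (at t)"
    and eq: "\<phi> t0 = \<psi> t0" "\<phi> t0 \<in> A"
  shows "\<exists>\<delta>>0. \<forall>t\<in>ball t0 \<delta>. \<phi> t = \<psi> t"
proof -
  obtain R where R: "R > 0" "cball (\<phi> t0) R \<subseteq> A"
    using holo2_open[OF X] eq(2) open_contains_cball by metis
  obtain L where L: "L > 0" "\<And>z w. z \<in> cball (\<phi> t0) R \<Longrightarrow> w \<in> cball (\<phi> t0) R \<Longrightarrow>
      norm (X z - X w) \<le> L * norm (z - w)"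
    using holo2_Lipschitz[OF X compact_cball convex_cball R(2)] by auto
  have "isCont \<phi> t0" "isCont \<psi> t0" using \<phi> \<psi> T has_derivative_continuous by blast+
  then obtain d1 d2 where d1: "d1 > 0" "\<And>t. dist t t0 < d1 \<Longrightarrow> dist (\<phi> t) (\<phi> t0) < R"
    and d2: "d2 > 0" "\<And>t. dist t t0 < d2 \<Longrightarrow> dist (\<psi> t) (\<psi> t0) < R"
    unfolding continuous_at_eps_delta using R(1) by metis
  obtain d3 where d3: "d3 > 0" "ball t0 d3 \<subseteq> T" using T open_contains_ball by metis
  define \<delta> where "\<delta> = Min {d1, d2, d3, 1 / (2 * L)}"
  have \<delta>: "\<delta> > 0" "\<delta> \<le> d1" "\<delta> \<le> d2" "\<delta> \<le> d3" "\<delta> \<le> 1 / (2 * L)"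
    using d1 d2 d3 L by (auto simp: \<delta>_def)
  then have L\<delta>: "L * \<delta> \<le> 1 / 2" using L by (simp add: field_simps)
  let ?B = "ball t0 \<delta>"
  have BT: "?B \<subseteq> T" using d3 \<delta> subset_ball[of \<delta> d3 t0] by auto
  have in_ball: "\<phi> t \<in> cball (\<phi> t0) R" "\<psi> t \<in> cball (\<phi> t0) R" if "t \<in> ?B" for t
    using d1(2)[of t] d2(2)[of t] that \<delta> eq by (auto simp: dist_commute)
  have "norm (\<phi> t - \<psi> t) \<le> 2 * R * (1/2)^n" if "t \<in> ?B" for n t
    using that
  proof (induction n arbitrary: t)
    case 0
    then show ?case
      using in_ball[OF 0] dist_triangle3[of "\<phi> t" "\<psi> t" "\<phi> t0"] by (auto simp: dist_norm)
  next
    case (Suc n)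
    have "norm ((\<phi> t - \<psi> t) - (\<phi> t0 - \<psi> t0)) \<le> (L * (2 * R * (1/2)^n)) * norm (t - t0)"
    proof (rule cscale_derivative_bound[where S = ?B and a = "\<lambda>t. X (\<phi> t)" and b = "\<lambda>t. X (\<psi> t)"])
      fix s assume s: "s \<in> ?B"
      then have "s \<in> T" using BT by auto
      then show "(\<phi> has_derivative (\<lambda>h. cscale h (X (\<phi> s)))) (at s within ?B)"
        "(\<psi> has_derivative (\<lambda>h. cscale h (X (\<psi> s)))) (at s within ?B)"
        by (auto intro: has_derivative_at_withinI \<phi> \<psi>)
      have "norm (X (\<phi> s) - X (\<psi> s)) \<le> L * norm (\<phi> s - \<psi> s)"
        by (rule L(2)[OF in_ball[OF s]])
      also have "\<dots> \<le> L * (2 * R * (1/2)^n)" by (intro mult_left_mono Suc.IH s) (use L in auto)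
      finally show "norm (X (\<phi> s) - X (\<psi> s)) \<le> L * (2 * R * (1/2)^n)" .
    qed (use Suc.prems \<delta> in auto)
    also have "\<dots> \<le> (L * (2 * R * (1/2)^n)) * \<delta>"
      using Suc.prems L R by (intro mult_left_mono) (auto simp: dist_norm norm_minus_commute)
    also have "\<dots> = (L * \<delta>) * (2 * R * (1/2)^n)" by simp
    also have "\<dots> \<le> 1/2 * (2 * R * (1/2)^n)" using L\<delta> R by (intro mult_right_mono) auto
    finally show ?case using eq by simp
  qed
  moreover have "(\<lambda>n. 2 * R * (1/2)^n) \<longlonglongrightarrow> 2 * R * 0"
    by (intro tendsto_intros LIMSEQ_power_zero) auto
  ultimately have "norm (\<phi> t - \<psi> t) \<le> 2 * R * 0" if "t \<in> ?B" for t
    using that by (intro LIMSEQ_le_const[where X = "\<lambda>n. 2 * R * (1/2)^n"]) auto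
  then show ?thesis using \<delta> by (intro exI[of _ \<delta>]) simp
qed

section \<open>Solutions on a surface\<close>

text \<open>A version of \<open>entire_solution\<close> for an open set of times, which can be
  restricted, translated and glued. As T is open, continuity can be expressed by open preimages in
  T.\<close>

definition sol_on :: "'a atlas \<Rightarrow> ('a chart \<Rightarrow> c2 \<Rightarrow> c2) \<Rightarrow> complex set \<Rightarrow> (complex \<Rightarrow> 'a) \<Rightarrow> bool" where
  "sol_on M Y T \<gamma> \<longleftrightarrow> open T \<and> (\<forall>t\<in>T. \<gamma> t \<in> points M) \<and>
     (\<forall>V. openin (surface_topology M) V \<longrightarrow> open {t\<in>T. \<gamma> t \<in> V}) \<and>
     (\<forall>t\<in>T. \<forall>(A, \<phi>)\<in>M. \<gamma> t \<in> \<phi> ` A \<longrightarrow>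
        ((\<lambda>\<tau>. inv_into A \<phi> (\<gamma> \<tau>)) has_derivative
           (\<lambda>h. cscale h (Y (A, \<phi>) (inv_into A \<phi> (\<gamma> t))))) (at t))"

lemma sol_onD:
  assumes "sol_on M Y T \<gamma>"
  shows "open T" "t \<in> T \<Longrightarrow> \<gamma> t \<in> points M"
    "openin (surface_topology M) V \<Longrightarrow> open {t\<in>T. \<gamma> t \<in> V}"
    "t \<in> T \<Longrightarrow> (A, \<phi>) \<in> M \<Longrightarrow> \<gamma> t \<in> \<phi> ` A \<Longrightarrow>
      ((\<lambda>\<tau>. inv_into A \<phi> (\<gamma> \<tau>)) has_derivative
           (\<lambda>h. cscale h (Y (A, \<phi>) (inv_into A \<phi> (\<gamma> t))))) (at t)"
  using assms unfolding sol_on_def by blast+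

lemma sol_onI:
  assumes "open T" "\<And>t. t \<in> T \<Longrightarrow> \<gamma> t \<in> points M"
    "\<And>V. openin (surface_topology M) V \<Longrightarrow> open {t\<in>T. \<gamma> t \<in> V}"
    "\<And>t A \<phi>. t \<in> T \<Longrightarrow> (A, \<phi>) \<in> M \<Longrightarrow> \<gamma> t \<in> \<phi> ` A \<Longrightarrow>
      ((\<lambda>\<tau>. inv_into A \<phi> (\<gamma> \<tau>)) has_derivative
           (\<lambda>h. cscale h (Y (A, \<phi>) (inv_into A \<phi> (\<gamma> t))))) (at t)"
  shows "sol_on M Y T \<gamma>"
  using assms unfolding sol_on_def by blast

lemma entire_solution_iff:
  assumes M: "\<And>A \<phi>. (A, \<phi>) \<in> M \<Longrightarrow> open A"
  shows "entire_solution M Y \<gamma> \<longleftrightarrow> sol_on M Y UNIV \<gamma>"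
proof -
  have "topspace (surface_topology M) = points M" by (rule topspace_surface_topology[OF M])
  then show ?thesis
    unfolding entire_solution_def sol_on_def continuous_map_def by (auto simp: Pi_iff)
qed

lemma sol_on_subset:
  assumes \<gamma>: "sol_on M Y T \<gamma>" and T': "open T'" "T' \<subseteq> T"
  shows "sol_on M Y T' \<gamma>"
proof (rule sol_onI[OF T'(1)])
  fix V assume "openin (surface_topology M) V"
  from open_Int[OF sol_onD(3)[OF \<gamma> this] T'(1)]
  have "open ({t \<in> T. \<gamma> t \<in> V} \<inter> T')" .
  moreover have "{t \<in> T. \<gamma> t \<in> V} \<inter> T' = {t \<in> T'. \<gamma> t \<in> V}" using T'(2) by auto
  ultimately show "open {t \<in> T'. \<gamma> t \<in> V}" by simp
next
  fix t A \<phi> assume "t \<in> T'" "(A, \<phi>) \<in> M" "\<gamma> t \<in> \<phi> ` A"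
  with T'(2) show "((\<lambda>\<tau>. inv_into A \<phi> (\<gamma> \<tau>)) has_derivative
           (\<lambda>h. cscale h (Y (A, \<phi>) (inv_into A \<phi> (\<gamma> t))))) (at t)"
    by (intro sol_onD(4)[OF \<gamma>]) auto
qed (use sol_onD(2)[OF \<gamma>] T'(2) in auto)

lemma sol_on_cong:
  assumes \<gamma>: "sol_on M Y T \<gamma>" and eq: "\<And>t. t \<in> T \<Longrightarrow> \<gamma> t = \<gamma>' t"
  shows "sol_on M Y T \<gamma>'"
proof (rule sol_onI[OF sol_onD(1)[OF \<gamma>]])
  fix V assume "openin (surface_topology M) V"
  from sol_onD(3)[OF \<gamma> this]
  show "open {t \<in> T. \<gamma>' t \<in> V}" using eq by (metis (mono_tags, lifting) Collect_cong)
next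
  fix t A \<phi> assume t: "t \<in> T" and M: "(A, \<phi>) \<in> M" and im: "\<gamma>' t \<in> \<phi> ` A"
  have "((\<lambda>\<tau>. inv_into A \<phi> (\<gamma> \<tau>)) has_derivative
           (\<lambda>h. cscale h (Y (A, \<phi>) (inv_into A \<phi> (\<gamma>' t))))) (at t)"
    using sol_onD(4)[OF \<gamma> t M] im eq[OF t] by simp
  then show "((\<lambda>\<tau>. inv_into A \<phi> (\<gamma>' \<tau>)) has_derivative
           (\<lambda>h. cscale h (Y (A, \<phi>) (inv_into A \<phi> (\<gamma>' t))))) (at t)"
    by (rule has_derivative_transform_within_open[OF _ sol_onD(1)[OF \<gamma>] t]) (simp add: eq)
qed (use sol_onD(2)[OF \<gamma>] eq in auto)

lemma sol_on_local:
  assumes "\<And>t. t \<in> T \<Longrightarrow> \<exists>T'. t \<in> T' \<and> T' \<subseteq> T \<and> sol_on M Y T' \<gamma>"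
  shows "sol_on M Y T \<gamma>"
proof (rule sol_onI)
  have "\<exists>U. open U \<and> t \<in> U \<and> U \<subseteq> T" if "t \<in> T" for t
  proof -
    obtain T' where T': "t \<in> T'" "T' \<subseteq> T" "sol_on M Y T' \<gamma>" using assms[OF \<open>t \<in> T\<close>] by auto
    with sol_onD(1)[OF T'(3)] show ?thesis by (intro exI[of _ T']) simp
  qed
  then show "open T" by (subst open_subopen) (rule ballI)
  fix V assume V: "openin (surface_topology M) V"
  show "open {t \<in> T. \<gamma> t \<in> V}"
  proof (subst open_subopen, intro ballI)
    fix t assume "t \<in> {t \<in> T. \<gamma> t \<in> V}"
    then have tT: "t \<in> T" and V': "\<gamma> t \<in> V" by auto
    obtain T' where T': "t \<in> T'" "T' \<subseteq> T" "sol_on M Y T' \<gamma>" using assms[OF tT] by auto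
    then show "\<exists>U. open U \<and> t \<in> U \<and> U \<subseteq> {t \<in> T. \<gamma> t \<in> V}"
      using sol_onD(3)[OF T'(3) V] V' by (intro exI[of _ "{t \<in> T'. \<gamma> t \<in> V}"]) auto
  qed
next
  fix t assume t: "t \<in> T"
  obtain T' where T': "t \<in> T'" "sol_on M Y T' \<gamma>" using assms[OF t] by auto
  show "\<gamma> t \<in> points M" by (rule sol_onD(2)[OF T'(2,1)])
  show "((\<lambda>\<tau>. inv_into A \<phi> (\<gamma> \<tau>)) has_derivative
           (\<lambda>h. cscale h (Y (A, \<phi>) (inv_into A \<phi> (\<gamma> t))))) (at t)"
    if "(A, \<phi>) \<in> M" "\<gamma> t \<in> \<phi> ` A" for A \<phi>
    by (rule sol_onD(4)[OF T'(2,1) that])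
qed

lemma sol_on_shift:
  assumes \<gamma>: "sol_on M Y T \<gamma>"
  shows "sol_on M Y {t. t + a \<in> T} (\<lambda>t. \<gamma> (t + a))"
proof (rule sol_onI)
  have vim: "open {t. t + a \<in> U}" if "open U" for U :: "complex set"
  proof -
    have "open ((\<lambda>t. t + a) -` U)" by (rule open_vimage[OF that]) (intro continuous_intros)
    then show ?thesis by (simp add: vimage_def)
  qed
  show "open {t. t + a \<in> T}" by (rule vim[OF sol_onD(1)[OF \<gamma>]])
  show "open {t \<in> {t. t + a \<in> T}. \<gamma> (t + a) \<in> V}" if "openin (surface_topology M) V" for V
    using vim[OF sol_onD(3)[OF \<gamma> that]] by simp
next
  fix t A \<phi> assume "t \<in> {t. t + a \<in> T}" "(A, \<phi>) \<in> M" "\<gamma> (t + a) \<in> \<phi> ` A"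
  then have "((\<lambda>\<tau>. inv_into A \<phi> (\<gamma> \<tau>)) has_derivative
           (\<lambda>h. cscale h (Y (A, \<phi>) (inv_into A \<phi> (\<gamma> (t + a)))))) (at (t + a))"
    by (intro sol_onD(4)[OF \<gamma>]) auto
  moreover have "((\<lambda>t. t + a) has_derivative (\<lambda>h. h)) (at t)"
    by (auto intro!: derivative_eq_intros)
  ultimately show "((\<lambda>\<tau>. inv_into A \<phi> (\<gamma> (\<tau> + a))) has_derivative
           (\<lambda>h. cscale h (Y (A, \<phi>) (inv_into A \<phi> (\<gamma> (t + a)))))) (at t)"
    by (rule has_derivative_compose[rotated])
qed (use sol_onD(2)[OF \<gamma>] in auto)

lemma chart_image_openin:
  assumes M: "complex_surface M" and A: "(A, \<phi>) \<in> M"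
  shows "openin (surface_topology M) (\<phi> ` A)"
  unfolding openin_surface_topology
proof (intro conjI ballI)
  show "\<phi> ` A \<subseteq> points M" using pointsI[OF A] by auto
  fix c assume "c \<in> M"
  then obtain B \<psi> where [simp]: "c = (B, \<psi>)" and B: "(B, \<psi>) \<in> M" by (cases c) auto
  show "case c of (B, \<psi>) \<Rightarrow> open {z \<in> B. \<psi> z \<in> \<phi> ` A}"
    using holo2_open[OF holomorphic_map_charts[OF complex_surface_id[OF M] B A]] by simp
qed

lemma holomorphic_field_chart:
  assumes "holomorphic_field M Y" "(A, \<phi>) \<in> M"
  shows "holo2 A (Y (A, \<phi>))"
proof -
  have "\<forall>(A, \<phi>)\<in>M. holo2 A (Y (A, \<phi>))" using assms(1) unfolding holomorphic_field_def by (rule conjunct1)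
  from bspec[OF this assms(2)] show ?thesis by simp
qed

text \<open>The set of times of agreement is open by local uniqueness in a chart, and its complement
  in T is open by the Hausdorff property; T is connected.\<close>

lemma sol_on_unique:
  assumes M: "complex_surface M" and Y: "holomorphic_field M Y"
    and \<gamma>: "sol_on M Y T \<gamma>" and \<gamma>': "sol_on M Y T \<gamma>'" and T: "connected T"
    and t0: "t0 \<in> T" "\<gamma> t0 = \<gamma>' t0" and t: "t \<in> T"
  shows "\<gamma> t = \<gamma>' t"
proof -
  define E where "E = {t \<in> T. \<gamma> t = \<gamma>' t}"
  have "open E"
  proof (subst open_subopen, intro ballI)
    fix s assume "s \<in> E"
    then have s: "s \<in> T" "\<gamma> s = \<gamma>' s" by (auto simp: E_def)
    obtain A \<phi> z where A: "(A, \<phi>) \<in> M" "z \<in> A" "\<gamma> s = \<phi> z"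
      using sol_onD(2)[OF \<gamma> s(1)] by (elim pointsE)
    note op = chart_image_openin[OF M A(1)]
    define T' where "T' = {t \<in> T. \<gamma> t \<in> \<phi> ` A} \<inter> {t \<in> T. \<gamma>' t \<in> \<phi> ` A}"
    have "holo2 A (Y (A, \<phi>))" by (rule holomorphic_field_chart[OF Y A(1)])
    moreover have "open T'" unfolding T'_def by (intro open_Int sol_onD(3)[OF \<gamma> op] sol_onD(3)[OF \<gamma>' op])
    moreover have sT': "s \<in> T'" using s A imageI[OF A(2), of \<phi>] by (simp add: T'_def)
    ultimately have "\<exists>\<delta>>0. \<forall>t\<in>ball s \<delta>. inv_into A \<phi> (\<gamma> t) = inv_into A \<phi> (\<gamma>' t)"
    proof (rule ode_local_unique)
      show "((\<lambda>t. inv_into A \<phi> (\<gamma> t)) has_derivative (\<lambda>h. cscale h (Y (A, \<phi>) (inv_into A \<phi> (\<gamma> t))))) (at t)"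
        if "t \<in> T'" for t using that by (intro sol_onD(4)[OF \<gamma> _ A(1)]) (auto simp: T'_def)
      show "((\<lambda>t. inv_into A \<phi> (\<gamma>' t)) has_derivative (\<lambda>h. cscale h (Y (A, \<phi>) (inv_into A \<phi> (\<gamma>' t))))) (at t)"
        if "t \<in> T'" for t using that by (intro sol_onD(4)[OF \<gamma>' _ A(1)]) (auto simp: T'_def)
      show "inv_into A \<phi> (\<gamma> s) = inv_into A \<phi> (\<gamma>' s)" using s by simp
      show "inv_into A \<phi> (\<gamma> s) \<in> A" using A by (simp add: inv_into_into)
    qed
    then obtain \<delta> where \<delta>: "\<delta> > 0"
      "\<And>t. t \<in> ball s \<delta> \<Longrightarrow> inv_into A \<phi> (\<gamma> t) = inv_into A \<phi> (\<gamma>' t)" by blast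
    have "\<gamma> t = \<gamma>' t" if "t \<in> ball s \<delta> \<inter> T'" for t
    proof -
      have "\<phi> (inv_into A \<phi> (\<gamma> t)) = \<gamma> t" "\<phi> (inv_into A \<phi> (\<gamma>' t)) = \<gamma>' t"
        using that by (simp_all add: T'_def f_inv_into_f)
      moreover have "inv_into A \<phi> (\<gamma> t) = inv_into A \<phi> (\<gamma>' t)" using \<delta>(2)[of t] that by blast
      ultimately show ?thesis by metis
    qed
    moreover have "t \<in> T" if "t \<in> T'" for t using that by (simp add: T'_def)
    ultimately have "ball s \<delta> \<inter> T' \<subseteq> E" unfolding E_def by blast
    then show "\<exists>U. open U \<and> s \<in> U \<and> U \<subseteq> E"
      using \<open>open T'\<close> sT' \<delta>(1) by (intro exI[of _ "ball s \<delta> \<inter> T'"]) auto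
  qed
  moreover have "open (T - E)"
  proof (subst open_subopen, intro ballI)
    fix s assume "s \<in> T - E"
    then have s: "s \<in> T" "\<gamma> s \<noteq> \<gamma>' s" by (auto simp: E_def)
    have "topspace (surface_topology M) = points M"
      by (intro topspace_surface_topology complex_surface_charts(1)[OF M])
    then have "\<gamma> s \<in> topspace (surface_topology M)" "\<gamma>' s \<in> topspace (surface_topology M)"
      using sol_onD(2)[OF \<gamma> s(1)] sol_onD(2)[OF \<gamma>' s(1)] by auto
    moreover have "Hausdorff_space (surface_topology M)" using M by (simp add: complex_surface_def)
    ultimately obtain U V where UV: "openin (surface_topology M) U" "openin (surface_topology M) V"
      "\<gamma> s \<in> U" "\<gamma>' s \<in> V" "disjnt U V"
      using s(2) unfolding Hausdorff_space_def by blast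
    have "open ({t \<in> T. \<gamma> t \<in> U} \<inter> {t \<in> T. \<gamma>' t \<in> V})"
      by (intro open_Int sol_onD(3)[OF \<gamma>] sol_onD(3)[OF \<gamma>'] UV)
    moreover have "{t \<in> T. \<gamma> t \<in> U} \<inter> {t \<in> T. \<gamma>' t \<in> V} \<subseteq> T - E"
      using UV(5) by (auto simp: E_def disjnt_iff)
    ultimately show "\<exists>W. open W \<and> s \<in> W \<and> W \<subseteq> T - E"
      using s UV by (intro exI[of _ "{t \<in> T. \<gamma> t \<in> U} \<inter> {t \<in> T. \<gamma>' t \<in> V}"]) auto
  qed
  ultimately have "E \<inter> T = {} \<or> (T - E) \<inter> T = {}"
    by (intro connectedD[OF T]) auto
  moreover have "t0 \<in> E" using t0 by (simp add: E_def)
  ultimately have "T \<subseteq> E" using t0 by auto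
  then show ?thesis using t by (auto simp: E_def)
qed

section \<open>From uniform local flows to global flows\<close>

lemma comp_funpow_commute:
  assumes "f \<circ> g = g \<circ> f"
  shows "(f \<circ> g) ^^ n = (f ^^ n) \<circ> (g ^^ n)"
proof -
  have *: "(f ^^ n) \<circ> g = g \<circ> (f ^^ n)" for n
  proof (induction n)
    case (Suc n)
    have "(f ^^ Suc n) \<circ> g = f \<circ> ((f ^^ n) \<circ> g)" by (simp add: comp_assoc)
    also have "\<dots> = f \<circ> (g \<circ> (f ^^ n))" by (simp only: Suc)
    also have "\<dots> = (g \<circ> f) \<circ> (f ^^ n)" by (simp only: assms[symmetric] comp_assoc)
    also have "\<dots> = g \<circ> (f ^^ Suc n)" by (simp add: comp_assoc)
    finally show ?case .
  qed simp
  show ?thesis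
  proof (induction n)
    case (Suc n)
    have "(f \<circ> g) ^^ Suc n = (f \<circ> g) \<circ> ((f ^^ n) \<circ> (g ^^ n))" by (simp only: funpow.simps Suc)
    also have "\<dots> = f \<circ> (g \<circ> (f ^^ n)) \<circ> (g ^^ n)" by (simp only: comp_assoc)
    also have "\<dots> = f \<circ> ((f ^^ n) \<circ> g) \<circ> (g ^^ n)" by (simp only: *)
    also have "\<dots> = (f ^^ Suc n) \<circ> (g ^^ Suc n)" by (simp add: comp_assoc)
    finally show ?case .
  qed simp
qed

text \<open>The global flow is \<open>(\<Phi> (t / n))\<^sup>n\<close> for large \<open>n\<close>; the local group law makes it independent of \<open>n\<close>.\<close>

lemma local_flow_extends:
  fixes \<Phi> :: "complex \<Rightarrow> 'a \<Rightarrow> 'a"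
  assumes \<epsilon>: "\<epsilon> > 0" and \<Phi>0: "\<Phi> 0 = id"
    and add: "\<And>s t. norm s < \<epsilon> \<Longrightarrow> norm t < \<epsilon> \<Longrightarrow> norm (s + t) < \<epsilon> \<Longrightarrow> \<Phi> (s + t) = \<Phi> s \<circ> \<Phi> t"
  shows "\<exists>\<Psi>. (\<forall>t. norm t < \<epsilon> \<longrightarrow> \<Psi> t = \<Phi> t) \<and> (\<forall>s t. \<Psi> (s + t) = \<Psi> s \<circ> \<Psi> t) \<and>
    (\<forall>t. \<exists>s n. norm s < \<epsilon> \<and> \<Psi> t = \<Phi> s ^^ n)"
proof -
  have a: "\<Phi> (t / of_nat n) ^^ k = \<Phi> (of_nat k * (t / of_nat n))"
    if t: "norm t < \<epsilon>" and k: "k \<le> n" "n > 0" for t n k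
    using k
  proof (induction k)
    case 0
    then show ?case by (simp add: \<Phi>0)
  next
    case (Suc k)
    have small: "norm (of_nat j * (t / of_nat n)) < \<epsilon>" if "j \<le> n" for j
    proof -
      have "norm (of_nat j * (t / of_nat n)) = real j / real n * norm t"
        by (simp add: norm_mult norm_divide)
      also have "\<dots> \<le> 1 * norm t"
        using that \<open>n > 0\<close> by (intro mult_right_mono) (auto simp: field_simps)
      finally show ?thesis using t by simp
    qed
    have "\<Phi> (t / of_nat n) ^^ Suc k = \<Phi> (t / of_nat n) \<circ> \<Phi> (of_nat k * (t / of_nat n))"
      using Suc by simp
    also have "\<dots> = \<Phi> (t / of_nat n + of_nat k * (t / of_nat n))"
      using small[of 1] small[of k] small[of "Suc k"] Suc.prems
      by (intro add[symmetric]) (auto simp: algebra_simps add_divide_distrib)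
    finally show ?case by (simp add: algebra_simps add_divide_distrib)
  qed
  define E where "E n t = \<Phi> (t / of_nat n) ^^ n" for n t
  have b: "E (n * m) t = E n t" if "norm t < real n * \<epsilon>" "n > 0" "m > 0" for n m t
  proof -
    have "norm (t / of_nat n) < \<epsilon>" using that by (simp add: norm_divide field_simps)
    from a[OF this order_refl that(3)]
    have "\<Phi> (t / of_nat n / of_nat m) ^^ m = \<Phi> (t / of_nat n)" using that by simp
    then have "(\<Phi> (t / of_nat n / of_nat m) ^^ m) ^^ n = E n t" by (simp add: E_def)
    then show ?thesis by (simp add: E_def funpow_mult mult.commute)
  qed
  have ex: "\<exists>n>0. norm t < real n * \<epsilon>" for t :: complex
  proof -
    obtain n where "norm t / \<epsilon> < real n" using reals_Archimedean2 by blast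
    then have "norm t < real n * \<epsilon>" using \<epsilon> by (simp add: field_simps)
    moreover from this have "n > 0" using norm_ge_zero[of t] by (cases n) auto
    ultimately show ?thesis by blast
  qed
  define N where "N t = (SOME n. n > 0 \<and> norm t < real n * \<epsilon>)" for t :: complex
  have N: "N t > 0" "norm t < real (N t) * \<epsilon>" for t
    using someI_ex[OF ex[of t]] by (auto simp: N_def)
  define \<Psi> where "\<Psi> t = E (N t) t" for t
  have c: "\<Psi> t = E n t" if "norm t < real n * \<epsilon>" "n > 0" for t n
    using b[OF that N(1)[of t]] b[OF N(2)[of t] N(1)[of t] that(2)] by (simp add: \<Psi>_def mult.commute)
  show ?thesis
  proof (intro exI[of _ \<Psi>] conjI allI impI)
    show "\<Psi> t = \<Phi> t" if "norm t < \<epsilon>" for t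
      using c[of t 1] that by (simp add: E_def)
    show "\<Psi> (s + t) = \<Psi> s \<circ> \<Psi> t" for s t
    proof -
      \<comment> \<open>One subdivision serves s, t and s + t at once, so that the n-th powers of
        commuting short-time maps can be compared.\<close>
      obtain n where n: "n > 0" "norm s + norm t < real n * \<epsilon>"
        using ex[of "of_real (norm s + norm t)"] by (auto simp del: of_real_add)
      then have st: "norm s < real n * \<epsilon>" "norm t < real n * \<epsilon>" "norm (s + t) < real n * \<epsilon>"
        using norm_triangle_ineq[of s t] norm_ge_zero[of s] norm_ge_zero[of t] by linarith+
      then have small: "norm (s / of_nat n) < \<epsilon>" "norm (t / of_nat n) < \<epsilon>" "norm (s / of_nat n + t / of_nat n) < \<epsilon>"
        using n by (auto simp: norm_divide field_simps simp flip: add_divide_distrib)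
      have 1: "\<Phi> (s / of_nat n + t / of_nat n) = \<Phi> (s / of_nat n) \<circ> \<Phi> (t / of_nat n)"
        by (rule add[OF small])
      have 2: "\<Phi> (t / of_nat n + s / of_nat n) = \<Phi> (t / of_nat n) \<circ> \<Phi> (s / of_nat n)"
        by (rule add[OF small(2,1)]) (use small(3) in \<open>simp add: add.commute\<close>)
      have comm: "\<Phi> (s / of_nat n) \<circ> \<Phi> (t / of_nat n) = \<Phi> (t / of_nat n) \<circ> \<Phi> (s / of_nat n)"
        using 1 2 by (simp add: add.commute)
      have "\<Psi> (s + t) = E n (s + t)" "\<Psi> s = E n s" "\<Psi> t = E n t"
        using c st n by auto
      then show ?thesis
        using comp_funpow_commute[OF comm, of n] 1 by (simp add: E_def add_divide_distrib)
    qed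
    show "\<exists>s n. norm s < \<epsilon> \<and> \<Psi> t = \<Phi> s ^^ n" for t
    proof (intro exI conjI)
      show "norm (t / of_nat (N t)) < \<epsilon>"
        using N[of t] by (simp add: norm_divide field_simps)
    qed (simp add: \<Psi>_def E_def)
  qed
qed

text \<open>Local solutions starting in K stay in K and share the lifetime \<epsilon>. By uniqueness
  they form a local group of maps preserving K, which extends to all complex times.\<close>

lemma uniform_local_solutions_extend:
  assumes M: "complex_surface M" and Y: "holomorphic_field M Y" and \<epsilon>: "\<epsilon> > 0"
    and loc: "\<And>s. s \<in> K \<Longrightarrow> \<exists>\<gamma>. sol_on M Y (ball 0 \<epsilon>) \<gamma> \<and> \<gamma> 0 = s \<and> \<gamma> ` ball 0 \<epsilon> \<subseteq> K"
    and s: "s \<in> K"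
  obtains \<gamma> where "sol_on M Y UNIV \<gamma>" "\<gamma> t0 = s"
proof -
  let ?B = "ball (0 :: complex) \<epsilon>"
  obtain g where g: "\<And>x. x \<in> K \<Longrightarrow> sol_on M Y ?B (g x)" "\<And>x. x \<in> K \<Longrightarrow> g x 0 = x"
    "\<And>x. x \<in> K \<Longrightarrow> g x ` ?B \<subseteq> K" using loc by metis
  \<comment> \<open>Outside K the map is the identity, so that \<open>\<Phi> 0 = id\<close> holds on
    the whole type.\<close>
  define \<Phi> where "\<Phi> t x = (if x \<in> K then g x t else x)" for t x
  have \<Phi>K: "\<Phi> t x \<in> K" if "x \<in> K" "norm t < \<epsilon>" for t x
    using g(3)[OF that(1)] that by (auto simp: \<Phi>_def)
  have add: "\<Phi> (s + t) = \<Phi> s \<circ> \<Phi> t" if st: "norm s < \<epsilon>" "norm t < \<epsilon>" "norm (s + t) < \<epsilon>" for s t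
  proof
    fix x
    show "\<Phi> (s + t) x = (\<Phi> s \<circ> \<Phi> t) x"
    proof (cases "x \<in> K")
      case True
      define y where "y = g x t"
      have y: "y \<in> K" "\<Phi> t x = y" using \<Phi>K[OF True st(2)] True by (auto simp: y_def \<Phi>_def)
      \<comment> \<open>The times at which both sides are defined. An intersection of two discs is
        convex, hence connected; it contains 0 and s.\<close>
      let ?T = "?B \<inter> {u. u + t \<in> ?B}"
      have eq: "{u. u + t \<in> ?B} = ball (- t) \<epsilon>" by (auto simp: dist_norm norm_minus_commute add.commute)
      have o: "open ?T" unfolding eq by (intro open_Int open_ball)
      have c: "connected ?T" unfolding eq by (intro convex_connected convex_Int convex_ball)
      have "g x (s + t) = g y s"
      proof (rule sol_on_unique[OF M Y _ _ c])
        show "sol_on M Y ?T (\<lambda>u. g x (u + t))"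
          by (rule sol_on_subset[OF sol_on_shift[OF g(1)[OF True]] o]) auto
        show "sol_on M Y ?T (g y)" by (rule sol_on_subset[OF g(1)[OF y(1)] o]) auto
        show "g x (0 + t) = g y 0" using g(2)[OF y(1)] by (simp add: y_def)
      qed (use st \<epsilon> in auto)
      then show ?thesis using y True by (simp add: \<Phi>_def)
    qed (simp add: \<Phi>_def)
  qed
  have \<Phi>0: "\<Phi> 0 = id" using g(2) by (auto simp: \<Phi>_def)
  have ex: "\<exists>\<Psi>. (\<forall>t. norm t < \<epsilon> \<longrightarrow> \<Psi> t = \<Phi> t) \<and> (\<forall>s t. \<Psi> (s + t) = \<Psi> s \<circ> \<Psi> t) \<and>
    (\<forall>t. \<exists>s n. norm s < \<epsilon> \<and> \<Psi> t = \<Phi> s ^^ n)"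
    by (rule local_flow_extends[of \<epsilon> \<Phi>, OF \<epsilon> \<Phi>0]) (rule add)
  obtain \<Psi> where \<Psi>: "\<And>t. norm t < \<epsilon> \<Longrightarrow> \<Psi> t = \<Phi> t" "\<And>s t. \<Psi> (s + t) = \<Psi> s \<circ> \<Psi> t"
    "\<And>t. \<exists>s n. norm s < \<epsilon> \<and> \<Psi> t = \<Phi> s ^^ n"
    using ex by blast
  have \<Psi>K: "\<Psi> t s \<in> K" for t
  proof -
    obtain u n where u: "norm u < \<epsilon>" "\<Psi> t = \<Phi> u ^^ n" using \<Psi>(3) by blast
    have "(\<Phi> u ^^ n) s \<in> K" by (induction n) (use s \<Phi>K u in auto)
    then show ?thesis using u by simp
  qed
  define \<gamma> where "\<gamma> t = \<Psi> (t - t0) s" for t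
  have "sol_on M Y UNIV \<gamma>"
  proof (rule sol_on_local)
    fix t1 :: complex
    define x where "x = \<gamma> t1"
    have x: "x \<in> K" using \<Psi>K by (simp add: x_def \<gamma>_def)
    \<comment> \<open>Near t1 the candidate is a translate of the local solution through its own
      value at t1, by additivity of \<Psi>.\<close>
    have "sol_on M Y {t. t + - t1 \<in> ?B} (\<lambda>t. g x (t + - t1))"
      by (rule sol_on_shift[OF g(1)[OF x]])
    then have "sol_on M Y {t. t + - t1 \<in> ?B} \<gamma>"
    proof (rule sol_on_cong)
      fix t assume "t \<in> {t. t + - t1 \<in> ?B}"
      then have "norm (t - t1) < \<epsilon>" by simp
      then have "g x (t - t1) = \<Psi> (t - t1) x" using x \<Psi>(1) by (simp add: \<Phi>_def)
      also have "\<dots> = \<Psi> ((t - t1) + (t1 - t0)) s" unfolding \<Psi>(2) by (simp add: x_def \<gamma>_def)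
      finally show "g x (t + - t1) = \<gamma> t" by (simp add: \<gamma>_def)
    qed
    then show "\<exists>T'. t1 \<in> T' \<and> T' \<subseteq> UNIV \<and> sol_on M Y T' \<gamma>"
      using \<epsilon> by (intro exI[of _ "{t. t + - t1 \<in> ?B}"]) auto
  qed
  moreover have "\<gamma> t0 = s" using \<Psi>(1)[of 0] \<epsilon> s g(2) by (simp add: \<gamma>_def \<Phi>_def)
  ultimately show thesis by (rule that)
qed

section \<open>Hamiltonian systems\<close>

definition ham_field :: "(c2 \<Rightarrow> complex) \<Rightarrow> c2 \<Rightarrow> c2" where
  "ham_field H z = (dy H z, - dx H z)"

lemma holo2_ham_field: "hol A H \<Longrightarrow> holo2 A (ham_field H)"
  unfolding ham_field_def by (intro holo2_Pair hol_dx hol_dy hol_uminus)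

text \<open>Differentiating H' o g = H gives dH' o Dg = dH. Since Dg preserves the form, the
  difference of the two fields pairs to zero with the whole image of Dg; as Dg has determinant 1,
  the difference is zero.\<close>

lemma ham_field_symplectic:
  assumes H: "hol UNIV H" and H': "hol UNIV H'" and g: "holo2 A g" and z: "z \<in> A"
    and eq: "\<And>w. w \<in> A \<Longrightarrow> H' (g w) = H w"
    and symp: "\<And>h k. symplectic_form (frechet_derivative g (at z) h) (frechet_derivative g (at z) k)
      = symplectic_form h k"
  shows "frechet_derivative g (at z) (ham_field H z) = ham_field H' (g z)"
proof -
  let ?D = "frechet_derivative g (at z)"
  have "((\<lambda>w. H' (g w)) has_derivative (\<lambda>h. dx H' (g z) * fst (?D h) + dy H' (g z) * snd (?D h))) (at z)"
    by (rule has_derivative_compose[OF holo2_has_derivative[OF g z] hol_has_derivative[OF H']]) simp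
  then have "(H has_derivative (\<lambda>h. dx H' (g z) * fst (?D h) + dy H' (g z) * snd (?D h))) (at z)"
    by (rule has_derivative_transform_within_open[OF _ holo2_open[OF g] z eq])
  from has_derivative_unique[OF this hol_has_derivative[OF H]]
  have dH: "dx H' (g z) * fst (?D h) + dy H' (g z) * snd (?D h) = dx H z * fst h + dy H z * snd h" for h
    by (metis UNIV_I)
  have "symplectic_form (?D (ham_field H z) - ham_field H' (g z)) (?D h) = 0" for h
  proof -
    have "symplectic_form (?D (ham_field H z)) (?D h) = dx H z * fst h + dy H z * snd h"
      unfolding symp by (simp add: symplectic_form_def ham_field_def)
    also have "\<dots> = symplectic_form (ham_field H' (g z)) (?D h)"
      unfolding dH[symmetric] by (simp add: symplectic_form_def ham_field_def)
    finally show ?thesis by (simp add: symplectic_form_def algebra_simps)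
  qed
  note e = this[of "(1, 0)"] this[of "(0, 1)"]
  obtain a b where ab: "?D (ham_field H z) - ham_field H' (g z) = (a, b)" by force
  obtain c d where cd: "?D (1, 0) = (c, d)" by force
  obtain c' d' where cd': "?D (0, 1) = (c', d')" by force
  have 1: "c * d' - d * c' = 1" using symp[of "(1, 0)" "(0, 1)"] cd cd' by (simp add: symplectic_form_def)
  have 2: "a * d - b * c = 0" "a * d' - b * c' = 0"
    using e cd cd' ab by (simp_all add: symplectic_form_def)
  have "a * (c * d' - d * c') = c * (a * d' - b * c') - c' * (a * d - b * c)"
    "b * (c * d' - d * c') = d * (a * d' - b * c') - d' * (a * d - b * c)"
    by (simp_all add: algebra_simps)
  then have "a = 0" "b = 0" unfolding 1 2 by simp_all
  then show ?thesis using ab by (simp add: zero_prod_def[symmetric])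
qed

lemma ham_field_conserved:
  assumes H: "hol UNIV H"
    and \<phi>: "\<And>t. t \<in> ball 0 \<epsilon> \<Longrightarrow> (\<phi> has_derivative (\<lambda>h. cscale h (ham_field H (\<phi> t)))) (at t)"
    and t: "t \<in> ball 0 \<epsilon>"
  shows "H (\<phi> t) = H (\<phi> 0)"
proof -
  have "((\<lambda>t. H (\<phi> t)) has_derivative (\<lambda>h. 0)) (at s within ball 0 \<epsilon>)" if s: "s \<in> ball 0 \<epsilon>" for s
  proof -
    have "((\<lambda>t. H (\<phi> t)) has_derivative (\<lambda>h. dx H (\<phi> s) * fst (cscale h (ham_field H (\<phi> s)))
        + dy H (\<phi> s) * snd (cscale h (ham_field H (\<phi> s))))) (at s)"
      by (rule has_derivative_compose[OF \<phi>[OF s] hol_has_derivative[OF H]]) simp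
    then show ?thesis
      by (rule has_derivative_at_withinI[OF has_derivative_eq_rhs]) (simp add: cscale_def ham_field_def algebra_simps)
  qed
  moreover have "0 \<in> ball (0 :: complex) \<epsilon>"
    using t by simp (rule order_le_less_trans[OF norm_ge_zero])
  ultimately show ?thesis
    using has_derivative_zero_unique[OF convex_ball, of 0 \<epsilon> "\<lambda>t. H (\<phi> t)" t 0] t by blast
qed

context plane_fields
begin

lemma plane_solution:
  assumes i: "i \<in> I" and T: "open T"
    and \<phi>: "\<And>t. t \<in> T \<Longrightarrow> (\<phi> has_derivative (\<lambda>h. cscale h (V i (\<phi> t)))) (at t)"
  shows "sol_on M (push_field \<Psi> I V) T (\<lambda>t. \<Psi> i (\<phi> t))"
proof (rule sol_onI[OF T])
  show "\<Psi> i (\<phi> t) \<in> points M" for t using i points_M by auto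
  have cont: "continuous_on T \<phi>" using \<phi> by (rule continuous_on_cscale_derivative)
  show "open {t \<in> T. \<Psi> i (\<phi> t) \<in> U}" if U: "openin (surface_topology M) U" for U
  proof -
    have "openin (surface_topology (plane_atlas \<Psi> I)) U" using U equiv_atlas_topology[OF equiv] by simp
    then have "open {w. \<Psi> i w \<in> U}"
      using i by (auto simp: openin_surface_topology plane_atlas_def)
    then have "open (\<phi> -` {w. \<Psi> i w \<in> U} \<inter> T)"
      using continuous_on_open_vimage[OF T] cont by blast
    moreover have "\<phi> -` {w. \<Psi> i w \<in> U} \<inter> T = {t \<in> T. \<Psi> i (\<phi> t) \<in> U}" by auto
    ultimately show ?thesis by simp
  qed
  fix t A \<xi> assume t: "t \<in> T" and M: "(A, \<xi>) \<in> M" and im: "\<Psi> i (\<phi> t) \<in> \<xi> ` A"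
  let ?g = "\<lambda>x. inv_into A \<xi> (\<Psi> i x)"
  have D: "\<phi> t \<in> {w. \<Psi> i w \<in> \<xi> ` A}" using im by simp
  note g = chart_holo(1)[OF i M]
  have "((\<lambda>t. ?g (\<phi> t)) has_derivative (\<lambda>h. frechet_derivative ?g (at (\<phi> t)) (cscale h (V i (\<phi> t))))) (at t)"
    by (rule has_derivative_compose[OF \<phi>[OF t] holo2_has_derivative[OF g D]])
  moreover have "push_field \<Psi> I V (A, \<xi>) (?g (\<phi> t)) = frechet_derivative ?g (at (\<phi> t)) (V i (\<phi> t))"
    by (rule push_field_eq[OF i M]) (use im in \<open>simp_all add: inv_into_into f_inv_into_f\<close>)
  ultimately show "((\<lambda>\<tau>. inv_into A \<xi> (\<Psi> i (\<phi> \<tau>))) has_derivative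
      (\<lambda>h. cscale h (push_field \<Psi> I V (A, \<xi>) (inv_into A \<xi> (\<Psi> i (\<phi> t)))))) (at t)"
    by (simp add: holo2_cscale[OF g D])
qed

text \<open>By \<open>proper\<close>, each point of a level set has coordinates of norm at most R in
  one of finitely many planes. Picard's theorem then gives a common lifetime on the level set, and
  conservation of H keeps the local solutions in it.\<close>

theorem hamiltonian_complete:
  assumes M: "complex_surface M" and fin: "finite I"
    and H: "\<And>i. i \<in> I \<Longrightarrow> hol UNIV (H i)" and VH: "\<And>i. i \<in> I \<Longrightarrow> V i = ham_field (H i)"
    and Heq: "\<And>i j w w'. i \<in> I \<Longrightarrow> j \<in> I \<Longrightarrow> \<Psi> i w = \<Psi> j w' \<Longrightarrow> H i w = H j w'"
    and proper: "\<And>c. \<exists>R. \<forall>i\<in>I. \<forall>w. H i w = c \<longrightarrow> (\<exists>j\<in>I. \<exists>w'. \<Psi> j w' = \<Psi> i w \<and> norm w' \<le> R)"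
    and s: "s \<in> points M"
  shows "\<exists>!\<gamma>. entire_solution M (push_field \<Psi> I V) \<gamma> \<and> \<gamma> t0 = s"
proof -
  let ?Y = "push_field \<Psi> I V"
  note Y = holomorphic_push_field
  have ent: "entire_solution M ?Y \<gamma> \<longleftrightarrow> sol_on M ?Y UNIV \<gamma>" for \<gamma>
    by (rule entire_solution_iff) (rule complex_surface_charts[OF M])
  obtain i0 w0 where i0: "i0 \<in> I" "s = \<Psi> i0 w0" using s points_M by auto
  define c where "c = H i0 w0"
  define K where "K = {\<Psi> i w | i w. i \<in> I \<and> H i w = c}"
  obtain R where R: "\<And>i w. i \<in> I \<Longrightarrow> H i w = c \<Longrightarrow> \<exists>j\<in>I. \<exists>w'. \<Psi> j w' = \<Psi> i w \<and> norm w' \<le> R"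
    using proper[of c] by blast
  have "\<exists>\<epsilon>>0. \<forall>w. norm w \<le> R \<longrightarrow>
      (\<exists>\<phi>. \<phi> 0 = w \<and> (\<forall>t\<in>ball 0 \<epsilon>. (\<phi> has_derivative (\<lambda>h. cscale h (V i (\<phi> t)))) (at t)))" if "i \<in> I" for i
    using picard[OF V[OF that], of R] by metis
  then obtain e where e: "\<And>i. i \<in> I \<Longrightarrow> e i > 0" "\<And>i w. i \<in> I \<Longrightarrow> norm w \<le> R \<Longrightarrow>
      (\<exists>\<phi>. \<phi> 0 = w \<and> (\<forall>t\<in>ball 0 (e i). (\<phi> has_derivative (\<lambda>h. cscale h (V i (\<phi> t)))) (at t)))"
    by metis
  define \<epsilon> where "\<epsilon> = Min (e ` I)"
  have "I \<noteq> {}" using i0(1) by auto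
  then have \<epsilon>0: "\<epsilon> > 0" unfolding \<epsilon>_def using fin e(1) by (subst Min_gr_iff) simp_all
  have \<epsilon>: "\<epsilon> \<le> e i" if "i \<in> I" for i
    unfolding \<epsilon>_def using fin that by simp
  have loc: "\<exists>\<gamma>. sol_on M ?Y (ball 0 \<epsilon>) \<gamma> \<and> \<gamma> 0 = x \<and> \<gamma> ` ball 0 \<epsilon> \<subseteq> K" if "x \<in> K" for x
  proof -
    obtain i w where iw: "x = \<Psi> i w" "i \<in> I" "H i w = c" using \<open>x \<in> K\<close> by (auto simp: K_def)
    \<comment> \<open>The point is moved to a plane in which its coordinates are bounded by R, so
      that the lifetime \<open>e j\<close> applies to it.\<close>
    obtain j w' where j: "j \<in> I" "\<Psi> j w' = x" "norm w' \<le> R"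
      using R[OF iw(2,3)] unfolding iw(1) by (elim bexE exE conjE)
    have Hj: "H j w' = c" using Heq[OF j(1) iw(2)] j iw by simp
    obtain \<phi> where \<phi>: "\<phi> 0 = w'"
      "\<And>t. t \<in> ball 0 (e j) \<Longrightarrow> (\<phi> has_derivative (\<lambda>h. cscale h (V j (\<phi> t)))) (at t)"
      using e(2)[OF j(1,3)] by (elim exE conjE) (auto dest: bspec)
    have \<phi>': "(\<phi> has_derivative (\<lambda>h. cscale h (V j (\<phi> t)))) (at t)" if "t \<in> ball 0 \<epsilon>" for t
      using \<phi>(2)[of t] that \<epsilon>[OF j(1)] by auto
    have "H j (\<phi> t) = c" if "t \<in> ball 0 \<epsilon>" for t
      using ham_field_conserved[OF H[OF j(1)], of \<epsilon> \<phi> t] \<phi>' that \<phi>(1) Hj VH[OF j(1)] by simp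
    then have "(\<lambda>t. \<Psi> j (\<phi> t)) ` ball 0 \<epsilon> \<subseteq> K" unfolding K_def using j(1) by blast
    moreover have "sol_on M ?Y (ball 0 \<epsilon>) (\<lambda>t. \<Psi> j (\<phi> t))"
      by (rule plane_solution[OF j(1) open_ball \<phi>'])
    ultimately show ?thesis using \<phi>(1) j(2) by (intro exI[of _ "\<lambda>t. \<Psi> j (\<phi> t)"]) simp
  qed
  have sK: "s \<in> K" unfolding K_def c_def using i0 by blast
  obtain \<gamma> where \<gamma>: "sol_on M ?Y UNIV \<gamma>" "\<gamma> t0 = s"
    by (rule uniform_local_solutions_extend[where K = K and ?t0.0 = t0, OF M Y \<epsilon>0 _ sK]) (rule loc)
  show ?thesis
  proof (rule ex1I[of _ \<gamma>])
    show "entire_solution M ?Y \<gamma> \<and> \<gamma> t0 = s" using \<gamma> ent by simp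
    fix \<gamma>' assume "entire_solution M ?Y \<gamma>' \<and> \<gamma>' t0 = s"
    then have \<gamma>': "sol_on M ?Y UNIV \<gamma>'" "\<gamma>' t0 = \<gamma> t0" using ent \<gamma>(2) by simp_all
    show "\<gamma>' = \<gamma>"
    proof
      fix t show "\<gamma>' t = \<gamma> t"
        by (rule sol_on_unique[OF M Y \<gamma>'(1) \<gamma>(1) connected_UNIV UNIV_I \<gamma>'(2) UNIV_I])
    qed
  qed
qed

end

section \<open>Blowing up and blowing down\<close>

lemma openin_open_part_weak:
  assumes "openin (surface_topology M) W" "W \<subseteq> U"
  shows "openin (surface_topology (open_part M U)) W"
  unfolding openin_surface_topology
proof (intro conjI ballI)
  show "W \<subseteq> points (open_part M U)"
    using assms by (auto simp: points_open_part openin_surface_topology)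
  fix c assume "c \<in> open_part M U"
  then obtain A \<phi> where c: "c = ({z\<in>A. \<phi> z \<in> U}, \<phi>)" "(A, \<phi>) \<in> M" by (auto simp: open_part_def)
  have "open {z\<in>A. \<phi> z \<in> W}" using assms(1) c(2) by (auto simp: openin_surface_topology)
  moreover have "{z \<in> {z\<in>A. \<phi> z \<in> U}. \<phi> z \<in> W} = {z\<in>A. \<phi> z \<in> W}" using assms(2) by auto
  ultimately show "case c of (A, \<phi>) \<Rightarrow> open {z\<in>A. \<phi> z \<in> W}" using c(1) by simp
qed

lemma open_part_open_part:
  assumes "W \<subseteq> U"
  shows "open_part (open_part M U) W = open_part M W"
proof -
  have "{z \<in> {z\<in>A. \<phi> z \<in> U}. \<phi> z \<in> W} = {z\<in>A. \<phi> z \<in> W}" for A and \<phi> :: "c2 \<Rightarrow> 'a"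
    using assms by auto
  then show ?thesis unfolding open_part_def by (simp add: image_image case_prod_unfold)
qed

lemma complex_surface_delete_point:
  assumes N: "complex_surface N" and P: "P \<in> points N"
  shows "openin (surface_topology N) (points N - {P})"
proof -
  have top: "topspace (surface_topology N) = points N"
    by (rule topspace_surface_topology) (rule complex_surface_charts[OF N])
  have "Hausdorff_space (surface_topology N)" using N by (simp add: complex_surface_def)
  then have "closedin (surface_topology N) {P}"
    using P top by (simp add: closedin_Hausdorff_singleton)
  then show ?thesis using top by (metis closedin_def)
qed

lemma blows_downE:
  assumes "blows_down M C N \<pi>"
  obtains P where "complex_surface N" "C \<subseteq> points M" "P \<in> points N" "\<pi> ` C = {P}"
    "biholomorphic (open_part M (points M - C)) (open_part N (points N - {P})) \<pi>"
  using assms unfolding blows_down_def by (elim conjE bexE) (rule that)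

lemma blows_down_bij:
  assumes "blows_down M C N \<pi>" "\<pi> ` C = {P}"
  shows "bij_betw \<pi> (points M - C) (points N - {P})"
proof -
  obtain P' where P': "\<pi> ` C = {P'}"
    "biholomorphic (open_part M (points M - C)) (open_part N (points N - {P'})) \<pi>"
    using assms(1) by (rule blows_downE)
  then have "P' = P" using assms(2) by simp
  then show ?thesis using P'(2) by (auto simp: biholomorphic_def points_open_part Int_absorb1)
qed

text \<open>The map is injective off C, and a point of E that lies in C goes to P, which is not the
  image of any point off C.\<close>

lemma blows_down_disjoint:
  assumes bd: "blows_down M C N \<pi>" and W: "W \<subseteq> points M" "W \<inter> C = {}"
    and E: "E \<subseteq> points M" "W \<inter> E = {}"
  shows "\<pi> ` W \<inter> \<pi> ` E = {}"
proof -
  obtain P where P: "\<pi> ` C = {P}" using bd by (rule blows_downE)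
  note bij = blows_down_bij[OF bd P]
  have "\<pi> w \<noteq> \<pi> e" if w: "w \<in> W" and e: "e \<in> E" for w e
  proof (cases "e \<in> C")
    case True
    then have "\<pi> e = P" using P by auto
    moreover have "\<pi> w \<in> points N - {P}" using bij_betwE[OF bij] w W by blast
    ultimately show ?thesis by auto
  next
    case False
    have "w \<in> points M - C" "e \<in> points M - C" "w \<noteq> e" using w e W E False by auto
    then show ?thesis using bij_betw_imp_inj_on[OF bij] by (meson inj_onD)
  qed
  then show ?thesis by auto
qed

text \<open>As E meets C, the point P belongs to the image of E; removing that image from N
  therefore removes the whole of C from M as well.\<close>

lemma blows_down_complement:
  assumes bd: "blows_down M C N \<pi>" and E: "E \<subseteq> points M" "C \<inter> E \<noteq> {}"
  shows "points N - \<pi> ` E = \<pi> ` (points M - (C \<union> E))"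
proof -
  obtain P where P: "\<pi> ` C = {P}" "C \<subseteq> points M" using bd by (rule blows_downE)
  note bij = blows_down_bij[OF bd P(1)]
  have PE: "P \<in> \<pi> ` E" using E(2) P(1) by auto
  show ?thesis
  proof (intro equalityI subsetI)
    fix y assume y: "y \<in> points N - \<pi> ` E"
    then have "y \<in> points N - {P}" using PE by auto
    then obtain x where "x \<in> points M - C" "y = \<pi> x" using bij by (auto simp: bij_betw_def)
    then show "y \<in> \<pi> ` (points M - (C \<union> E))" using y by auto
  next
    fix y assume y: "y \<in> \<pi> ` (points M - (C \<union> E))"
    have "\<pi> ` (points M - (C \<union> E)) \<inter> \<pi> ` E = {}"
      by (rule blows_down_disjoint[OF bd _ _ E(1)]) auto
    moreover have "y \<in> points N" using y bij_betwE[OF bij] by auto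
    ultimately show "y \<in> points N - \<pi> ` E" using y by auto
  qed
qed

text \<open>An open set missing C is open in the complement of C, where the contraction is
  biholomorphic. Its image is open in N because the single point P is closed in a Hausdorff
  surface.\<close>

lemma blows_down_restrict:
  assumes bd: "blows_down M C N \<pi>" and M: "inj_atlas M"
    and W: "openin (surface_topology M) W" "W \<inter> C = {}"
  shows "biholomorphic (open_part M W) (open_part N (\<pi> ` W)) \<pi>"
    and "openin (surface_topology N) (\<pi> ` W)"
proof -
  obtain P where N: "complex_surface N" and P: "P \<in> points N" "\<pi> ` C = {P}"
    and b: "biholomorphic (open_part M (points M - C)) (open_part N (points N - {P})) \<pi>"
    using bd by (rule blows_downE)
  have WM: "W \<subseteq> points M - C" using W by (auto simp: openin_surface_topology)
  have iN: "inj_atlas N" by (rule complex_surface_inj_atlas[OF N])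
  have W': "openin (surface_topology (open_part M (points M - C))) W"
    by (rule openin_open_part_weak[OF W(1) WM])
  have im: "\<pi> ` W \<subseteq> points N - {P}"
    using WM bij_betwE[OF blows_down_bij[OF bd P(2)]] by blast
  have "openin (surface_topology (open_part N (points N - {P}))) (\<pi> ` W)"
    by (rule biholomorphic_image_openin[OF b W'])
  then show "openin (surface_topology N) (\<pi> ` W)"
    using openin_open_part[OF complex_surface_delete_point[OF N P(1)]] by simp
  have "biholomorphic (open_part (open_part M (points M - C)) W)
      (open_part (open_part N (points N - {P})) (\<pi> ` W)) \<pi>"
    by (rule biholomorphic_open_part[OF b inj_atlas_open_part[OF M] inj_atlas_open_part[OF iN] W'])
  then show "biholomorphic (open_part M W) (open_part N (\<pi> ` W)) \<pi>"
    by (simp add: open_part_open_part[OF WM] open_part_open_part[OF im])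
qed

section \<open>Charts and points of a blow-up\<close>

lemma blowup_cases:
  assumes "(A, \<phi>) \<in> blowup M K c"
  obtains (old) B \<psi> where "(B, \<psi>) \<in> M" "A = {z\<in>B. \<psi> z \<notin> centres K c}" "\<phi> = (\<lambda>z. Inl (\<psi> z))"
  | (uv) k where "k \<in> K" "A = {(u, v). v = 0 \<or> c k (u * v, v) \<notin> centres K c}" "\<phi> = uv_chart c k"
  | (st) k where "k \<in> K" "A = {(s, t). s = 0 \<or> c k (s, s * t) \<notin> centres K c}" "\<phi> = st_chart c k"
proof -
  from assms consider "(A, \<phi>) \<in> (\<lambda>(A, \<phi>). ({z\<in>A. \<phi> z \<notin> centres K c}, \<lambda>z. Inl (\<phi> z))) ` M"
    | "(A, \<phi>) \<in> (\<lambda>k. ({(u, v). v = 0 \<or> c k (u * v, v) \<notin> centres K c}, uv_chart c k)) ` K"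
    | "(A, \<phi>) \<in> (\<lambda>k. ({(s, t). s = 0 \<or> c k (s, s * t) \<notin> centres K c}, st_chart c k)) ` K"
    unfolding blowup_def by (elim UnE)
  then show thesis
  proof cases
    case 1
    then obtain b where b: "b \<in> M"
      "(A, \<phi>) = (case b of (A, \<phi>) \<Rightarrow> ({z\<in>A. \<phi> z \<notin> centres K c}, \<lambda>z. Inl (\<phi> z)))" by (elim imageE)
    obtain B \<psi> where "b = (B, \<psi>)" by (cases b)
    with b show thesis by (intro old[of B \<psi>]) simp_all
  next
    case 2
    then obtain k where "k \<in> K" "(A, \<phi>) = ({(u, v). v = 0 \<or> c k (u * v, v) \<notin> centres K c}, uv_chart c k)"
      by (elim imageE)
    then show thesis by (intro uv[of k]) simp_all
  next
    case 3
    then obtain k where "k \<in> K" "(A, \<phi>) = ({(s, t). s = 0 \<or> c k (s, s * t) \<notin> centres K c}, st_chart c k)"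
      by (elim imageE)
    then show thesis by (intro st[of k]) simp_all
  qed
qed

lemma uv_chart_simps:
  "uv_chart c k (u, 0) = Inr (k, Some u)" "v \<noteq> 0 \<Longrightarrow> uv_chart c k (u, v) = Inl (c k (u * v, v))"
  by (simp_all add: uv_chart_def)

lemma st_chart_simps:
  "st_chart c k (0, t) = Inr (k, if t = 0 then None else Some (1 / t))"
  "s \<noteq> 0 \<Longrightarrow> st_chart c k (s, t) = Inl (c k (s, s * t))"
  by (simp_all add: st_chart_def)

lemma inj_uv_chart:
  assumes "inj (c k)"
  shows "inj (uv_chart c k)"
proof -
  have "u = u' \<and> v = v'" if eq: "uv_chart c k (u, v) = uv_chart c k (u', v')" for u v u' v'
  proof (cases "v = 0 \<or> v' = 0")
    case True
    with eq show ?thesis by (cases "v = 0"; cases "v' = 0") (simp_all add: uv_chart_def)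
  next
    case False
    with eq have "c k (u * v, v) = c k (u' * v', v')" by (simp add: uv_chart_def)
    from injD[OF assms this] False show ?thesis by auto
  qed
  then show ?thesis unfolding inj_def by (simp add: split_paired_all)
qed

lemma inj_st_chart:
  assumes "inj (c k)"
  shows "inj (st_chart c k)"
proof -
  have "s = s' \<and> t = t'" if eq: "st_chart c k (s, t) = st_chart c k (s', t')" for s t s' t'
  proof (cases "s = 0 \<or> s' = 0")
    case True
    with eq show ?thesis by (cases "s = 0"; cases "s' = 0") (simp_all add: st_chart_def split: if_splits)
  next
    case False
    with eq have "c k (s, s * t) = c k (s', s' * t')" by (simp add: st_chart_def)
    from injD[OF assms this] False show ?thesis by auto
  qed
  then show ?thesis unfolding inj_def by (simp add: split_paired_all)
qed

lemma inj_atlas_blowup: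
  assumes M: "inj_atlas M" and c: "\<And>k. k \<in> K \<Longrightarrow> inj (c k)"
  shows "inj_atlas (blowup M K c)"
proof -
  have "inj_on \<phi> A" if "(A, \<phi>) \<in> blowup M K c" for A \<phi>
    using that
  proof (cases rule: blowup_cases)
    case (old B \<psi>)
    then show ?thesis using inj_atlasD[OF M old(1)] by (auto simp: inj_on_def)
  next
    case (uv k)
    show ?thesis unfolding uv(3) by (rule inj_on_subset[OF inj_uv_chart[of c k, OF c[OF uv(1)]] subset_UNIV])
  next
    case (st k)
    show ?thesis unfolding st(3) by (rule inj_on_subset[OF inj_st_chart[of c k, OF c[OF st(1)]] subset_UNIV])
  qed
  then show ?thesis by (auto simp: inj_atlas_def)
qed

text \<open>A chart domain omits only preimages of centres; there are finitely many centres and the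
  coordinate maps involved are injective, so a finite set is omitted.\<close>

lemma open_blowup_chart:
  assumes M: "inj_atlas M" "\<And>A \<phi>. (A, \<phi>) \<in> M \<Longrightarrow> open A"
    and c: "\<And>k. k \<in> K \<Longrightarrow> inj (c k)" and K: "finite K" and ch: "(A, \<phi>) \<in> blowup M K c"
  shows "open A"
proof -
  have fin: "finite (centres K c)" using K by (simp add: centres_def)
  show ?thesis
    using ch
  proof (cases rule: blowup_cases)
    case (old B \<psi>)
    have "finite (\<psi> -` centres K c \<inter> B)"
      by (rule finite_vimage_IntI[OF fin inj_atlasD[OF M(1) old(1)]])
    then have "open (B - (\<psi> -` centres K c \<inter> B))"
      by (intro open_Diff M(2)[OF old(1)] finite_imp_closed)
    moreover have "A = B - (\<psi> -` centres K c \<inter> B)" using old by auto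
    ultimately show ?thesis by simp
  next
    case (uv k)
    let ?f = "\<lambda>(u, v). c k (u * v, v)" and ?D = "{(u, v). v \<noteq> 0}"
    have "inj_on ?f ?D" by (auto simp: inj_on_def dest!: injD[OF c[OF uv(1)]])
    then have "finite (?f -` centres K c \<inter> ?D)" by (rule finite_vimage_IntI[OF fin])
    then have "open (- (?f -` centres K c \<inter> ?D))" by (intro open_Compl finite_imp_closed)
    moreover have "A = - (?f -` centres K c \<inter> ?D)" using uv by auto
    ultimately show ?thesis by simp
  next
    case (st k)
    let ?f = "\<lambda>(s, t). c k (s, s * t)" and ?D = "{(s, t). s \<noteq> 0}"
    have "inj_on ?f ?D" by (auto simp: inj_on_def dest!: injD[OF c[OF st(1)]])
    then have "finite (?f -` centres K c \<inter> ?D)" by (rule finite_vimage_IntI[OF fin])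
    then have "open (- (?f -` centres K c \<inter> ?D))" by (intro open_Compl finite_imp_closed)
    moreover have "A = - (?f -` centres K c \<inter> ?D)" using st by auto
    ultimately show ?thesis by simp
  qed
qed

lemma Inl_in_points_blowup:
  assumes "Inl x \<in> points (blowup M K c)" "\<And>k z. k \<in> K \<Longrightarrow> c k z \<in> points M"
  shows "x \<in> points M" "x \<notin> centres K c"
proof -
  obtain A \<phi> z where ch: "(A, \<phi>) \<in> blowup M K c" and z: "z \<in> A" "Inl x = \<phi> z"
    using assms(1) by (rule pointsE)
  have "x \<in> points M \<and> x \<notin> centres K c"
    using ch
  proof (cases rule: blowup_cases)
    case (old B \<psi>)
    then show ?thesis using z pointsI[OF old(1), of z] by auto
  next
    case (uv k)
    then show ?thesis using z assms(2)[OF uv(1)]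
      by (cases z) (auto simp: uv_chart_def split: if_splits)
  next
    case (st k)
    then show ?thesis using z assms(2)[OF st(1)]
      by (cases z) (auto simp: st_chart_def split: if_splits)
  qed
  then show "x \<in> points M" "x \<notin> centres K c" by auto
qed

lemma Inr_in_points_blowup:
  assumes "Inr (k, l) \<in> points (blowup M K c)"
  shows "k \<in> K"
proof -
  obtain A \<phi> z where ch: "(A, \<phi>) \<in> blowup M K c" and z: "z \<in> A" "Inr (k, l) = \<phi> z"
    using assms(1) by (rule pointsE)
  show ?thesis using ch
  proof (cases rule: blowup_cases)
    case old
    then show ?thesis using z by auto
  next
    case (uv k')
    then show ?thesis using z by (cases z) (auto simp: uv_chart_def split: if_splits)
  next
    case (st k')
    then show ?thesis using z by (cases z) (auto simp: st_chart_def split: if_splits)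
  qed
qed

lemma Inl_points_blowup:
  assumes "x \<in> points M" "x \<notin> centres K c"
  shows "Inl x \<in> points (blowup M K c)"
proof -
  obtain B \<psi> z where B: "(B, \<psi>) \<in> M" "z \<in> B" "x = \<psi> z" using assms(1) by (rule pointsE)
  have "({z\<in>B. \<psi> z \<notin> centres K c}, \<lambda>z. Inl (\<psi> z)) \<in> blowup M K c"
    using B(1) unfolding blowup_def by (intro UnI1) auto
  from pointsI[OF this, of z] B assms(2) show ?thesis by simp
qed

lemma uv_chart_in_blowup:
  "k \<in> K \<Longrightarrow> ({(u, v). v = 0 \<or> c k (u * v, v) \<notin> centres K c}, uv_chart c k) \<in> blowup M K c"
  unfolding blowup_def by auto

lemma st_chart_in_blowup:
  "k \<in> K \<Longrightarrow> ({(s, t). s = 0 \<or> c k (s, s * t) \<notin> centres K c}, st_chart c k) \<in> blowup M K c"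
  unfolding blowup_def by auto

lemma None_points_blowup: "k \<in> K \<Longrightarrow> Inr (k, None) \<in> points (blowup M K c)"
  using pointsI[OF st_chart_in_blowup[of k K c M], of "(0, 0)"] by (simp add: st_chart_simps)

lemma Some_points_blowup: "k \<in> K \<Longrightarrow> Inr (k, Some u) \<in> points (blowup M K c)"
  using pointsI[OF uv_chart_in_blowup[of k K c M], of "(u, 0)"] by (simp add: uv_chart_simps)

section \<open>Strict transforms\<close>

lemma strict_transform_superset:
  assumes top: "topspace (surface_topology (blowup M K c)) = points (blowup M K c)"
    and x: "x \<in> C" "x \<notin> centres K c" "x \<in> points M"
  shows "Inl x \<in> strict_transform M K c C"
proof -
  have "Inl x \<in> topspace (surface_topology (blowup M K c))"
    unfolding top by (rule Inl_points_blowup[OF x(3,2)])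
  moreover have "Inl x \<in> Inl ` (C - centres K c)" using x by auto
  ultimately show ?thesis
    unfolding strict_transform_def by (intro subsetD[OF closure_of_subset_Int] IntI)
qed

text \<open>A curve through the centre along the first coordinate axis leaves the blown-up point
  in the direction \<open>1 : 0\<close>.\<close>

lemma None_in_strict_transform:
  assumes top: "topspace (surface_topology (blowup M K c)) = points (blowup M K c)"
    and k: "k \<in> K" and C: "\<And>s. c k (s, 0) \<in> C"
  shows "Inr (k, None) \<in> strict_transform M K c C"
  unfolding strict_transform_def in_closure_of top
proof (intro conjI allI impI)
  show "Inr (k, None) \<in> points (blowup M K c)" by (rule None_points_blowup[OF k])
  fix V assume V: "Inr (k, None) \<in> V \<and> openin (surface_topology (blowup M K c)) V"
  define A where "A = {(s, t). s = 0 \<or> c k (s, s * t) \<notin> centres K c}"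
  have ch: "(A, st_chart c k) \<in> blowup M K c" unfolding A_def by (rule st_chart_in_blowup[OF k])
  have "open {z\<in>A. st_chart c k z \<in> V}"
    using V ch by (auto simp: openin_surface_topology)
  moreover have "(0, 0) \<in> {z\<in>A. st_chart c k z \<in> V}" using V by (simp add: A_def st_chart_simps)
  ultimately obtain R where R: "R > 0" "cball 0 R \<times> cball 0 R \<subseteq> {z\<in>A. st_chart c k z \<in> V}"
    by (rule open_contains_bicball)
  define s where "s = complex_of_real R"
  have s: "s \<noteq> 0" "(s, 0) \<in> cball 0 R \<times> cball 0 R" using R(1) by (auto simp: s_def)
  then have "(s, 0) \<in> A" "st_chart c k (s, 0) \<in> V" using subsetD[OF R(2) s(2)] by simp_all
  then have "c k (s, 0) \<notin> centres K c" "Inl (c k (s, 0)) \<in> V"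
    using s(1) by (auto simp: A_def st_chart_simps)
  then show "\<exists>y. y \<in> Inl ` (C - centres K c) \<and> y \<in> V"
    using C[of s] by (intro exI[of _ "Inl (c k (s, 0))"]) simp
qed

lemma strict_transform_disjoint:
  assumes "openin (surface_topology (blowup M K c)) W" "\<And>x. x \<in> C \<Longrightarrow> Inl x \<notin> W"
  shows "strict_transform M K c C \<inter> W = {}"
proof -
  have "W \<inter> Inl ` (C - centres K c) = {}" using assms(2) by auto
  then have "W \<inter> strict_transform M K c C = {}"
    unfolding strict_transform_def by (simp only: openin_Int_closure_of_eq_empty[OF assms(1)])
  then show ?thesis by auto
qed

lemma strict_transform_points: "strict_transform M K c C \<subseteq> points (blowup M K c)"
proof -
  have "topspace (surface_topology N) \<subseteq> points N" for N :: "('a + 'b \<times> complex option) atlas"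
    using openin_topspace[of "surface_topology N"] unfolding openin_surface_topology by (rule conjunct1)
  then show ?thesis unfolding strict_transform_def by (rule subset_trans[OF closure_of_subset_topspace])
qed

section \<open>Glued planes\<close>

lemma glue_rel_sym: "(x, y) \<in> (S \<union> S\<inverse>)\<^sup>* \<Longrightarrow> (y, x) \<in> (S \<union> S\<inverse>)\<^sup>*"
  using sym_rtrancl[OF sym_Un_converse] by (rule symD)

lemma glue_point_eq_iff: "glue_point S i z = glue_point S j w \<longleftrightarrow> ((i, z), (j, w)) \<in> (S \<union> S\<inverse>)\<^sup>*"
proof
  assume "glue_point S i z = glue_point S j w"
  moreover have "(j, w) \<in> glue_point S j w" by (simp add: glue_point_def)
  ultimately have "(j, w) \<in> glue_point S i z" by simp
  then show "((i, z), (j, w)) \<in> (S \<union> S\<inverse>)\<^sup>*" by (simp add: glue_point_def)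
next
  assume *: "((i, z), (j, w)) \<in> (S \<union> S\<inverse>)\<^sup>*"
  show "glue_point S i z = glue_point S j w"
    unfolding glue_point_def
    using rtrancl_trans[OF *] rtrancl_trans[OF glue_rel_sym[OF *]] by auto
qed

lemma glue_point_step: "((i, z), (j, w)) \<in> S \<Longrightarrow> glue_point S i z = glue_point S j w"
  unfolding glue_point_eq_iff by (rule r_into_rtrancl) simp

text \<open>The means of telling points of a glued surface apart: what is constant along generating
  pairs is constant on classes.\<close>

lemma glue_rel_invariant:
  assumes "\<And>x y. (x, y) \<in> S \<Longrightarrow> f x = f y" "(x, y) \<in> (S \<union> S\<inverse>)\<^sup>*"
  shows "f x = f y"
  using assms(2)
proof (induction rule: rtrancl_induct)
  case (step y z)
  from step(2) have "f y = f z" using assms(1)[of y z] assms(1)[of z y] by auto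
  then show ?case using step(3) by simp
qed simp

section \<open>The Hirzebruch surface\<close>

text \<open>A normal form for the points: chart 0 wherever it applies, and otherwise the first of
  charts 1, 2, 3 that applies.\<close>

fun nf1 :: "(nat \<Rightarrow> complex) \<Rightarrow> complex \<Rightarrow> complex \<Rightarrow> nat \<times> c2" where
  "nf1 \<alpha> z w = (if z \<noteq> 0 then (0, (1 / z, - (w * z + \<alpha> 0) * z)) else (1, (0, w)))"

definition nf :: "(nat \<Rightarrow> complex) \<Rightarrow> nat \<times> c2 \<Rightarrow> nat \<times> c2" where
  "nf \<alpha> = (\<lambda>(i, (z, w)).
     if i = 0 then (0, (z, w))
     else if i = 1 then nf1 \<alpha> z w
     else if i = 2 then (if w \<noteq> 0 then (0, (z, 1 / w)) else (2, (z, 0)))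
     else if w \<noteq> 0 then nf1 \<alpha> z (1 / w)
     else if z \<noteq> 0 then (2, (1 / z, 0)) else (3, (0, 0)))"

text \<open>Only the pairs between charts 2 and 3 need care: off w = 0 both sides reduce to the same
  point of chart 0, and on w = 0 both become a point of chart 2.\<close>

lemma nf_sigma2_rel:
  assumes "(x, y) \<in> sigma2_rel \<alpha>"
  shows "nf \<alpha> x = nf \<alpha> y"
proof -
  consider q p where "q \<noteq> 0" "x = (0, (q, p))" "y = (1, (1 / q, - (q * p + \<alpha> 0) * q))"
    | q p where "p \<noteq> 0" "x = (0, (q, p))" "y = (2, (q, 1 / p))"
    | z w where "w \<noteq> 0" "x = (1, (z, w))" "y = (3, (z, 1 / w))"
    | z w where "z \<noteq> 0" "z + \<alpha> 0 * w \<noteq> 0" "x = (2, (z, w))" "y = (3, (1 / z, - w / (z * (z + \<alpha> 0 * w))))"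
    using assms unfolding sigma2_rel_def by auto
  then show ?thesis
  proof cases
    case (1 q p)
    then show ?thesis by (simp add: nf_def field_simps)
  next
    case (4 z w)
    show ?thesis
    proof (cases "w = 0")
      case False
      then have "- w / (z * (z + \<alpha> 0 * w)) \<noteq> 0" using 4 by simp
      moreover have "1 / w = - (1 / (- w / (z * (z + \<alpha> 0 * w))) * (1 / z) + \<alpha> 0) * (1 / z)"
        using 4 False by (simp add: field_simps)
      ultimately show ?thesis using 4 False by (simp add: nf_def)
    qed (use 4 in \<open>simp add: nf_def\<close>)
  qed (simp_all add: nf_def)
qed

lemma zw_eqD: "zw \<alpha> i z = zw \<alpha> j w \<Longrightarrow> nf \<alpha> (i, z) = nf \<alpha> (j, w)"
  unfolding glue_point_eq_iff by (rule glue_rel_invariant[OF nf_sigma2_rel])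

text \<open>The chart number in the normal form records which formula produced it, and each single
  formula is injective.\<close>

lemma nf_inj: "i \<le> 3 \<Longrightarrow> nf \<alpha> (i, z) = nf \<alpha> (i, w) \<Longrightarrow> z = w"
proof -
  have nf1: "z = z' \<and> w = w'" if "nf1 \<alpha> z w = nf1 \<alpha> z' w'" for z w z' w'
    using that by (auto split: if_splits)
  assume "i \<le> 3" and eq: "nf \<alpha> (i, z) = nf \<alpha> (i, w)"
  obtain z1 z2 where z: "z = (z1, z2)" by (cases z)
  obtain w1 w2 where w: "w = (w1, w2)" by (cases w)
  have nf1_neq: "nf1 \<alpha> a b \<noteq> (2, c)" "nf1 \<alpha> a b \<noteq> (3, c)" for a b c by auto
  consider "i = 0" | "i = 1" | "i = 2" | "i = 3" using \<open>i \<le> 3\<close> by linarith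
  then show "z = w"
  proof cases
    case 2
    then show ?thesis using eq nf1[of z1 z2 w1 w2] by (simp add: z w nf_def del: nf1.simps)
  next
    case 3
    then show ?thesis using eq by (simp add: z w nf_def split: if_splits)
  next
    case 4
    then show ?thesis
      using eq nf1[of z1 "1 / z2" w1 "1 / w2"] nf1_neq nf1_neq[symmetric]
      by (simp add: z w nf_def del: nf1.simps split: if_splits)
  qed (use eq in \<open>simp add: z w nf_def\<close>)
qed

lemma inj_zw: "i \<le> 3 \<Longrightarrow> inj (zw \<alpha> i)"
  by (rule injI) (rule nf_inj[OF _ zw_eqD])

lemma zw_0_1: "q \<noteq> 0 \<Longrightarrow> zw \<alpha> 0 (q, p) = zw \<alpha> 1 (1 / q, - (q * p + \<alpha> 0) * q)"
  by (rule glue_point_step) (auto simp: sigma2_rel_def)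

lemma zw_2_0: "w \<noteq> 0 \<Longrightarrow> zw \<alpha> 2 (z, w) = zw \<alpha> 0 (z, 1 / w)"
  by (rule glue_point_step[symmetric]) (force simp: sigma2_rel_def)

lemma zw_3_1: "w \<noteq> 0 \<Longrightarrow> zw \<alpha> 3 (z, w) = zw \<alpha> 1 (z, 1 / w)"
  by (rule glue_point_step[symmetric]) (force simp: sigma2_rel_def)

lemma zw_0_1_eqD: "zw \<alpha> 0 (q, p) = zw \<alpha> 1 (z, w) \<Longrightarrow> z \<noteq> 0"
  by (drule zw_eqD) (auto simp: nf_def split: if_splits)

lemma D_section_nf:
  assumes "x \<in> D_section \<alpha>" "x = zw \<alpha> i z"
  shows "fst (nf \<alpha> (i, z)) \<ge> 2"
proof -
  obtain z' where "x = zw \<alpha> 2 (z', 0) \<or> x = zw \<alpha> 3 (z', 0)" using assms(1) unfolding D_section_def by auto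
  then have "nf \<alpha> (i, z) = nf \<alpha> (2, (z', 0)) \<or> nf \<alpha> (i, z) = nf \<alpha> (3, (z', 0))"
    using assms(2) zw_eqD by metis
  then show ?thesis by (auto simp: nf_def)
qed

lemma not_D_section: "zw \<alpha> 0 z \<notin> D_section \<alpha>" "zw \<alpha> 1 z \<notin> D_section \<alpha>"
proof -
  show "zw \<alpha> 0 z \<notin> D_section \<alpha>"
  proof
    assume "zw \<alpha> 0 z \<in> D_section \<alpha>"
    from D_section_nf[OF this refl] show False by (cases z) (simp add: nf_def)
  qed
  show "zw \<alpha> 1 z \<notin> D_section \<alpha>"
  proof
    assume "zw \<alpha> 1 z \<in> D_section \<alpha>"
    from D_section_nf[OF this refl] show False by (cases z) (simp add: nf_def split: if_splits)
  qed
qed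

lemma D_section_2: "zw \<alpha> 2 (z, w) \<in> D_section \<alpha> \<longleftrightarrow> w = 0"
proof (cases "w = 0")
  case True
  have "zw \<alpha> 2 (z, 0) \<in> D_section \<alpha>" unfolding D_section_def by (rule UnI1) (rule rangeI)
  with True show ?thesis by simp
next
  case False
  then show ?thesis using not_D_section(1)[of \<alpha> "(z, 1 / w)"] by (simp add: zw_2_0)
qed

lemma D_section_3: "zw \<alpha> 3 (z, w) \<in> D_section \<alpha> \<longleftrightarrow> w = 0"
proof (cases "w = 0")
  case True
  have "zw \<alpha> 3 (z, 0) \<in> D_section \<alpha>" unfolding D_section_def by (rule UnI2) (rule rangeI)
  with True show ?thesis by simp
next
  case False
  then show ?thesis using not_D_section(2)[of \<alpha> "(z, 1 / w)"] by (simp add: zw_3_1)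
qed

lemma sigma2_charts: "(A, \<phi>) \<in> sigma2 \<alpha> \<longleftrightarrow> A = UNIV \<and> (\<exists>i\<le>3. \<phi> = zw \<alpha> i)"
proof -
  have *: "{0, 1, 2, 3 :: nat} = {..3}" by auto
  show ?thesis unfolding sigma2_def glue_def * by auto
qed

lemma zw_in_points: "i \<le> 3 \<Longrightarrow> zw \<alpha> i z \<in> points (sigma2 \<alpha>)"
  by (rule pointsI[of UNIV]) (auto simp: sigma2_charts)

lemma points_sigma2:
  assumes "x \<in> points (sigma2 \<alpha>)" "x \<notin> D_section \<alpha>"
  shows "x \<in> range (zw \<alpha> 0) \<union> range (zw \<alpha> 1)"
proof -
  obtain i z where i: "i \<le> 3" "x = zw \<alpha> i z" using assms(1) by (elim pointsE) (auto simp: sigma2_charts)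
  obtain z1 z2 where z: "z = (z1, z2)" by (cases z)
  consider "i = 0" | "i = 1" | "i = 2" | "i = 3" using \<open>i \<le> 3\<close> by linarith
  then show ?thesis
  proof cases
    case 3
    then have "z2 \<noteq> 0" using assms(2) i z D_section_2 by auto
    then show ?thesis using 3 i z zw_2_0 by auto
  next
    case 4
    then have "z2 \<noteq> 0" using assms(2) i z D_section_3 by auto
    then show ?thesis using 4 i z zw_3_1 by auto
  qed (use i in auto)
qed

section \<open>The two blow-ups\<close>

lemma inj_first_coords: "inj (first_coords \<alpha> \<nu>)"
proof (rule injI)
  fix x y assume eq: "first_coords \<alpha> \<nu> x = first_coords \<alpha> \<nu> y"
  obtain a b where x: "x = (a, b)" by (cases x)
  obtain c d where y: "y = (c, d)" by (cases y)
  show "x = y"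
    using eq injD[OF inj_zw[of 2], of \<alpha> x y] injD[OF inj_zw[of 2], of \<alpha> "(a + 1, b)" "(c + 1, d)"]
      injD[OF inj_zw[of 3], of \<alpha> x y]
    unfolding x y by (cases \<nu>) auto
qed

lemma first_coords_D_section: "first_coords \<alpha> \<nu> (z, w) \<in> D_section \<alpha> \<longleftrightarrow> w = 0"
  by (cases \<nu>) (simp_all add: D_section_2 D_section_3)

lemma first_coords_points: "first_coords \<alpha> \<nu> z \<in> points (sigma2 \<alpha>)"
  by (cases \<nu>; cases z) (simp_all add: zw_in_points)

lemma finite_base: "finite (UNIV :: base set)"
proof -
  have "(UNIV :: base set) = {At0, At1, AtInf}" using base.exhaust by auto
  then show ?thesis by (metis finite.emptyI finite_insert)
qed

lemma inj_atlas_sigma2: "inj_atlas (sigma2 \<alpha>)"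
  unfolding inj_atlas_def using inj_zw by (auto simp: sigma2_charts)

lemma inj_atlas_first: "inj_atlas (X1 \<alpha>)"
  unfolding X1_def by (rule inj_atlas_blowup[OF inj_atlas_sigma2 inj_first_coords])

lemma open_first_chart: "(A, \<phi>) \<in> X1 \<alpha> \<Longrightarrow> open A"
  unfolding X1_def
  by (rule open_blowup_chart[OF inj_atlas_sigma2 _ inj_first_coords finite_base]) (auto simp: sigma2_charts)

lemma topspace_first: "topspace (surface_topology (X1 \<alpha>)) = points (X1 \<alpha>)"
  by (rule topspace_surface_topology) (rule open_first_chart)

lemma second_coords_simps:
  "second_coords \<alpha> k (a, 0) = Inr (second_base k, Some (second_pos \<alpha> k + a))"
  "b \<noteq> 0 \<Longrightarrow> second_coords \<alpha> k (a, b) = Inl (first_coords \<alpha> (second_base k) ((second_pos \<alpha> k + a) * b, b))"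
  by (simp_all add: second_coords_def uv_chart_def)

lemma inj_second_coords: "inj (second_coords \<alpha> k)"
proof (rule injI)
  fix x y assume eq: "second_coords \<alpha> k x = second_coords \<alpha> k y"
  obtain a b where x: "x = (a, b)" by (cases x)
  obtain c d where y: "y = (c, d)" by (cases y)
  have "(second_pos \<alpha> k + a, b) = (second_pos \<alpha> k + c, d)"
    by (rule injD[OF inj_uv_chart[of "first_coords \<alpha>" "second_base k", OF inj_first_coords]])
       (use eq in \<open>simp add: second_coords_def x y\<close>)
  then show "x = y" by (simp add: x y)
qed

lemma centres_first: "x \<in> centres UNIV (first_coords \<alpha>) \<Longrightarrow> x \<in> D_section \<alpha>"
  by (auto simp: centres_def first_coords_D_section)

lemma second_coords_points: "second_coords \<alpha> k z \<in> points (X1 \<alpha>)"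
proof (cases z)
  case (Pair a b)
  show ?thesis
  proof (cases "b = 0")
    case True
    then show ?thesis unfolding X1_def Pair by (simp add: second_coords_simps Some_points_blowup)
  next
    case False
    have "first_coords \<alpha> (second_base k) ((second_pos \<alpha> k + a) * b, b) \<notin> centres UNIV (first_coords \<alpha>)"
    proof
      assume "first_coords \<alpha> (second_base k) ((second_pos \<alpha> k + a) * b, b) \<in> centres UNIV (first_coords \<alpha>)"
      then have "first_coords \<alpha> (second_base k) ((second_pos \<alpha> k + a) * b, b) \<in> D_section \<alpha>"
        by (rule centres_first)
      then show False using False by (simp add: first_coords_D_section)
    qed
    then show ?thesis unfolding X1_def Pair
      by (simp add: second_coords_simps False Inl_points_blowup first_coords_points)
  qed
qed

lemma centres_second: "x \<in> centres K (second_coords \<alpha>) \<Longrightarrow> \<exists>k\<in>K. x = Inr (second_base k, Some (second_pos \<alpha> k))"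
  by (auto simp: centres_def second_coords_simps)

lemma inj_atlas_second: "inj_atlas (X2 \<alpha>)"
  unfolding X2_def by (rule inj_atlas_blowup[OF inj_atlas_first inj_second_coords])

lemma open_second_chart: "(A, \<phi>) \<in> X2 \<alpha> \<Longrightarrow> open A"
  unfolding X2_def
  by (rule open_blowup_chart[OF inj_atlas_first open_first_chart inj_second_coords]) auto

lemma topspace_second: "topspace (surface_topology (X2 \<alpha>)) = points (X2 \<alpha>)"
  by (rule topspace_surface_topology) (rule open_second_chart)

text \<open>The complement of the total transform of \<open>D\<^sup>(\<^sup>0\<^sup>)\<close> in the first blow-up, and the
  complement of the four strict transforms in the second.\<close>

definition W1 :: "(nat \<Rightarrow> complex) \<Rightarrow> bl1 set" where
  "W1 \<alpha> = {x \<in> points (X1 \<alpha>). \<exists>y. x = Inl y \<and> y \<notin> D_section \<alpha>}"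

definition W2 :: "(nat \<Rightarrow> complex) \<Rightarrow> bl2 set" where
  "W2 \<alpha> = {x \<in> points (X2 \<alpha>). (\<exists>y. x = Inl (Inl y) \<and> y \<notin> D_section \<alpha>) \<or> (\<exists>k u. x = Inr (k, Some u))}"

lemma open_snd_nonzero: "open {z :: c2. snd z \<noteq> 0}"
  by (intro open_Collect_neq continuous_intros)

lemma open_fst_nonzero: "open {z :: c2. fst z \<noteq> 0}"
  by (intro open_Collect_neq continuous_intros)

lemma openin_W1: "openin (surface_topology (X1 \<alpha>)) (W1 \<alpha>)"
  unfolding openin_surface_topology
proof (intro conjI ballI)
  show "W1 \<alpha> \<subseteq> points (X1 \<alpha>)" by (auto simp: W1_def)
  fix c assume c: "c \<in> X1 \<alpha>"
  obtain A \<phi> where [simp]: "c = (A, \<phi>)" by (cases c)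
  have ch: "(A, \<phi>) \<in> X1 \<alpha>" using c by simp
  have eq: "{z\<in>A. \<phi> z \<in> W1 \<alpha>} = A \<inter> {z. \<exists>y. \<phi> z = Inl y \<and> y \<notin> D_section \<alpha>}"
    using pointsI[OF ch] by (auto simp: W1_def)
  have "open {z. \<exists>y. \<phi> z = Inl y \<and> y \<notin> D_section \<alpha>}"
    using ch unfolding X1_def
  proof (cases rule: blowup_cases)
    case (old B \<psi>)
    then obtain i where i: "i \<le> 3" "\<psi> = zw \<alpha> i" by (auto simp: sigma2_charts)
    consider "i = 0 \<or> i = 1" | "i = 2 \<or> i = 3" using i(1) by linarith
    then show ?thesis
    proof cases
      case 1
      then have "{z. \<exists>y. \<phi> z = Inl y \<and> y \<notin> D_section \<alpha>} = UNIV"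
        using old i not_D_section by auto
      then show ?thesis by simp
    next
      case 2
      then have "{z. \<exists>y. \<phi> z = Inl y \<and> y \<notin> D_section \<alpha>} = {z. snd z \<noteq> 0}"
        using old i D_section_2 D_section_3 by auto
      then show ?thesis using open_snd_nonzero by simp
    qed
  next
    case (uv k)
    have "{z. \<exists>y. \<phi> z = Inl y \<and> y \<notin> D_section \<alpha>} = {z. snd z \<noteq> 0}"
      by (auto simp: uv uv_chart_def first_coords_D_section)
    then show ?thesis using open_snd_nonzero by simp
  next
    case (st k)
    \<comment> \<open>In this chart s = 0 is the exceptional curve and t = 0 the strict transform of
      the section, so both axes are removed.\<close>
    have "(\<exists>y. \<phi> z = Inl y \<and> y \<notin> D_section \<alpha>) \<longleftrightarrow> snd z \<noteq> 0 \<and> fst z \<noteq> 0" for z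
      by (cases z; cases "fst z = 0") (simp_all add: st st_chart_simps first_coords_D_section)
    then have "{z. \<exists>y. \<phi> z = Inl y \<and> y \<notin> D_section \<alpha>} = {z. snd z \<noteq> 0} \<inter> {z. fst z \<noteq> 0}"
      by (simp add: set_eq_iff)
    then show ?thesis using open_snd_nonzero open_fst_nonzero by auto
  qed
  then show "case c of (A, \<phi>) \<Rightarrow> open {z\<in>A. \<phi> z \<in> W1 \<alpha>}"
    using open_first_chart[OF ch] eq by auto
qed

lemma openin_W2: "openin (surface_topology (X2 \<alpha>)) (W2 \<alpha>)"
  unfolding openin_surface_topology
proof (intro conjI ballI)
  show "W2 \<alpha> \<subseteq> points (X2 \<alpha>)" by (auto simp: W2_def)
  fix c assume c: "c \<in> X2 \<alpha>"
  obtain A \<phi> where [simp]: "c = (A, \<phi>)" by (cases c)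
  have ch: "(A, \<phi>) \<in> X2 \<alpha>" using c by simp
  define good where "good x \<longleftrightarrow> (\<exists>y. x = Inl (Inl y) \<and> y \<notin> D_section \<alpha>) \<or> (\<exists>k u. x = Inr (k, Some u))" for x :: bl2
  have good: "good (Inl (Inl y)) \<longleftrightarrow> y \<notin> D_section \<alpha>" "\<not> good (Inl (Inr l))" "good (Inr (k, Some u))"
    "\<not> good (Inr (k, None))" for y l k u
    by (simp_all add: good_def)
  have eq: "{z\<in>A. \<phi> z \<in> W2 \<alpha>} = A \<inter> {z. good (\<phi> z)}"
    using pointsI[OF ch] by (auto simp: W2_def good_def)
  have "open (A \<inter> {z. good (\<phi> z)})"
    using ch unfolding X2_def
  proof (cases rule: blowup_cases)
    case (old B \<psi>)
    have "open {z \<in> B. \<psi> z \<in> W1 \<alpha>}" using bspec[OF conjunct2[OF openin_W1[of \<alpha>, unfolded openin_surface_topology]] old(1)] by simp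
    moreover have "A \<inter> {z. good (\<phi> z)} = A \<inter> {z \<in> B. \<psi> z \<in> W1 \<alpha>}"
      using pointsI[OF old(1)] by (auto simp: old W1_def good_def)
    ultimately show ?thesis using open_second_chart[OF ch] by (simp add: open_Int)
  next
    case (uv k)
    have "good (\<phi> (u, v))" for u v
      by (cases "v = 0") (simp_all add: uv uv_chart_simps second_coords_simps good first_coords_D_section)
    then have "A \<inter> {z. good (\<phi> z)} = A" by auto
    then show ?thesis using open_second_chart[OF ch] by simp
  next
    case (st k)
    \<comment> \<open>Here t = 0 is the strict transform of a first exceptional curve. The new
      exceptional curve s = 0 is kept, except for its point on that transform.\<close>
    have "good (\<phi> (s, t)) \<longleftrightarrow> t \<noteq> 0" for s t
      by (cases "s = 0"; cases "t = 0")
         (simp_all add: st st_chart_simps second_coords_simps good first_coords_D_section)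
    then have "{z. good (\<phi> z)} = {z. snd z \<noteq> 0}" by auto
    then show ?thesis using open_second_chart[OF ch] open_snd_nonzero by auto
  qed
  then show "case c of (A, \<phi>) \<Rightarrow> open {z\<in>A. \<phi> z \<in> W2 \<alpha>}" using eq by simp
qed

lemma second_top: "topspace (surface_topology (blowup (X1 \<alpha>) {1..8} (second_coords \<alpha>))) = points (blowup (X1 \<alpha>) {1..8} (second_coords \<alpha>))"
  using topspace_second unfolding X2_def .

lemma first_top: "topspace (surface_topology (blowup (sigma2 \<alpha>) UNIV (first_coords \<alpha>))) = points (blowup (sigma2 \<alpha>) UNIV (first_coords \<alpha>))"
  using topspace_first unfolding X1_def .

lemma D_exc_strict_disjoint: "D_exc_strict \<alpha> \<nu> \<inter> W2 \<alpha> = {}"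
  unfolding D_exc_strict_def
  by (rule strict_transform_disjoint[OF openin_W2[unfolded X2_def]]) (auto simp: W2_def D_exc_def)

lemma D_section_strict_disjoint: "D_section_strict \<alpha> \<inter> W2 \<alpha> = {}"
  unfolding D_section_strict_def
proof (rule strict_transform_disjoint[OF openin_W2[unfolded X2_def]])
  fix x assume x: "x \<in> strict_transform (sigma2 \<alpha>) UNIV (first_coords \<alpha>) (D_section \<alpha>)"
  have "strict_transform (sigma2 \<alpha>) UNIV (first_coords \<alpha>) (D_section \<alpha>) \<inter> W1 \<alpha> = {}"
    by (rule strict_transform_disjoint[OF openin_W1[unfolded X1_def]]) (auto simp: W1_def)
  then have "x \<notin> W1 \<alpha>" using x by auto
  moreover have "x \<in> points (X1 \<alpha>)" using x strict_transform_points unfolding X1_def by blast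
  ultimately show "Inl x \<notin> W2 \<alpha>" by (auto simp: W1_def W2_def)
qed

lemma Inr_in_D_exc_strict:
  assumes "Inl (Inr (\<nu>, l)) \<in> points (X2 \<alpha>)"
  shows "Inl (Inr (\<nu>, l)) \<in> D_exc_strict \<alpha> \<nu>"
proof -
  have "Inr (\<nu>, l) \<in> points (X1 \<alpha>)" "Inr (\<nu>, l) \<notin> centres {1..8} (second_coords \<alpha>)"
    using Inl_in_points_blowup[OF assms[unfolded X2_def] second_coords_points] by auto
  then show ?thesis unfolding D_exc_strict_def
    by (intro strict_transform_superset[OF second_top]) (auto simp: D_exc_def)
qed

text \<open>The section leaves each of the three first centres in the direction 1 : 0, and the
  second centres sit at finite directions, so the second blow-up does not separate the section from
  the first exceptional curves.\<close>

lemma strict_intersection: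
  "Inl (Inr (\<nu>, None)) \<in> D_section_strict \<alpha>" "Inl (Inr (\<nu>, None)) \<in> D_exc_strict \<alpha> \<nu>"
proof -
  have 1: "Inr (\<nu>, None) \<in> points (X1 \<alpha>)" unfolding X1_def by (rule None_points_blowup) simp
  have 2: "Inr (\<nu>, None) \<notin> centres {1..8} (second_coords \<alpha>)" using centres_second by blast
  have "Inl (Inr (\<nu>, None)) \<in> points (X2 \<alpha>)" unfolding X2_def by (rule Inl_points_blowup[OF 1 2])
  then show "Inl (Inr (\<nu>, None)) \<in> D_exc_strict \<alpha> \<nu>" by (rule Inr_in_D_exc_strict)
  have "Inr (\<nu>, None) \<in> strict_transform (sigma2 \<alpha>) UNIV (first_coords \<alpha>) (D_section \<alpha>)"
    by (rule None_in_strict_transform[OF first_top]) (simp_all add: first_coords_D_section)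
  then show "Inl (Inr (\<nu>, None)) \<in> D_section_strict \<alpha>"
    unfolding D_section_strict_def by (intro strict_transform_superset[OF second_top] 1 2)
qed

lemma second_base_cases: "second_base k = At0 \<or> second_base k = At1 \<or> second_base k = AtInf"
  by (simp add: second_base_def)

lemma Inl_in_points_first:
  assumes "Inl u \<in> points (X1 \<alpha>)"
  shows "u \<in> points (sigma2 \<alpha>)" "u \<notin> centres UNIV (first_coords \<alpha>)"
  using Inl_in_points_blowup[OF assms[unfolded X1_def] first_coords_points] by auto

lemma Inl_in_points_second:
  assumes "Inl u \<in> points (X2 \<alpha>)"
  shows "u \<in> points (X1 \<alpha>)" "u \<notin> centres {1..8} (second_coords \<alpha>)"
  using Inl_in_points_blowup[OF assms[unfolded X2_def] second_coords_points] by auto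

lemma Inr_in_points_second: "Inr (k, l) \<in> points (X2 \<alpha>) \<Longrightarrow> k \<in> {1..8}"
  unfolding X2_def by (rule Inr_in_points_blowup)

lemma W2_points: "W2 \<alpha> \<subseteq> points (X2 \<alpha>)"
  by (auto simp: W2_def)

text \<open>A point outside the four curves lies neither over the section nor on a first exceptional
  curve, and on a second exceptional curve it avoids the direction 1 : 0, where that curve meets a
  strict transform. The bracketing follows the order of the contractions.\<close>

lemma W2_complement:
  "points (X2 \<alpha>) - (D_section_strict \<alpha> \<union> (D_exc_strict \<alpha> AtInf \<union> (D_exc_strict \<alpha> At1 \<union> D_exc_strict \<alpha> At0))) = W2 \<alpha>"
  (is "_ - ?Z = _")
proof (intro equalityI subsetI)
  fix x assume "x \<in> W2 \<alpha>"
  then show "x \<in> points (X2 \<alpha>) - ?Z"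
    using D_exc_strict_disjoint[of \<alpha> AtInf] D_exc_strict_disjoint[of \<alpha> At1] D_exc_strict_disjoint[of \<alpha> At0]
      D_section_strict_disjoint[of \<alpha>] W2_points[of \<alpha>] by blast
next
  fix x assume "x \<in> points (X2 \<alpha>) - ?Z"
  then have x: "x \<in> points (X2 \<alpha>)" "x \<notin> ?Z" by auto
  show "x \<in> W2 \<alpha>"
  proof (cases x)
    case (Inl y)
    have y: "y \<in> points (X1 \<alpha>)" "y \<notin> centres {1..8} (second_coords \<alpha>)"
      using Inl_in_points_second[of y \<alpha>] x(1) Inl by auto
    show ?thesis
    proof (cases y)
      case (Inl u)
      have u: "u \<in> points (sigma2 \<alpha>)" "u \<notin> centres UNIV (first_coords \<alpha>)"
        using Inl_in_points_first[of u \<alpha>] y(1) Inl by auto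
      have "u \<notin> D_section \<alpha>"
      proof
        assume "u \<in> D_section \<alpha>"
        then have "Inl u \<in> strict_transform (sigma2 \<alpha>) UNIV (first_coords \<alpha>) (D_section \<alpha>)"
          by (intro strict_transform_superset[OF first_top] u)
        then have "x \<in> D_section_strict \<alpha>"
          unfolding D_section_strict_def \<open>x = Inl y\<close> using y Inl
          by (intro strict_transform_superset[OF second_top]) auto
        then show False using x(2) by auto
      qed
      then show ?thesis using x(1) Inl \<open>x = Inl y\<close> by (auto simp: W2_def)
    next
      case (Inr p)
      obtain \<nu> l where p: "p = (\<nu>, l)" by (cases p)
      have "x \<in> D_exc_strict \<alpha> \<nu>"
        using Inr_in_D_exc_strict[of \<nu> l \<alpha>] x(1) Inr p \<open>x = Inl y\<close> by simp
      then show ?thesis using x(2) by (cases \<nu>) auto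
    qed
  next
    case (Inr p)
    obtain k l where p: "p = (k, l)" by (cases p)
    have k: "k \<in> {1..8}" using Inr_in_points_second[of k l \<alpha>] x(1) Inr p by simp
    show ?thesis
    proof (cases l)
      case None
      have "x \<in> D_exc_strict \<alpha> (second_base k)"
        unfolding D_exc_strict_def Inr p None
        by (rule None_in_strict_transform[OF second_top k]) (simp add: second_coords_simps D_exc_def)
      then show ?thesis using x(2) second_base_cases[of k] by auto
    next
      case (Some u)
      then show ?thesis using x(1) Inr p by (auto simp: W2_def)
    qed
  qed
qed

section \<open>The ten planes in the blown-up surface\<close>

definition ten_idx :: "nat option set" where
  "ten_idx = insert None (Some ` {0..8})"

text \<open>\<open>None\<close> and \<open>Some 0\<close> are charts 0 and 1 of the Hirzebruch
  surface. At a centre c the standard first coordinate is (u - c) / v, whereas \<open>r\<close> has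
  its negative, because 1 / v is p (or, for k = 8, the coordinate y of U_0); hence the sign.\<close>

definition psi :: "(nat \<Rightarrow> complex) \<Rightarrow> nat option \<Rightarrow> c2 \<Rightarrow> bl2" where
  "psi \<alpha> i = (\<lambda>(x, y). case i of None \<Rightarrow> Inl (Inl (zw \<alpha> 0 (x, y)))
     | Some k \<Rightarrow> if k = 0 then Inl (Inl (zw \<alpha> 1 (x, y))) else uv_chart (second_coords \<alpha>) k (- x, y))"

definition flip :: "nat option \<Rightarrow> c2 \<Rightarrow> c2" where
  "flip i = (\<lambda>(x, y). if i = None \<or> i = Some 0 then (x, y) else (- x, y))"

lemma flip_flip [simp]: "flip i (flip i z) = z"
  by (cases z) (simp add: flip_def)

lemma holo2_flip: "holo2 UNIV (flip i)"
proof -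
  have "holo2 UNIV (\<lambda>z::c2. (- fst z, snd z))" by (intro holo2_Pair hol_intros open_UNIV)
  moreover have "holo2 UNIV (\<lambda>z::c2. z)" by (rule holo2_id) simp
  ultimately show ?thesis
    by (cases "i = None \<or> i = Some 0") (auto intro: holo2_cong simp: flip_def case_prod_unfold)
qed

lemma ten_idx_cases:
  assumes "i \<in> ten_idx"
  obtains "i = None" | "i = Some 0" | k where "i = Some k" "1 \<le> k" "k \<le> 8"
proof (cases i)
  case (Some k)
  then have "k \<le> 8" using assms by (auto simp: ten_idx_def)
  then show thesis using that Some by (cases "k = 0") auto
qed (use that in auto)

lemma psi_chart_aux:
  assumes "i \<le> 1"
  shows "(UNIV, \<lambda>z. Inl (Inl (zw \<alpha> i z))) \<in> X2 \<alpha>"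
proof -
  have s: "(UNIV, zw \<alpha> i) \<in> sigma2 \<alpha>" using assms by (auto simp: sigma2_charts intro!: exI[of _ i])
  have nD: "zw \<alpha> i z \<notin> D_section \<alpha>" for z
    using assms not_D_section[of \<alpha> z] by (cases "i = 0") (auto simp: le_Suc_eq)
  then have 1: "{z \<in> UNIV. zw \<alpha> i z \<notin> centres UNIV (first_coords \<alpha>)} = UNIV" using centres_first by blast
  have "({z \<in> UNIV. zw \<alpha> i z \<notin> centres UNIV (first_coords \<alpha>)}, \<lambda>z. Inl (zw \<alpha> i z)) \<in> X1 \<alpha>"
    unfolding X1_def blowup_def by (intro UnI1) (rule image_eqI[OF _ s], simp)
  then have s1: "(UNIV, \<lambda>z. Inl (zw \<alpha> i z)) \<in> X1 \<alpha>" by (simp only: 1)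
  have 2: "{z \<in> UNIV. (Inl (zw \<alpha> i z) :: bl1) \<notin> centres {1..8} (second_coords \<alpha>)} = UNIV"
    using centres_second by blast
  have "({z \<in> UNIV. (Inl (zw \<alpha> i z) :: bl1) \<notin> centres {1..8} (second_coords \<alpha>)}, \<lambda>z. Inl (Inl (zw \<alpha> i z))) \<in> X2 \<alpha>"
    unfolding X2_def blowup_def by (intro UnI1) (rule image_eqI[OF _ s1], simp)
  then show ?thesis by (simp only: 2)
qed

text \<open>All chart domains are whole planes: the (q, p)-plane and U_0 avoid the section, hence
  the centres, and a point with v nonzero in the chart at a second centre lies off the first
  exceptional curves, which contain all second centres.\<close>

lemma psi_chart:
  assumes "i \<in> ten_idx"
  shows "(UNIV, \<lambda>z. psi \<alpha> i (flip i z)) \<in> X2 \<alpha>"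
  using assms
proof (cases rule: ten_idx_cases)
  case (3 k)
  have k: "k \<in> {1..8}" using 3 by auto
  have "(b = 0 \<or> second_coords \<alpha> k (a * b, b) \<notin> centres {1..8} (second_coords \<alpha>))" for a b
    using centres_second[of "second_coords \<alpha> k (a * b, b)" "{1..8}" \<alpha>]
    by (cases "b = 0") (auto simp: second_coords_simps)
  then have "{(u, v). v = 0 \<or> second_coords \<alpha> k (u * v, v) \<notin> centres {1..8} (second_coords \<alpha>)} = UNIV" by auto
  then have "(UNIV, uv_chart (second_coords \<alpha>) k) \<in> X2 \<alpha>"
    using uv_chart_in_blowup[OF k, of "second_coords \<alpha>" "X1 \<alpha>"] unfolding X2_def by simp
  moreover have "(\<lambda>z. psi \<alpha> i (flip i z)) = uv_chart (second_coords \<alpha>) k"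
    using 3 by (auto simp: psi_def flip_def)
  ultimately show ?thesis by simp
next
  case 1
  have "(UNIV, \<lambda>z. Inl (Inl (zw \<alpha> 0 z))) \<in> X2 \<alpha>" by (rule psi_chart_aux) simp
  then show ?thesis using 1 by (simp add: psi_def flip_def case_prod_unfold)
next
  case 2
  have "(UNIV, \<lambda>z. Inl (Inl (zw \<alpha> 1 z))) \<in> X2 \<alpha>" by (rule psi_chart_aux) simp
  then show ?thesis using 2 by (simp add: psi_def flip_def case_prod_unfold)
qed

lemma inj_psi:
  assumes "i \<in> ten_idx"
  shows "inj (psi \<alpha> i)"
proof (rule injI)
  fix z w assume eq: "psi \<alpha> i z = psi \<alpha> i w"
  have "inj (\<lambda>z. psi \<alpha> i (flip i z))" using inj_atlasD[OF inj_atlas_second psi_chart[OF assms]] .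
  from injD[OF this, of "flip i z" "flip i w"] eq have "flip i z = flip i w" by simp
  then show "z = w" by (metis flip_flip)
qed

lemma range_psi_subset:
  assumes "i \<in> ten_idx"
  shows "psi \<alpha> i z \<in> W2 \<alpha>"
proof -
  have "psi \<alpha> i z \<in> points (X2 \<alpha>)"
    using pointsI[OF psi_chart[OF assms, of \<alpha>], of "flip i z"] by simp
  moreover have "(\<exists>y. psi \<alpha> i z = Inl (Inl y) \<and> y \<notin> D_section \<alpha>) \<or> (\<exists>k u. psi \<alpha> i z = Inr (k, Some u))"
    using assms
  proof (cases rule: ten_idx_cases)
    case (3 k)
    obtain x y where z: "z = (x, y)" by (cases z)
    show ?thesis
      using 3 by (cases "y = 0")
        (simp_all add: z psi_def uv_chart_simps second_coords_simps first_coords_D_section)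
  next
    case 1
    then have "psi \<alpha> i z = Inl (Inl (zw \<alpha> 0 z))" by (cases z) (simp add: psi_def)
    then show ?thesis using not_D_section(1)[of \<alpha> z] by simp
  next
    case 2
    then have "psi \<alpha> i z = Inl (Inl (zw \<alpha> 1 z))" by (cases z) (simp add: psi_def)
    then show ?thesis using not_D_section(2)[of \<alpha> z] by simp
  qed
  ultimately show ?thesis unfolding W2_def by simp
qed

lemma W2_subset_range:
  assumes "x \<in> W2 \<alpha>"
  shows "\<exists>i\<in>ten_idx. x \<in> range (psi \<alpha> i)"
proof -
  have x: "x \<in> points (X2 \<alpha>)" using assms W2_points by auto
  have "(\<exists>y. x = Inl (Inl y) \<and> y \<notin> D_section \<alpha>) \<or> (\<exists>k u. x = Inr (k, Some u))"
    using assms by (simp add: W2_def)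
  then show ?thesis
  proof (elim disjE exE conjE)
    fix y assume y: "x = Inl (Inl y)" "y \<notin> D_section \<alpha>"
    have "Inl y \<in> points (X1 \<alpha>)"
      using Inl_in_points_second(1)[of "Inl y" \<alpha>] x y by simp
    then have "y \<in> points (sigma2 \<alpha>)"
      using Inl_in_points_first(1)[of y \<alpha>] by simp
    then have "y \<in> range (zw \<alpha> 0) \<union> range (zw \<alpha> 1)" by (rule points_sigma2[OF _ y(2)])
    then obtain z where "y = zw \<alpha> 0 z \<or> y = zw \<alpha> 1 z" by blast
    then have "x = psi \<alpha> None z \<or> x = psi \<alpha> (Some 0) z"
      by (cases z) (simp add: y(1) psi_def)
    then have "x \<in> range (psi \<alpha> None) \<or> x \<in> range (psi \<alpha> (Some 0))"
      by (elim disjE) simp_all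
    moreover have "None \<in> ten_idx" "Some 0 \<in> ten_idx" by (simp_all add: ten_idx_def)
    ultimately show ?thesis by (elim disjE) (rule bexI, assumption+)+
  next
    fix k u assume ku: "x = Inr (k, Some u)"
    have k: "k \<in> {1..8}" using Inr_in_points_second[of k "Some u" \<alpha>] x ku by simp
    have "x = psi \<alpha> (Some k) (- u, 0)" using k by (simp add: ku psi_def uv_chart_simps)
    then show ?thesis using k by (intro bexI[of _ "Some k"]) (simp_all add: ten_idx_def)
  qed
qed

text \<open>The inverses of the \<open>r k\<close>, read in the blown-up surface. Off the
  exceptional line y = 0 the planes at the centres lie over the (q, p)-plane, the last one over
  U_0.\<close>

lemma psi_second:
  assumes "1 \<le> k" "k \<le> 8" "y \<noteq> 0"
  shows "psi \<alpha> (Some k) (x, y) =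
    (if k \<le> 5 then psi \<alpha> None ((\<rho> \<alpha> k - x * y) * y, 1 / y)
     else if k = 6 then psi \<alpha> None ((\<alpha> 6 - x * y) * y + 1, 1 / y)
     else if k = 7 then psi \<alpha> None ((\<alpha> 6 + \<alpha> 7 - x * y) * y + 1, 1 / y)
     else psi \<alpha> (Some 0) ((\<alpha> 8 - x * y) * y, 1 / y))"
  using assms
  by (simp add: psi_def uv_chart_simps second_coords_simps second_base_def second_pos_def zw_2_0 zw_3_1)

lemma psi_0:
  assumes "x \<noteq> 0"
  shows "psi \<alpha> (Some 0) (x, y) = psi \<alpha> None (1 / x, - (x * y + \<alpha> 0) * x)"
  using zw_0_1[of "1 / x" \<alpha> "- (x * y + \<alpha> 0) * x"] assms by (simp add: psi_def field_simps)

lemma r_simps: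
  "r \<alpha> 0 (q, p) = (1 / q, - (q * p + \<alpha> 0) * q)"
  "1 \<le> k \<Longrightarrow> k \<le> 5 \<Longrightarrow> r \<alpha> k (q, p) = (- (p * q - \<rho> \<alpha> k) * p, 1 / p)"
  "r \<alpha> 6 (q, p) = (- (p * (q - 1) - \<alpha> 6) * p, 1 / p)"
  "r \<alpha> 7 (q, p) = (- (p * (q - 1) - (\<alpha> 6 + \<alpha> 7)) * p, 1 / p)"
  "r \<alpha> 8 (q, p) = (- (q * p - \<alpha> 8) * p, 1 / p)"
  by (auto simp: r_def \<rho>_def)

lemma psi_r:
  assumes "j \<le> 7" "z \<in> r_dom j"
  shows "psi \<alpha> None z = psi \<alpha> (Some j) (r \<alpha> j z)"
proof -
  obtain q p where z: "z = (q, p)" by (cases z)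
  consider "j = 0" | "1 \<le> j" "j \<le> 5" | "j = 6" | "j = 7" using assms(1) by linarith
  then show ?thesis
  proof cases
    case 1
    then show ?thesis using assms zw_0_1[of q \<alpha> p] by (simp add: z r_dom_def r_simps psi_def)
  next
    case 2
    then have p: "p \<noteq> 0" using assms by (simp add: z r_dom_def)
    then have "(\<rho> \<alpha> j - (- (p * q - \<rho> \<alpha> j) * p) * (1 / p)) * (1 / p) = q" by (simp add: field_simps)
    then show ?thesis using 2 p psi_second[of j "1 / p" \<alpha> "- (p * q - \<rho> \<alpha> j) * p"] by (simp add: z r_simps)
  next
    case 3
    then have p: "p \<noteq> 0" using assms by (simp add: z r_dom_def)
    then have "(\<alpha> 6 - (- (p * (q - 1) - \<alpha> 6) * p) * (1 / p)) * (1 / p) + 1 = q" by (simp add: field_simps)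
    then show ?thesis using 3 p psi_second[of 6 "1 / p" \<alpha> "- (p * (q - 1) - \<alpha> 6) * p"] by (simp add: z r_simps)
  next
    case 4
    then have p: "p \<noteq> 0" using assms by (simp add: z r_dom_def)
    then have "(\<alpha> 6 + \<alpha> 7 - (- (p * (q - 1) - (\<alpha> 6 + \<alpha> 7)) * p) * (1 / p)) * (1 / p) + 1 = q" by (simp add: field_simps)
    then show ?thesis using 4 p psi_second[of 7 "1 / p" \<alpha> "- (p * (q - 1) - (\<alpha> 6 + \<alpha> 7)) * p"] by (simp add: z r_simps)
  qed
qed

lemma psi_r_8:
  assumes "z \<in> r_dom 8"
  shows "psi \<alpha> (Some 0) z = psi \<alpha> (Some 8) (r \<alpha> 8 z)"
proof -
  obtain q p where z: "z = (q, p)" by (cases z)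
  have p: "p \<noteq> 0" using assms by (simp add: z r_dom_def)
  then have "(\<alpha> 8 - (- (q * p - \<alpha> 8) * p) * (1 / p)) * (1 / p) = q" by (simp add: field_simps)
  then show ?thesis using p psi_second[of 8 "1 / p" \<alpha> "- (q * p - \<alpha> 8) * p"] by (simp add: z r_simps)
qed

lemma ten_rel_cases:
  assumes "(x, y) \<in> ten_rel \<alpha>"
  obtains j z where "j \<le> 7" "z \<in> r_dom j" "x = (None, z)" "y = (Some j, r \<alpha> j z)"
  | z where "z \<in> r_dom 8" "x = (Some 0, z)" "y = (Some 8, r \<alpha> 8 z)"
  using assms unfolding ten_rel_def by (elim UnE CollectE exE conjE) auto

lemma psi_ten_rel: "(x, y) \<in> ten_rel \<alpha> \<Longrightarrow> psi \<alpha> (fst x) (snd x) = psi \<alpha> (fst y) (snd y)"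
  by (erule ten_rel_cases) (simp_all add: psi_r psi_r_8)

text \<open>The representatives on the lines x = 0 of U_0 and y = 0 of the other U_k are the points
  that the maps \<open>r j\<close> do not reach; everything else moves to the (q, p)-plane, for U_8
  possibly by way of U_0.\<close>

lemma ten_rel_normal_form:
  assumes "i \<in> ten_idx"
  shows "\<exists>i' z'. ((i, z), (i', z')) \<in> (ten_rel \<alpha> \<union> (ten_rel \<alpha>)\<inverse>)\<^sup>* \<and>
    (i' = None \<or> (i' = Some 0 \<and> fst z' = 0) \<or> (\<exists>k. i' = Some k \<and> 1 \<le> k \<and> k \<le> 8 \<and> snd z' = 0))"
proof -
  let ?E = "(ten_rel \<alpha> \<union> (ten_rel \<alpha>)\<inverse>)\<^sup>*"
  let ?N = "\<lambda>i' z'. i' = None \<or> (i' = Some 0 \<and> fst z' = 0) \<or> (\<exists>k. i' = Some k \<and> 1 \<le> k \<and> k \<le> 8 \<and> snd z' = 0)"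
  obtain x y where z: "z = (x, y)" by (cases z)
  have to_None: "((Some j, r \<alpha> j w), (None, w)) \<in> ?E" if "j \<le> 7" "w \<in> r_dom j" for j w
  proof -
    have "((None, w), (Some j, r \<alpha> j w)) \<in> ten_rel \<alpha>" unfolding ten_rel_def using that by blast
    then show ?thesis by (intro r_into_rtrancl) simp
  qed
  have to_0: "((Some 8, r \<alpha> 8 w), (Some 0, w)) \<in> ?E" if "w \<in> r_dom 8" for w
  proof -
    have "((Some 0, w), (Some 8, r \<alpha> 8 w)) \<in> ten_rel \<alpha>" unfolding ten_rel_def using that by blast
    then show ?thesis by (intro r_into_rtrancl) simp
  qed
  have fin: "\<exists>i' z'. (a, (i', z')) \<in> ?E \<and> ?N i' z'" if "(a, (c, d)) \<in> ?E" "?N c d" for a c d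
    by (rule exI[of _ c], rule exI[of _ d]) (rule conjI[OF that])
  have chart0: "\<exists>i' z'. ((Some 0, (x, y)), (i', z')) \<in> ?E \<and> ?N i' z'" for x y
  proof (cases "x = 0")
    case False
    have "r \<alpha> 0 (1 / x, - (x * y + \<alpha> 0) * x) = (x, y)" using False by (simp add: r_simps field_simps)
    then have "((Some 0, (x, y)), (None, (1 / x, - (x * y + \<alpha> 0) * x))) \<in> ?E"
      using to_None[of 0 "(1 / x, - (x * y + \<alpha> 0) * x)"] False by (simp add: r_dom_def)
    then show ?thesis by (rule fin) simp
  next
    case True
    show ?thesis by (rule fin[OF rtrancl_refl]) (simp add: True)
  qed
  show ?thesis
    using assms
  proof (cases rule: ten_idx_cases)
    case 1
    show ?thesis by (rule fin[OF rtrancl_refl]) (simp add: 1)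
  next
    case 2
    then show ?thesis using chart0 z by simp
  next
    case (3 k)
    show ?thesis
    proof (cases "y = 0")
      case True
      show ?thesis by (rule fin[OF rtrancl_refl]) (use 3 z True in auto)
    next
      case False
      consider "k \<le> 5" | "k = 6" | "k = 7" | "k = 8" using 3 by linarith
      then show ?thesis
      proof cases
        case 1
        have "r \<alpha> k ((\<rho> \<alpha> k - x * y) * y, 1 / y) = (x, y)"
          using False 1 3 by (simp add: r_simps field_simps)
        then have "((Some k, (x, y)), (None, ((\<rho> \<alpha> k - x * y) * y, 1 / y))) \<in> ?E"
          using to_None[of k "((\<rho> \<alpha> k - x * y) * y, 1 / y)"] False 1 3 by (simp add: r_dom_def)
        then show ?thesis unfolding 3(1) z by (rule fin) simp
      next
        case 2
        have "r \<alpha> 6 ((\<alpha> 6 - x * y) * y + 1, 1 / y) = (x, y)"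
          using False by (simp add: r_simps field_simps)
        then have "((Some k, (x, y)), (None, ((\<alpha> 6 - x * y) * y + 1, 1 / y))) \<in> ?E"
          using to_None[of 6 "((\<alpha> 6 - x * y) * y + 1, 1 / y)"] False 2 by (simp add: r_dom_def)
        then show ?thesis unfolding 3(1) z by (rule fin) simp
      next
        case c: 3
        have "r \<alpha> 7 ((\<alpha> 6 + \<alpha> 7 - x * y) * y + 1, 1 / y) = (x, y)"
          using False by (simp add: r_simps field_simps)
        then have "((Some k, (x, y)), (None, ((\<alpha> 6 + \<alpha> 7 - x * y) * y + 1, 1 / y))) \<in> ?E"
          using to_None[of 7 "((\<alpha> 6 + \<alpha> 7 - x * y) * y + 1, 1 / y)"] False c by (simp add: r_dom_def)
        then show ?thesis unfolding 3(1) z by (rule fin) simp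
      next
        case 4
        let ?w = "((\<alpha> 8 - x * y) * y, 1 / y)"
        have "r \<alpha> 8 ?w = (x, y)"
          using False by (simp add: r_simps field_simps)
        then have "((Some k, (x, y)), (Some 0, ?w)) \<in> ?E"
          using to_0[of ?w] False 4 by (simp add: r_dom_def)
        moreover obtain i' z' where "((Some 0, ?w), (i', z')) \<in> ?E" "?N i' z'" 
          using chart0[of "(\<alpha> 8 - x * y) * y" "1 / y"] by (elim exE conjE) (rule that)
        ultimately show ?thesis unfolding 3(1) z by (intro fin[OF rtrancl_trans])
      qed
    qed
  qed
qed

text \<open>The gluing maps respect \<open>psi\<close>. Conversely, points with the same image have
  normal forms with the same image; the different kinds of normal form have disjoint images and
  \<open>psi\<close> is injective on each plane, so the normal forms coincide.\<close>

lemma glue_point_ten_iff: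
  assumes "i \<in> ten_idx" "j \<in> ten_idx"
  shows "glue_point (ten_rel \<alpha>) i z = glue_point (ten_rel \<alpha>) j w \<longleftrightarrow> psi \<alpha> i z = psi \<alpha> j w"
proof -
  let ?E = "(ten_rel \<alpha> \<union> (ten_rel \<alpha>)\<inverse>)\<^sup>*"
  have inv: "psi \<alpha> a b = psi \<alpha> c d" if "((a, b), (c, d)) \<in> ?E" for a b c d
    using glue_rel_invariant[where f = "\<lambda>x. psi \<alpha> (fst x) (snd x)", OF psi_ten_rel that] by simp
  show ?thesis unfolding glue_point_eq_iff
  proof
    assume eq: "psi \<alpha> i z = psi \<alpha> j w"
    let ?N = "\<lambda>i' z'. i' = None \<or> (i' = Some 0 \<and> fst z' = 0) \<or> (\<exists>k. i' = Some k \<and> 1 \<le> k \<and> k \<le> (8::nat) \<and> snd z' = 0)"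
    obtain i' z' where 1: "((i, z), (i', z')) \<in> ?E" "?N i' z'" 
      using ten_rel_normal_form[OF assms(1), of z \<alpha>] by (elim exE conjE) (rule that)
    obtain j' w' where 2: "((j, w), (j', w')) \<in> ?E" "?N j' w'" 
      using ten_rel_normal_form[OF assms(2), of w \<alpha>] by (elim exE conjE) (rule that)
    have eq': "psi \<alpha> i' z' = psi \<alpha> j' w'" using inv[OF 1(1)] inv[OF 2(1)] eq by simp
    \<comment> \<open>Recovers the plane of a normal form from its image: a point of a second
      exceptional curve carries the index of its centre, and among the other points the range of
      chart 0 singles out the (q, p)-plane.\<close>
    define kind where "kind x = (case x of Inl y \<Rightarrow> if y \<in> range (\<lambda>z. Inl (zw \<alpha> 0 z)) then None else Some 0
      | Inr (k, l) \<Rightarrow> Some k)" for x :: bl2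
    have kind: "kind (psi \<alpha> a b) = a" if "?N a b" for a b
    proof -
      obtain x y where b: "b = (x, y)" by (cases b)
      from that consider "a = None" | "a = Some 0" "x = 0" | k where "a = Some k" "1 \<le> k" "y = 0"
        unfolding b by auto
      then show ?thesis
      proof cases
        case 1
        then show ?thesis by (simp add: b kind_def psi_def)
      next
        case 2
        have "(Inl (zw \<alpha> 1 (0, y)) :: bl1) \<notin> range (\<lambda>z. Inl (zw \<alpha> 0 z))"
        proof
          assume "(Inl (zw \<alpha> 1 (0, y)) :: bl1) \<in> range (\<lambda>z. Inl (zw \<alpha> 0 z))"
          then obtain z where "zw \<alpha> 0 z = zw \<alpha> 1 (0, y)" by auto
          then show False using zw_0_1_eqD[of \<alpha> "fst z" "snd z" 0 y] by simp
        qed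
        moreover have "psi \<alpha> a b = Inl (Inl (zw \<alpha> 1 (0, y)))" using 2 by (simp add: b psi_def)
        ultimately show ?thesis using 2 by (simp only: kind_def sum.case if_False)
      next
        case (3 k)
        then show ?thesis by (simp add: b kind_def psi_def uv_chart_simps)
      qed
    qed
    have ij: "i' = j'" using kind[OF 1(2)] kind[OF 2(2)] eq' by simp
    moreover have "i' \<in> ten_idx" using 1(2) by (auto simp: ten_idx_def)
    ultimately have "z' = w'" using injD[OF inj_psi, of i' \<alpha> z' w'] eq' by simp
    with ij have "i' = j' \<and> z' = w'" by simp
    then show "((i, z), (j, w)) \<in> ?E" using rtrancl_trans[OF 1(1)] glue_rel_sym[OF 2(1)] by simp
  qed (rule inv)
qed

section \<open>The Hamiltonian in the ten charts\<close>

text \<open>Treating the coefficients as constants subject to equations keeps the polynomial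
  identities free of \<open>\<beta>\<close> and \<open>\<rho>\<close>. The centres over q = 1 are a
  and b, and the equation for \<open>b1\<close> is the linear relation among the parameters.\<close>

locale ham_coeffs =
  fixes \<alpha>0 \<alpha>8 a b \<kappa> \<epsilon> \<gamma>1 \<gamma>2 b1 b2 b3 b4 b5 v m b0 A3 X k0 A2 B2 C2 c2 c1 c0 B1 C1 G1 f3 f2 :: complex
    and rho :: "nat \<Rightarrow> complex"
  assumes \<kappa>: "\<kappa> = 2 * \<alpha>0 + \<alpha>8" and \<epsilon>: "\<epsilon> = \<alpha>0 * (\<alpha>0 + \<alpha>8)"
    and \<gamma>1: "\<gamma>1 = a + b" and \<gamma>2: "\<gamma>2 = a * b"
    and b1: "b1 = - 3 * \<kappa> - 2 * \<gamma>1"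
    and v: "v = \<gamma>1^2 + 2 * \<gamma>2 - b2"
    and m: "m = v - 3 * (\<kappa>^2 + \<epsilon>)"
    and b0: "b0 = v + 4 * \<kappa> * \<gamma>1 + 3 * \<kappa>^2 - \<epsilon>"
    and A3: "A3 = \<kappa>^3 + 6 * \<kappa> * \<epsilon>"
    and X: "X = 2 * \<kappa> * v + 3 * \<kappa>^3 - 12 * \<kappa> * \<epsilon> + 6 * \<kappa>^2 * \<gamma>1 - 4 * \<epsilon> * \<gamma>1"
    and k0: "k0 = \<gamma>1^3 + 5 * \<kappa> * \<gamma>1^2 + \<kappa> * \<gamma>2 + 9 * \<kappa>^2 * \<gamma>1 - \<epsilon> * \<gamma>1 + 5 * \<kappa>^3
              - (\<gamma>1 + 2 * \<kappa>) * b2 - b3"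
    and A2: "A2 = 3 * \<kappa>^2 * \<epsilon> + 3 * \<epsilon>^2"
    and B2: "B2 = (\<kappa>^2 + 2 * \<epsilon>) * v + 4 * \<kappa>^3 * \<gamma>1 + 4 * \<kappa> * \<epsilon> * \<gamma>1 + 3 * \<kappa>^4
              - 3 * \<kappa>^2 * \<epsilon> - 6 * \<epsilon>^2"
    and C2: "C2 = b4 - 3 * A2 - 2 * B2
              + \<gamma>2 * (\<gamma>1^2 + \<gamma>2 + 3 * \<kappa> * \<gamma>1 + 3 * \<kappa>^2 + 3 * \<epsilon> - b2) - \<gamma>1 * k0"
    and c2: "c2 = - 2 * \<gamma>1^2 - 4 * \<gamma>2 + 3 * b2 - 3 * \<kappa>^2 + 3 * \<epsilon> - 6 * \<kappa> * \<gamma>1"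
    and c1: "c1 = - 2 * \<gamma>1 * \<gamma>2 - 4 * \<kappa>^3 + 3 * \<kappa> * \<epsilon> - 2 * \<kappa> * \<gamma>1^2 - 4 * \<kappa> * \<gamma>2 + \<kappa> * b2
              - 6 * \<kappa>^2 * \<gamma>1 + 2 * \<epsilon> * \<gamma>1 - b3"
    and c0: "c0 = C2 - \<kappa> * c1 - \<epsilon> * c2"
    and B1: "B1 = 2 * \<kappa> * \<epsilon> * b0 - 2 * \<epsilon>^2 * (2 * \<kappa> + \<gamma>1)"
    and C1: "C1 = \<kappa> * c0 + \<epsilon> * c1"
    and G1: "G1 = \<gamma>2 * k0 + b5 - 3 * \<kappa> * \<epsilon>^2 - B1 - C1"
    and f3: "f3 = A3 + X + b3 + 2 * \<gamma>1 * \<gamma>2"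
    and f2: "f2 = \<gamma>2^2 - A2 - B2 - C2 - b4"
    and rho: "\<And>u. u^5 - b1 * u^4 + b2 * u^3 - b3 * u^2 + b4 * u - b5 = (\<Prod>k\<in>{1..5}. u - rho k)"
    and rho_inj: "inj_on rho {1..5}" and ab: "a \<noteq> b"
begin

definition e5 where "e5 q = 3 * \<kappa> * q + b1"
definition e4 where "e4 q = 3 * (\<kappa>^2 + \<epsilon>) * q^2 + m * q + b2"
definition e3 where "e3 q = A3 * q^3 + X * q^2 - f3 * q + b3"
definition e2 where "e2 q = A2 * q^4 + B2 * q^3 + C2 * q^2 + f2 * q + b4"
definition e1 where "e1 q = 3 * \<kappa> * \<epsilon>^2 * q^4 + B1 * q^3 + C1 * q^2 + G1 * q - b5"
definition e0 where "e0 q = \<epsilon>^3 * q^3 + \<epsilon>^2 * b0 * q^2 + \<epsilon> * c0 * q"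

lemmas e_defs = e5_def e4_def e3_def e2_def e1_def e0_def

definition h where
  "h q p = q^5 * (q - 1)^4 * p^6 + q^4 * (q - 1)^3 * e5 q * p^5 + q^3 * (q - 1)^2 * e4 q * p^4
     + q^2 * (q - 1) * e3 q * p^3 + q * e2 q * p^2 + e1 q * p + e0 q"

text \<open>With w = u y, this is y h(u y, 1/y) minus its value at y = 0, divided by y. The
  polynomials in w that occur are the quotients ((w - 1)^n - (-1)^n) / w.\<close>

definition Rk where
  "Rk u w = u * (u^5 * (w^3 - 4*w^2 + 6*w - 4) + u^4 * ((w - 1)^3 * (3 * \<kappa>) + b1 * (w^2 - 3*w + 3))
      + u^3 * ((w - 1)^2 * (3 * (\<kappa>^2 + \<epsilon>) * w + m) + b2 * (w - 2))
      + u^2 * ((w - 1) * (A3 * w^2 + X * w - f3) + b3)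
      + u * (A2 * w^3 + B2 * w^2 + C2 * w + f2) + (3 * \<kappa> * \<epsilon>^2 * w^3 + B1 * w^2 + C1 * w + G1)) + e0 w"

text \<open>Over q = 0 all terms of h have at most a simple pole along y = 0, and the coefficient of
  the pole vanishes exactly at the five centres.\<close>

lemma h_uv_0:
  assumes "y \<noteq> 0"
  shows "y * h (u * y) (1 / y) = (\<Prod>k\<in>{1..5}. u - rho k) + y * Rk u (u * y)"
proof -
  define w where "w = u * y"
  have "y * h w (1 / y) = u^5 * (w - 1)^4 + u^4 * (w - 1)^3 * e5 w + u^3 * (w - 1)^2 * e4 w
      + u^2 * (w - 1) * e3 w + u * e2 w + e1 w + y * e0 w"
  proof -
    have "w^5 * (1 / y)^6 * y = u^5" "w^4 * (1 / y)^5 * y = u^4" "w^3 * (1 / y)^4 * y = u^3"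
      "w^2 * (1 / y)^3 * y = u^2" "w * (1 / y)^2 * y = u" "1 / y * y = 1"
      using assms by (simp_all add: w_def field_simps eval_nat_numeral)
    then show ?thesis unfolding h_def by algebra
  qed
  also have "\<dots> = (u^5 - b1 * u^4 + b2 * u^3 - b3 * u^2 + b4 * u - b5) + y * Rk u w"
    unfolding Rk_def e_defs w_def by algebra
  finally show ?thesis unfolding rho w_def .
qed

text \<open>\<open>T2\<close> and \<open>T3\<close> are ((1 + w)^4 - 1 - 4 w) / w^2 and ((1 + w)^5 -
  1 - 5 w) / w^2, used to expand powers of q = 1 + w.\<close>

definition T2 :: "complex \<Rightarrow> complex" where "T2 w = 6 + 4 * w + w^2"
definition T3 :: "complex \<Rightarrow> complex" where "T3 w = 10 + 10 * w + 5 * w^2 + w^3"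

text \<open>The quotient by (u - a)(u - b) of the coefficient of y at q = 1, obtained by polynomial
  division; its constant term is \<open>k0\<close>.\<close>

definition Lq where
  "Lq u = 5 * u^3 + (4 * (3 * \<kappa> + b1) + 3 * \<kappa> + 5 * \<gamma>1) * u^2
     + (3 * (3 * (\<kappa>^2 + \<epsilon>) + m + b2) + 6 * (\<kappa>^2 + \<epsilon>) + m
        + \<gamma>1 * (4 * (3 * \<kappa> + b1) + 3 * \<kappa> + 5 * \<gamma>1) - 5 * \<gamma>2) * u + k0"

definition Mq where
  "Mq u w = u^2 * (u^4 * T3 w + u^3 * (3 * \<kappa> * T3 w + b1 * T2 w)
      + u^2 * (3 * (\<kappa>^2 + \<epsilon>) * T3 w + m * T2 w + b2 * (3 + w))
      + u * (A3 * T3 w + X * T2 w - f3 * (3 + w) + b3)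
      + (A2 * T3 w + B2 * T2 w + C2 * (3 + w) + f2))
     + u * (3 * \<kappa> * \<epsilon>^2 * (4 + 6*w + 4*w^2 + w^3) + B1 * (3 + 3*w + w^2) + C1 * (2 + w) + G1) + e0 (1 + w)"

lemma q_square:
  "u^4 + (3 * \<kappa> + b1) * u^3 + (3 * (\<kappa>^2 + \<epsilon>) + m + b2) * u^2 - 2 * \<gamma>1 * \<gamma>2 * u + \<gamma>2^2
    = ((u - a) * (u - b))^2"
  unfolding b1 m v \<gamma>1 \<gamma>2 by algebra

text \<open>The higher coefficients determine the quotient; those of u^2 and u leave the identities
  \<open>2\<close> and \<open>3\<close>, which hold by the choice of \<open>X\<close>,
  \<open>k0\<close> and \<open>C2\<close>.\<close>

lemma q_linear:
  "u * (5 * u^4 + (4 * (3 * \<kappa> + b1) + 3 * \<kappa>) * u^3 + (3 * (3 * (\<kappa>^2 + \<epsilon>) + m + b2) + 6 * (\<kappa>^2 + \<epsilon>) + m) * u^2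
      + (- 4 * \<gamma>1 * \<gamma>2 + 3 * A3 + 2 * X - f3) * u + (\<gamma>2^2 + 4 * A2 + 3 * B2 + 2 * C2 + f2)) + \<gamma>2 * k0
    = (u - a) * (u - b) * Lq u"
proof -
  have 1: "(u - a) * (u - b) = u^2 - \<gamma>1 * u + \<gamma>2" unfolding \<gamma>1 \<gamma>2 by algebra
  define l2 where "l2 = 4 * (3 * \<kappa> + b1) + 3 * \<kappa> + 5 * \<gamma>1"
  define l1 where "l1 = 3 * (3 * (\<kappa>^2 + \<epsilon>) + m + b2) + 6 * (\<kappa>^2 + \<epsilon>) + m + \<gamma>1 * l2 - 5 * \<gamma>2"
  have L: "Lq u = 5 * u^3 + l2 * u^2 + l1 * u + k0" by (simp add: Lq_def l1_def l2_def)
  have 2: "- 4 * \<gamma>1 * \<gamma>2 + 3 * A3 + 2 * X - f3 = k0 - \<gamma>1 * l1 + \<gamma>2 * l2"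
    unfolding l1_def l2_def f3 X A3 k0 m v b1 by algebra
  have 3: "\<gamma>2^2 + 4 * A2 + 3 * B2 + 2 * C2 + f2 = - \<gamma>1 * k0 + \<gamma>2 * l1"
    unfolding l1_def l2_def f2 C2 m v b1 by algebra
  show ?thesis unfolding 1 L 2 3 unfolding l1_def l2_def by algebra
qed

text \<open>Over q = 1 the pole is double. Its leading coefficient is a square and the next one
  contains the same two factors once, so putting u - a = -xy (or u - b = -xy) cancels both
  orders.\<close>

lemma h_uv_1:
  assumes "y \<noteq> 0"
  shows "y^2 * h (1 + u * y) (1 / y) =
    ((u - a) * (u - b))^2 + y * ((u - a) * (u - b) * Lq u) + y^2 * Mq u (u * y)"
proof -
  define w where "w = u * y"
  define q where "q = 1 + w"
  have "y^2 * h q (1 / y) = q^5 * u^4 + q^4 * u^3 * e5 q + q^3 * u^2 * e4 q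
      + q^2 * u * e3 q + q * e2 q + y * e1 q + y^2 * e0 q"
  proof -
    have "(q - 1)^4 * (1 / y)^6 * y^2 = u^4" "(q - 1)^3 * (1 / y)^5 * y^2 = u^3" "(q - 1)^2 * (1 / y)^4 * y^2 = u^2"
      "(q - 1) * (1 / y)^3 * y^2 = u" "(1 / y)^2 * y^2 = 1" "1 / y * y^2 = y"
      using assms by (simp_all add: q_def w_def field_simps eval_nat_numeral)
    then show ?thesis unfolding h_def by algebra
  qed
  also have "\<dots> = (u^4 + (3 * \<kappa> + b1) * u^3 + (3 * (\<kappa>^2 + \<epsilon>) + m + b2) * u^2 - 2 * \<gamma>1 * \<gamma>2 * u + \<gamma>2^2)
     + y * (u * (5 * u^4 + (4 * (3 * \<kappa> + b1) + 3 * \<kappa>) * u^3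
        + (3 * (3 * (\<kappa>^2 + \<epsilon>) + m + b2) + 6 * (\<kappa>^2 + \<epsilon>) + m) * u^2
        + (- 4 * \<gamma>1 * \<gamma>2 + 3 * A3 + 2 * X - f3) * u + (\<gamma>2^2 + 4 * A2 + 3 * B2 + 2 * C2 + f2)) + \<gamma>2 * k0)
     + y^2 * Mq u w"
    unfolding Mq_def T2_def T3_def e_defs w_def q_def unfolding f3 f2 G1 by algebra
  finally show ?thesis unfolding q_square q_linear w_def q_def .
qed

text \<open>\<open>L1\<close> and \<open>L2\<close> are the quotients of the coefficients of x and
  x^2 at infinity by the square and the first power of P^2 - \<kappa> P + \<epsilon>;
  \<open>b0\<close>, \<open>c2\<close>, \<open>c1\<close>, \<open>c0\<close> come from these
  divisions. \<open>M0\<close> holds everything from x^3 on.\<close>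

definition L1 where "L1 P = - 4 * P^2 + (\<kappa> - b1) * P + b0"
definition L2 where "L2 P = 6 * P^4 + (3 * b1 - 3 * \<kappa>) * P^3 + c2 * P^2 - c1 * P + c0"
definition M0 where
  "M0 P x = P^6 * (x - 4) - P^5 * (3 * b1 - 3 * \<kappa> - b1 * x) + P^4 * (m - 2 * b2 + b2 * x)
     - P^3 * (f3 + b3 - b3 * x) + P^2 * (f2 + b4 * x) - P * (G1 - b5 * x)"

text \<open>The polynomial x^3 h in the variables x = 1/q and P, where p = -P x. In the plane U_0
  one has P = xy + \<alpha>0.\<close>

definition g where
  "g P x = P^6 * (1 - x)^4 - P^5 * ((1 - x)^3 * (3 * \<kappa> + b1 * x))
    + P^4 * ((1 - x)^2 * (3 * (\<kappa>^2 + \<epsilon>) + m * x + b2 * x^2))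
    - P^3 * ((1 - x) * (A3 + X * x - f3 * x^2 + b3 * x^3))
    + P^2 * (A2 + B2 * x + C2 * x^2 + f2 * x^3 + b4 * x^4)
    - P * (3 * \<kappa> * \<epsilon>^2 + B1 * x + C1 * x^2 + G1 * x^3 - b5 * x^4)
    + (\<epsilon>^3 + \<epsilon>^2 * b0 * x + \<epsilon> * c0 * x^2)"

lemma h_infinity:
  assumes "x \<noteq> 0"
  shows "x^3 * h (1 / x) (- P * x) = g P x"
proof -
  define q where "q = 1 / x"
  have qx: "q * x = 1" using assms by (simp add: q_def)
  then show ?thesis unfolding q_def[symmetric] h_def g_def e_defs by algebra
qed

text \<open>The roots of P^2 - \<kappa> P + \<epsilon> are \<alpha>0 and \<alpha>0 + \<alpha>8. In
  U_0 the quadratic becomes x y (xy - \<alpha>8), so every term contains x^3 and the triple pole at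
  infinity cancels.\<close>

lemma g_expand:
  "g P x = (P^2 - \<kappa> * P + \<epsilon>)^3 + x * ((P^2 - \<kappa> * P + \<epsilon>)^2 * L1 P) + x^2 * ((P^2 - \<kappa> * P + \<epsilon>) * L2 P) + x^3 * M0 P x"
proof -
  have 0: "P^6 - 3 * \<kappa> * P^5 + 3 * (\<kappa>^2 + \<epsilon>) * P^4 - A3 * P^3 + A2 * P^2 - 3 * \<kappa> * \<epsilon>^2 * P + \<epsilon>^3
      = (P^2 - \<kappa> * P + \<epsilon>)^3" unfolding A3 A2 by algebra
  have 1: "- 4 * P^6 - (b1 - 9 * \<kappa>) * P^5 + (m - 6 * (\<kappa>^2 + \<epsilon>)) * P^4 - (X - A3) * P^3 + B2 * P^2 - B1 * P + \<epsilon>^2 * b0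
      = (P^2 - \<kappa> * P + \<epsilon>)^2 * L1 P"
    unfolding L1_def unfolding X A3 B2 B1 b0 b1 m by algebra
  have 2: "6 * P^6 - (9 * \<kappa> - 3 * b1) * P^5 + (b2 - 2 * m + 3 * (\<kappa>^2 + \<epsilon>)) * P^4 + (f3 + X) * P^3 + C2 * P^2 - C1 * P + \<epsilon> * c0
      = (P^2 - \<kappa> * P + \<epsilon>) * L2 P"
    unfolding L2_def unfolding C1 c0 c1 c2 f3 X A3 b1 m v by algebra
  have "g P x = (P^6 - 3 * \<kappa> * P^5 + 3 * (\<kappa>^2 + \<epsilon>) * P^4 - A3 * P^3 + A2 * P^2 - 3 * \<kappa> * \<epsilon>^2 * P + \<epsilon>^3)
    + x * (- 4 * P^6 - (b1 - 9 * \<kappa>) * P^5 + (m - 6 * (\<kappa>^2 + \<epsilon>)) * P^4 - (X - A3) * P^3 + B2 * P^2 - B1 * P + \<epsilon>^2 * b0)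
    + x^2 * (6 * P^6 - (9 * \<kappa> - 3 * b1) * P^5 + (b2 - 2 * m + 3 * (\<kappa>^2 + \<epsilon>)) * P^4 + (f3 + X) * P^3 + C2 * P^2 - C1 * P + \<epsilon> * c0)
    + x^3 * M0 P x"
    unfolding g_def M0_def by algebra
  then show ?thesis unfolding 0 1 2 .
qed

text \<open>\<open>Hk\<close> and \<open>Hq\<close> are what is left after division by y and y^2,
  using that u minus the centre is -xy. \<open>H0\<close> results from division by x^3, and in
  \<open>H8\<close> the quantity \<open>\<tau>\<close> of \<open>H0\<close> has become -x.\<close>

definition Hk where
  "Hk k x y = (let u = rho k - x * y in - x * (\<Prod>i\<in>{1..5} - {k}. u - rho i) + Rk u (u * y))"

definition Hq where
  "Hq s t x y = (let u = s - x * y in x^2 * (u - t)^2 - x * ((u - t) * Lq u) + Mq u (u * y))"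

definition H0 where
  "H0 x y = (let \<tau> = y * (x * y - \<alpha>8); P = x * y + \<alpha>0 in \<tau>^3 + \<tau>^2 * L1 P + \<tau> * L2 P + M0 P x)"

definition H8 where
  "H8 x y = (let u = \<alpha>8 - x * y; P = u + \<alpha>0 in - (x^3) + x^2 * L1 P - x * L2 P + M0 P (u * y))"

lemma h_Hk:
  assumes "y \<noteq> 0" "k \<in> {1..5}"
  shows "h ((rho k - x * y) * y) (1 / y) = Hk k x y"
proof -
  define u where "u = rho k - x * y"
  have "(\<Prod>i\<in>{1..5}. u - rho i) = (u - rho k) * (\<Prod>i\<in>{1..5} - {k}. u - rho i)"
    by (rule prod.remove) (use assms(2) in auto)
  then have "y * h (u * y) (1 / y) = y * Hk k x y"
    using h_uv_0[OF assms(1), of u] by (simp add: Hk_def Let_def u_def algebra_simps)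
  then show ?thesis using assms(1) by (simp add: u_def)
qed

lemma h_Hq:
  assumes "y \<noteq> 0"
  shows "h ((a - x * y) * y + 1) (1 / y) = Hq a b x y" "h ((b - x * y) * y + 1) (1 / y) = Hq b a x y"
proof -
  have "y^2 * h (1 + (a - x * y) * y) (1 / y) = y^2 * Hq a b x y"
    unfolding h_uv_1[OF assms] Hq_def Let_def by algebra
  moreover have "y^2 * h (1 + (b - x * y) * y) (1 / y) = y^2 * Hq b a x y"
    unfolding h_uv_1[OF assms] Hq_def Let_def by algebra
  ultimately show "h ((a - x * y) * y + 1) (1 / y) = Hq a b x y" "h ((b - x * y) * y + 1) (1 / y) = Hq b a x y"
    using assms by (simp_all add: add.commute)
qed

lemma h_H0:
  assumes "x \<noteq> 0"
  shows "h (1 / x) (- (x * y + \<alpha>0) * x) = H0 x y"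
proof -
  define P where "P = x * y + \<alpha>0"
  have T: "P^2 - \<kappa> * P + \<epsilon> = x * (y * (x * y - \<alpha>8))" unfolding P_def \<kappa> \<epsilon> by algebra
  have "x^3 * h (1 / x) (- P * x) = x^3 * H0 x y"
    unfolding h_infinity[OF assms] g_expand T H0_def Let_def P_def[symmetric] by algebra
  then show ?thesis using assms by (simp add: P_def)
qed

lemma H0_H8:
  assumes "y \<noteq> 0"
  shows "H0 ((\<alpha>8 - x * y) * y) (1 / y) = H8 x y"
proof -
  have "(\<alpha>8 - x * y) * y * (1 / y) = \<alpha>8 - x * y" using assms by simp
  moreover have "1 / y * (\<alpha>8 - x * y - \<alpha>8) = - x" using assms by simp
  ultimately show ?thesis unfolding H0_def H8_def Let_def by simp
qed

lemma hol_prod: "open A \<Longrightarrow> (\<And>i. i \<in> I \<Longrightarrow> hol A (f i)) \<Longrightarrow> hol A (\<lambda>z. \<Prod>i\<in>I. f i z)"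
  by (induction I rule: infinite_finite_induct) (simp_all add: hol_const hol_mult)

lemma hol_Rk: "hol UNIV U \<Longrightarrow> hol UNIV W \<Longrightarrow> hol UNIV (\<lambda>z. Rk (U z) (W z))"
  unfolding Rk_def e0_def by (intro hol_intros open_UNIV)

lemma hol_Lq: "hol UNIV U \<Longrightarrow> hol UNIV (\<lambda>z. Lq (U z))"
  unfolding Lq_def by (intro hol_intros open_UNIV)

lemma hol_Mq: "hol UNIV U \<Longrightarrow> hol UNIV W \<Longrightarrow> hol UNIV (\<lambda>z. Mq (U z) (W z))"
  unfolding Mq_def T2_def T3_def e0_def by (intro hol_intros open_UNIV)

lemma hol_L1: "hol UNIV U \<Longrightarrow> hol UNIV (\<lambda>z. L1 (U z))"
  unfolding L1_def by (intro hol_intros open_UNIV)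

lemma hol_L2: "hol UNIV U \<Longrightarrow> hol UNIV (\<lambda>z. L2 (U z))"
  unfolding L2_def by (intro hol_intros open_UNIV)

lemma hol_M0: "hol UNIV U \<Longrightarrow> hol UNIV W \<Longrightarrow> hol UNIV (\<lambda>z. M0 (U z) (W z))"
  unfolding M0_def by (intro hol_intros open_UNIV)

lemma hol_e: "hol UNIV U \<Longrightarrow> hol UNIV (\<lambda>z. e5 (U z))" "hol UNIV U \<Longrightarrow> hol UNIV (\<lambda>z. e4 (U z))"
  "hol UNIV U \<Longrightarrow> hol UNIV (\<lambda>z. e3 (U z))" "hol UNIV U \<Longrightarrow> hol UNIV (\<lambda>z. e2 (U z))"
  "hol UNIV U \<Longrightarrow> hol UNIV (\<lambda>z. e1 (U z))" "hol UNIV U \<Longrightarrow> hol UNIV (\<lambda>z. e0 (U z))"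
  unfolding e_defs by (intro hol_intros open_UNIV; assumption)+

lemma hol_h: "hol UNIV (\<lambda>z. h (fst z) (snd z))"
  unfolding h_def by (intro hol_intros open_UNIV hol_e)

lemma hol_Hk: "hol UNIV (\<lambda>z. Hk k (fst z) (snd z))"
  unfolding Hk_def Let_def by (intro hol_intros open_UNIV hol_Rk hol_prod)

lemma hol_Hq: "hol UNIV (\<lambda>z. Hq s t (fst z) (snd z))"
  unfolding Hq_def Let_def by (intro hol_intros open_UNIV hol_Lq hol_Mq)

lemma hol_H0: "hol UNIV (\<lambda>z. H0 (fst z) (snd z))"
  unfolding H0_def Let_def by (intro hol_intros open_UNIV hol_L1 hol_L2 hol_M0)

lemma hol_H8: "hol UNIV (\<lambda>z. H8 (fst z) (snd z))"
  unfolding H8_def Let_def by (intro hol_intros open_UNIV hol_L1 hol_L2 hol_M0)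

end

section \<open>Properness of the Hamiltonian\<close>

text \<open>The zeros of G over K with |v| at most 1 form a compact set on which v is nonzero, so
  |v| has a positive minimum there.\<close>

lemma zero_free_near_compact:
  assumes G: "continuous_on UNIV (G :: c2 \<Rightarrow> complex)" and K: "compact K" and nz: "\<And>u. u \<in> K \<Longrightarrow> G (u, 0) \<noteq> 0"
  shows "\<exists>\<eta>>0. \<forall>u\<in>K. \<forall>v. norm v < \<eta> \<longrightarrow> G (u, v) \<noteq> 0"
proof -
  define Z where "Z = (K \<times> cball 0 1) \<inter> {z. G z = 0}"
  have "closed {z. G z = 0}"
    by (rule closed_Collect_eq[OF G continuous_on_const])
  then have Z: "compact Z" unfolding Z_def by (intro compact_Int_closed compact_Times K compact_cball)
  show ?thesis
  proof (cases "Z = {}")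
    case True
    have "G (u, v) \<noteq> 0" if "u \<in> K" "norm v < 1" for u v
    proof
      assume "G (u, v) = 0"
      then have "(u, v) \<in> Z" using that by (simp add: Z_def)
      then show False using True by simp
    qed
    then show ?thesis by (intro exI[of _ 1]) simp
  next
    case False
    have "continuous_on Z (\<lambda>z. norm (snd z))" by (intro continuous_intros)
    from continuous_attains_inf[OF Z False this]
    obtain z0 where z0: "z0 \<in> Z" "\<And>z. z \<in> Z \<Longrightarrow> norm (snd z0) \<le> norm (snd z)" by blast
    obtain u0 v0 where uv: "z0 = (u0, v0)" by (cases z0)
    have "v0 \<noteq> 0" using z0(1) nz[of u0] by (auto simp: uv Z_def)
    have "G (u, v) \<noteq> 0" if "u \<in> K" "norm v < min 1 (norm v0)" for u v
    proof
      assume "G (u, v) = 0"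
      then have "(u, v) \<in> Z" using that by (simp add: Z_def)
      from z0(2)[OF this] that(2) show False by (simp add: uv)
    qed
    then show ?thesis using \<open>v0 \<noteq> 0\<close> by (intro exI[of _ "min 1 (norm v0)"]) simp
  qed
qed

lemma nonzero_near_origin:
  assumes G: "continuous_on UNIV (G :: c2 \<Rightarrow> complex)" and nz: "G (0, 0) \<noteq> 0"
  obtains \<eta> where "\<eta> > 0" "\<And>u v. norm u < \<eta> \<Longrightarrow> norm v < \<eta> \<Longrightarrow> G (u, v) \<noteq> 0"
proof -
  have "open {z. G z \<noteq> 0}" by (rule open_Collect_neq[OF G continuous_on_const])
  moreover have "(0, 0) \<in> {z. G z \<noteq> 0}" using nz by simp
  ultimately obtain R where R: "R > 0" "cball 0 R \<times> cball 0 R \<subseteq> {z. G z \<noteq> 0}"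
    by (rule open_contains_bicball)
  have "G (u, v) \<noteq> 0" if "norm u < R" "norm v < R" for u v
    using subsetD[OF R(2), of "(u, v)"] that by simp
  with R(1) show thesis by (rule that)
qed

text \<open>If x were large on the level set while xy is small, then F would vanish close to (0, 0).
  In the applications xy is the distance from the centre along the exceptional curve, up to
  sign.\<close>

lemma level_set_chart:
  assumes F: "continuous_on UNIV (F :: c2 \<Rightarrow> complex)" "F (0, 0) \<noteq> 0"
    and H: "\<And>x y. x \<noteq> 0 \<Longrightarrow> H x y - c = x ^ n * F (x * y, 1 / x)"
  shows "\<exists>\<mu>>0. \<forall>x y. H x y = c \<longrightarrow> norm (x * y) < \<mu> \<longrightarrow> norm x \<le> 1 / \<mu>"
proof -
  obtain \<eta> where \<eta>: "\<eta> > 0" "\<And>u v. norm u < \<eta> \<Longrightarrow> norm v < \<eta> \<Longrightarrow> F (u, v) \<noteq> 0"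
    using nonzero_near_origin[OF F] by metis
  have "norm x \<le> 1 / \<eta>" if "H x y = c" "norm (x * y) < \<eta>" for x y
  proof (rule ccontr)
    assume *: "\<not> norm x \<le> 1 / \<eta>"
    moreover have "1 / \<eta> > 0" using \<eta>(1) by simp
    ultimately have nx: "norm x > 0" by linarith
    then have "x \<noteq> 0" by auto
    have "norm (1 / x) < \<eta>" using * nx \<eta>(1) by (simp add: norm_divide field_simps)
    then have "F (x * y, 1 / x) \<noteq> 0" using \<eta>(2) that(2) by blast
    then show False using H[OF \<open>x \<noteq> 0\<close>, of y] that(1) \<open>x \<noteq> 0\<close> by simp
  qed
  with \<eta>(1) show ?thesis by blast
qed

text \<open>Controls a level set near a removed fibre z = 0 in three regimes for u = z p. Large u is
  excluded for small z by \<open>G1\<close>, the level equation in z and t = 1/u. For bounded u away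
  from the centres, \<open>G2\<close> excludes small v = 1/p. For u close to a centre, the plane at
  that centre has bounded coordinates.\<close>

lemma level_set_region:
  fixes h :: "complex \<Rightarrow> complex \<Rightarrow> complex" and pos :: "'k \<Rightarrow> complex" and G1 G2 :: "c2 \<Rightarrow> complex"
  assumes G1: "continuous_on UNIV G1" "G1 (0, 0) \<noteq> 0"
      "\<And>z t. z \<noteq> 0 \<Longrightarrow> t \<noteq> 0 \<Longrightarrow> h z (1 / (z * t)) = c \<Longrightarrow> G1 (z, t) = 0"
    and G2: "continuous_on UNIV G2" "\<And>u. u \<notin> pos ` J \<Longrightarrow> G2 (u, 0) \<noteq> 0"
      "\<And>u v. v \<noteq> 0 \<Longrightarrow> h (u * v) (1 / v) = c \<Longrightarrow> G2 (u, v) = 0"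
    and J: "finite J"
    and charts: "\<And>k. k \<in> J \<Longrightarrow> \<exists>\<mu>>0. \<forall>x y. H k x y = c \<longrightarrow> norm (x * y) < \<mu> \<longrightarrow> norm x \<le> 1 / \<mu>"
    and conv: "\<And>k z p. k \<in> J \<Longrightarrow> p \<noteq> 0 \<Longrightarrow> H k (- (z * p - pos k) * p) (1 / p) = h z p"
  shows "\<exists>\<eta>>0. \<exists>R. \<forall>z p. norm z < \<eta> \<longrightarrow> h z p = c \<longrightarrow>
    norm p \<le> R \<or> (\<exists>k\<in>J. p \<noteq> 0 \<and> norm (- (z * p - pos k) * p) \<le> R \<and> norm (1 / p) \<le> R)"
proof -
  obtain \<eta> where \<eta>: "\<eta> > 0" "\<And>z t. norm z < \<eta> \<Longrightarrow> norm t < \<eta> \<Longrightarrow> G1 (z, t) \<noteq> 0"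
    using nonzero_near_origin[OF G1(1,2)] by metis
  obtain \<mu> where \<mu>: "\<And>k. k \<in> J \<Longrightarrow> \<mu> k > 0"
    "\<And>k x y. k \<in> J \<Longrightarrow> H k x y = c \<Longrightarrow> norm (x * y) < \<mu> k \<Longrightarrow> norm x \<le> 1 / \<mu> k"
    using charts by metis
  \<comment> \<open>The radius \<open>1 / \<eta>\<close> is the bound on u obtained from
    \<open>G1\<close>; the discs of radius \<open>\<mu> k\<close> are left to the planes at the
    centres.\<close>
  define K where "K = cball 0 (1 / \<eta>) - (\<Union>k\<in>J. ball (pos k) (\<mu> k))"
  have "compact K" unfolding K_def by (intro compact_diff compact_cball open_UN) auto
  moreover have "G2 (u, 0) \<noteq> 0" if "u \<in> K" for u
  proof (rule G2(2))
    show "u \<notin> pos ` J" using that \<mu>(1) by (auto simp: K_def)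
  qed
  ultimately obtain \<eta>' where \<eta>': "\<eta>' > 0" "\<And>u v. u \<in> K \<Longrightarrow> norm v < \<eta>' \<Longrightarrow> G2 (u, v) \<noteq> 0"
    using zero_free_near_compact[OF G2(1)] by metis
  \<comment> \<open>The summands bound, in this order, p, 1/p and the first coordinates in the
    planes at the centres.\<close>
  define R where "R = 1 / \<eta>' + \<eta>' + (\<Sum>k\<in>J. 1 / \<mu> k)"
  have sum_nn: "(\<Sum>k\<in>J. 1 / \<mu> k) \<ge> 0" using \<mu>(1) by (intro sum_nonneg) (simp add: less_imp_le)
  have R: "1 / \<eta>' \<le> R" "\<eta>' \<le> R" "k \<in> J \<Longrightarrow> 1 / \<mu> k \<le> R" for k
  proof -
    show "1 / \<eta>' \<le> R" "\<eta>' \<le> R" using \<eta>'(1) sum_nn by (simp_all add: R_def)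
    assume k: "k \<in> J"
    have "1 / \<mu> k \<le> (\<Sum>k\<in>J. 1 / \<mu> k)"
      using \<mu>(1) by (intro member_le_sum[OF k _ J]) (simp add: less_imp_le)
    moreover have "1 / \<eta>' > 0" using \<eta>'(1) by simp
    ultimately show "1 / \<mu> k \<le> R" using \<eta>'(1) unfolding R_def by linarith
  qed
  have "norm p \<le> R \<or> (\<exists>k\<in>J. p \<noteq> 0 \<and> norm (- (z * p - pos k) * p) \<le> R \<and> norm (1 / p) \<le> R)"
    if z: "norm z < \<eta>" and hc: "h z p = c" for z p
  proof (cases "norm p \<le> 1 / \<eta>'")
    case True
    then show ?thesis using R(1) by linarith
  next
    case False
    moreover have "1 / \<eta>' > 0" using \<eta>'(1) by simp
    ultimately have np: "norm p > 0" by linarith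
    then have p: "p \<noteq> 0" by auto
    have v: "norm (1 / p) < \<eta>'" using False np \<eta>'(1) by (simp add: norm_divide field_simps)
    define u where "u = z * p"
    have zu: "u * (1 / p) = z" using p by (simp add: u_def)
    have "G2 (u, 1 / p) = 0" by (rule G2(3)) (use p hc zu in auto)
    then have "u \<notin> K" using \<eta>'(2) v by blast
    moreover have "norm u \<le> 1 / \<eta>"
    proof (cases "z = 0")
      case True
      then show ?thesis using \<eta>(1) by (simp add: u_def)
    next
      case zn: False
      have u0: "u \<noteq> 0" using zn p by (simp add: u_def)
      have "1 / (z * (1 / u)) = p" using zn p by (simp add: u_def)
      then have "G1 (z, 1 / u) = 0" by (intro G1(3) zn) (use hc u0 in auto)
      then have "\<not> norm (1 / u) < \<eta>" using \<eta>(2)[OF z] by blast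
      then show ?thesis using u0 \<eta>(1) by (simp add: norm_divide field_simps)
    qed
    ultimately obtain k where k: "k \<in> J" "u \<in> ball (pos k) (\<mu> k)" by (auto simp: K_def)
    define x where "x = - (z * p - pos k) * p"
    have "H k x (1 / p) = c" unfolding x_def using conv[OF k(1) p] hc by simp
    moreover have "x * (1 / p) = pos k - u" using p by (simp add: x_def u_def)
    then have "norm (x * (1 / p)) < \<mu> k" using k(2) by (simp add: dist_norm)
    ultimately have "norm x \<le> 1 / \<mu> k" by (rule \<mu>(2)[OF k(1)])
    then have "norm x \<le> R" "norm (1 / p) \<le> R" using R(2) R(3)[OF k(1)] v by linarith+
    then show ?thesis using k(1) p unfolding x_def by blast
  qed
  with \<eta>(1) show ?thesis by blast
qed

context ham_coeffs
begin

lemma chart_k: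
  assumes k: "k \<in> {1..5}"
  shows "\<exists>\<mu>>0. \<forall>x y. Hk k x y = c \<longrightarrow> norm (x * y) < \<mu> \<longrightarrow> norm x \<le> 1 / \<mu>"
proof -
  define F where "F = (\<lambda>z. - (\<Prod>i\<in>{1..5} - {k}. (rho k - fst z) - rho i)
    + snd z * (Rk (rho k - fst z) ((rho k - fst z) * (fst z * snd z)) - c))"
  have "hol UNIV F" unfolding F_def by (intro hol_intros open_UNIV hol_Rk hol_prod)
  then have 1: "continuous_on UNIV F" by (rule hol_continuous_on)
  \<comment> \<open>\<open>F (0, 0)\<close> is minus the product of the differences of
    \<open>rho k\<close> from the other centres.\<close>
  have "rho k \<noteq> rho i" if "i \<in> {1..5} - {k}" for i
    using rho_inj k that by (auto dest: inj_onD)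
  then have 2: "F (0, 0) \<noteq> 0" by (simp add: F_def)
  have 3: "Hk k x y - c = x ^ 1 * F (x * y, 1 / x)" if x: "x \<noteq> 0" for x y
  proof -
    define i where "i = 1 / x"
    have xi: "x * i = 1" using x by (simp add: i_def)
    then have yi: "x * y * i = y" by algebra
    show ?thesis unfolding F_def Hk_def Let_def fst_conv snd_conv i_def[symmetric] yi using xi by algebra
  qed
  show ?thesis by (rule level_set_chart[OF 1 2 3])
qed

lemma chart_q:
  assumes st: "s \<noteq> t"
  shows "\<exists>\<mu>>0. \<forall>x y. Hq s t x y = c \<longrightarrow> norm (x * y) < \<mu> \<longrightarrow> norm x \<le> 1 / \<mu>"
proof -
  define F where "F = (\<lambda>z. (s - fst z - t)^2 - snd z * ((s - fst z - t) * Lq (s - fst z))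
    + snd z^2 * (Mq (s - fst z) ((s - fst z) * (fst z * snd z)) - c))"
  have "hol UNIV F" unfolding F_def by (intro hol_intros open_UNIV hol_Lq hol_Mq)
  then have 1: "continuous_on UNIV F" by (rule hol_continuous_on)
  have 2: "F (0, 0) \<noteq> 0" using st by (simp add: F_def)
  have 3: "Hq s t x y - c = x ^ 2 * F (x * y, 1 / x)" if x: "x \<noteq> 0" for x y
  proof -
    define i where "i = 1 / x"
    have xi: "x * i = 1" using x by (simp add: i_def)
    then have yi: "x * y * i = y" by algebra
    show ?thesis unfolding F_def Hq_def Let_def fst_conv snd_conv i_def[symmetric] yi using xi by algebra
  qed
  show ?thesis by (rule level_set_chart[OF 1 2 3])
qed

lemma chart_8: "\<exists>\<mu>>0. \<forall>x y. H8 x y = c \<longrightarrow> norm (x * y) < \<mu> \<longrightarrow> norm x \<le> 1 / \<mu>"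
proof -
  define F where "F = (\<lambda>z. - 1 + snd z * L1 (\<alpha>8 - fst z + \<alpha>0) - snd z^2 * L2 (\<alpha>8 - fst z + \<alpha>0)
    + snd z^3 * (M0 (\<alpha>8 - fst z + \<alpha>0) ((\<alpha>8 - fst z) * (fst z * snd z)) - c))"
  have "hol UNIV F" unfolding F_def by (intro hol_intros open_UNIV hol_L1 hol_L2 hol_M0)
  then have 1: "continuous_on UNIV F" by (rule hol_continuous_on)
  have 2: "F (0, 0) \<noteq> 0" by (simp add: F_def)
  have 3: "H8 x y - c = x ^ 3 * F (x * y, 1 / x)" if x: "x \<noteq> 0" for x y
  proof -
    define i where "i = 1 / x"
    have xi: "x * i = 1" using x by (simp add: i_def)
    then have yi: "x * y * i = y" by algebra
    show ?thesis unfolding F_def H8_def Let_def fst_conv snd_conv i_def[symmetric] yi using xi by algebra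
  qed
  show ?thesis by (rule level_set_chart[OF 1 2 3])
qed

lemma region_0:
  "\<exists>\<eta>>0. \<exists>R. \<forall>z p. norm z < \<eta> \<longrightarrow> h z p = c \<longrightarrow>
    norm p \<le> R \<or> (\<exists>k\<in>{1..5}. p \<noteq> 0 \<and> norm (- (z * p - rho k) * p) \<le> R \<and> norm (1 / p) \<le> R)"
proof -
  \<comment> \<open>\<open>Ga\<close> is z t^6 (h - c) at p = 1 / (z t), the factor being the one
    that clears z^5 p^6; \<open>Gb\<close> is v (h - c) in the coordinates u, v.\<close>
  define Ga where "Ga = (\<lambda>z. (fst z - 1)^4 + snd z * (fst z - 1)^3 * e5 (fst z) + snd z^2 * (fst z - 1)^2 * e4 (fst z)
    + snd z^3 * (fst z - 1) * e3 (fst z) + snd z^4 * e2 (fst z) + snd z^5 * e1 (fst z)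
    + fst z * snd z^6 * (e0 (fst z) - c))"
  define Gb where "Gb = (\<lambda>z. (\<Prod>k\<in>{1..5}. fst z - rho k) + snd z * (Rk (fst z) (fst z * snd z) - c))"
  have "hol UNIV Ga" unfolding Ga_def by (intro hol_intros open_UNIV hol_e)
  then have a1: "continuous_on UNIV Ga" by (rule hol_continuous_on)
  have a2: "Ga (0, 0) \<noteq> 0" by (simp add: Ga_def)
  have a3: "Ga (z, t) = 0" if zt: "z \<noteq> 0" "t \<noteq> 0" "h z (1 / (z * t)) = c" for z t
  proof -
    define p where "p = 1 / (z * t)"
    have "z * t * p = 1" using zt by (simp add: p_def)
    then have "z * t^6 * (h z p - c) = Ga (z, t)" unfolding h_def Ga_def fst_conv snd_conv by algebra
    then show ?thesis using zt(3) by (simp add: p_def)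
  qed
  have "hol UNIV Gb" unfolding Gb_def by (intro hol_intros open_UNIV hol_Rk hol_prod)
  then have b1': "continuous_on UNIV Gb" by (rule hol_continuous_on)
  have b2': "Gb (u, 0) \<noteq> 0" if "u \<notin> rho ` {1..5}" for u
  proof -
    have "u - rho k \<noteq> 0" if "k \<in> {1..5}" for k using \<open>u \<notin> rho ` {1..5}\<close> that by auto
    then show ?thesis by (simp add: Gb_def)
  qed
  have b3': "Gb (u, v) = 0" if "v \<noteq> 0" "h (u * v) (1 / v) = c" for u v
    using h_uv_0[OF that(1), of u] unfolding Gb_def that(2) fst_conv snd_conv by algebra
  show ?thesis
  proof (rule level_set_region[OF a1 a2 a3 b1' b2' b3' _ chart_k])
    fix k :: nat and z p :: complex assume k: "k \<in> {1..5}" and p: "p \<noteq> 0"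
    have "(rho k - (- (z * p - rho k) * p) * (1 / p)) * (1 / p) = z" using p by (simp add: field_simps)
    then show "Hk k (- (z * p - rho k) * p) (1 / p) = h z p"
      using h_Hk[of "1 / p" k "- (z * p - rho k) * p"] p k by simp
  qed auto
qed

lemma region_1:
  "\<exists>\<eta>>0. \<exists>R. \<forall>z p. norm z < \<eta> \<longrightarrow> h (1 + z) p = c \<longrightarrow>
    norm p \<le> R \<or> (\<exists>s\<in>{a, b}. p \<noteq> 0 \<and> norm (- (z * p - s) * p) \<le> R \<and> norm (1 / p) \<le> R)"
proof -
  \<comment> \<open>Here the leading term contains (q - 1)^4 p^6, so the clearing factor is z^2 t^6;
    for \<open>Gb\<close> it is v^2.\<close>
  define Ga where "Ga = (\<lambda>z. (1 + fst z)^5 + snd z * (1 + fst z)^4 * e5 (1 + fst z) + snd z^2 * (1 + fst z)^3 * e4 (1 + fst z)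
    + snd z^3 * (1 + fst z)^2 * e3 (1 + fst z) + snd z^4 * (1 + fst z) * e2 (1 + fst z)
    + fst z * snd z^5 * e1 (1 + fst z) + fst z^2 * snd z^6 * (e0 (1 + fst z) - c))"
  define Gb where "Gb = (\<lambda>z. ((fst z - a) * (fst z - b))^2 + snd z * ((fst z - a) * (fst z - b) * Lq (fst z))
    + snd z^2 * (Mq (fst z) (fst z * snd z) - c))"
  have "hol UNIV Ga" unfolding Ga_def by (intro hol_intros open_UNIV hol_e)
  then have a1: "continuous_on UNIV Ga" by (rule hol_continuous_on)
  have a2: "Ga (0, 0) \<noteq> 0" by (simp add: Ga_def)
  have a3: "Ga (z, t) = 0" if zt: "z \<noteq> 0" "t \<noteq> 0" "h (1 + z) (1 / (z * t)) = c" for z t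
  proof -
    define p where "p = 1 / (z * t)"
    have "z * t * p = 1" using zt by (simp add: p_def)
    then have "z^2 * t^6 * (h (1 + z) p - c) = Ga (z, t)" unfolding h_def Ga_def fst_conv snd_conv by algebra
    then show ?thesis using zt(3) by (simp add: p_def)
  qed
  have "hol UNIV Gb" unfolding Gb_def by (intro hol_intros open_UNIV hol_Lq hol_Mq)
  then have b1': "continuous_on UNIV Gb" by (rule hol_continuous_on)
  have b2': "Gb (u, 0) \<noteq> 0" if "u \<notin> id ` {a, b}" for u using that by (simp add: Gb_def)
  have b3': "Gb (u, v) = 0" if "v \<noteq> 0" "h (1 + u * v) (1 / v) = c" for u v
    using h_uv_1[OF that(1), of u] unfolding Gb_def that(2) fst_conv snd_conv by algebra
  have "\<exists>\<eta>>0. \<exists>R. \<forall>z p. norm z < \<eta> \<longrightarrow> h (1 + z) p = c \<longrightarrow>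
    norm p \<le> R \<or> (\<exists>s\<in>{a, b}. p \<noteq> 0 \<and> norm (- (z * p - id s) * p) \<le> R \<and> norm (1 / p) \<le> R)"
  proof (rule level_set_region[where H = "\<lambda>s. if s = a then Hq a b else Hq b a" and h = "\<lambda>z. h (1 + z)", OF a1 a2 a3 b1' b2' b3'])
    show "\<exists>\<mu>>0. \<forall>x y. (if s = a then Hq a b else Hq b a) x y = c \<longrightarrow> norm (x * y) < \<mu> \<longrightarrow> norm x \<le> 1 / \<mu>"
      if "s \<in> {a, b}" for s using chart_q[OF ab, of c] chart_q[OF ab[symmetric], of c] by (cases "s = a") simp_all
    fix s z p assume s: "s \<in> {a, b}" and p: "(p :: complex) \<noteq> 0"
    have "(s - (- (z * p - s) * p) * (1 / p)) * (1 / p) + 1 = 1 + z" using p by (simp add: field_simps)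
    then show "(if s = a then Hq a b else Hq b a) (- (z * p - id s) * p) (1 / p) = h (1 + z) p"
      using h_Hq[of "1 / p" "- (z * p - s) * p"] p s ab by (auto simp: add.commute[of 1 z])
  qed auto
  then show ?thesis by simp
qed

lemma region_infinity:
  "\<exists>\<eta>>0. \<exists>R. \<forall>x y. norm x < \<eta> \<longrightarrow> H0 x y = c \<longrightarrow>
    norm y \<le> R \<or> (y \<noteq> 0 \<and> norm (- (x * y - \<alpha>8) * y) \<le> R \<and> norm (1 / y) \<le> R)"
proof -
  \<comment> \<open>This is z^3 t^6 (H0 - c), made polynomial through the relation t P = 1 +
    \<alpha>0 t.\<close>
  define Ga where "Ga = (\<lambda>z. (1 + \<alpha>0 * snd z)^6 * (1 - fst z)^4
    - snd z * (1 + \<alpha>0 * snd z)^5 * ((1 - fst z)^3 * (3 * \<kappa> + b1 * fst z))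
    + snd z^2 * (1 + \<alpha>0 * snd z)^4 * ((1 - fst z)^2 * (3 * (\<kappa>^2 + \<epsilon>) + m * fst z + b2 * fst z^2))
    - snd z^3 * (1 + \<alpha>0 * snd z)^3 * ((1 - fst z) * (A3 + X * fst z - f3 * fst z^2 + b3 * fst z^3))
    + snd z^4 * (1 + \<alpha>0 * snd z)^2 * (A2 + B2 * fst z + C2 * fst z^2 + f2 * fst z^3 + b4 * fst z^4)
    - snd z^5 * (1 + \<alpha>0 * snd z) * (3 * \<kappa> * \<epsilon>^2 + B1 * fst z + C1 * fst z^2 + G1 * fst z^3 - b5 * fst z^4)
    + snd z^6 * (\<epsilon>^3 + \<epsilon>^2 * b0 * fst z + \<epsilon> * c0 * fst z^2 - c * fst z^3))"
  define Gb where "Gb = (\<lambda>z. (fst z - \<alpha>8)^3 + snd z * ((fst z - \<alpha>8)^2 * L1 (fst z + \<alpha>0))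
    + snd z^2 * ((fst z - \<alpha>8) * L2 (fst z + \<alpha>0)) + snd z^3 * (M0 (fst z + \<alpha>0) (fst z * snd z) - c))"
  have "hol UNIV Ga" unfolding Ga_def by (intro hol_intros open_UNIV)
  then have a1: "continuous_on UNIV Ga" by (rule hol_continuous_on)
  have a2: "Ga (0, 0) \<noteq> 0" by (simp add: Ga_def)
  have a3: "Ga (z, t) = 0" if zt: "z \<noteq> 0" "t \<noteq> 0" "H0 z (1 / (z * t)) = c" for z t
  proof -
    define P where "P = z * (1 / (z * t)) + \<alpha>0"
    have T: "P^2 - \<kappa> * P + \<epsilon> = z * (1 / (z * t) * (z * (1 / (z * t)) - \<alpha>8))" unfolding P_def \<kappa> \<epsilon> by algebra
    have "z^3 * H0 z (1 / (z * t)) = g P z"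
      unfolding g_expand T H0_def Let_def P_def[symmetric] by algebra
    then have "g P z = z^3 * c" using zt(3) by simp
    moreover have "t * P = 1 + \<alpha>0 * t" using zt(1,2) by (simp add: P_def field_simps)
    ultimately show ?thesis unfolding g_def Ga_def fst_conv snd_conv by algebra
  qed
  have "hol UNIV Gb" unfolding Gb_def by (intro hol_intros open_UNIV hol_L1 hol_L2 hol_M0)
  then have b1': "continuous_on UNIV Gb" by (rule hol_continuous_on)
  have b2': "Gb (u, 0) \<noteq> 0" if "u \<notin> (\<lambda>k. \<alpha>8) ` {()}" for u using that by (simp add: Gb_def)
  have b3': "Gb (u, v) = 0" if v: "v \<noteq> 0" and H: "H0 (u * v) (1 / v) = c" for u v
  proof -
    define i where "i = 1 / v"
    have i: "v * i = 1" using v by (simp add: i_def)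
    then have uvi: "u * v * i = u" by algebra
    have "(i * (u - \<alpha>8))^3 + (i * (u - \<alpha>8))^2 * L1 (u + \<alpha>0) + i * (u - \<alpha>8) * L2 (u + \<alpha>0) + M0 (u + \<alpha>0) (u * v) = c"
      by (rule H[unfolded H0_def Let_def i_def[symmetric] uvi])
    moreover have "Gb (u, v) = v^3 * (((i * (u - \<alpha>8))^3 + (i * (u - \<alpha>8))^2 * L1 (u + \<alpha>0)
        + i * (u - \<alpha>8) * L2 (u + \<alpha>0) + M0 (u + \<alpha>0) (u * v)) - c)"
      using i unfolding Gb_def fst_conv snd_conv by algebra
    ultimately show ?thesis by simp
  qed
  have "\<exists>\<eta>>0. \<exists>R. \<forall>x y. norm x < \<eta> \<longrightarrow> H0 x y = c \<longrightarrow>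
    norm y \<le> R \<or> (\<exists>k\<in>{()}. y \<noteq> 0 \<and> norm (- (x * y - \<alpha>8) * y) \<le> R \<and> norm (1 / y) \<le> R)"
  proof (rule level_set_region[where H = "\<lambda>_. H8" and pos = "\<lambda>_. \<alpha>8", OF a1 a2 a3 b1' b2' b3' _ chart_8])
    fix z p assume p: "(p :: complex) \<noteq> 0"
    have "(\<alpha>8 - (- (z * p - \<alpha>8) * p) * (1 / p)) * (1 / p) = z" using p by (simp add: field_simps)
    then show "H8 (- (z * p - \<alpha>8) * p) (1 / p) = H0 z p"
      using H0_H8[of "1 / p" "- (z * p - \<alpha>8) * p"] p by simp
  qed auto
  then show ?thesis by simp
qed

text \<open>The coefficient of p^6 in h vanishes only at q = 0 and q = 1, so p cannot escape to
  infinity over the rest.\<close>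

lemma region_generic:
  assumes "compact K" "0 \<notin> K" "1 \<notin> K"
  shows "\<exists>R. \<forall>q\<in>K. \<forall>p. h q p = c \<longrightarrow> norm p \<le> R"
proof -
  define G where "G = (\<lambda>z. fst z^5 * (fst z - 1)^4 + fst z^4 * (fst z - 1)^3 * e5 (fst z) * snd z
     + fst z^3 * (fst z - 1)^2 * e4 (fst z) * snd z^2 + fst z^2 * (fst z - 1) * e3 (fst z) * snd z^3
     + fst z * e2 (fst z) * snd z^4 + e1 (fst z) * snd z^5 + (e0 (fst z) - c) * snd z^6)"
  have "hol UNIV G" unfolding G_def by (intro hol_intros open_UNIV hol_e)
  then have 1: "continuous_on UNIV G" by (rule hol_continuous_on)
  have 2: "G (u, 0) \<noteq> 0" if "u \<in> K" for u
  proof -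
    have "u \<noteq> 0" "u \<noteq> 1" using assms that by auto
    then show ?thesis by (simp add: G_def)
  qed
  obtain \<eta> where \<eta>: "\<eta> > 0" "\<And>u v. u \<in> K \<Longrightarrow> norm v < \<eta> \<Longrightarrow> G (u, v) \<noteq> 0"
    using zero_free_near_compact[OF 1 assms(1) 2] by metis
  have "norm p \<le> 1 / \<eta>" if q: "q \<in> K" and hc: "h q p = c" for q p
  proof (rule ccontr)
    assume *: "\<not> norm p \<le> 1 / \<eta>"
    moreover have "1 / \<eta> > 0" using \<eta>(1) by simp
    ultimately have np: "norm p > 0" by linarith
    then have p: "p \<noteq> 0" by auto
    define i where "i = 1 / p"
    have "p * i = 1" using p by (simp add: i_def)
    then have "G (q, i) = i^6 * (h q p - c)" unfolding G_def h_def fst_conv snd_conv by algebra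
    then have "G (q, i) = 0" using hc by simp
    moreover have "norm i < \<eta>" using * np \<eta>(1) by (simp add: i_def norm_divide field_simps)
    ultimately show False using \<eta>(2)[OF q] by blast
  qed
  then show ?thesis by blast
qed

end

section \<open>The ten Hamiltonians\<close>

definition bounded_point :: "(nat \<Rightarrow> complex) \<Rightarrow> real \<Rightarrow> bl2 \<Rightarrow> bool" where
  "bounded_point \<alpha> R s \<longleftrightarrow> (\<exists>j\<in>ten_idx. \<exists>w. psi \<alpha> j w = s \<and> norm w \<le> R)"

lemma bounded_point_mono: "bounded_point \<alpha> R s \<Longrightarrow> R \<le> R' \<Longrightarrow> bounded_point \<alpha> R' s"
  unfolding bounded_point_def by (meson order_trans)

lemma bounded_pointI:
  assumes "j \<in> ten_idx" "psi \<alpha> j (x, y) = s" "norm x \<le> R" "norm y \<le> R'"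
  shows "bounded_point \<alpha> (R + R') s"
  unfolding bounded_point_def
  using assms norm_Pair_le[of x y] by (intro bexI[of _ j] exI[of _ "(x, y)"]) auto

locale ten_hamiltonians = ham_coeffs "\<alpha> 0" "\<alpha> 8" "\<alpha> 6" "\<alpha> 6 + \<alpha> 7" \<kappa> \<epsilon> \<gamma>1 \<gamma>2 b1 b2 b3 b4 b5 v m b0 A3 X k0 A2 B2 C2 c2 c1 c0 B1 C1 G1 f3 f2 "\<rho> \<alpha>"
  for \<alpha> \<kappa> \<epsilon> \<gamma>1 \<gamma>2 b1 b2 b3 b4 b5 v m b0 A3 X k0 A2 B2 C2 c2 c1 c0 B1 C1 G1 f3 f2
begin

definition H :: "nat option \<Rightarrow> c2 \<Rightarrow> complex" where
  "H i z = (case i of None \<Rightarrow> h (fst z) (snd z) | Some k \<Rightarrow>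
     if k = 0 then H0 (fst z) (snd z) else if k \<le> 5 then Hk k (fst z) (snd z)
     else if k = 6 then Hq (\<alpha> 6) (\<alpha> 6 + \<alpha> 7) (fst z) (snd z)
     else if k = 7 then Hq (\<alpha> 6 + \<alpha> 7) (\<alpha> 6) (fst z) (snd z) else H8 (fst z) (snd z))"

lemma hol_H: "hol UNIV (H i)"
proof (cases i)
  case None
  then have "H i = (\<lambda>z. h (fst z) (snd z))" by (simp add: H_def fun_eq_iff)
  then show ?thesis using hol_h by simp
next
  case (Some k)
  consider "k = 0" | "1 \<le> k" "k \<le> 5" | "k = 6" | "k = 7" | "k \<ge> 8" by linarith
  then show ?thesis
  proof cases
    case 1
    then have "H i = (\<lambda>z. H0 (fst z) (snd z))" using Some by (simp add: H_def fun_eq_iff)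
    then show ?thesis using hol_H0 by simp
  next
    case 2
    then have "H i = (\<lambda>z. Hk k (fst z) (snd z))" using Some by (simp add: H_def fun_eq_iff)
    then show ?thesis using hol_Hk by simp
  next
    case 3
    then have "H i = (\<lambda>z. Hq (\<alpha> 6) (\<alpha> 6 + \<alpha> 7) (fst z) (snd z))" using Some by (simp add: H_def fun_eq_iff)
    then show ?thesis using hol_Hq by simp
  next
    case 4
    then have "H i = (\<lambda>z. Hq (\<alpha> 6 + \<alpha> 7) (\<alpha> 6) (fst z) (snd z))" using Some by (simp add: H_def fun_eq_iff)
    then show ?thesis using hol_Hq by simp
  next
    case 5
    then have "H i = (\<lambda>z. H8 (fst z) (snd z))" using Some by (simp add: H_def fun_eq_iff)
    then show ?thesis using hol_H8 by simp
  qed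
qed

lemma H_r:
  assumes "j \<le> 7" "z \<in> r_dom j"
  shows "H (Some j) (r \<alpha> j z) = H None z"
proof -
  obtain q p where z: "z = (q, p)" by (cases z)
  consider "j = 0" | "1 \<le> j" "j \<le> 5" | "j = 6" | "j = 7" using assms(1) by linarith
  then show ?thesis
  proof cases
    case 1
    then have q: "q \<noteq> 0" using assms by (simp add: z r_dom_def)
    then have "- (1 / q * (- (q * p + \<alpha> 0) * q) + \<alpha> 0) * (1 / q) = p" by (simp add: field_simps)
    then show ?thesis using 1 q h_H0[of "1 / q" "- (q * p + \<alpha> 0) * q"] by (simp add: z r_simps H_def)
  next
    case 2
    then have p: "p \<noteq> 0" using assms by (simp add: z r_dom_def)
    then have "(\<rho> \<alpha> j - (- (p * q - \<rho> \<alpha> j) * p) * (1 / p)) * (1 / p) = q" by (simp add: field_simps)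
    then show ?thesis using 2 p h_Hk[of "1 / p" j "- (p * q - \<rho> \<alpha> j) * p"] by (simp add: z r_simps H_def)
  next
    case 3
    then have p: "p \<noteq> 0" using assms by (simp add: z r_dom_def)
    then have "(\<alpha> 6 - (- (p * (q - 1) - \<alpha> 6) * p) * (1 / p)) * (1 / p) + 1 = q" by (simp add: field_simps)
    then show ?thesis using 3 p h_Hq(1)[of "1 / p" "- (p * (q - 1) - \<alpha> 6) * p"] by (simp add: z r_simps H_def)
  next
    case 4
    then have p: "p \<noteq> 0" using assms by (simp add: z r_dom_def)
    then have "(\<alpha> 6 + \<alpha> 7 - (- (p * (q - 1) - (\<alpha> 6 + \<alpha> 7)) * p) * (1 / p)) * (1 / p) + 1 = q" by (simp add: field_simps)
    then show ?thesis using 4 p h_Hq(2)[of "1 / p" "- (p * (q - 1) - (\<alpha> 6 + \<alpha> 7)) * p"] by (simp add: z r_simps H_def)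
  qed
qed

lemma H_r_8:
  assumes "z \<in> r_dom 8"
  shows "H (Some 8) (r \<alpha> 8 z) = H (Some 0) z"
proof -
  obtain q p where z: "z = (q, p)" by (cases z)
  have p: "p \<noteq> 0" using assms by (simp add: z r_dom_def)
  then have "(\<alpha> 8 - (- (q * p - \<alpha> 8) * p) * (1 / p)) * (1 / p) = q" by (simp add: field_simps)
  then show ?thesis using p H0_H8[of "1 / p" "- (q * p - \<alpha> 8) * p"] by (simp add: z r_simps H_def)
qed

lemma H_ten_rel: "(x, y) \<in> ten_rel \<alpha> \<Longrightarrow> H (fst x) (snd x) = H (fst y) (snd y)"
  by (erule ten_rel_cases) (simp_all add: H_r H_r_8)

text \<open>Points with the same image are linked by gluing maps, and each gluing map carries one
  Hamiltonian to the next.\<close>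

lemma H_psi:
  assumes "i \<in> ten_idx" "j \<in> ten_idx" "psi \<alpha> i z = psi \<alpha> j w"
  shows "H i z = H j w"
proof -
  have "((i, z), (j, w)) \<in> (ten_rel \<alpha> \<union> (ten_rel \<alpha>)\<inverse>)\<^sup>*"
    using glue_point_ten_iff[OF assms(1,2)] assms(3) unfolding glue_point_eq_iff by simp
  from glue_rel_invariant[where f = "\<lambda>x. H (fst x) (snd x)", OF H_ten_rel this] show ?thesis by simp
qed

lemma proper_None_aux:
  obtains \<eta> R where "\<eta> > 0" "\<And>x y. norm x < \<eta> \<Longrightarrow> H (Some 0) (x, y) = c \<Longrightarrow> bounded_point \<alpha> R (psi \<alpha> (Some 0) (x, y))"
proof -
  obtain \<eta> R where \<eta>: "\<eta> > 0" and R: "\<And>x y. norm x < \<eta> \<Longrightarrow> H0 x y = c \<Longrightarrow>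
    norm y \<le> R \<or> (y \<noteq> 0 \<and> norm (- (x * y - \<alpha> 8) * y) \<le> R \<and> norm (1 / y) \<le> R)"
    using region_infinity[of c] by blast
  have "bounded_point \<alpha> (max \<eta> R + R) (psi \<alpha> (Some 0) (x, y))" if x: "norm x < \<eta>" and "H (Some 0) (x, y) = c" for x y
  proof -
    have "H0 x y = c" using that by (simp add: H_def)
    from R[OF x this] show ?thesis
    proof (elim disjE conjE)
      assume "norm y \<le> R"
      then show ?thesis using x by (intro bounded_pointI[of "Some 0" \<alpha> x y]) (auto simp: ten_idx_def)
    next
      assume y: "y \<noteq> 0" "norm (- (x * y - \<alpha> 8) * y) \<le> R" "norm (1 / y) \<le> R"
      have "psi \<alpha> (Some 8) (- (x * y - \<alpha> 8) * y, 1 / y) = psi \<alpha> (Some 0) (x, y)"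
        using psi_r_8[of "(x, y)" \<alpha>] y(1) by (simp add: r_dom_def r_simps)
      then show ?thesis using y(2,3)
        by (intro bounded_pointI[of "Some 8" \<alpha> "- (x * y - \<alpha> 8) * y" "1 / y"]) (auto simp: ten_idx_def)
    qed
  qed
  with \<eta> show thesis by (rule that)
qed

text \<open>The q-plane is divided into neighbourhoods of 0, of 1 and of infinity, the last being
  small x in U_0, and a compact rest that avoids 0 and 1.\<close>

lemma proper_None:
  obtains R where "\<And>q p. H None (q, p) = c \<Longrightarrow> bounded_point \<alpha> R (psi \<alpha> None (q, p))"
proof -
  obtain \<eta>' R' where \<eta>': "\<eta>' > 0"
    "\<And>x y. norm x < \<eta>' \<Longrightarrow> H (Some 0) (x, y) = c \<Longrightarrow> bounded_point \<alpha> R' (psi \<alpha> (Some 0) (x, y))"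
    using proper_None_aux[of c] by metis
  obtain \<eta>0 R0 where \<eta>0: "\<eta>0 > 0" and R0: "\<And>z p. norm z < \<eta>0 \<Longrightarrow> h z p = c \<Longrightarrow>
    norm p \<le> R0 \<or> (\<exists>k\<in>{1..5}. p \<noteq> 0 \<and> norm (- (z * p - \<rho> \<alpha> k) * p) \<le> R0 \<and> norm (1 / p) \<le> R0)"
    using region_0[of c] by blast
  obtain \<eta>1 R1 where \<eta>1: "\<eta>1 > 0" and R1: "\<And>z p. norm z < \<eta>1 \<Longrightarrow> h (1 + z) p = c \<Longrightarrow>
    norm p \<le> R1 \<or> (\<exists>s\<in>{\<alpha> 6, \<alpha> 6 + \<alpha> 7}. p \<noteq> 0 \<and> norm (- (z * p - s) * p) \<le> R1 \<and> norm (1 / p) \<le> R1)"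
    using region_1[of c] by blast
  define K where "K = cball (0::complex) (1 / \<eta>') - (ball 0 \<eta>0 \<union> ball 1 \<eta>1)"
  have "compact K" unfolding K_def by (intro compact_diff compact_cball open_Un open_ball)
  moreover have "0 \<notin> K" "1 \<notin> K" using \<eta>0 \<eta>1 by (auto simp: K_def)
  ultimately obtain R2 where R2: "\<And>q p. q \<in> K \<Longrightarrow> h q p = c \<Longrightarrow> norm p \<le> R2"
    using region_generic[of K c] by blast
  define R where "R = max R' (max (max \<eta>0 R0 + R0) (max (max (1 + \<eta>1) R1 + R1) (1 / \<eta>' + R2)))"
  have "bounded_point \<alpha> R (psi \<alpha> None (q, p))" if "H None (q, p) = c" for q p
  proof -
    have hc: "h q p = c" using that by (simp add: H_def)
    have None: "None \<in> ten_idx" by (simp add: ten_idx_def)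
    have "norm q < \<eta>0 \<or> norm (q - 1) < \<eta>1 \<or> norm q > 1 / \<eta>' \<or> q \<in> K"
      by (auto simp: K_def dist_norm norm_minus_commute)
    then consider "norm q < \<eta>0" | "norm (q - 1) < \<eta>1" | "norm q > 1 / \<eta>'" | "q \<in> K"
      by blast
    then show ?thesis
    proof cases
      case 1
      have "bounded_point \<alpha> (max \<eta>0 R0 + R0) (psi \<alpha> None (q, p))"
        using R0[OF 1 hc]
      proof (elim disjE bexE conjE)
        assume "norm p \<le> R0"
        then show ?thesis using 1 None by (intro bounded_pointI[of None \<alpha> q p]) auto
      next
        fix k assume k: "k \<in> {1..5}" and p: "p \<noteq> 0" "norm (- (q * p - \<rho> \<alpha> k) * p) \<le> R0" "norm (1 / p) \<le> R0"
        have "psi \<alpha> (Some k) (- (q * p - \<rho> \<alpha> k) * p, 1 / p) = psi \<alpha> None (q, p)"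
          using psi_r[of k "(q, p)" \<alpha>] p(1) k by (simp add: r_dom_def r_simps mult.commute)
        then show ?thesis using p(2,3) k
          by (intro bounded_pointI[of "Some k" \<alpha> "- (q * p - \<rho> \<alpha> k) * p" "1 / p"]) (auto simp: ten_idx_def)
      qed
      then show ?thesis by (rule bounded_point_mono) (simp add: R_def)
    next
      case 2
      have "h (1 + (q - 1)) p = c" using hc by simp
      from R1[OF 2 this]
      have "bounded_point \<alpha> (max (1 + \<eta>1) R1 + R1) (psi \<alpha> None (q, p))"
      proof (elim disjE bexE conjE)
        assume "norm p \<le> R1"
        moreover have "norm q \<le> 1 + \<eta>1" using 2 norm_triangle_ineq[of "q - 1" 1] by simp
        ultimately show ?thesis using None by (intro bounded_pointI[of None \<alpha> q p]) auto
      next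
        fix s assume s: "s \<in> {\<alpha> 6, \<alpha> 6 + \<alpha> 7}"
          and p: "p \<noteq> 0" "norm (- ((q - 1) * p - s) * p) \<le> R1" "norm (1 / p) \<le> R1"
        define k where "k = (if s = \<alpha> 6 then 6 else 7 :: nat)"
        have "psi \<alpha> (Some k) (- ((q - 1) * p - s) * p, 1 / p) = psi \<alpha> None (q, p)"
          using psi_r[of k "(q, p)" \<alpha>] p(1) s
          by (auto simp: k_def r_dom_def r_simps mult.commute)
        then show ?thesis using p(2,3)
          by (intro bounded_pointI[of "Some k" \<alpha> "- ((q - 1) * p - s) * p" "1 / p"]) (auto simp: ten_idx_def k_def)
      qed
      then show ?thesis by (rule bounded_point_mono) (simp add: R_def)
    next
      case 3
      moreover have "1 / \<eta>' > 0" using \<eta>'(1) by simp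
      ultimately have nq: "norm q > 0" by linarith
      then have q: "q \<noteq> 0" by auto
      have dom: "(q, p) \<in> r_dom 0" using q by (simp add: r_dom_def)
      define w where "w = - (q * p + \<alpha> 0) * q"
      have rw: "r \<alpha> 0 (q, p) = (1 / q, w)" by (simp add: r_simps w_def)
      have "norm (1 / q) < \<eta>'" using 3 nq \<eta>'(1) by (simp add: norm_divide field_simps)
      moreover have "H (Some 0) (1 / q, w) = c" using H_r[of 0 "(q, p)"] dom that rw by simp
      ultimately have "bounded_point \<alpha> R' (psi \<alpha> (Some 0) (1 / q, w))" by (rule \<eta>'(2))
      moreover have "psi \<alpha> None (q, p) = psi \<alpha> (Some 0) (1 / q, w)" using psi_r[of 0 "(q, p)" \<alpha>] dom rw by simp
      ultimately have "bounded_point \<alpha> R' (psi \<alpha> None (q, p))" by simp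
      then show ?thesis by (rule bounded_point_mono) (simp add: R_def)
    next
      case 4
      have "bounded_point \<alpha> (1 / \<eta>' + R2) (psi \<alpha> None (q, p))"
        using R2[OF 4 hc] 4 None by (intro bounded_pointI[of None \<alpha> q p]) (auto simp: K_def)
      then show ?thesis by (rule bounded_point_mono) (simp add: R_def)
    qed
  qed
  then show thesis by (rule that)
qed

text \<open>Outside the (q, p)-plane only the line x = 0 of U_0 and the lines y = 0 of the other U_k
  remain; on the latter xy = 0, so the chart estimates bound x directly.\<close>

lemma proper:
  "\<exists>R. \<forall>i\<in>ten_idx. \<forall>w. H i w = c \<longrightarrow> (\<exists>j\<in>ten_idx. \<exists>w'. psi \<alpha> j w' = psi \<alpha> i w \<and> norm w' \<le> R)"
proof -
  obtain R1 where R1: "\<And>q p. H None (q, p) = c \<Longrightarrow> bounded_point \<alpha> R1 (psi \<alpha> None (q, p))"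
    using proper_None[of c] by metis
  obtain \<eta> R2 where \<eta>: "\<eta> > 0"
    "\<And>x y. norm x < \<eta> \<Longrightarrow> H (Some 0) (x, y) = c \<Longrightarrow> bounded_point \<alpha> R2 (psi \<alpha> (Some 0) (x, y))"
    using proper_None_aux[of c] by metis
  have None_idx: "None \<in> ten_idx" "Some 0 \<in> ten_idx" by (simp_all add: ten_idx_def)
  have P0: "bounded_point \<alpha> (max R1 R2) (psi \<alpha> (Some 0) (x, y))" if "H (Some 0) (x, y) = c" for x y
  proof (cases "x = 0")
    case True
    then have "bounded_point \<alpha> R2 (psi \<alpha> (Some 0) (x, y))" using \<eta> that by simp
    then show ?thesis by (rule bounded_point_mono) simp
  next
    case False
    note eq = psi_0[OF False, of \<alpha> y]
    have "H None (1 / x, - (x * y + \<alpha> 0) * x) = c" using H_psi[OF None_idx(2,1) eq] that by simp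
    from R1[OF this] have "bounded_point \<alpha> R1 (psi \<alpha> (Some 0) (x, y))" by (simp only: eq)
    then show ?thesis by (rule bounded_point_mono) simp
  qed
  have ch: "\<exists>\<mu>>0. \<forall>x. H (Some k) (x, 0) = c \<longrightarrow> norm x \<le> 1 / \<mu>" if k: "k \<in> {1..8}" for k
  proof -
    consider "1 \<le> k" "k \<le> 5" | "k = 6" | "k = 7" | "k = 8" using k by force
    then show ?thesis
    proof cases
      case 1
      then obtain \<mu> where "\<mu> > 0" "\<And>x y. Hk k x y = c \<Longrightarrow> norm (x * y) < \<mu> \<Longrightarrow> norm x \<le> 1 / \<mu>"
        using chart_k[of k c] by auto
      moreover have "H (Some k) (x, 0) = Hk k x 0" for x using 1 by (simp add: H_def)
      ultimately show ?thesis by (intro exI[of _ \<mu>]) auto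
    next
      case 2
      obtain \<mu> where "\<mu> > 0" "\<And>x y. Hq (\<alpha> 6) (\<alpha> 6 + \<alpha> 7) x y = c \<Longrightarrow> norm (x * y) < \<mu> \<Longrightarrow> norm x \<le> 1 / \<mu>"
        using chart_q[OF ab, of c] by auto
      moreover have "H (Some k) (x, 0) = Hq (\<alpha> 6) (\<alpha> 6 + \<alpha> 7) x 0" for x using 2 by (simp add: H_def)
      ultimately show ?thesis by (intro exI[of _ \<mu>]) auto
    next
      case 3
      obtain \<mu> where "\<mu> > 0" "\<And>x y. Hq (\<alpha> 6 + \<alpha> 7) (\<alpha> 6) x y = c \<Longrightarrow> norm (x * y) < \<mu> \<Longrightarrow> norm x \<le> 1 / \<mu>"
        using chart_q[OF ab[symmetric], of c] by auto
      moreover have "H (Some k) (x, 0) = Hq (\<alpha> 6 + \<alpha> 7) (\<alpha> 6) x 0" for x using 3 by (simp add: H_def)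
      ultimately show ?thesis by (intro exI[of _ \<mu>]) auto
    next
      case 4
      obtain \<mu> where "\<mu> > 0" "\<And>x y. H8 x y = c \<Longrightarrow> norm (x * y) < \<mu> \<Longrightarrow> norm x \<le> 1 / \<mu>"
        using chart_8[of c] by auto
      moreover have "H (Some k) (x, 0) = H8 x 0" for x using 4 by (simp add: H_def)
      ultimately show ?thesis by (intro exI[of _ \<mu>]) auto
    qed
  qed
  then obtain \<mu> where \<mu>: "\<And>k. k \<in> {1..8} \<Longrightarrow> \<mu> k > 0"
    "\<And>k x. k \<in> {1..8} \<Longrightarrow> H (Some k) (x, 0) = c \<Longrightarrow> norm x \<le> 1 / \<mu> k" by metis
  define R3 where "R3 = (\<Sum>k\<in>{1..8}. 1 / \<mu> k)"
  have R3: "1 / \<mu> k \<le> R3" if "k \<in> {1..8}" for k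
    unfolding R3_def using \<mu>(1) that by (intro member_le_sum) (simp_all add: less_imp_le)
  define R where "R = max (max R1 R2) (R3 + 0)"
  have "bounded_point \<alpha> R (psi \<alpha> i (x, y))" if i: "i \<in> ten_idx" and Hc: "H i (x, y) = c" for i x y
    using i
  proof (cases rule: ten_idx_cases)
    case 1
    then have "bounded_point \<alpha> R1 (psi \<alpha> i (x, y))" using R1 Hc by simp
    then show ?thesis by (rule bounded_point_mono) (simp add: R_def)
  next
    case 2
    then have "bounded_point \<alpha> (max R1 R2) (psi \<alpha> i (x, y))" using P0 Hc by simp
    then show ?thesis by (rule bounded_point_mono) (simp add: R_def)
  next
    case (3 k)
    show ?thesis
    proof (cases "y = 0")
      case True
      have "norm x \<le> R3" using \<mu>(2)[of k x] R3[of k] 3 Hc True by simp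
      then have "bounded_point \<alpha> (R3 + 0) (psi \<alpha> i (x, y))"
        using True by (intro bounded_pointI[OF i refl]) simp_all
      then show ?thesis by (rule bounded_point_mono) (simp add: R_def)
    next
      case False
      have "\<exists>q p. psi \<alpha> i (x, y) = psi \<alpha> None (q, p) \<or> psi \<alpha> i (x, y) = psi \<alpha> (Some 0) (q, p)"
        using psi_second[of k y \<alpha> x] 3 False by (auto split: if_splits)
      then obtain q p where "psi \<alpha> i (x, y) = psi \<alpha> None (q, p) \<or> psi \<alpha> i (x, y) = psi \<alpha> (Some 0) (q, p)" by blast
      then have "bounded_point \<alpha> (max R1 R2) (psi \<alpha> i (x, y))"
      proof
        assume eq: "psi \<alpha> i (x, y) = psi \<alpha> None (q, p)"
        have "H None (q, p) = c" using H_psi[OF i None_idx(1) eq] Hc by simp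
        from R1[OF this] have "bounded_point \<alpha> R1 (psi \<alpha> i (x, y))" by (simp only: eq)
        then show ?thesis by (rule bounded_point_mono) simp
      next
        assume eq: "psi \<alpha> i (x, y) = psi \<alpha> (Some 0) (q, p)"
        have "H (Some 0) (q, p) = c" using H_psi[OF i None_idx(2) eq] Hc by simp
        from P0[OF this] show ?thesis by (simp only: eq)
      qed
      then show ?thesis by (rule bounded_point_mono) (simp add: R_def)
    qed
  qed
  then show ?thesis unfolding bounded_point_def by (intro exI[of _ R]) (simp add: split_paired_all)
qed

end

section \<open>Elementary symmetric functions\<close>

text \<open>\<open>\<beta>\<close> with a variable index set, so that a recursion on the set is
  available.\<close>

definition esym :: "('i \<Rightarrow> complex) \<Rightarrow> 'i set \<Rightarrow> nat \<Rightarrow> complex" where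
  "esym f A k = (\<Sum>J | J \<subseteq> A \<and> card J = k. \<Prod>i\<in>J. f i)"

lemma esym_0: "finite A \<Longrightarrow> esym f A 0 = 1"
proof -
  assume "finite A"
  then have "{J. J \<subseteq> A \<and> card J = 0} = {{}}" using finite_subset by fastforce
  then show ?thesis by (simp add: esym_def)
qed

lemma esym_empty: "esym f {} (Suc k) = 0"
proof -
  have "{J. J \<subseteq> {} \<and> card J = Suc k} = ({} :: 'a set set)" by auto
  then show ?thesis by (simp only: esym_def sum.empty)
qed

lemma esym_insert:
  assumes A: "finite A" "x \<notin> A"
  shows "esym f (insert x A) (Suc k) = esym f A (Suc k) + f x * esym f A k"
proof -
  let ?S = "\<lambda>k. {J. J \<subseteq> A \<and> card J = k}"
  have fin: "finite J" if "J \<subseteq> A" for J using A(1) that finite_subset by blast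
  have eq: "{J. J \<subseteq> insert x A \<and> card J = Suc k} = ?S (Suc k) \<union> insert x ` ?S k"
  proof (intro equalityI subsetI)
    fix J assume "J \<in> {J. J \<subseteq> insert x A \<and> card J = Suc k}"
    then have J: "J \<subseteq> insert x A" "card J = Suc k" by auto
    show "J \<in> ?S (Suc k) \<union> insert x ` ?S k"
    proof (cases "x \<in> J")
      case True
      then have "J = insert x (J - {x})" "J - {x} \<subseteq> A" "card (J - {x}) = k" using J by auto
      then show ?thesis by blast
    qed (use J in auto)
  next
    fix J assume "J \<in> ?S (Suc k) \<union> insert x ` ?S k"
    then show "J \<in> {J. J \<subseteq> insert x A \<and> card J = Suc k}"
    proof
      assume "J \<in> insert x ` ?S k"
      then obtain J' where J': "J = insert x J'" "J' \<subseteq> A" "card J' = k" by auto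
      moreover have "x \<notin> J'" "finite J'" using J'(2) A fin by auto
      ultimately show ?thesis by auto
    qed auto
  qed
  have inj: "inj_on (insert x) (?S k)"
  proof (rule inj_onI)
    fix J J' assume "J \<in> ?S k" "J' \<in> ?S k" "insert x J = insert x J'"
    then show "J = J'" using A(2) by (metis (mono_tags, lifting) insert_ident mem_Collect_eq subsetD)
  qed
  have "esym f (insert x A) (Suc k) = (\<Sum>J\<in>?S (Suc k). \<Prod>i\<in>J. f i) + (\<Sum>J\<in>insert x ` ?S k. \<Prod>i\<in>J. f i)"
    unfolding esym_def eq using A by (intro sum.union_disjoint) (auto simp: finite_subset)
  also have "(\<Sum>J\<in>insert x ` ?S k. \<Prod>i\<in>J. f i) = (\<Sum>J\<in>?S k. \<Prod>i\<in>insert x J. f i)"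
    by (simp add: sum.reindex[OF inj])
  also have "\<dots> = (\<Sum>J\<in>?S k. f x * (\<Prod>i\<in>J. f i))"
    using A(2) fin by (intro sum.cong refl) (auto intro!: prod.insert)
  finally show ?thesis by (simp add: esym_def sum_distrib_left)
qed

lemma prod_minus_esym:
  "u^5 - esym f {1..5} 1 * u^4 + esym f {1..5} 2 * u^3 - esym f {1..5} 3 * u^2 + esym f {1..5} 4 * u - esym f {1..5} 5
    = (\<Prod>k\<in>{1..5::nat}. u - f k)"
proof -
  \<comment> \<open>The chain of nested sets lets the recursion remove one index at a time.\<close>
  define S5 where "S5 = {5::nat}"
  define S4 where "S4 = insert 4 S5"
  define S3 where "S3 = insert 3 S4"
  define S2 where "S2 = insert 2 S3"
  define S1 where "S1 = insert 1 S2"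
  note S = S1_def S2_def S3_def S4_def S5_def
  have set: "{1..5::nat} = S1" unfolding S by auto
  define f1 f2 f3 f4 f5 where "f1 = f 1" "f2 = f 2" "f3 = f 3" "f4 = f 4" "f5 = f 5"
  note ff = this
  have rec: "esym f S5 0 = 1" "esym f S4 0 = 1" "esym f S3 0 = 1" "esym f S2 0 = 1"
    "esym f S5 (Suc k) = esym f {} (Suc k) + f5 * esym f {} k" "esym f {} 0 = 1"
    "esym f S4 (Suc k) = esym f S5 (Suc k) + f4 * esym f S5 k"
    "esym f S3 (Suc k) = esym f S4 (Suc k) + f3 * esym f S4 k"
    "esym f S2 (Suc k) = esym f S3 (Suc k) + f2 * esym f S3 k"
    "esym f S1 (Suc k) = esym f S2 (Suc k) + f1 * esym f S2 k" for k
    unfolding S ff by (rule esym_0 esym_insert; simp)+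
  have "(\<Prod>k\<in>S1. u - f k) = (u - f1) * ((u - f2) * ((u - f3) * ((u - f4) * (u - f5))))"
    unfolding S ff by simp
  moreover have "esym f S1 1 = f1 + f2 + f3 + f4 + f5"
    by (simp add: rec esym_empty)
  moreover have "esym f S1 2 = f1 * (f2 + f3 + f4 + f5) + f2 * (f3 + f4 + f5) + f3 * (f4 + f5) + f4 * f5"
    by (simp add: numeral_eq_Suc rec esym_empty algebra_simps)
  moreover have "esym f S1 3 = f1 * (f2 * (f3 + f4 + f5) + f3 * (f4 + f5) + f4 * f5) + f2 * (f3 * (f4 + f5) + f4 * f5) + f3 * f4 * f5"
    by (simp add: numeral_eq_Suc rec esym_empty algebra_simps)
  moreover have "esym f S1 4 = f1 * (f2 * (f3 * (f4 + f5) + f4 * f5) + f3 * f4 * f5) + f2 * f3 * f4 * f5"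
    by (simp add: numeral_eq_Suc rec esym_empty algebra_simps)
  moreover have "esym f S1 5 = f1 * f2 * f3 * f4 * f5"
    by (simp add: numeral_eq_Suc rec esym_empty algebra_simps)
  ultimately show ?thesis unfolding set by algebra
qed

lemma esym_1: "esym f {1..5::nat} 1 = f 1 + f 2 + f 3 + f 4 + f 5"
proof -
  have "{J. J \<subseteq> {1..5::nat} \<and> card J = 1} = (\<lambda>i. {i}) ` {1..5}" by (auto simp: card_1_singleton_iff)
  then have "esym f {1..5} 1 = (\<Sum>J\<in>(\<lambda>i. {i}) ` {1..5::nat}. \<Prod>i\<in>J. f i)" by (simp only: esym_def)
  also have "\<dots> = (\<Sum>i\<in>{1..5::nat}. f i)" by (subst sum.reindex) auto
  also have "\<dots> = f 1 + f 2 + f 3 + f 4 + f 5" by (simp add: numeral_eq_Suc)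
  finally show ?thesis .
qed

section \<open>The coordinate changes\<close>

text \<open>A complex-linear map of the plane multiplies the form by its determinant.\<close>

lemma symplectic_onI:
  assumes "open A" and D: "\<And>z. z \<in> A \<Longrightarrow>
      (f has_derivative (\<lambda>h. (a z * fst h + b z * snd h, c z * fst h + d z * snd h))) (at z)"
    and det: "\<And>z. z \<in> A \<Longrightarrow> a z * d z - b z * c z = 1"
  shows "symplectic_on A f"
  unfolding symplectic_on_def
proof (intro conjI ballI allI)
  show "holo2 A f"
  proof (rule holo2I[OF assms(1)])
    fix z assume "z \<in> A"
    from D[OF this] show "\<exists>D. (f has_derivative D) (at z) \<and> (\<forall>c h. D (cscale c h) = cscale c (D h))"
      by (intro exI conjI) (auto simp: cscale_def algebra_simps)
  qed
  fix z h k assume z: "z \<in> A"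
  have eq: "frechet_derivative f (at z) = (\<lambda>h. (a z * fst h + b z * snd h, c z * fst h + d z * snd h))"
    using frechet_derivative_at[OF D[OF z]] by simp
  have "symplectic_form (frechet_derivative f (at z) h) (frechet_derivative f (at z) k)
    = (a z * d z - b z * c z) * symplectic_form h k"
    unfolding eq symplectic_form_def by (simp add: algebra_simps)
  then show "symplectic_form (frechet_derivative f (at z) h) (frechet_derivative f (at z) k) = symplectic_form h k"
    by (simp add: det[OF z])
qed

lemma open_r_dom: "open (r_dom j)"
proof -
  have "open {z :: c2. fst z \<noteq> 0}" "open {z :: c2. snd z \<noteq> 0}"
    by (intro open_Collect_neq continuous_intros)+
  moreover have "{(q, p). q \<noteq> 0} = {z :: c2. fst z \<noteq> 0}" "{(q, p). p \<noteq> 0} = {z :: c2. snd z \<noteq> 0}" by auto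
  ultimately show ?thesis by (simp add: r_dom_def)
qed

text \<open>For j at least 1 the maps differ only in the fibre s and the centre t, so Jacobian and
  inverse can be computed once for all of them.\<close>

lemma r_form:
  assumes "1 \<le> j" "j \<le> 8"
  shows "\<exists>s t. r \<alpha> j = (\<lambda>(q, p). (- (p * (q - s) - t) * p, 1 / p))"
proof -
  consider "j \<le> 5" | "j = 6" | "j = 7" | "j = 8" using assms by linarith
  then show ?thesis
  proof cases
    case 1
    then have "r \<alpha> j = (\<lambda>(q, p). (- (p * (q - 0) - \<rho> \<alpha> j) * p, 1 / p))" using assms by (auto simp: r_simps)
    then show ?thesis by blast
  next
    case 2
    then have "r \<alpha> j = (\<lambda>(q, p). (- (p * (q - 1) - \<alpha> 6) * p, 1 / p))" by (auto simp: r_simps)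
    then show ?thesis by blast
  next
    case 3
    then have "r \<alpha> j = (\<lambda>(q, p). (- (p * (q - 1) - (\<alpha> 6 + \<alpha> 7)) * p, 1 / p))" by (auto simp: r_simps)
    then show ?thesis by blast
  next
    case 4
    then have "r \<alpha> j = (\<lambda>(q, p). (- (p * (q - 0) - \<alpha> 8) * p, 1 / p))" by (auto simp: r_simps mult.commute)
    then show ?thesis by blast
  qed
qed

lemma r_0_form: "r \<alpha> 0 = (\<lambda>(q, p). (1 / q, - (q * p + \<alpha> 0) * q))"
  by (auto simp: r_simps)

lemma symplectic_r:
  assumes "j \<le> 8"
  shows "symplectic_on (r_dom j) (r \<alpha> j)"
proof (cases "j = 0")
  case True
  show ?thesis
  proof (rule symplectic_onI[OF open_r_dom, where a = "\<lambda>z. - (1 / fst z^2)" and b = "\<lambda>z. 0"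
        and c = "\<lambda>z. - (2 * fst z * snd z + \<alpha> 0)" and d = "\<lambda>z. - (fst z^2)"])
    fix z assume "z \<in> r_dom j"
    then have z: "fst z \<noteq> 0" using True by (auto simp: r_dom_def)
    have "((\<lambda>z. (1 / fst z, - (fst z * snd z + \<alpha> 0) * fst z)) has_derivative
        (\<lambda>h. (- (1 / fst z^2) * fst h + 0 * snd h,
          - (2 * fst z * snd z + \<alpha> 0) * fst h + - (fst z^2) * snd h))) (at z)"
      by (rule derivative_eq_intros refl z | simp add: z)+
         (use z in \<open>simp add: fun_eq_iff field_simps power2_eq_square\<close>)
    then show "(r \<alpha> j has_derivative (\<lambda>h. (- (1 / fst z^2) * fst h + 0 * snd h,
          - (2 * fst z * snd z + \<alpha> 0) * fst h + - (fst z^2) * snd h))) (at z)"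
      by (simp add: True r_0_form case_prod_unfold)
    show "- (1 / fst z^2) * - (fst z^2) - 0 * - (2 * fst z * snd z + \<alpha> 0) = 1" using z by simp
  qed
next
  case False
  then obtain s t where st: "r \<alpha> j = (\<lambda>(q, p). (- (p * (q - s) - t) * p, 1 / p))"
    using r_form[of j \<alpha>] assms by auto
  show ?thesis
  proof (rule symplectic_onI[OF open_r_dom, where a = "\<lambda>z. - (snd z^2)" and b = "\<lambda>z. t - 2 * snd z * (fst z - s)"
        and c = "\<lambda>z. 0" and d = "\<lambda>z. - (1 / snd z^2)"])
    fix z assume "z \<in> r_dom j"
    then have z: "snd z \<noteq> 0" using False by (auto simp: r_dom_def)
    have "((\<lambda>z. (- (snd z * (fst z - s) - t) * snd z, 1 / snd z)) has_derivative
        (\<lambda>h. (- (snd z^2) * fst h + (t - 2 * snd z * (fst z - s)) * snd h,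
          0 * fst h + - (1 / snd z^2) * snd h))) (at z)"
      by (rule derivative_eq_intros refl z | simp add: z)+
         (use z in \<open>simp add: fun_eq_iff field_simps power2_eq_square\<close>)
    then show "(r \<alpha> j has_derivative (\<lambda>h. (- (snd z^2) * fst h + (t - 2 * snd z * (fst z - s)) * snd h,
          0 * fst h + - (1 / snd z^2) * snd h))) (at z)"
      by (simp add: st case_prod_unfold)
    show "- (snd z^2) * - (1 / snd z^2) - (t - 2 * snd z * (fst z - s)) * 0 = 1" using z by simp
  qed
qed

section \<open>Birationality of the coordinate changes\<close>

definition pX :: "complex poly poly" where "pX = [:[:0, 1:]:]"
definition pY :: "complex poly poly" where "pY = [:0, 1:]"
definition pC :: "complex \<Rightarrow> complex poly poly" where "pC c = [:[:c:]:]"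

lemma polyfun2_simps:
  "polyfun2 pX z = fst z" "polyfun2 pY z = snd z" "polyfun2 (pC c) z = c"
  "polyfun2 (P + Q) z = polyfun2 P z + polyfun2 Q z" "polyfun2 (P - Q) z = polyfun2 P z - polyfun2 Q z"
  "polyfun2 (P * Q) z = polyfun2 P z * polyfun2 Q z" "polyfun2 (- P) z = - polyfun2 P z" "polyfun2 1 z = 1"
  by (simp_all add: polyfun2_def pX_def pY_def pC_def)

lemma polyfun2_vars_nonzero: "pX \<noteq> 0" "pY \<noteq> 0" "(1 :: complex poly poly) \<noteq> 0"
  by (simp_all add: pX_def pY_def)

lemma rational2I:
  assumes "Q1 \<noteq> 0" "Q2 \<noteq> 0"
    "\<And>z. polyfun2 Q1 z \<noteq> 0 \<Longrightarrow> polyfun2 Q2 z \<noteq> 0 \<Longrightarrow>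
      f z = (polyfun2 P1 z / polyfun2 Q1 z, polyfun2 P2 z / polyfun2 Q2 z)"
  shows "rational2 f"
  unfolding rational2_def using assms by blast

lemma birational_r:
  assumes "j \<le> 8"
  shows "birational2 (r \<alpha> j)"
proof (cases "j = 0")
  case True
  have rat: "rational2 (r \<alpha> j)"
    by (rule rational2I[of pX 1 _ 1 "- (pX * pY + pC (\<alpha> 0)) * pX"])
       (simp_all add: polyfun2_vars_nonzero polyfun2_simps True r_0_form case_prod_unfold)
  \<comment> \<open>\<open>r \<alpha> 0\<close> is an involution, hence its own rational
    inverse.\<close>
  have "r \<alpha> j (r \<alpha> j z) = z" if "polyfun2 pX z \<noteq> 0" for z
    using that by (cases z) (simp add: True r_0_form polyfun2_simps field_simps)
  then show ?thesis unfolding birational2_def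
    using rat polyfun2_vars_nonzero(1) by blast
next
  case False
  then obtain s t where st: "r \<alpha> j = (\<lambda>(q, p). (- (p * (q - s) - t) * p, 1 / p))"
    using r_form[of j \<alpha>] assms by auto
  define g where "g = (\<lambda>(x, y). ((t - x * y) * y + s, 1 / y) :: c2)"
  have "rational2 (r \<alpha> j)"
    by (rule rational2I[of 1 pY _ "- (pY * (pX - pC s) - pC t) * pY" 1])
       (simp_all add: polyfun2_vars_nonzero polyfun2_simps st case_prod_unfold)
  moreover have "rational2 g"
    by (rule rational2I[of 1 pY _ "(pC t - pX * pY) * pY + pC s" 1])
       (simp_all add: polyfun2_vars_nonzero polyfun2_simps g_def case_prod_unfold)
  moreover have "g (r \<alpha> j z) = z \<and> r \<alpha> j (g z) = z" if "polyfun2 pY z \<noteq> 0" for z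
    using that by (cases z) (simp add: st g_def polyfun2_simps field_simps)
  ultimately show ?thesis unfolding birational2_def
    using polyfun2_vars_nonzero(2) by blast
qed

section \<open>Existence of the ten Hamiltonians\<close>

text \<open>Collects what the main proof needs, free of the coefficient names. The linear relation
  becomes the equation for \<open>b1\<close>, and distinctness of the eight points becomes
  distinctness of the centres on each exceptional curve.\<close>

lemma ten_hamiltonians_exist:
  assumes rel: "6 * \<alpha> 0 + 5 * \<alpha> 1 + 4 * \<alpha> 2 + 3 * \<alpha> 3 + 2 * \<alpha> 4 + \<alpha> 5 + 4 * \<alpha> 6 + 2 * \<alpha> 7 + 3 * \<alpha> 8 = 0"
    and inj: "inj_on (\<lambda>k. second_coords \<alpha> k (0, 0)) {1..8}"
  shows "\<exists>H. (\<forall>i. hol UNIV (H i)) \<and> (\<forall>q p. H None (q, p) = hamiltonian \<alpha> q p) \<and>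
    (\<forall>j z. j \<le> 7 \<longrightarrow> z \<in> r_dom j \<longrightarrow> H (Some j) (r \<alpha> j z) = H None z) \<and>
    (\<forall>z. z \<in> r_dom 8 \<longrightarrow> H (Some 8) (r \<alpha> 8 z) = H (Some 0) z) \<and>
    (\<forall>i j z w. i \<in> ten_idx \<longrightarrow> j \<in> ten_idx \<longrightarrow> psi \<alpha> i z = psi \<alpha> j w \<longrightarrow> H i z = H j w) \<and>
    (\<forall>c. \<exists>R. \<forall>i\<in>ten_idx. \<forall>w. H i w = c \<longrightarrow> (\<exists>j\<in>ten_idx. \<exists>w'. psi \<alpha> j w' = psi \<alpha> i w \<and> norm w' \<le> R))"
proof -
  define \<kappa> where "\<kappa> = 2 * \<alpha> 0 + \<alpha> 8"
  define \<epsilon> where "\<epsilon> = \<alpha> 0 * (\<alpha> 0 + \<alpha> 8)"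
  define \<gamma>1 where "\<gamma>1 = 2 * \<alpha> 6 + \<alpha> 7"
  define \<gamma>2 where "\<gamma>2 = \<alpha> 6 * (\<alpha> 6 + \<alpha> 7)"
  define b1 b2 b3 b4 b5 where "b1 = \<beta> \<alpha> 1" "b2 = \<beta> \<alpha> 2" "b3 = \<beta> \<alpha> 3" "b4 = \<beta> \<alpha> 4" "b5 = \<beta> \<alpha> 5"
  note bs = this
  define v where "v = \<gamma>1^2 + 2 * \<gamma>2 - b2"
  define m where "m = v - 3 * (\<kappa>^2 + \<epsilon>)"
  define b0 where "b0 = v + 4 * \<kappa> * \<gamma>1 + 3 * \<kappa>^2 - \<epsilon>"
  define A3 where "A3 = \<kappa>^3 + 6 * \<kappa> * \<epsilon>"
  define X where "X = 2 * \<kappa> * v + 3 * \<kappa>^3 - 12 * \<kappa> * \<epsilon> + 6 * \<kappa>^2 * \<gamma>1 - 4 * \<epsilon> * \<gamma>1"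
  define k0 where "k0 = \<gamma>1^3 + 5 * \<kappa> * \<gamma>1^2 + \<kappa> * \<gamma>2 + 9 * \<kappa>^2 * \<gamma>1 - \<epsilon> * \<gamma>1 + 5 * \<kappa>^3
              - (\<gamma>1 + 2 * \<kappa>) * b2 - b3"
  define A2 where "A2 = 3 * \<kappa>^2 * \<epsilon> + 3 * \<epsilon>^2"
  define B2 where "B2 = (\<kappa>^2 + 2 * \<epsilon>) * v + 4 * \<kappa>^3 * \<gamma>1 + 4 * \<kappa> * \<epsilon> * \<gamma>1 + 3 * \<kappa>^4
              - 3 * \<kappa>^2 * \<epsilon> - 6 * \<epsilon>^2"
  define C2 where "C2 = b4 - 3 * A2 - 2 * B2
              + \<gamma>2 * (\<gamma>1^2 + \<gamma>2 + 3 * \<kappa> * \<gamma>1 + 3 * \<kappa>^2 + 3 * \<epsilon> - b2) - \<gamma>1 * k0"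
  define c2 where "c2 = - 2 * \<gamma>1^2 - 4 * \<gamma>2 + 3 * b2 - 3 * \<kappa>^2 + 3 * \<epsilon> - 6 * \<kappa> * \<gamma>1"
  define c1 where "c1 = - 2 * \<gamma>1 * \<gamma>2 - 4 * \<kappa>^3 + 3 * \<kappa> * \<epsilon> - 2 * \<kappa> * \<gamma>1^2 - 4 * \<kappa> * \<gamma>2 + \<kappa> * b2
              - 6 * \<kappa>^2 * \<gamma>1 + 2 * \<epsilon> * \<gamma>1 - b3"
  define c0 where "c0 = C2 - \<kappa> * c1 - \<epsilon> * c2"
  define B1 where "B1 = 2 * \<kappa> * \<epsilon> * b0 - 2 * \<epsilon>^2 * (2 * \<kappa> + \<gamma>1)"
  define C1 where "C1 = \<kappa> * c0 + \<epsilon> * c1"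
  define G1 where "G1 = \<gamma>2 * k0 + b5 - 3 * \<kappa> * \<epsilon>^2 - B1 - C1"
  define f3 where "f3 = A3 + X + b3 + 2 * \<gamma>1 * \<gamma>2"
  define f2 where "f2 = \<gamma>2^2 - A2 - B2 - C2 - b4"
  have beta: "\<beta> \<alpha> k = esym (\<rho> \<alpha>) {1..5} k" for k by (simp add: \<beta>_def esym_def)
  have prod: "u^5 - b1 * u^4 + b2 * u^3 - b3 * u^2 + b4 * u - b5 = (\<Prod>k\<in>{1..5}. u - \<rho> \<alpha> k)" for u
    unfolding bs beta by (rule prod_minus_esym)
  have rhos: "\<rho> \<alpha> 1 = \<alpha> 1" "\<rho> \<alpha> 2 = \<alpha> 1 + \<alpha> 2" "\<rho> \<alpha> 3 = \<alpha> 1 + \<alpha> 2 + \<alpha> 3"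
    "\<rho> \<alpha> 4 = \<alpha> 1 + \<alpha> 2 + \<alpha> 3 + \<alpha> 4" "\<rho> \<alpha> 5 = \<alpha> 1 + \<alpha> 2 + \<alpha> 3 + \<alpha> 4 + \<alpha> 5"
    by (simp_all add: \<rho>_def numeral_eq_Suc)
  have b1_sum: "b1 = \<rho> \<alpha> 1 + \<rho> \<alpha> 2 + \<rho> \<alpha> 3 + \<rho> \<alpha> 4 + \<rho> \<alpha> 5"
    unfolding bs beta using esym_1[of "\<rho> \<alpha>"] by simp
  have b1: "b1 = - 3 * \<kappa> - 2 * \<gamma>1"
    unfolding b1_sum rhos \<kappa>_def \<gamma>1_def using rel by algebra
  have inj_pos: "second_pos \<alpha> j \<noteq> second_pos \<alpha> k"
    if "j \<in> {1..8}" "k \<in> {1..8}" "j \<noteq> k" "second_base j = second_base k" for j k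
    using inj_onD[OF inj, of j k] that by (auto simp: second_coords_simps)
  have rho_inj: "inj_on (\<rho> \<alpha>) {1..5}"
  proof (rule inj_onI, rule ccontr)
    fix j k assume "j \<in> {1..5::nat}" "k \<in> {1..5::nat}" "\<rho> \<alpha> j = \<rho> \<alpha> k" "j \<noteq> k"
    then show False using inj_pos[of j k] by (simp add: second_pos_def second_base_def)
  qed
  have ab: "\<alpha> 6 \<noteq> \<alpha> 6 + \<alpha> 7"
    using inj_pos[of 6 7] by (simp add: second_pos_def second_base_def)
  interpret T: ten_hamiltonians \<alpha> \<kappa> \<epsilon> \<gamma>1 \<gamma>2 b1 b2 b3 b4 b5 v m b0 A3 X k0 A2 B2 C2 c2 c1 c0 B1 C1 G1 f3 f2
    by unfold_locales
       (fact \<kappa>_def \<epsilon>_def b1 v_def m_def b0_def A3_def X_def k0_def A2_def B2_def C2_def c2_def c1_def c0_def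
         B1_def C1_def G1_def f3_def f2_def prod rho_inj ab | simp add: \<gamma>1_def \<gamma>2_def)+
  have ham: "T.H None (q, p) = hamiltonian \<alpha> q p" for q p
    unfolding hamiltonian_def Let_def \<kappa>_def[symmetric] \<epsilon>_def[symmetric] \<gamma>1_def[symmetric] \<gamma>2_def[symmetric]
      bs[symmetric] v_def[symmetric] m_def[symmetric] b0_def[symmetric] A3_def[symmetric] X_def[symmetric]
      k0_def[symmetric] A2_def[symmetric] B2_def[symmetric] C2_def[symmetric] c2_def[symmetric] c1_def[symmetric]
      c0_def[symmetric] B1_def[symmetric] C1_def[symmetric] G1_def[symmetric] f3_def[symmetric] f2_def[symmetric]
    by (simp add: T.H_def T.h_def T.e_defs)
  show ?thesis
    by (intro exI[of _ T.H] conjI allI impI) (fact T.hol_H ham T.proper | erule (2) T.H_psi | erule (1) T.H_r | erule T.H_r_8)+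
qed

section \<open>Plane atlases\<close>

lemma plane_transition:
  assumes "holomorphic_map (plane_atlas \<Psi> I) (plane_atlas \<Psi> I) (\<lambda>x. x)" "i \<in> I" "j \<in> I"
  shows "holo2 {w. \<Psi> i w \<in> range (\<Psi> j)} (\<lambda>w. inv (\<Psi> j) (\<Psi> i w))"
proof -
  have "(UNIV, \<Psi> i) \<in> plane_atlas \<Psi> I" "(UNIV, \<Psi> j) \<in> plane_atlas \<Psi> I"
    using assms by (auto simp: plane_atlas_def)
  from holomorphic_map_charts[OF assms(1) this] show ?thesis by simp
qed

text \<open>Compatibility of the plane fields at one pair of identified points, phrased as a
  relation so that it can be followed along a chain of identifications.\<close>

definition compatible_at :: "('i \<Rightarrow> c2 \<Rightarrow> 'a) \<Rightarrow> 'i set \<Rightarrow> ('i \<Rightarrow> c2 \<Rightarrow> c2) \<Rightarrow> 'i \<times> c2 \<Rightarrow> 'i \<times> c2 \<Rightarrow> bool" where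
  "compatible_at \<Psi> I V = (\<lambda>(i, w) (j, w'). i \<in> I \<and> j \<in> I \<and> \<Psi> i w = \<Psi> j w' \<and>
     frechet_derivative (\<lambda>x. inv (\<Psi> j) (\<Psi> i x)) (at w) (V i w) = V j w')"

context
  fixes \<Psi> :: "'i \<Rightarrow> c2 \<Rightarrow> 'a" and I :: "'i set" and V :: "'i \<Rightarrow> c2 \<Rightarrow> c2"
  assumes holo: "holomorphic_map (plane_atlas \<Psi> I) (plane_atlas \<Psi> I) (\<lambda>x. x)"
    and inj: "\<And>i. i \<in> I \<Longrightarrow> inj (\<Psi> i)"
begin

lemma compatible_at_refl:
  assumes "i \<in> I"
  shows "compatible_at \<Psi> I V (i, w) (i, w)"
proof -
  have "(\<lambda>x. inv (\<Psi> i) (\<Psi> i x)) = (\<lambda>x. x)" using inj[OF assms] by simp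
  then show ?thesis using assms by (simp add: compatible_at_def)
qed

lemma compatible_at_trans:
  assumes 1: "compatible_at \<Psi> I V (i, w) (j, w')" and 2: "compatible_at \<Psi> I V (j, w') (k, w'')"
  shows "compatible_at \<Psi> I V (i, w) (k, w'')"
proof -
  have I: "i \<in> I" "j \<in> I" "k \<in> I" and eq: "\<Psi> i w = \<Psi> j w'" "\<Psi> j w' = \<Psi> k w''"
    using 1 2 by (auto simp: compatible_at_def)
  let ?g = "\<lambda>x. inv (\<Psi> j) (\<Psi> i x)" and ?h = "\<lambda>x. inv (\<Psi> k) (\<Psi> j x)"
  let ?A = "{w. \<Psi> i w \<in> range (\<Psi> j)}"
  note g = plane_transition[OF holo I(1,2)] and h = plane_transition[OF holo I(2,3)]
    and gh = plane_transition[OF holo I(1,3)]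
  have gw: "?g w = w'" unfolding eq(1) by (rule inv_f_f[OF inj[OF I(2)]])
  have wA: "w \<in> ?A" by (simp only: mem_Collect_eq eq(1) rangeI)
  have "frechet_derivative (\<lambda>x. inv (\<Psi> k) (\<Psi> i x)) (at w) = frechet_derivative (\<lambda>x. ?h (?g x)) (at w)"
  proof (rule holo2_derivative_cong[OF holo2_open[OF g] wA])
    show "(\<lambda>x. inv (\<Psi> k) (\<Psi> i x)) differentiable at w"
      by (rule holo2_differentiable[OF gh]) (simp only: mem_Collect_eq eq rangeI)
  qed (auto simp: f_inv_into_f)
  moreover have "frechet_derivative (\<lambda>x. ?h (?g x)) (at w) (V i w)
      = frechet_derivative ?h (at (?g w)) (frechet_derivative ?g (at w) (V i w))"
    by (rule holo2_derivative_compose[OF g h wA]) (simp only: mem_Collect_eq gw eq(2) rangeI)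
  ultimately show ?thesis
    using 1 2 I eq gw unfolding compatible_at_def by simp
qed

lemma compatible_at_sym:
  assumes 1: "compatible_at \<Psi> I V (i, w) (j, w')"
  shows "compatible_at \<Psi> I V (j, w') (i, w)"
proof -
  have I: "i \<in> I" "j \<in> I" and eq: "\<Psi> i w = \<Psi> j w'"
    and D: "frechet_derivative (\<lambda>x. inv (\<Psi> j) (\<Psi> i x)) (at w) (V i w) = V j w'"
    using 1 by (auto simp: compatible_at_def)
  let ?g = "\<lambda>x. inv (\<Psi> j) (\<Psi> i x)" and ?h = "\<lambda>x. inv (\<Psi> i) (\<Psi> j x)"
  let ?A = "{w. \<Psi> i w \<in> range (\<Psi> j)}"
  note g = plane_transition[OF holo I(1,2)] and h = plane_transition[OF holo I(2,1)]
  have gw: "?g w = w'" using inj[OF I(2)] eq by simp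
  have wA: "w \<in> ?A" by (simp only: mem_Collect_eq eq rangeI)
  have ident: "frechet_derivative (\<lambda>x. x) (at w) = frechet_derivative (\<lambda>x. ?h (?g x)) (at w)"
    by (rule holo2_derivative_cong[OF holo2_open[OF g] wA]) (use inj[OF I(1)] in \<open>simp_all add: f_inv_into_f\<close>)
  have "frechet_derivative (\<lambda>x. ?h (?g x)) (at w) (V i w)
      = frechet_derivative ?h (at (?g w)) (frechet_derivative ?g (at w) (V i w))"
    by (rule holo2_derivative_compose[OF g h wA]) (simp only: mem_Collect_eq gw eq[symmetric] rangeI)
  then have "V i w = frechet_derivative ?h (at w') (V j w')"
    by (simp only: ident[symmetric] gw D frechet_derivative_ident)
  then show ?thesis using I eq unfolding compatible_at_def by simp
qed

text \<open>The transition maps are explicit only along generating pairs, where they are the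
  \<open>r j\<close>. The chain rule and the derivative of the inverse carry compatibility to all
  overlaps.\<close>

lemma compatible_at_rtrancl:
  assumes step: "\<And>x y. (x, y) \<in> S \<Longrightarrow> compatible_at \<Psi> I V x y"
    and xy: "(x, y) \<in> (S \<union> S\<inverse>)\<^sup>*" and x: "fst x \<in> I"
  shows "compatible_at \<Psi> I V x y"
  using xy
proof (induction rule: rtrancl_induct)
  case base
  then show ?case using compatible_at_refl[OF x, of "snd x"] by simp
next
  case (step y z)
  have "compatible_at \<Psi> I V y z"
  proof (cases "(y, z) \<in> S")
    case False
    then have "(z, y) \<in> S" using step(2) by simp
    then have "compatible_at \<Psi> I V (fst z, snd z) (fst y, snd y)" using assms(1)[of z y] by simp
    then have "compatible_at \<Psi> I V (fst y, snd y) (fst z, snd z)" by (rule compatible_at_sym)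
    then show ?thesis by simp
  qed (rule assms(1))
  then have "compatible_at \<Psi> I V (fst y, snd y) (fst z, snd z)" by simp
  moreover have "compatible_at \<Psi> I V (fst x, snd x) (fst y, snd y)" using step(3) by simp
  ultimately have "compatible_at \<Psi> I V (fst x, snd x) (fst z, snd z)" by (rule compatible_at_trans[rotated])
  then show ?case by simp
qed

end

text \<open>Families of planes with the same identifications give the same surface. The map is
  chosen on representatives and does not depend on them by \<open>eq\<close>.\<close>

lemma plane_transfer:
  assumes eq: "\<And>i j z w. i \<in> I \<Longrightarrow> j \<in> I \<Longrightarrow> \<Theta> i z = \<Theta> j w \<longleftrightarrow> \<Psi> i z = \<Psi> j w"
    and inj: "\<And>i. i \<in> I \<Longrightarrow> inj (\<Psi> i)" and equiv: "equiv_atlas (plane_atlas \<Psi> I) M"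
  shows "\<exists>F. biholomorphic (plane_atlas \<Theta> I) M F \<and> (\<forall>i\<in>I. \<forall>z. F (\<Theta> i z) = \<Psi> i z)"
proof -
  have P\<Psi>: "points M = (\<Union>i\<in>I. range (\<Psi> i))"
    using equiv_atlas_points[OF equiv] by (auto simp: points_def plane_atlas_def)
  have P\<Theta>: "points (plane_atlas \<Theta> I) = (\<Union>i\<in>I. range (\<Theta> i))"
    by (auto simp: points_def plane_atlas_def)
  have inj\<Theta>: "inj (\<Theta> i)" if "i \<in> I" for i
    using eq[OF that that] inj[OF that] by (auto simp: inj_def)
  define F where "F x = (SOME y. \<exists>i\<in>I. \<exists>z. x = \<Theta> i z \<and> y = \<Psi> i z)" for x
  have F: "F (\<Theta> i z) = \<Psi> i z" if i: "i \<in> I" for i z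
  proof -
    have "\<exists>y. \<exists>j\<in>I. \<exists>w. \<Theta> i z = \<Theta> j w \<and> y = \<Psi> j w" using i by blast
    then have "\<exists>j\<in>I. \<exists>w. \<Theta> i z = \<Theta> j w \<and> F (\<Theta> i z) = \<Psi> j w" unfolding F_def by (rule someI_ex)
    then obtain j w where "j \<in> I" "\<Theta> i z = \<Theta> j w" "F (\<Theta> i z) = \<Psi> j w" by blast
    then show ?thesis using eq[OF i, of j z w] by simp
  qed
  define G where "G y = (SOME x. \<exists>i\<in>I. \<exists>z. y = \<Psi> i z \<and> x = \<Theta> i z)" for y
  have G: "G (\<Psi> i z) = \<Theta> i z" if i: "i \<in> I" for i z
  proof -
    have "\<exists>x. \<exists>j\<in>I. \<exists>w. \<Psi> i z = \<Psi> j w \<and> x = \<Theta> j w" using i by blast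
    then have "\<exists>j\<in>I. \<exists>w. \<Psi> i z = \<Psi> j w \<and> G (\<Psi> i z) = \<Theta> j w" unfolding G_def by (rule someI_ex)
    then obtain j w where "j \<in> I" "\<Psi> i z = \<Psi> j w" "G (\<Psi> i z) = \<Theta> j w" by blast
    then show ?thesis using eq[OF i, of j z w] by simp
  qed
  have "biholomorphic (plane_atlas \<Theta> I) M F"
  proof (rule biholomorphicI[of _ _ _ G])
    show "holomorphic_map (plane_atlas \<Theta> I) M F"
    proof (rule holomorphic_mapI)
      show "F x \<in> points M" if x: "x \<in> points (plane_atlas \<Theta> I)" for x
      proof -
        obtain i z where "i \<in> I" "x = \<Theta> i z" using x unfolding P\<Theta> by blast
        then show ?thesis unfolding P\<Psi> using F by blast
      qed
      fix A \<phi> B \<psi> assume A: "(A, \<phi>) \<in> plane_atlas \<Theta> I" and B: "(B, \<psi>) \<in> M"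
      then obtain i where i: "i \<in> I" "A = UNIV" "\<phi> = \<Theta> i" by (auto simp: plane_atlas_def)
      have "(UNIV, \<Psi> i) \<in> plane_atlas \<Psi> I" using i by (auto simp: plane_atlas_def)
      from holomorphic_map_charts[OF _ this B, of "\<lambda>x. x"] equiv
      show "holo2 {z \<in> A. F (\<phi> z) \<in> \<psi> ` B} (\<lambda>z. inv_into B \<psi> (F (\<phi> z)))"
        by (simp add: i F equiv_atlas_def)
    qed
    show "holomorphic_map M (plane_atlas \<Theta> I) G"
    proof (rule holomorphic_mapI)
      show "G x \<in> points (plane_atlas \<Theta> I)" if x: "x \<in> points M" for x
      proof -
        obtain i z where "i \<in> I" "x = \<Psi> i z" using x unfolding P\<Psi> by blast
        then show ?thesis unfolding P\<Theta> using G by blast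
      qed
      fix A \<phi> B \<psi> assume A: "(A, \<phi>) \<in> M" and B: "(B, \<psi>) \<in> plane_atlas \<Theta> I"
      then obtain i where i: "i \<in> I" "B = UNIV" "\<psi> = \<Theta> i" by (auto simp: plane_atlas_def)
      have "(UNIV, \<Psi> i) \<in> plane_atlas \<Psi> I" using i by (auto simp: plane_atlas_def)
      from holomorphic_map_charts[OF _ A this, of "\<lambda>x. x"] equiv
      have h: "holo2 {z \<in> A. \<phi> z \<in> range (\<Psi> i)} (\<lambda>z. inv (\<Psi> i) (\<phi> z))"
        by (simp add: equiv_atlas_def)
      have iff: "G (\<phi> z) \<in> range (\<Theta> i) \<longleftrightarrow> \<phi> z \<in> range (\<Psi> i)" if z: "z \<in> A" for z
      proof -
        obtain j w where j: "j \<in> I" "\<phi> z = \<Psi> j w" using pointsI[OF A z] unfolding P\<Psi> by auto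
        show ?thesis unfolding j(2) G[OF j(1)] using eq[OF j(1) i(1), of w] by (simp add: image_iff)
      qed
      then have "{z \<in> A. G (\<phi> z) \<in> range (\<Theta> i)} = {z \<in> A. \<phi> z \<in> range (\<Psi> i)}" by blast
      moreover have "inv (\<Psi> i) (\<phi> z) = inv (\<Theta> i) (G (\<phi> z))" if z: "\<phi> z \<in> range (\<Psi> i)" for z
      proof -
        obtain w where "\<phi> z = \<Psi> i w" using z by auto
        then show ?thesis using inj[OF i(1)] inj\<Theta>[OF i(1)] by (simp add: G[OF i(1)])
      qed
      then have "holo2 {z \<in> A. \<phi> z \<in> range (\<Psi> i)} (\<lambda>z. inv (\<Theta> i) (G (\<phi> z)))"
        by (intro holo2_cong[OF h]) auto
      ultimately show "holo2 {z \<in> A. G (\<phi> z) \<in> \<psi> ` B} (\<lambda>z. inv_into B \<psi> (G (\<phi> z)))"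
        by (simp add: i)
    qed
    show "G (F x) = x" if "x \<in> points (plane_atlas \<Theta> I)" for x using that F G unfolding P\<Theta> by auto
    show "F (G y) = y" if "y \<in> points M" for y using that F G unfolding P\<Psi> by auto
  qed
  then show ?thesis using F by (intro exI[of _ F]) simp
qed

text \<open>The Hausdorff property and second countability pass along the homeomorphism underlying
  F; this is how the glued planes acquire them.\<close>

lemma biholomorphic_complex_surface:
  assumes F: "biholomorphic N M F" and M: "complex_surface M"
    and N: "\<And>A \<phi>. (A, \<phi>) \<in> N \<Longrightarrow> open A" "\<And>A \<phi>. (A, \<phi>) \<in> N \<Longrightarrow> inj_on \<phi> A"
  shows "complex_surface N"
proof (rule complex_surfaceI)
  obtain G where G: "holomorphic_map N M F" "holomorphic_map M N G" "\<And>x. x \<in> points N \<Longrightarrow> G (F x) = x"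
    using biholomorphicE[OF F] by metis
  show "holomorphic_map N N (\<lambda>x. x)"
    by (rule holomorphic_map_cong[OF holomorphic_map_comp[OF G(1,2)]]) (rule G(3))
  have "homeomorphic_map (surface_topology N) (surface_topology M) F"
    by (rule biholomorphic_homeomorphic_map[OF F]) (rule N(1) complex_surface_charts(1)[OF M], assumption)+
  then have hom: "surface_topology N homeomorphic_space surface_topology M"
    by (rule homeomorphic_map_imp_homeomorphic_space)
  show "Hausdorff_space (surface_topology N)"
    using homeomorphic_Hausdorff_space[OF hom] M by (simp add: complex_surface_def)
  show "second_countable (surface_topology N)"
    using homeomorphic_space_second_countability[OF hom] M by (simp add: complex_surface_def)
qed (use N in auto)

lemma open_subset_axis_empty:
  assumes "open (U :: c2 set)" "U \<subseteq> {z. fst z = 0} \<or> U \<subseteq> {z. snd z = 0}"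
  shows "U = {}"
proof (rule ccontr)
  assume "U \<noteq> {}"
  then obtain a b where "(a, b) \<in> U" by auto
  then obtain R where R: "R > 0" "cball a R \<times> cball b R \<subseteq> U"
    using open_contains_bicball[OF assms(1)] by metis
  have in_U: "(x, y) \<in> U" if "x \<in> cball a R" "y \<in> cball b R" for x y
    using subsetD[OF R(2)] that by blast
  have 1: "a + of_real R \<in> cball a R" "a \<in> cball a R" "b + of_real R \<in> cball b R" "b \<in> cball b R"
    using R(1) by (simp_all add: dist_norm)
  from assms(2) show False
  proof
    assume *: "U \<subseteq> {z. fst z = 0}"
    have "a = 0" using subsetD[OF * in_U[OF 1(2,4)]] by simp
    moreover have "a + of_real R = 0" using subsetD[OF * in_U[OF 1(1,4)]] by simp
    ultimately show False using R(1) by simp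
  next
    assume *: "U \<subseteq> {z. snd z = 0}"
    have "b = 0" using subsetD[OF * in_U[OF 1(2,4)]] by simp
    moreover have "b + of_real R = 0" using subsetD[OF * in_U[OF 1(2,3)]] by simp
    ultimately show False using R(1) by simp
  qed
qed

text \<open>The part of the plane outside C is open and contained in a coordinate axis, hence empty.
  It serves to show that the (q, p)-plane is dense.\<close>

lemma closed_contains_plane:
  assumes C: "closedin (surface_topology M) C" and \<Psi>: "(UNIV, \<Psi>) \<in> M" and top: "topspace (surface_topology M) = points M"
    and ax: "(\<forall>z. fst z \<noteq> 0 \<longrightarrow> \<Psi> z \<in> C) \<or> (\<forall>z. snd z \<noteq> 0 \<longrightarrow> \<Psi> z \<in> C)"
  shows "\<Psi> z \<in> C"
proof -
  have "openin (surface_topology M) (points M - C)" using C top by (metis closedin_def)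
  then have "open {z \<in> UNIV. \<Psi> z \<in> points M - C}" using \<Psi> by (auto simp: openin_surface_topology)
  moreover have "{z \<in> UNIV. \<Psi> z \<in> points M - C} \<subseteq> {z. fst z = 0} \<or> {z \<in> UNIV. \<Psi> z \<in> points M - C} \<subseteq> {z. snd z = 0}"
    using ax by auto
  ultimately have "{z \<in> UNIV. \<Psi> z \<in> points M - C} = {}" by (rule open_subset_axis_empty)
  then have "z \<notin> {z \<in> UNIV. \<Psi> z \<in> points M - C}" by blast
  then show ?thesis using pointsI[OF \<Psi>, of z] by blast
qed

section \<open>The theorem\<close>

lemma holo2_precompose:
  assumes f: "holo2 UNIV f" and g: "holo2 B g"
  shows "holo2 {z. f z \<in> B} (\<lambda>z. g (f z))"
proof -
  have "open (f -` B)" by (rule open_vimage[OF holo2_open[OF g] holo2_continuous_on[OF f]])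
  then have "open {z. f z \<in> B}" by (simp add: vimage_def)
  then show ?thesis by (intro holo2_compose[OF holo2_subset[OF f] g]) auto
qed

text \<open>Each of the three exceptional curves meets the section, so after the first contraction
  they all pass through the common point P. Hence each later contracted curve meets those that
  remain, and at every stage the complement is exactly the image of
  \<open>W2 \<alpha>\<close>.\<close>

lemma W2_biholomorphic:
  assumes bd1: "blows_down (X2 \<alpha>) (D_section_strict \<alpha>) S1 \<pi>1"
    and bd2: "blows_down S1 (\<pi>1 ` D_exc_strict \<alpha> AtInf) S2 \<pi>2"
    and bd3: "blows_down S2 ((\<pi>2 \<circ> \<pi>1) ` D_exc_strict \<alpha> At1) S3 \<pi>3"
  shows "biholomorphic (open_part (X2 \<alpha>) (W2 \<alpha>)) (open_part S3 (points S3 - (\<pi>3 \<circ> \<pi>2 \<circ> \<pi>1) ` D_exc_strict \<alpha> At0)) (\<pi>3 \<circ> \<pi>2 \<circ> \<pi>1)"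
    and "openin (surface_topology S3) (points S3 - (\<pi>3 \<circ> \<pi>2 \<circ> \<pi>1) ` D_exc_strict \<alpha> At0)"
proof -
  let ?C = "D_section_strict \<alpha>" and ?E = "D_exc_strict \<alpha>"
  have Em: "?E \<nu> \<subseteq> points (X2 \<alpha>)" for \<nu>
    unfolding D_exc_strict_def X2_def by (rule strict_transform_points)
  have meet: "?C \<inter> ?E \<nu> \<noteq> {}" for \<nu> using strict_intersection[of \<nu> \<alpha>] by blast
  have S1: "complex_surface S1" "holomorphic_map (X2 \<alpha>) S1 \<pi>1" using bd1 unfolding blows_down_def by simp_all
  have S2: "complex_surface S2" "holomorphic_map S1 S2 \<pi>2" using bd2 unfolding blows_down_def by simp_all
  obtain P where P: "\<pi>1 ` ?C = {P}" using bd1 by (rule blows_downE)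
  have PE: "P \<in> \<pi>1 ` ?E \<nu>" for \<nu>
  proof -
    obtain c where c: "c \<in> ?C" "c \<in> ?E \<nu>" using meet[of \<nu>] by blast
    have "\<pi>1 c \<in> {P}" using imageI[OF c(1), of \<pi>1] unfolding P .
    then show ?thesis using imageI[OF c(2), of \<pi>1] by simp
  qed
  have sub1: "\<pi>1 ` ?E \<nu> \<subseteq> points S1" for \<nu>
    using Em[of \<nu>] holomorphic_map_points[OF S1(2)] by blast
  have sub2: "\<pi>2 ` \<pi>1 ` ?E \<nu> \<subseteq> points S2" for \<nu>
    using sub1[of \<nu>] holomorphic_map_points[OF S2(2)] by blast
  have W0: "W2 \<alpha> \<inter> ?C = {}" using D_section_strict_disjoint by blast
  have WE: "W2 \<alpha> \<inter> ?E \<nu> = {}" for \<nu> using D_exc_strict_disjoint by blast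
  note b1 = blows_down_restrict[OF bd1 inj_atlas_second openin_W2 W0]
  have d1: "\<pi>1 ` W2 \<alpha> \<inter> \<pi>1 ` ?E \<nu> = {}" for \<nu>
    by (rule blows_down_disjoint[OF bd1 W2_points W0 Em WE])
  have m1: "\<pi>1 ` W2 \<alpha> \<subseteq> points S1" using b1(2) by (simp add: openin_surface_topology)
  note b2 = blows_down_restrict[OF bd2 complex_surface_inj_atlas[OF S1(1)] b1(2) d1]
  have d2: "\<pi>2 ` \<pi>1 ` W2 \<alpha> \<inter> \<pi>2 ` \<pi>1 ` ?E \<nu> = {}" for \<nu>
    by (rule blows_down_disjoint[OF bd2 m1 d1 sub1 d1])
  have d2': "\<pi>2 ` \<pi>1 ` W2 \<alpha> \<inter> (\<pi>2 \<circ> \<pi>1) ` ?E At1 = {}" using d2 by (simp add: image_comp)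
  note b3 = blows_down_restrict[OF bd3 complex_surface_inj_atlas[OF S2(1)] b2(2) d2']
  have c1: "points S1 - \<pi>1 ` (?E AtInf \<union> (?E At1 \<union> ?E At0)) = \<pi>1 ` W2 \<alpha>"
    using blows_down_complement[OF bd1, of "?E AtInf \<union> (?E At1 \<union> ?E At0)"] Em meet[of AtInf] W2_complement[of \<alpha>]
    by (auto simp: Int_Un_distrib)
  have c2: "points S2 - \<pi>2 ` \<pi>1 ` (?E At1 \<union> ?E At0) = \<pi>2 ` \<pi>1 ` W2 \<alpha>"
  proof -
    have "points S2 - \<pi>2 ` \<pi>1 ` (?E At1 \<union> ?E At0)
        = \<pi>2 ` (points S1 - (\<pi>1 ` ?E AtInf \<union> \<pi>1 ` (?E At1 \<union> ?E At0)))"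
      by (rule blows_down_complement[OF bd2]) (use sub1 PE in blast)+
    also have "\<pi>1 ` ?E AtInf \<union> \<pi>1 ` (?E At1 \<union> ?E At0) = \<pi>1 ` (?E AtInf \<union> (?E At1 \<union> ?E At0))" by blast
    finally show ?thesis by (simp only: c1)
  qed
  have c3: "points S3 - \<pi>3 ` \<pi>2 ` \<pi>1 ` ?E At0 = \<pi>3 ` \<pi>2 ` \<pi>1 ` W2 \<alpha>"
  proof -
    have "points S3 - \<pi>3 ` \<pi>2 ` \<pi>1 ` ?E At0
        = \<pi>3 ` (points S2 - ((\<pi>2 \<circ> \<pi>1) ` ?E At1 \<union> \<pi>2 ` \<pi>1 ` ?E At0))"
    proof (rule blows_down_complement[OF bd3 sub2])
      have "\<pi>2 P \<in> (\<pi>2 \<circ> \<pi>1) ` ?E At1" "\<pi>2 P \<in> \<pi>2 ` \<pi>1 ` ?E At0"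
        using PE[of At1] PE[of At0] by (auto simp: image_comp[symmetric])
      then show "(\<pi>2 \<circ> \<pi>1) ` ?E At1 \<inter> \<pi>2 ` \<pi>1 ` ?E At0 \<noteq> {}" by blast
    qed
    also have "(\<pi>2 \<circ> \<pi>1) ` ?E At1 \<union> \<pi>2 ` \<pi>1 ` ?E At0 = \<pi>2 ` \<pi>1 ` (?E At1 \<union> ?E At0)"
      by (simp only: image_comp[symmetric] image_Un)
    finally show ?thesis by (simp only: c2)
  qed
  have eq: "points S3 - (\<pi>3 \<circ> \<pi>2 \<circ> \<pi>1) ` ?E At0 = \<pi>3 ` \<pi>2 ` \<pi>1 ` W2 \<alpha>"
    using c3 by (simp only: image_comp comp_assoc)
  have "biholomorphic (open_part (X2 \<alpha>) (W2 \<alpha>)) (open_part S3 (\<pi>3 ` \<pi>2 ` \<pi>1 ` W2 \<alpha>)) (\<lambda>x. \<pi>3 (\<pi>2 (\<pi>1 x)))"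
    by (rule biholomorphic_comp[OF biholomorphic_comp[OF b1(1) b2(1)] b3(1)])
  then show "biholomorphic (open_part (X2 \<alpha>) (W2 \<alpha>)) (open_part S3 (points S3 - (\<pi>3 \<circ> \<pi>2 \<circ> \<pi>1) ` ?E At0)) (\<pi>3 \<circ> \<pi>2 \<circ> \<pi>1)"
    unfolding eq by (simp only: comp_def)
  show "openin (surface_topology S3) (points S3 - (\<pi>3 \<circ> \<pi>2 \<circ> \<pi>1) ` ?E At0)"
    using b3(2) by (simp only: eq)
qed

text \<open>Up to \<open>flip\<close> the planes are charts of the blow-up, so \<pi> and its inverse
  are holomorphic in them. The transition maps between planes are holomorphic because they factor
  through the charts of S.\<close>

lemma ten_planes_in_surface:
  assumes b: "biholomorphic (open_part (X2 \<alpha>) (W2 \<alpha>)) S \<pi>"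
  shows "equiv_atlas (plane_atlas (\<lambda>i z. \<pi> (psi \<alpha> i z)) ten_idx) S"
    and "i \<in> ten_idx \<Longrightarrow> j \<in> ten_idx \<Longrightarrow> \<pi> (psi \<alpha> i z) = \<pi> (psi \<alpha> j w) \<longleftrightarrow> psi \<alpha> i z = psi \<alpha> j w"
proof -
  let ?X = "open_part (X2 \<alpha>) (W2 \<alpha>)" and ?\<Psi> = "\<lambda>i z. \<pi> (psi \<alpha> i z)"
  obtain G where G: "holomorphic_map ?X S \<pi>" "holomorphic_map S ?X G"
    "\<And>x. x \<in> points ?X \<Longrightarrow> G (\<pi> x) = x" "\<And>y. y \<in> points S \<Longrightarrow> \<pi> (G y) = y"
    "\<And>x. x \<in> points ?X \<Longrightarrow> \<pi> x \<in> points S" "\<And>y. y \<in> points S \<Longrightarrow> G y \<in> points ?X"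
    using biholomorphicE[OF b] by metis
  have pX: "points ?X = W2 \<alpha>" using W2_points by (auto simp: points_open_part)
  have psi_in: "psi \<alpha> i z \<in> points ?X" if "i \<in> ten_idx" for i z
    using range_psi_subset[OF that] by (simp add: pX)
  have G\<Psi>: "G (?\<Psi> i z) = psi \<alpha> i z" if "i \<in> ten_idx" for i z
    by (rule G(3)[OF psi_in[OF that]])
  show "\<pi> (psi \<alpha> i z) = \<pi> (psi \<alpha> j w) \<longleftrightarrow> psi \<alpha> i z = psi \<alpha> j w" if "i \<in> ten_idx" "j \<in> ten_idx"
  proof
    assume "\<pi> (psi \<alpha> i z) = \<pi> (psi \<alpha> j w)"
    then have "G (?\<Psi> i z) = G (?\<Psi> j w)" by (rule arg_cong)
    then show "psi \<alpha> i z = psi \<alpha> j w" by (simp only: G\<Psi>[OF that(1)] G\<Psi>[OF that(2)])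
  qed (rule arg_cong)
  have chart: "(UNIV, \<lambda>z. psi \<alpha> i (flip i z)) \<in> ?X" if i: "i \<in> ten_idx" for i
  proof -
    have "{z \<in> UNIV. psi \<alpha> i (flip i z) \<in> W2 \<alpha>} = UNIV" using range_psi_subset[OF i] by auto
    then show ?thesis unfolding open_part_charts by (intro exI[of _ UNIV] conjI psi_chart[OF i]) simp
  qed
  have 1: "holomorphic_map (plane_atlas ?\<Psi> ten_idx) S (\<lambda>x. x)"
  proof (rule holomorphic_mapI)
    show "x \<in> points S" if x: "x \<in> points (plane_atlas ?\<Psi> ten_idx)" for x
    proof -
      obtain i z where "i \<in> ten_idx" "x = ?\<Psi> i z" using x unfolding points_def plane_atlas_def by blast
      then show ?thesis using G(5)[OF psi_in] by simp
    qed
    fix A \<phi> B \<psi> assume A: "(A, \<phi>) \<in> plane_atlas ?\<Psi> ten_idx" and B: "(B, \<psi>) \<in> S"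
    then obtain i where i: "i \<in> ten_idx" "A = UNIV" "\<phi> = ?\<Psi> i" by (auto simp: plane_atlas_def)
    from holo2_precompose[OF holo2_flip[of i] holomorphic_map_charts[OF G(1) chart[OF i(1)] B]]
    show "holo2 {z \<in> A. \<phi> z \<in> \<psi> ` B} (\<lambda>z. inv_into B \<psi> (\<phi> z))" by (simp add: i)
  qed
  have 2: "holomorphic_map S (plane_atlas ?\<Psi> ten_idx) (\<lambda>x. x)"
  proof (rule holomorphic_mapI)
    show "x \<in> points (plane_atlas ?\<Psi> ten_idx)" if x: "x \<in> points S" for x
    proof -
      have "G x \<in> W2 \<alpha>" using G(6)[OF x] pX by simp
      then obtain i z where i: "i \<in> ten_idx" "G x = psi \<alpha> i z" using W2_subset_range by blast
      then have "x = ?\<Psi> i z" using G(4)[OF x] by metis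
      moreover have "(UNIV, ?\<Psi> i) \<in> plane_atlas ?\<Psi> ten_idx" using i by (auto simp: plane_atlas_def)
      ultimately show ?thesis using pointsI[of UNIV "?\<Psi> i"] by blast
    qed
    fix A \<phi> B \<psi> assume A: "(A, \<phi>) \<in> S" and B: "(B, \<psi>) \<in> plane_atlas ?\<Psi> ten_idx"
    then obtain i where i: "i \<in> ten_idx" "B = UNIV" "\<psi> = ?\<Psi> i" by (auto simp: plane_atlas_def)
    let ?\<theta> = "\<lambda>z. psi \<alpha> i (flip i z)"
    have h: "holo2 {z \<in> A. G (\<phi> z) \<in> range ?\<theta>} (\<lambda>z. inv ?\<theta> (G (\<phi> z)))"
      by (rule holomorphic_map_charts[OF G(2) A chart[OF i(1)]])
    have "holo2 {z \<in> A. G (\<phi> z) \<in> range ?\<theta>} (\<lambda>z. flip i (inv ?\<theta> (G (\<phi> z))))"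
      by (rule holo2_compose[OF h holo2_flip]) simp
    moreover have "{z \<in> A. G (\<phi> z) \<in> range ?\<theta>} = {z \<in> A. \<phi> z \<in> range (?\<Psi> i)}"
    proof -
      have "G (\<phi> z) \<in> range ?\<theta> \<longleftrightarrow> \<phi> z \<in> range (?\<Psi> i)" if z: "z \<in> A" for z
      proof
        assume "G (\<phi> z) \<in> range ?\<theta>"
        then obtain w where "G (\<phi> z) = ?\<theta> w" by auto
        then have "\<phi> z = ?\<Psi> i (flip i w)" using G(4)[OF pointsI[OF A z]] by metis
        then show "\<phi> z \<in> range (?\<Psi> i)" by (metis rangeI)
      next
        assume "\<phi> z \<in> range (?\<Psi> i)"
        then obtain w where "\<phi> z = ?\<Psi> i w" by auto
        then have "G (\<phi> z) = ?\<theta> (flip i w)" using G\<Psi>[OF i(1)] by simp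
        then show "G (\<phi> z) \<in> range ?\<theta>" by (metis rangeI)
      qed
      then show ?thesis by blast
    qed
    moreover have "flip i (inv ?\<theta> (G (\<phi> z))) = inv (?\<Psi> i) (\<phi> z)" if z: "\<phi> z \<in> range (?\<Psi> i)" for z
    proof -
      obtain w where w: "\<phi> z = ?\<Psi> i w" using z by auto
      have inj: "inj (?\<Psi> i)"
      proof (rule injI)
        fix z w assume "?\<Psi> i z = ?\<Psi> i w"
        then have "G (?\<Psi> i z) = G (?\<Psi> i w)" by (rule arg_cong)
        then show "z = w" unfolding G\<Psi>[OF i(1)] by (rule injD[OF inj_psi[OF i(1)]])
      qed
      have Gz: "G (\<phi> z) = ?\<theta> (flip i w)" using w G\<Psi>[OF i(1)] by simp
      have inj\<theta>: "inj ?\<theta>" by (rule inj_atlasD[OF inj_atlas_second psi_chart[OF i(1)]])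
      have "inv ?\<theta> (G (\<phi> z)) = flip i w" unfolding Gz by (rule inv_f_f[OF inj\<theta>])
      then show ?thesis using inv_f_f[OF inj, of w] w by simp
    qed
    ultimately have "holo2 {z \<in> A. \<phi> z \<in> range (?\<Psi> i)} (\<lambda>z. inv (?\<Psi> i) (\<phi> z))"
      using holo2_cong[of "{z \<in> A. \<phi> z \<in> range (?\<Psi> i)}"] by simp
    then show "holo2 {z \<in> A. \<phi> z \<in> \<psi> ` B} (\<lambda>z. inv_into B \<psi> (\<phi> z))" by (simp add: i)
  qed
  show "equiv_atlas (plane_atlas ?\<Psi> ten_idx) S" using 1 2 by (simp add: equiv_atlas_def)
qed

theorem theorem13p2:
  fixes \<alpha> :: "nat \<Rightarrow> complex"
    and S1 :: "'a atlas" and S2 :: "'b atlas" and S_tilde :: "'c atlas"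
    and \<pi>1 :: "bl2 \<Rightarrow> 'a" and \<pi>2 :: "'a \<Rightarrow> 'b" and \<pi>3 :: "'b \<Rightarrow> 'c"
  assumes "6 * \<alpha> 0 + 5 * \<alpha> 1 + 4 * \<alpha> 2 + 3 * \<alpha> 3 + 2 * \<alpha> 4 + \<alpha> 5 + 4 * \<alpha> 6 + 2 * \<alpha> 7 + 3 * \<alpha> 8 = 0"
    and "inj_on (\<lambda>k. second_coords \<alpha> k (0, 0)) {1..8}"
    and "blows_down (X2 \<alpha>) (D_section_strict \<alpha>) S1 \<pi>1"
    and "blows_down S1 (\<pi>1 ` D_exc_strict \<alpha> AtInf) S2 \<pi>2"
    and "blows_down S2 ((\<pi>2 \<circ> \<pi>1) ` D_exc_strict \<alpha> At1) S_tilde \<pi>3"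
  shows "let \<pi> = \<pi>3 \<circ> \<pi>2 \<circ> \<pi>1;
             anticanonical_red = \<pi> ` D_exc_strict \<alpha> At0;
             S = open_part S_tilde (points S_tilde - anticanonical_red);
             qp = \<pi> \<circ> qp_point \<alpha>
         in space_of_initial_conditions S qp (hamiltonian_field \<alpha>) \<and>
            complex_surface (ten_planes \<alpha>) \<and>
            (\<exists>F. biholomorphic (ten_planes \<alpha>) S F \<and>
                 (\<forall>z. F (glue_point (ten_rel \<alpha>) None z) = qp z)) \<and>
            (\<forall>j\<in>{0..8}. birational2 (r \<alpha> j) \<and> symplectic_on (r_dom j) (r \<alpha> j))"
proof -
  define \<pi> where "\<pi> = \<pi>3 \<circ> \<pi>2 \<circ> \<pi>1"
  define S where "S = open_part S_tilde (points S_tilde - \<pi> ` D_exc_strict \<alpha> At0)"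
  define qp where "qp = \<pi> \<circ> qp_point \<alpha>"
  have b: "biholomorphic (open_part (X2 \<alpha>) (W2 \<alpha>)) S \<pi>"
    and op: "openin (surface_topology S_tilde) (points S_tilde - \<pi> ` D_exc_strict \<alpha> At0)"
    using W2_biholomorphic[OF assms(3-5)] by (simp_all add: S_def \<pi>_def)
  have "complex_surface S_tilde" using assms(5) by (simp add: blows_down_def)
  then have S: "complex_surface S" unfolding S_def using op by (rule complex_surface_open_part)
  define \<Psi> where "\<Psi> = (\<lambda>i z. \<pi> (psi \<alpha> i z))"
  have qp: "qp = \<Psi> None" by (auto simp: qp_def \<Psi>_def qp_point_def psi_def fun_eq_iff)
  have None: "None \<in> ten_idx" by (simp add: ten_idx_def)
  have equiv_S: "equiv_atlas (plane_atlas \<Psi> ten_idx) S"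
    unfolding \<Psi>_def by (rule ten_planes_in_surface(1)[OF b])
  have \<Psi>_eq: "\<Psi> i z = \<Psi> j w \<longleftrightarrow> psi \<alpha> i z = psi \<alpha> j w" if "i \<in> ten_idx" "j \<in> ten_idx" for i j z w
    unfolding \<Psi>_def by (rule ten_planes_in_surface(2)[OF b that])
  have inj: "inj (\<Psi> i)" if "i \<in> ten_idx" for i
  proof (rule injI)
    fix z w assume "\<Psi> i z = \<Psi> i w"
    then show "z = w" unfolding \<Psi>_eq[OF that that] by (rule injD[OF inj_psi[OF that]])
  qed
  obtain H where H: "\<forall>i. hol UNIV (H i)" "\<forall>q p. H None (q, p) = hamiltonian \<alpha> q p"
    "\<forall>j z. j \<le> 7 \<longrightarrow> z \<in> r_dom j \<longrightarrow> H (Some j) (r \<alpha> j z) = H None z"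
    "\<forall>z. z \<in> r_dom 8 \<longrightarrow> H (Some 8) (r \<alpha> 8 z) = H (Some 0) z"
    "\<forall>i j z w. i \<in> ten_idx \<longrightarrow> j \<in> ten_idx \<longrightarrow> psi \<alpha> i z = psi \<alpha> j w \<longrightarrow> H i z = H j w"
    "\<forall>c. \<exists>R. \<forall>i\<in>ten_idx. \<forall>w. H i w = c \<longrightarrow> (\<exists>j\<in>ten_idx. \<exists>w'. psi \<alpha> j w' = psi \<alpha> i w \<and> norm w' \<le> R)"
    using ten_hamiltonians_exist[OF assms(1,2)] by (elim exE conjE) (rule that)
  note H = H[rule_format]
  define V where "V i = ham_field (H i)" for i
  have V_None: "V None = hamiltonian_field \<alpha>"
    by (auto simp: V_def ham_field_def hamiltonian_field_def dx_def dy_def H(2) fun_eq_iff)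
  note holo = equiv_atlas_self[OF equiv_S]
  \<comment> \<open>On \<open>r_dom j\<close> the transition map is \<open>r \<alpha> j\<close>,
    which is symplectic and matches the Hamiltonians; it therefore carries one field to the
    other.\<close>
  have step: "compatible_at \<Psi> ten_idx V (i, z) (Some j, r \<alpha> j z)"
    if i: "i \<in> ten_idx" and j: "j \<le> 8" and z: "z \<in> r_dom j"
      and p: "\<And>w. w \<in> r_dom j \<Longrightarrow> psi \<alpha> i w = psi \<alpha> (Some j) (r \<alpha> j w)"
      and h: "\<And>w. w \<in> r_dom j \<Longrightarrow> H (Some j) (r \<alpha> j w) = H i w" for i j z
  proof -
    have jI: "Some j \<in> ten_idx" using j by (simp add: ten_idx_def)
    have eq: "\<Psi> i w = \<Psi> (Some j) (r \<alpha> j w)" if "w \<in> r_dom j" for w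
      unfolding \<Psi>_def using p[OF that] by simp
    have "symplectic_on (r_dom j) (r \<alpha> j)" by (rule symplectic_r[OF j])
    then have g: "holo2 (r_dom j) (r \<alpha> j)" and symp: "\<And>h k. symplectic_form (frechet_derivative (r \<alpha> j) (at z) h)
        (frechet_derivative (r \<alpha> j) (at z) k) = symplectic_form h k"
      using z unfolding symplectic_on_def by blast+
    have "frechet_derivative (r \<alpha> j) (at z) = frechet_derivative (\<lambda>x. inv (\<Psi> (Some j)) (\<Psi> i x)) (at z)"
      by (rule holo2_derivative_cong[OF open_r_dom z _ holo2_differentiable[OF g z]])
         (simp add: eq inv_f_f[OF inj[OF jI]])
    moreover have "frechet_derivative (r \<alpha> j) (at z) (V i z) = V (Some j) (r \<alpha> j z)"
      unfolding V_def by (rule ham_field_symplectic[OF H(1) H(1) g z h symp])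
    ultimately show ?thesis using i jI eq[OF z] by (simp add: compatible_at_def)
  qed
  have compat_rel: "compatible_at \<Psi> ten_idx V x y" if "(x, y) \<in> ten_rel \<alpha>" for x y
    using that
  proof (cases rule: ten_rel_cases)
    case (1 j z)
    show ?thesis unfolding 1(3,4) using 1(1,2) None
      by (intro step) (simp_all add: psi_r H(3))
  next
    case (2 z)
    show ?thesis unfolding 2(2,3) using 2(1)
      by (intro step) (simp_all add: psi_r_8 H(4) ten_idx_def)
  qed
  \<comment> \<open>The extra chart demanded by \<open>space_of_initial_conditions\<close> is one of
    the ten planes, so M remains equivalent to S.\<close>
  define M where "M = insert (UNIV, qp) S"
  have "(UNIV, qp) \<in> plane_atlas \<Psi> ten_idx" using None by (auto simp: plane_atlas_def qp)
  then have MS: "equiv_atlas M S" unfolding M_def by (rule equiv_atlas_insert[OF equiv_atlas_sym[OF equiv_S]])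
  have M_charts: "open A" "inj_on \<phi> A" if "(A, \<phi>) \<in> M" for A \<phi>
    using that complex_surface_charts[OF S, of A \<phi>] inj[OF None] by (auto simp: M_def qp)
  have M: "complex_surface M"
    by (rule equiv_atlas_complex_surface[OF S equiv_atlas_sym[OF MS]]) (rule M_charts, assumption)+
  interpret plane_fields \<Psi> ten_idx V M
  proof
    show "equiv_atlas (plane_atlas \<Psi> ten_idx) M"
      by (rule equiv_atlas_trans[OF equiv_S equiv_atlas_sym[OF MS]])
    show "inj_atlas M" by (rule complex_surface_inj_atlas[OF M])
    show "holo2 UNIV (V i)" for i unfolding V_def by (rule holo2_ham_field[OF H(1)])
    show "frechet_derivative (\<lambda>x. inv (\<Psi> j) (\<Psi> i x)) (at w) (V i w) = V j w'"
      if ij: "i \<in> ten_idx" "j \<in> ten_idx" "\<Psi> i w = \<Psi> j w'" for i j w w'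
    proof -
      have "((i, w), (j, w')) \<in> (ten_rel \<alpha> \<union> (ten_rel \<alpha>)\<inverse>)\<^sup>*"
        using glue_point_ten_iff[OF ij(1,2)] \<Psi>_eq[OF ij(1,2)] ij(3) unfolding glue_point_eq_iff by simp
      then have "compatible_at \<Psi> ten_idx V (i, w) (j, w')"
        using ij(1) by (intro compatible_at_rtrancl[OF holo inj compat_rel]) simp_all
      then show ?thesis by (simp add: compatible_at_def)
    qed
  qed (rule inj)
  have pts: "points M = points S" by (rule equiv_atlas_points[OF MS])
  have topM: "topspace (surface_topology S) = points S"
    by (rule topspace_surface_topology) (rule complex_surface_charts(1)[OF S])
  have solutions: "\<exists>!\<gamma>. entire_solution M (push_field \<Psi> ten_idx V) \<gamma> \<and> \<gamma> t0 = s" if s: "s \<in> points S" for t0 s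
  proof (rule hamiltonian_complete[OF M, where H = H])
    show "finite ten_idx" by (simp add: ten_idx_def)
    show "H i w = H j w'" if "i \<in> ten_idx" "j \<in> ten_idx" "\<Psi> i w = \<Psi> j w'" for i j w w'
      using H(5)[OF that(1,2)] \<Psi>_eq[OF that(1,2)] that(3) by simp
    show "\<exists>R. \<forall>i\<in>ten_idx. \<forall>w. H i w = c \<longrightarrow> (\<exists>j\<in>ten_idx. \<exists>w'. \<Psi> j w' = \<Psi> i w \<and> norm w' \<le> R)" for c
    proof -
      obtain R where R: "\<forall>i\<in>ten_idx. \<forall>w. H i w = c \<longrightarrow> (\<exists>j\<in>ten_idx. \<exists>w'. psi \<alpha> j w' = psi \<alpha> i w \<and> norm w' \<le> R)"
        using H(6)[of c] by (rule exE)
      have "\<exists>j\<in>ten_idx. \<exists>w'. \<Psi> j w' = \<Psi> i w \<and> norm w' \<le> R" if i: "i \<in> ten_idx" and w: "H i w = c" for i w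
      proof -
        have "\<exists>j\<in>ten_idx. \<exists>w'. psi \<alpha> j w' = psi \<alpha> i w \<and> norm w' \<le> R" by (rule R[rule_format, OF i w])
        then obtain j w' where j: "j \<in> ten_idx" "psi \<alpha> j w' = psi \<alpha> i w" "norm w' \<le> R" by (elim bexE exE conjE)
        then show ?thesis by (intro bexI[of _ j] exI[of _ w'] conjI) (simp_all add: \<Psi>_def)
      qed
      then show ?thesis by (intro exI[of _ R] ballI allI impI)
    qed
  qed (simp_all add: H(1) V_def s pts)
  have field: "push_field \<Psi> ten_idx V (UNIV, qp) = hamiltonian_field \<alpha>"
  proof
    fix z
    have "push_field \<Psi> ten_idx V (UNIV, qp) z = frechet_derivative (\<lambda>x. inv qp (\<Psi> None x)) (at z) (V None z)"
      by (rule push_field_eq[OF None]) (simp_all add: M_def qp)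
    \<comment> \<open>The passage from the plane \<open>None\<close> to the chart \<open>qp\<close>
      is the identity, so the extended field restricts to the given one.\<close>
    also have "(\<lambda>x. inv qp (\<Psi> None x)) = (\<lambda>x. x)" using inj[OF None] by (simp add: qp)
    finally show "push_field \<Psi> ten_idx V (UNIV, qp) z = hamiltonian_field \<alpha> z" by (simp add: V_None)
  qed
  have dense: "surface_topology S closure_of range qp = points S"
  proof -
    let ?P = "plane_atlas \<Psi> ten_idx"
    have tP: "surface_topology ?P = surface_topology S" by (rule equiv_atlas_topology[OF equiv_S])
    have pP: "points ?P = points S" by (rule equiv_atlas_points[OF equiv_S])
    let ?C = "surface_topology ?P closure_of range qp"
    have closed: "closedin (surface_topology ?P) ?C" by simp
    have top: "topspace (surface_topology ?P) = points ?P" using tP pP topM by simp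
    have ch: "(UNIV, \<Psi> i) \<in> ?P" if "i \<in> ten_idx" for i using that by (auto simp: plane_atlas_def)
    have cN: "\<Psi> None z \<in> ?C" for z
    proof -
      have "\<Psi> None z \<in> points ?P" using pointsI[OF ch[OF None], of z] by simp
      then have "\<Psi> None z \<in> topspace (surface_topology ?P) \<inter> range qp" by (simp add: top qp)
      then show ?thesis by (rule subsetD[OF closure_of_subset_Int])
    qed
    have idx0: "Some 0 \<in> ten_idx" by (simp add: ten_idx_def)
    \<comment> \<open>U_0 is treated before the planes at the centres, since U_8 is attached to it
      and not to the (q, p)-plane.\<close>
    have c0: "\<Psi> (Some 0) z \<in> ?C" for z
    proof (rule closed_contains_plane[OF closed ch[OF idx0] top], rule disjI1, intro allI impI)
      fix w :: c2 assume w: "fst w \<noteq> 0"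
      obtain x y where xy: "w = (x, y)" by (cases w)
      have "\<Psi> (Some 0) w = \<Psi> None (1 / x, - (x * y + \<alpha> 0) * x)"
        using psi_0[of x \<alpha> y] w by (simp add: \<Psi>_def xy)
      then show "\<Psi> (Some 0) w \<in> ?C" using cN by simp
    qed
    have "\<Psi> i z \<in> ?C" if i: "i \<in> ten_idx" for i z
      using i
    proof (cases rule: ten_idx_cases)
      case (3 k)
      show ?thesis
      proof (rule closed_contains_plane[OF closed ch[OF i] top], rule disjI2, intro allI impI)
        fix w :: c2 assume w: "snd w \<noteq> 0"
        obtain x y where xy: "w = (x, y)" by (cases w)
        have "y \<noteq> 0" using w by (simp add: xy)
        then have "psi \<alpha> (Some k) (x, y) \<in> range (psi \<alpha> None) \<union> range (psi \<alpha> (Some 0))"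
          unfolding psi_second[OF 3(2,3) \<open>y \<noteq> 0\<close>] by simp
        then show "\<Psi> i w \<in> ?C"
        proof
          assume "psi \<alpha> (Some k) (x, y) \<in> range (psi \<alpha> None)"
          then obtain z where "psi \<alpha> (Some k) (x, y) = psi \<alpha> None z" by (rule imageE)
          then have "\<Psi> i w = \<Psi> None z" by (simp add: \<Psi>_def 3(1) xy)
          then show ?thesis using cN by simp
        next
          assume "psi \<alpha> (Some k) (x, y) \<in> range (psi \<alpha> (Some 0))"
          then obtain z where "psi \<alpha> (Some k) (x, y) = psi \<alpha> (Some 0) z" by (rule imageE)
          then have "\<Psi> i w = \<Psi> (Some 0) z" by (simp add: \<Psi>_def 3(1) xy)
          then show ?thesis using c0 by simp
        qed
      qed
    qed (use cN c0 in simp_all)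
    then have "points S \<subseteq> ?C" using points_M pts by auto
    moreover have "?C \<subseteq> points S" using closure_of_subset_topspace[of "surface_topology ?P"] top pP by blast
    ultimately show ?thesis using tP by auto
  qed
  have "space_of_initial_conditions S qp (hamiltonian_field \<alpha>)"
    unfolding space_of_initial_conditions_def M_def[symmetric]
  proof (intro conjI exI[of _ "push_field \<Psi> ten_idx V"] allI ballI)
    show "range qp \<subseteq> points S" using points_M pts None by (auto simp: qp)
    show "holomorphic_field M (push_field \<Psi> ten_idx V)" by (rule holomorphic_push_field)
  qed (use S M dense field solutions in simp_all)
  moreover have ten: "ten_planes \<alpha> = plane_atlas (glue_point (ten_rel \<alpha>)) ten_idx"
    by (simp add: ten_planes_def glue_def plane_atlas_def ten_idx_def)
  have glue_eq: "glue_point (ten_rel \<alpha>) i z = glue_point (ten_rel \<alpha>) j w \<longleftrightarrow> \<Psi> i z = \<Psi> j w"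
    if "i \<in> ten_idx" "j \<in> ten_idx" for i j z w
    by (simp only: glue_point_ten_iff[OF that] \<Psi>_eq[OF that])
  have "\<exists>F. biholomorphic (ten_planes \<alpha>) S F \<and> (\<forall>i\<in>ten_idx. \<forall>z. F (glue_point (ten_rel \<alpha>) i z) = \<Psi> i z)"
    unfolding ten by (rule plane_transfer[OF _ _ equiv_S]) (rule glue_eq inj, assumption+)+
  then obtain F where F: "biholomorphic (ten_planes \<alpha>) S F"
    "\<forall>i\<in>ten_idx. \<forall>z. F (glue_point (ten_rel \<alpha>) i z) = \<Psi> i z"
    by (elim exE conjE) (rule that)
  have "complex_surface (ten_planes \<alpha>)"
  proof (rule biholomorphic_complex_surface[OF F(1) S])
    show "open A" if "(A, \<phi>) \<in> ten_planes \<alpha>" for A \<phi> using that by (auto simp: ten plane_atlas_def)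
    show "inj_on \<phi> A" if A: "(A, \<phi>) \<in> ten_planes \<alpha>" for A \<phi>
    proof -
      obtain i where i: "i \<in> ten_idx" "\<phi> = glue_point (ten_rel \<alpha>) i" "A = UNIV"
        using A by (auto simp: ten plane_atlas_def)
      have "inj (glue_point (ten_rel \<alpha>) i)"
      proof (rule injI)
        fix z w assume "glue_point (ten_rel \<alpha>) i z = glue_point (ten_rel \<alpha>) i w"
        then show "z = w" unfolding glue_point_ten_iff[OF i(1) i(1)] by (rule injD[OF inj_psi[OF i(1)]])
      qed
      then show ?thesis by (simp add: i)
    qed
  qed
  moreover have "\<exists>F. biholomorphic (ten_planes \<alpha>) S F \<and> (\<forall>z. F (glue_point (ten_rel \<alpha>) None z) = qp z)"
    using F None by (intro exI[of _ F]) (simp add: qp)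
  moreover have "\<forall>j\<in>{0..8}. birational2 (r \<alpha> j) \<and> symplectic_on (r_dom j) (r \<alpha> j)"
    using birational_r symplectic_r by simp
  ultimately show ?thesis
    unfolding Let_def \<pi>_def[symmetric] S_def[symmetric] qp_def[symmetric] by (intro conjI)
qed

end
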